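(* Let $S$ be a set and let $r\in F(S)'$ be such that one of the following holds: (1) $S=S_1\cup S_2$ with $S_1\cap S_2=\emptyset$, and $r=r_1r_2$, where $r_1\in F(S_1)'$ and $r_2\in F(S_2)'$ are both non-trivial; (2) $S=S'\cup\{t\}$ with $t\notin S'$, and $r=r_1\,t\,r_2\,t^{-1}$ with $r_1,r_2\in F(S')'\setminus\{e\}$. Then $$\|G_r\| = 4\cdot\Bigl(\operatorname{scl}_S(r)-\tfrac12\Bigr).$$
   Context: For a set $S$, $F(S)$ is the free group on $S$, $F(S)'$ its commutator subgroup and $e$ the neutral element. For $r\in F(S)'\setminus\{e\}$ let $G_r:=\langle S\mid r\rangle$. Let $P_r$ be the presentation complex (one vertex, one $1$-cell for each element of $S$, one $2$-cell attached along $r$) and let $X_r$ be a classifying space of $G_r$ obtained from $P_r$ by attaching cells of dimension $\ge 3$, with inclusion $c_r\colon P_r\to X_r$. Since $r\in F(S)'$, the $2$-cell of $P_r$ defines a class $\widetilde\alpha_r\in H_2(P_r;\mathbb Z)$; the fundamental class is $\alpha_r:=H_2(c_r;\mathbb Z)(\widetilde\alpha_r)\in H_2(X_r;\mathbb Z)=H_2(G_r;\mathbb Z)$ (this group is infinite cyclic, generated by $\alpha_r$), and $\alpha_{r,\mathbb R}\in H_2(G_r;\mathbb R)$ is its image under change of coefficients. The simplicial volume of $G_r$ is $\|G_r\|:=\|\alpha_{r,\mathbb R}\|_1$, where $\|\alpha\|_1$ is the infimum of the $\ell^1$-norms (with respect to the basis of singular simplices) of all real singular cycles representing $\alpha$.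 For $w\in F(S)'$, $\operatorname{cl}_S(w)$ is the minimal $n\in\mathbb N$ such that $w$ is a product of $n$ commutators in $F(S)$, and $\operatorname{scl}_S(w):=\lim_{n\to\infty}\operatorname{cl}_S(w^n)/n$. *)

theory Defs
  imports "HOL-Analysis.Analysis" "HOL-Algebra.Generated_Groups" "HOL-Homology.Homology"
begin

section \<open>Free groups and one-relator groups\<close>

text \<open>
  A letter is a pair \<open>(s, b)\<close>, standing for \<open>s\<close> if \<open>b\<close> is true and for the inverse of \<open>s\<close>
  otherwise. The elements of the free group on \<open>S\<close> are the reduced words over \<open>S\<close>, so that
  \<open>free_group T\<close> is literally a subgroup of \<open>free_group S\<close> for \<open>T \<subseteq> S\<close>.
\<close>

definition inv_letter :: "'a \<times> bool \<Rightarrow> 'a \<times> bool" where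
  "inv_letter x = (fst x, \<not> snd x)"

definition reduced_word :: "('a \<times> bool) list \<Rightarrow> bool" where
  "reduced_word w \<longleftrightarrow> successively (\<lambda>x y. y \<noteq> inv_letter x) w"

definition cancel_cons :: "'a \<times> bool \<Rightarrow> ('a \<times> bool) list \<Rightarrow> ('a \<times> bool) list" where
  "cancel_cons x w =
     (case w of [] \<Rightarrow> [x] | y # ys \<Rightarrow> if y = inv_letter x then ys else x # w)"

definition free_group :: "'a set \<Rightarrow> ('a \<times> bool) list monoid" where
  "free_group S = \<lparr>carrier = {w. reduced_word w \<and> fst ` set w \<subseteq> S},
                   mult = (\<lambda>u v. foldr cancel_cons u v),
                   one = []\<rparr>"

definition normal_closure :: "('g, 'm) monoid_scheme \<Rightarrow> 'g set \<Rightarrow> 'g set" where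
  "normal_closure G R =
     generate G (\<Union>g \<in> carrier G. \<Union>r \<in> R. {g \<otimes>\<^bsub>G\<^esub> r \<otimes>\<^bsub>G\<^esub> inv\<^bsub>G\<^esub> g})"

definition one_relator_group :: "'a set \<Rightarrow> ('a \<times> bool) list \<Rightarrow> ('a \<times> bool) list set monoid" where
  "one_relator_group S r = free_group S Mod normal_closure (free_group S) {r}"

abbreviation free_commutator_subgroup :: "'a set \<Rightarrow> ('a \<times> bool) list set" where
  "free_commutator_subgroup S \<equiv> derived (free_group S) (carrier (free_group S))"

subsection \<open>Stable commutator length\<close>

definition cl :: "'a set \<Rightarrow> ('a \<times> bool) list \<Rightarrow> nat" where
  "cl S w = (LEAST n. \<exists>cs. length cs = n \<and>
       set cs \<subseteq> derived_set (free_group S) (carrier (free_group S)) \<and>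
       w = foldr (\<otimes>\<^bsub>free_group S\<^esub>) cs \<one>\<^bsub>free_group S\<^esub>)"

definition scl :: "'a set \<Rightarrow> ('a \<times> bool) list \<Rightarrow> real" where
  "scl S w = lim (\<lambda>n. real (cl S (w [^]\<^bsub>free_group S\<^esub> n)) / real n)"

subsection \<open>The group axioms\<close>

lemma inv_letter_inv_letter [simp]: "inv_letter (inv_letter x) = x"
  by (simp add: inv_letter_def)

lemma inv_letter_neq [simp]: "inv_letter x \<noteq> x" "x \<noteq> inv_letter x"
  by (simp_all add: inv_letter_def prod_eq_iff)

lemma inv_letter_eq_iff [simp]: "inv_letter x = inv_letter y \<longleftrightarrow> x = y"
  by (metis inv_letter_inv_letter)

lemma fst_inv_letter [simp]: "fst (inv_letter x) = fst x"
  by (simp add: inv_letter_def)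

lemma reduced_Nil [simp]: "reduced_word []"
  by (simp add: reduced_word_def)

lemma reduced_Cons: "reduced_word (x # w) \<longleftrightarrow> reduced_word w \<and> (w = [] \<or> hd w \<noteq> inv_letter x)"
  by (cases w) (auto simp: reduced_word_def)

lemma reduced_cancel_cons: "reduced_word w \<Longrightarrow> reduced_word (cancel_cons x w)"
  by (cases w) (auto simp: cancel_cons_def reduced_Cons)

lemma cancel_cons_reduced: "reduced_word (x # w) \<Longrightarrow> cancel_cons x w = x # w"
  by (cases w) (auto simp: cancel_cons_def reduced_Cons)

lemma cancel_cons_inverse: "reduced_word w \<Longrightarrow> cancel_cons x (cancel_cons (inv_letter x) w) = w"
  by (cases w) (auto simp: cancel_cons_def reduced_Cons split: list.splits)

lemma reduced_foldr_cancel_cons: "reduced_word w \<Longrightarrow> reduced_word (foldr cancel_cons u w)"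
  by (induction u) (auto intro: reduced_cancel_cons)

lemma set_cancel_cons: "set (cancel_cons x w) \<subseteq> insert x (set w)"
  by (cases w) (auto simp: cancel_cons_def)

lemma set_foldr_cancel_cons: "set (foldr cancel_cons u w) \<subseteq> set u \<union> set w"
proof (induction u)
  case (Cons x u)
  then show ?case
    using set_cancel_cons[of x "foldr cancel_cons u w"] by auto
qed simp

lemma foldr_cancel_cons_Nil: "reduced_word u \<Longrightarrow> foldr cancel_cons u [] = u"
  by (induction u) (auto simp: reduced_Cons cancel_cons_reduced)

lemma foldr_cancel_cons_cancel_cons:
  "reduced_word w \<Longrightarrow> reduced_word v \<Longrightarrow>
     foldr cancel_cons (cancel_cons x v) w = cancel_cons x (foldr cancel_cons v w)"
proof (cases v)
  case (Cons y ys)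
  assume "reduced_word w" "reduced_word v"
  then show ?thesis
    using Cons cancel_cons_inverse[of "foldr cancel_cons ys w" x]
    by (auto simp: cancel_cons_def[of x "_ # _"] reduced_foldr_cancel_cons)
qed (simp add: cancel_cons_def)

lemma foldr_cancel_cons_assoc:
  "reduced_word v \<Longrightarrow> reduced_word w \<Longrightarrow>
     foldr cancel_cons (foldr cancel_cons u v) w = foldr cancel_cons u (foldr cancel_cons v w)"
  by (induction u) (auto simp: foldr_cancel_cons_cancel_cons reduced_foldr_cancel_cons)

lemma foldr_cancel_cons_left_inverse:
  "reduced_word w \<Longrightarrow> foldr cancel_cons (rev (map inv_letter u)) (foldr cancel_cons u w) = w"
proof (induction u arbitrary: w)
  case (Cons x u)
  then show ?case
    using cancel_cons_inverse[of "foldr cancel_cons u w" "inv_letter x"]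
    by (simp add: reduced_foldr_cancel_cons)
qed simp

lemma group_free_group: "group (free_group S)"
proof (rule groupI)
  fix u v assume "u \<in> carrier (free_group S)" "v \<in> carrier (free_group S)"
  then show "u \<otimes>\<^bsub>free_group S\<^esub> v \<in> carrier (free_group S)"
    using set_foldr_cancel_cons[of u v]
    by (fastforce simp: free_group_def reduced_foldr_cancel_cons)
next
  fix u assume u: "u \<in> carrier (free_group S)"
  let ?v = "foldr cancel_cons (rev (map inv_letter u)) []"
  have "?v \<in> carrier (free_group S)"
    using u set_foldr_cancel_cons[of "rev (map inv_letter u)" "[]"]
    by (fastforce simp: free_group_def reduced_foldr_cancel_cons)
  moreover have "?v \<otimes>\<^bsub>free_group S\<^esub> u = \<one>\<^bsub>free_group S\<^esub>"
    using u foldr_cancel_cons_left_inverse[of "[]" u]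
    by (simp add: free_group_def foldr_cancel_cons_assoc foldr_cancel_cons_Nil)
  ultimately show "\<exists>v \<in> carrier (free_group S). v \<otimes>\<^bsub>free_group S\<^esub> u = \<one>\<^bsub>free_group S\<^esub>"
    by blast
qed (auto simp: free_group_def foldr_cancel_cons_assoc)

section \<open>Attaching cells\<close>

definition disc :: "nat \<Rightarrow> (nat \<Rightarrow> real) topology" where
  "disc n = subtopology (Euclidean_space n) {x. (\<Sum>i<n. (x i)\<^sup>2) \<le> 1}"

definition open_disc :: "nat \<Rightarrow> (nat \<Rightarrow> real) set" where
  "open_disc n = {x \<in> topspace (Euclidean_space n). (\<Sum>i<n. (x i)\<^sup>2) < 1}"

text \<open>
  \<open>attaches_cells n A Y I \<phi>\<close>: the space \<open>Y\<close> is obtained from its subspace \<open>A\<close> by attaching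
  \<open>n\<close>-cells indexed by \<open>I\<close>, with characteristic maps \<open>\<phi> i\<close>; that is, \<open>Y\<close> is (up to the
  canonical homeomorphism) the pushout of \<open>A\<close> and \<open>I\<close> many \<open>n\<close>-discs along the attaching maps.
  The last two conditions say that \<open>Y\<close> has the underlying set and the topology of the pushout;
  they imply that the maps \<open>\<phi> i\<close> are continuous and that \<open>A\<close> is a closed subspace.
  This is used for \<open>n \<ge> 1\<close> only, where the boundary of \<open>disc n\<close> is \<open>nsphere (n - 1)\<close>.
\<close>

definition attaches_cells ::
  "nat \<Rightarrow> 'x topology \<Rightarrow> 'x topology \<Rightarrow> 'i set \<Rightarrow> ('i \<Rightarrow> (nat \<Rightarrow> real) \<Rightarrow> 'x) \<Rightarrow> bool" where
  "attaches_cells n A Y I \<phi> \<longleftrightarrow>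
     topspace A \<subseteq> topspace Y \<and>
     (\<forall>i\<in>I. continuous_map (nsphere (n - 1)) A (\<phi> i)) \<and>
     bij_betw (\<lambda>(i, x). \<phi> i x) (I \<times> open_disc n) (topspace Y - topspace A) \<and>
     (\<forall>C. C \<subseteq> topspace Y \<longrightarrow>
        (closedin Y C \<longleftrightarrow>
           closedin A (C \<inter> topspace A) \<and>
           (\<forall>i\<in>I. closedin (disc n) {x \<in> topspace (disc n). \<phi> i x \<in> C})))"

lemma topspace_disc: "topspace (disc n) = topspace (Euclidean_space n) \<inter> {x. (\<Sum>i<n. (x i)\<^sup>2) \<le> 1}"
  by (simp add: disc_def)

lemma disc_eq_open_disc_Un_nsphere:
  assumes "n \<ge> 1"
  shows "topspace (disc n) = open_disc n \<union> topspace (nsphere (n - 1))"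
proof -
  obtain m where n: "n = Suc m"
    using assms by (cases n) auto
  have "topspace (nsphere m) = {x \<in> topspace (Euclidean_space n). (\<Sum>i<n. (x i)\<^sup>2) = 1}"
    unfolding nsphere_def n lessThan_Suc_atMost topspace_subtopology by blast
  moreover have "topspace (disc n) =
      {x \<in> topspace (Euclidean_space n). (\<Sum>i<n. (x i)\<^sup>2) < 1 \<or> (\<Sum>i<n. (x i)\<^sup>2) = 1}"
    unfolding topspace_disc le_less by blast
  ultimately show ?thesis
    unfolding open_disc_def by (auto simp only: n diff_Suc_1 Un_iff mem_Collect_eq)
qed

lemma attaches_cells_continuous_map:
  assumes "attaches_cells n A Y I \<phi>" "n \<ge> 1" "i \<in> I"
  shows "continuous_map (disc n) Y (\<phi> i)"
proof -
  have "\<phi> i x \<in> topspace Y" if "x \<in> topspace (disc n)" for x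
  proof (cases "x \<in> open_disc n")
    case True
    then show ?thesis
      using assms bij_betwE[of "\<lambda>(i, x). \<phi> i x" "I \<times> open_disc n" "topspace Y - topspace A"]
      by (fastforce simp: attaches_cells_def)
  next
    case False
    then have "x \<in> topspace (nsphere (n - 1))"
      using that disc_eq_open_disc_Un_nsphere[OF assms(2)] by blast
    then have "\<phi> i x \<in> topspace A"
      using assms continuous_map_image_subset_topspace[of "nsphere (n - 1)" A "\<phi> i"]
      by (auto simp: attaches_cells_def)
    then show ?thesis
      using assms by (auto simp: attaches_cells_def)
  qed
  moreover have "closedin (disc n) {x \<in> topspace (disc n). \<phi> i x \<in> C}" if "closedin Y C" for C
    using assms that closedin_subset[OF that] unfolding attaches_cells_def by simp
  ultimately show ?thesis
    by (simp add: continuous_map_closedin Pi_iff)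
qed

text \<open>
  In \<open>attaches_high_cells\<close>, \<open>K m\<close> is the \<open>m\<close>-skeleton for \<open>m \<ge> 2\<close>, \<open>K 2 = P\<close>, and \<open>X\<close> carries the
  colimit topology. The cells of a fixed dimension are indexed by their own characteristic maps,
  which is no restriction as different cells have different characteristic maps.
\<close>

definition attaches_high_cells :: "'x topology \<Rightarrow> 'x topology \<Rightarrow> bool" where
  "attaches_high_cells P X \<longleftrightarrow>
     (\<exists>K. K 2 = P \<and>
        (\<forall>m\<ge>2. \<exists>J. attaches_cells (Suc m) (K m) (K (Suc m)) J (\<lambda>f. f)) \<and>
        topspace X = (\<Union>m\<in>{2::nat..}. topspace (K m)) \<and>
        (\<forall>C. C \<subseteq> topspace X \<longrightarrow>
           (closedin X C \<longleftrightarrow> (\<forall>m\<ge>2. closedin (K m) (C \<inter> topspace (K m))))))"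

section \<open>Presentation complexes\<close>

text \<open>
  The \<open>1\<close>-cell of \<open>s\<close> is a loop that is traversed from \<open>- 1\<close> to \<open>1\<close> for the letter \<open>(s, True)\<close>
  and backwards for \<open>(s, False)\<close>. The path of a word with \<open>k\<close> letters traverses the \<open>j\<close>-th letter
  (counting from \<open>0\<close>) on the interval from \<open>j / k\<close> to \<open>(j + 1) / k\<close>.
\<close>

definition letter_path :: "('a \<Rightarrow> (nat \<Rightarrow> real) \<Rightarrow> 'x) \<Rightarrow> 'a \<times> bool \<Rightarrow> real \<Rightarrow> 'x" where
  "letter_path \<phi> l u =
     \<phi> (fst l) (\<lambda>i. if i = 0 then (if snd l then 2 * u - 1 else 1 - 2 * u) else 0)"

definition word_path ::
  "'x \<Rightarrow> ('a \<Rightarrow> (nat \<Rightarrow> real) \<Rightarrow> 'x) \<Rightarrow> ('a \<times> bool) list \<Rightarrow> real \<Rightarrow> 'x" where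
  "word_path v \<phi> w t =
     (let k = length w; j = nat \<lfloor>real k * t\<rfloor>
      in if j < k then letter_path \<phi> (w ! j) (real k * t - real j) else v)"

definition circle_point :: "real \<Rightarrow> nat \<Rightarrow> real" where
  "circle_point t =
     (\<lambda>i. if i = 0 then cos (2 * pi * t) else if i = 1 then sin (2 * pi * t) else 0)"

text \<open>
  \<open>v\<close> is the vertex, \<open>\<phi>\<close> gives the characteristic maps of the \<open>1\<close>-cells, \<open>P1\<close> is the
  \<open>1\<close>-skeleton, and \<open>\<Phi>\<close> is the characteristic map of the \<open>2\<close>-cell.
\<close>

definition presentation_complex ::
  "'a set \<Rightarrow> ('a \<times> bool) list \<Rightarrow> 'x \<Rightarrow> ('a \<Rightarrow> (nat \<Rightarrow> real) \<Rightarrow> 'x) \<Rightarrow> 'x topology \<Rightarrow>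
     ((nat \<Rightarrow> real) \<Rightarrow> 'x) \<Rightarrow> 'x topology \<Rightarrow> bool" where
  "presentation_complex S r v \<phi> P1 \<Phi> P \<longleftrightarrow>
     attaches_cells 1 (discrete_topology {v}) P1 S \<phi> \<and>
     attaches_cells 2 P1 P {()} (\<lambda>_. \<Phi>) \<and>
     (\<forall>t\<in>{0..1}. \<Phi> (circle_point t) = word_path v \<phi> r t)"

section \<open>Classifying spaces\<close>

definition loop_at :: "'x topology \<Rightarrow> 'x \<Rightarrow> (real \<Rightarrow> 'x) \<Rightarrow> bool" where
  "loop_at X v p \<longleftrightarrow> continuous_map (top_of_set {0..1}) X p \<and> p 0 = v \<and> p 1 = v"

definition loops_homotopic :: "'x topology \<Rightarrow> 'x \<Rightarrow> (real \<Rightarrow> 'x) \<Rightarrow> (real \<Rightarrow> 'x) \<Rightarrow> bool" where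
  "loops_homotopic X v = homotopic_with (\<lambda>p. p 0 = v \<and> p 1 = v) (top_of_set {0..1}) X"

definition concat_loops :: "(real \<Rightarrow> 'x) \<Rightarrow> (real \<Rightarrow> 'x) \<Rightarrow> real \<Rightarrow> 'x" where
  "concat_loops p q t = (if t \<le> 1 / 2 then p (2 * t) else q (2 * t - 1))"

definition fundamental_group :: "'x topology \<Rightarrow> 'x \<Rightarrow> (real \<Rightarrow> 'x) set monoid" where
  "fundamental_group X v =
     \<lparr>carrier = {Collect (loops_homotopic X v p) |p. loop_at X v p},
      mult = (\<lambda>A B. \<Union>p\<in>A. \<Union>q\<in>B. Collect (loops_homotopic X v (concat_loops p q))),
      one = Collect (loops_homotopic X v (\<lambda>_. v))\<rparr>"

text \<open>
  For path-connected \<open>X\<close>, the last condition says that all higher homotopy groups vanish.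
\<close>

definition classifying_space :: "('g, 'm) monoid_scheme \<Rightarrow> 'x topology \<Rightarrow> 'x \<Rightarrow> bool" where
  "classifying_space G X v \<longleftrightarrow>
     v \<in> topspace X \<and> path_connected_space X \<and> fundamental_group X v \<cong> G \<and>
     (\<forall>n\<ge>2. \<forall>f. continuous_map (nsphere n) X f \<longrightarrow>
        (\<exists>c. homotopic_with (\<lambda>_. True) (nsphere n) X f (\<lambda>_. c)))"

section \<open>The fundamental class\<close>

text \<open>
  An orientation of the \<open>2\<close>-cell is a generator \<open>\<omega>\<close> of the infinite cyclic group
  \<open>H\<^sub>2(D\<^sup>2, S\<^sup>1; \<int>)\<close>. If the relator is in the commutator subgroup, then the boundary of the relative
  class of the \<open>2\<close>-cell in \<open>H\<^sub>2(P, P1; \<int>)\<close> vanishes in \<open>H\<^sub>1(P1; \<int>)\<close>, and, as \<open>H\<^sub>2(P1; \<int>) = 0\<close>,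
  this relative class is the image of exactly one class in \<open>H\<^sub>2(P; \<int>)\<close>.
\<close>

definition cell_orientation :: "(nat \<Rightarrow> real) chain set \<Rightarrow> bool" where
  "cell_orientation \<omega> \<longleftrightarrow>
     (let H = relative_homology_group 2 (disc 2) (topspace (nsphere 1))
      in \<omega> \<in> carrier H \<and> subgroup_generated H {\<omega>} = H)"

definition two_cell_class ::
  "'x topology \<Rightarrow> ((nat \<Rightarrow> real) \<Rightarrow> 'x) \<Rightarrow> 'x topology \<Rightarrow> (nat \<Rightarrow> real) chain set \<Rightarrow> 'x chain set" where
  "two_cell_class P1 \<Phi> P \<omega> =
     (THE a. a \<in> carrier (homology_group 2 P) \<and>
        hom_induced 2 P {} P (topspace P1) id a =
        hom_induced 2 (disc 2) (topspace (nsphere 1)) P (topspace P1) \<Phi> \<omega>)"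

definition fundamental_class ::
  "'x topology \<Rightarrow> ((nat \<Rightarrow> real) \<Rightarrow> 'x) \<Rightarrow> 'x topology \<Rightarrow> 'x topology \<Rightarrow>
     (nat \<Rightarrow> real) chain set \<Rightarrow> 'x chain set" where
  "fundamental_class P1 \<Phi> P X \<omega> = hom_induced 2 P {} X {} id (two_cell_class P1 \<Phi> P \<omega>)"

section \<open>Real singular homology and the \<open>\<ell>\<^sup>1\<close>-seminorm\<close>

type_synonym 'x real_chain = "((nat \<Rightarrow> real) \<Rightarrow> 'x) \<Rightarrow>\<^sub>0 real"

definition real_singular_chain :: "nat \<Rightarrow> 'x topology \<Rightarrow> 'x real_chain \<Rightarrow> bool" where
  "real_singular_chain p X c \<longleftrightarrow> Poly_Mapping.keys c \<subseteq> singular_simplex_set p X"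

definition real_chain_boundary :: "nat \<Rightarrow> 'x real_chain \<Rightarrow> 'x real_chain" where
  "real_chain_boundary p c =
     (if p = 0 then 0
      else \<Sum>\<sigma>\<in>Poly_Mapping.keys c. \<Sum>k\<le>p.
             Poly_Mapping.single (singular_face p k \<sigma>) ((- 1) ^ k * Poly_Mapping.lookup c \<sigma>))"

definition real_singular_cycle :: "nat \<Rightarrow> 'x topology \<Rightarrow> 'x real_chain \<Rightarrow> bool" where
  "real_singular_cycle p X c \<longleftrightarrow> real_singular_chain p X c \<and> real_chain_boundary p c = 0"

definition real_homologous :: "nat \<Rightarrow> 'x topology \<Rightarrow> 'x real_chain \<Rightarrow> 'x real_chain \<Rightarrow> bool" where
  "real_homologous p X c c' \<longleftrightarrow>
     (\<exists>d. real_singular_chain (Suc p) X d \<and> real_chain_boundary (Suc p) d = c - c')"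

lemma real_chain_boundary_of_int:
  "real_chain_boundary p (Poly_Mapping.map real_of_int z) =
     Poly_Mapping.map real_of_int (chain_boundary p z)"
proof (rule poly_mapping_eqI)
  fix f
  have lookup_map: "Poly_Mapping.lookup (Poly_Mapping.map real_of_int c) g =
      real_of_int (Poly_Mapping.lookup c g)" for c :: "'a chain" and g
    by (simp add: Poly_Mapping.map.rep_eq when_def)
  have keys_map: "Poly_Mapping.keys (Poly_Mapping.map real_of_int z) = Poly_Mapping.keys z"
    by (auto simp: Poly_Mapping.in_keys_iff lookup_map)
  show "Poly_Mapping.lookup (real_chain_boundary p (Poly_Mapping.map real_of_int z)) f =
        Poly_Mapping.lookup (Poly_Mapping.map real_of_int (chain_boundary p z)) f"
    unfolding real_chain_boundary_def chain_boundary_def lookup_map keys_map frag_extend_def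
    by (auto simp: lookup_sum lookup_single lookup_map when_def
          sum_distrib_left intro!: sum.cong)
qed

text \<open>
  As in the library, a homology class is the set of all cycles representing it.
\<close>

definition change_of_coefficients :: "nat \<Rightarrow> 'x topology \<Rightarrow> 'x chain set \<Rightarrow> 'x real_chain set" where
  "change_of_coefficients p X a =
     {c. real_singular_cycle p X c \<and>
         (\<exists>z\<in>a. real_homologous p X c (Poly_Mapping.map real_of_int z))}"

definition l1_norm :: "'x real_chain \<Rightarrow> real" where
  "l1_norm c = (\<Sum>\<sigma>\<in>Poly_Mapping.keys c. \<bar>Poly_Mapping.lookup c \<sigma>\<bar>)"

definition l1_seminorm :: "'x real_chain set \<Rightarrow> real" where
  "l1_seminorm \<alpha> = Inf (l1_norm ` \<alpha>)"

text \<open>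
  The simplicial volume of \<open>\<langle>S | r\<rangle>\<close>, computed in a classifying space \<open>X\<close> obtained from the
  presentation complex \<open>P\<close>.
\<close>

definition simplicial_volume ::
  "'x topology \<Rightarrow> ((nat \<Rightarrow> real) \<Rightarrow> 'x) \<Rightarrow> 'x topology \<Rightarrow> 'x topology \<Rightarrow>
     (nat \<Rightarrow> real) chain set \<Rightarrow> real" where
  "simplicial_volume P1 \<Phi> P X \<omega> =
     l1_seminorm (change_of_coefficients 2 X (fundamental_class P1 \<Phi> P X \<omega>))"

end

theory Submission
  imports Defs "HOL-Library.Function_Algebras"
begin

text \<open>
  Write \<open>r = a b\<close>, where \<open>a = r1\<close> and \<open>b\<close> is \<open>r2\<close> or a conjugate of it, and let \<open>q\<close> be the supremum of
  \<open>\<phi>(r1) + \<phi>(r2)\<close>, where \<open>\<phi>\<close> ranges over the homogenizations of the quasimorphisms of defect at most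
  \<open>1\<close> on the free group without \<open>t\<close> (on \<open>F(S)\<close> in the first case). Both sides of the equation equal \<open>q\<close>.

  By Hahn--Banach, some multiple \<open>m (a\<^sup>n + b\<^sup>n)\<close> bounds a bar chain of norm at most \<open>m (n q + 5)\<close>. Since
  \<open>a b = 1\<close> in \<open>\<langle>S | r\<rangle>\<close>, there is a triangle with sides \<open>a\<^sup>n\<close>, \<open>b\<^sup>n\<close> and a constant one that covers the
  2-cell \<open>n\<close> times. Capping off with \<open>m\<close> such triangles gives an integral cycle of norm at most
  \<open>m (n q + 7)\<close> that represents \<open>m n\<close> times the fundamental class, up to sign. Hence the simplicial
  volume is at most \<open>q\<close>.

  Conversely, averaging a quasimorphism over the cusps of the triangles of a normal form for an HNN
  extension gives a quasimorphism \<open>Q\<close> on \<open>F(S)\<close> of defect at most \<open>1\<close> with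
  \<open>Q (g h r h\<inverse>) = Q g + Q r\<close> and \<open>Q r\<close> close to \<open>q\<close>. Its coboundary descends to a quotient of \<open>\<langle>S | r\<rangle>\<close>.
  A covering of the 1-skeleton with that structure group extends over all cells, so the coboundary
  becomes a singular cocycle of norm at most \<open>1\<close>, and its value on the fundamental class is \<open>\<plusminus> Q r\<close>.

  Finally, \<open>4 scl(r) = q + 2\<close>: gluing the boundary polygons of a bar chain to a surface turns the
  estimates above into bounds for the commutator length, where \<open>2\<close> accounts for the pair of pants
  with boundary \<open>a\<close>, \<open>b\<close> and \<open>a b\<close>.
\<close>

section \<open>A Hahn--Banach theorem for abelian groups\<close>

text \<open>The constant is sharp, so no step may lose a factor in the defect. For this reason exact
  additivity along the powers of \<open>r1\<close> and \<open>r2\<close> is obtained from means over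
  both ends of an edge, which do not raise the defect, and not by correcting a quasimorphism
  afterwards. The same calculus of normal forms serves twice. With infinite cyclic edge groups the
  relator acts as a central shift, so the coboundary of \<open>Q\<close> descends. With trivial edge
  groups the powers of the relator are their own normal forms, and a sign can be added at each of
  the two cusps; this produces the summand 2. Errors that do not grow with \<open>n\<close> are
  harmless. In \<open>n q + 5\<close>, each of the two powers costs 1 for antisymmetrization and 1
  for homogenization, and 1 is the slack of the duality; 7 adds two caps, a power triangle and a
  constant one. The 4 is the number of polygon edges that a handle uses up. Chains are integral
  throughout this duality: a multiple \<open>m b\<close> that bounds with norm at most
  \<open>m s\<close> replaces a rational filling, hence Hahn--Banach is proved for abelian
  groups.\<close>

text \<open>
 \<open>P b s\<close> is to be read as ``the seminorm of \<open>b\<close> is at most \<open>s\<close>''; the seminorm is allowed to be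
 infinite. Partially defined additive functionals are represented by their graphs.
\<close>

locale seminorm_bound =
 fixes P :: "'v::ab_group_add => real => bool"
 assumes zero: "P 0 0"
  and add: "P b s ==> P b' s' ==> P (b + b') (s + s')"
  and minus: "P b s ==> P (- b) s"
  and nonneg: "P 0 s ==> s >= 0"
begin

definition mult :: "nat => 'v => 'v" where
 "mult k b = (\<Sum>i<k. b)"

lemma mult_simps [simp]: "mult 0 b = 0" "mult (Suc k) b = mult k b + b"
 by (auto simp: mult_def)

lemma mult_add_left: "mult (k + l) b = mult k b + mult l b"
 by (induction l) (auto simp: algebra_simps)

lemma mult_add: "mult k (b + c) = mult k b + mult k c"
 by (simp add: mult_def sum.distrib)

lemma mult_diff: "mult k (b - c) = mult k b - mult k c"
 by (simp add: mult_def sum_subtractf)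

lemma mult_mult: "mult k (mult l b) = mult (k * l) b"
 by (induction k) (auto simp: mult_add_left algebra_simps)

lemma P_mult: "P b s ==> P (mult k b) (real k * s)"
proof (induction k)
 case 0
 then show ?case using zero by simp
next
 case (Suc k)
 then show ?case using add[of "mult k b" "real k * s" b s] by (simp add: algebra_simps)
qed

lemma P_nonneg: "P b s ==> s >= 0"
 using add[of b s "- b" s] minus[of b s] nonneg[of "s + s"] by auto

definition graph :: "('v \<times> real) set => bool" where
 "graph G \<longleftrightarrow> (0, 0) \<in> G \<and> (\<forall>b y c z. (b, y) \<in> G --> (c, z) \<in> G --> (b - c, y - z) \<in> G) \<and>
   (\<forall>b y s. (b, y) \<in> G --> P b s --> y <= s)"

lemma graph_diff: "graph G ==> (b, y) \<in> G ==> (c, z) \<in> G ==> (b - c, y - z) \<in> G"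
 by (auto simp: graph_def)

lemma graph_zero: "graph G ==> (0, 0) \<in> G"
 by (auto simp: graph_def)

lemma graph_minus: "graph G ==> (b, y) \<in> G ==> (- b, - y) \<in> G"
 using graph_diff[of G 0 0 b y] graph_zero[of G] by simp

lemma graph_add: "graph G ==> (b, y) \<in> G ==> (c, z) \<in> G ==> (b + c, y + z) \<in> G"
 using graph_diff[of G b y "- c" "- z"] graph_minus[of G c z] by simp

lemma graph_mult: "graph G ==> (b, y) \<in> G ==> (mult k b, real k * y) \<in> G"
proof (induction k)
 case (Suc k)
 then show ?case using graph_add[of G "mult k b" "real k * y" b y] by (simp add: algebra_simps)
qed (simp add: graph_zero)

lemma graph_le: "graph G ==> (b, y) \<in> G ==> P b s ==> y <= s"
 by (auto simp: graph_def)

lemma graph_unique: "graph G ==> (b, y) \<in> G ==> (b, z) \<in> G ==> y = z"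
 using graph_le[of G 0 "y - z" 0] graph_le[of G 0 "z - y" 0] graph_diff[of G b y b z]
  graph_diff[of G b z b y] zero by force

lemma graph_extend_value:
 assumes G: "graph G"
 obtains \<alpha> where
  "!!k b y s. k > 0 ==> (b, y) \<in> G ==> P (b + mult k x) s ==> y + real k * \<alpha> <= s"
  "!!k b y s. k > 0 ==> (b, y) \<in> G ==> P (b - mult k x) s ==> y - real k * \<alpha> <= s"
proof -
 define L where "L = {(y - s) / real k |b y s k. k > 0 \<and> (b, y) \<in> G \<and> P (b - mult k x) s}"
 define U where "U = {(s - y) / real k |b y s k. k > 0 \<and> (b, y) \<in> G \<and> P (b + mult k x) s}"
 \<comment> \<open>Adding \<open>k'\<close> times the argument for L to \<open>k\<close> times the
   argument for U eliminates \<open>x\<close>, so the bound on the old graph applies.\<close>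
 have LU: "l <= u" if lL: "l \<in> L" and uU: "u \<in> U" for l u
 proof -
  obtain b y s k where l: "l = (y - s) / real k" "k > 0" "(b, y) \<in> G" "P (b - mult k x) s"
   using lL unfolding L_def by blast
  obtain b' y' s' k' where u: "u = (s' - y') / real k'" "k' > 0" "(b', y') \<in> G" "P (b' + mult k' x) s'"
   using uU unfolding U_def by blast
  have "P (mult k' (b - mult k x) + mult k (b' + mult k' x)) (real k' * s + real k * s')"
   by (intro add P_mult l u)
  moreover have "mult k' (b - mult k x) + mult k (b' + mult k' x) = mult k' b + mult k b'"
   by (simp add: mult_add mult_diff mult_mult mult.commute)
  ultimately have "real k' * y + real k * y' <= real k' * s + real k * s'"
   using graph_le[OF G graph_add[OF G graph_mult[OF G l(3)] graph_mult[OF G u(3)]]] by simp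
  then show ?thesis
   using l(2) u(2) unfolding l(1) u(1) by (simp add: field_simps)
 qed
 \<comment> \<open>Negation exchanges the two conditions. If no bound is finite, both sets are empty
   and the value at \<open>x\<close> is arbitrary.\<close>
 have sym: "L ~= {} \<longleftrightarrow> U ~= {}"
 proof -
  have "(\<exists>k b y s. k > 0 \<and> (b, y) \<in> G \<and> P (b - mult k x) s) \<longleftrightarrow>
    (\<exists>k b y s. k > 0 \<and> (b, y) \<in> G \<and> P (b + mult k x) s)"
  proof safe
   fix k b y s assume "0 < k" "(b, y) \<in> G" "P (b - mult k x) s"
   then show "\<exists>k b y s. 0 < k \<and> (b, y) \<in> G \<and> P (b + mult k x) s"
    using minus[of "b - mult k x" s] graph_minus[OF G, of b y]
    by (intro exI[of _ k] exI[of _ "- b"] exI[of _ "- y"] exI[of _ s]) (auto simp: algebra_simps)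
  next
   fix k b y s assume "0 < k" "(b, y) \<in> G" "P (b + mult k x) s"
   then show "\<exists>k b y s. 0 < k \<and> (b, y) \<in> G \<and> P (b - mult k x) s"
    using minus[of "b + mult k x" s] graph_minus[OF G, of b y]
    by (intro exI[of _ k] exI[of _ "- b"] exI[of _ "- y"] exI[of _ s]) (auto simp: algebra_simps)
  qed
  then show ?thesis unfolding L_def U_def by blast
 qed
 obtain \<alpha> where \<alpha>: "!!l. l \<in> L ==> l <= \<alpha>" "!!u. u \<in> U ==> \<alpha> <= u"
 proof (cases "L = {}")
  case True
  then show ?thesis using that[of 0] sym by auto
 next
  case False
  then obtain u where "u \<in> U" using sym by auto
  then have "bdd_above L" using LU by (meson bdd_above.I)
  then show ?thesis
   using that[of "Sup L"] False LU by (meson cSup_least cSup_upper)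
 qed
 show ?thesis
 proof (rule that)
  fix k b y s assume "(k::nat) > 0" "(b, y) \<in> G" "P (b + mult k x) s"
  then show "y + real k * \<alpha> <= s"
   using \<alpha>(2)[of "(s - y) / real k"] unfolding U_def by (fastforce simp: field_simps)
 next
  fix k b y s assume "(k::nat) > 0" "(b, y) \<in> G" "P (b - mult k x) s"
  then show "y - real k * \<alpha> <= s"
   using \<alpha>(1)[of "(y - s) / real k"] unfolding L_def by (fastforce simp: field_simps)
 qed
qed

lemma graph_extend:
 assumes G: "graph G"
 obtains \<Delta> \<alpha> where "graph \<Delta>" "G \<subseteq> \<Delta>" "(x, \<alpha>) \<in> \<Delta>"
proof -
 obtain \<alpha> where \<alpha>:
  "!!k b y s. k > 0 ==> (b, y) \<in> G ==> P (b + mult k x) s ==> y + real k * \<alpha> <= s"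
  "!!k b y s. k > 0 ==> (b, y) \<in> G ==> P (b - mult k x) s ==> y - real k * \<alpha> <= s"
  using graph_extend_value[OF G, of x] by metis
 \<comment> \<open>A difference of two natural multiples stands for an integral multiple of
   \<open>x\<close>.\<close>
 define \<Delta> where "\<Delta> = {(b + mult k x - mult l x, y + real k * \<alpha> - real l * \<alpha>) |b y k l. (b, y) \<in> G}"
 have 1: "G \<subseteq> \<Delta>"
  unfolding \<Delta>_def by (clarsimp, metis add_0_right diff_zero mult_simps(1) mult_zero_left of_nat_0)
 have 2: "(x, \<alpha>) \<in> \<Delta>"
  unfolding \<Delta>_def using graph_zero[OF G]
  by (intro CollectI exI[of _ 0] exI[of _ 0] exI[of _ "Suc 0"] exI[of _ "0::nat"]) auto
 have "graph \<Delta>"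
  unfolding graph_def
 proof (intro conjI allI impI)
  show "(0, 0) \<in> \<Delta>" using 1 graph_zero[OF G] by auto
 next
  fix b y c z assume "(b, y) \<in> \<Delta>" "(c, z) \<in> \<Delta>"
  then obtain b1 y1 k1 l1 c1 z1 k2 l2 where
   "(b1, y1) \<in> G" "(c1, z1) \<in> G" and e: "b = b1 + mult k1 x - mult l1 x" "y = y1 + real k1 * \<alpha> - real l1 * \<alpha>"
   "c = c1 + mult k2 x - mult l2 x" "z = z1 + real k2 * \<alpha> - real l2 * \<alpha>"
   unfolding \<Delta>_def by auto
  then have "(b1 - c1, y1 - z1) \<in> G" using graph_diff[OF G] by blast
  then show "(b - c, y - z) \<in> \<Delta>"
   unfolding \<Delta>_def
   by (intro CollectI exI[of _ "b1 - c1"] exI[of _ "y1 - z1"] exI[of _ "k1 + l2"] exI[of _ "l1 + k2"])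
    (auto simp: e mult_add_left algebra_simps)
 next
  fix b y s assume "(b, y) \<in> \<Delta>" "P b s"
  then obtain b1 y1 k l where b1: "(b1, y1) \<in> G" and e: "b = b1 + mult k x - mult l x"
   "y = y1 + real k * \<alpha> - real l * \<alpha>"
   unfolding \<Delta>_def by auto
  consider "k = l" | m where "k = l + m" "m > 0" | m where "l = k + m" "m > 0"
   by (metis less_imp_add_positive linorder_neqE_nat)
  then show "y <= s"
  proof cases
   case 1
   then show ?thesis using graph_le[OF G b1] \<open>P b s\<close> e by simp
  next
   case 2
   then show ?thesis using \<alpha>(1)[of m b1 y1 s] b1 \<open>P b s\<close> e by (simp add: mult_add_left algebra_simps)
  next
   case 3
   then show ?thesis using \<alpha>(2)[of m b1 y1 s] b1 \<open>P b s\<close> e by (simp add: mult_add_left algebra_simps)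
  qed
 qed
 then show ?thesis using that 1 2 by blast
qed

text \<open>Zorn's lemma on graphs; a maximal graph is total by \<open>graph_extend\<close>. The
  hypothesis tests only natural multiples of \<open>b0\<close>: on a negative multiple the
  functional is at most 0, and bounds in \<open>P\<close> are never negative.\<close>

theorem hahn_banach:
 assumes "!!k s. P (mult k b0) s ==> real k * \<mu> <= s" "\<mu> >= 0"
 obtains f where "!!b c. f (b + c) = f b + f c" "!!b s. P b s ==> f b <= s" "f b0 = \<mu>"
proof -
 define G0 where "G0 = {(mult k b0 - mult l b0, real k * \<mu> - real l * \<mu>) |k l. True}"
 have G0: "graph G0"
  unfolding graph_def
 proof (intro conjI allI impI)
  show "(0, 0) \<in> G0" unfolding G0_def by (intro CollectI exI[of _ "0::nat"]) auto
 next
  fix b y c z assume "(b, y) \<in> G0" "(c, z) \<in> G0"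
  then obtain k1 l1 k2 l2 where e: "b = mult k1 b0 - mult l1 b0" "y = real k1 * \<mu> - real l1 * \<mu>"
   "c = mult k2 b0 - mult l2 b0" "z = real k2 * \<mu> - real l2 * \<mu>" unfolding G0_def by auto
  show "(b - c, y - z) \<in> G0" unfolding G0_def
   by (intro CollectI exI[of _ "k1 + l2"] exI[of _ "l1 + k2"]) (auto simp: e mult_add_left algebra_simps)
 next
  fix b y s assume "(b, y) \<in> G0" "P b s"
  then obtain k l where e: "b = mult k b0 - mult l b0" "y = real k * \<mu> - real l * \<mu>" unfolding G0_def by auto
  consider m where "k = l + m" | m where "l = k + m" by (metis le_Suc_ex linorder_linear)
  then show "y <= s"
  proof cases
   case 1
   then show ?thesis using assms(1)[of m s] \<open>P b s\<close> e by (simp add: mult_add_left algebra_simps)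
  next
   case 2
   then have "y = - (real m * \<mu>)" using e by (simp add: algebra_simps)
   then show ?thesis using P_nonneg[OF \<open>P b s\<close>] assms(2)
    by (metis mult_nonneg_nonneg neg_le_0_iff_le of_nat_0_le_iff order_trans)
  qed
 qed
 define \<A> where "\<A> = {G. graph G \<and> G0 \<subseteq> G}"
 have "\<exists>M\<in>\<A>. \<forall>X\<in>\<A>. M \<subseteq> X --> X = M"
 proof (rule subset_Zorn_nonempty)
  show "\<A> ~= {}" using G0 by (auto simp: \<A>_def)
 next
  fix C assume C: "C ~= {}" "subset.chain \<A> C"
  then have CA: "C \<subseteq> \<A>" and tot: "!!X Y. X \<in> C ==> Y \<in> C ==> X \<subseteq> Y \<or> Y \<subseteq> X"
   by (auto simp: subset.chain_def)
  have "graph (\<Union>C)"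
   unfolding graph_def
  proof (intro conjI allI impI)
   show "(0, 0) \<in> \<Union>C" using C(1) CA graph_zero by (fastforce simp: \<A>_def)
  next
   fix b y c z assume "(b, y) \<in> \<Union>C" "(c, z) \<in> \<Union>C"
   then obtain X Y where "X \<in> C" "Y \<in> C" "(b, y) \<in> X" "(c, z) \<in> Y" by auto
   then obtain Z where "Z \<in> C" "(b, y) \<in> Z" "(c, z) \<in> Z" using tot by blast
   moreover from this have "graph Z" using CA unfolding \<A>_def by blast
   ultimately show "(b - c, y - z) \<in> \<Union>C" using graph_diff by blast
  next
   fix b y s assume "(b, y) \<in> \<Union>C" "P b s"
   then obtain X where "X \<in> C" "(b, y) \<in> X" by auto
   moreover from this have "graph X" using CA unfolding \<A>_def by blast
   ultimately show "y <= s" using \<open>P b s\<close> graph_le by blast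
  qed
  then show "\<Union>C \<in> \<A>" using C(1) CA unfolding \<A>_def by blast
 qed
 then obtain M where MA: "M \<in> \<A>" and max': "\<forall>X\<in>\<A>. M \<subseteq> X --> X = M" ..
 have M: "graph M" "G0 \<subseteq> M" using MA by (simp_all add: \<A>_def)
 have max: "X = M" if "graph X" "M \<subseteq> X" for X
  using max' that M(2) by (simp add: \<A>_def)
 have total: "\<exists>y. (x, y) \<in> M" for x
  using graph_extend[OF M(1), of x] max by metis
 define f where "f = (\<lambda>x. SOME y. (x, y) \<in> M)"
 have f: "(x, f x) \<in> M" for x
  unfolding f_def using total[of x] by (rule someI_ex)
 have "(b0, \<mu>) \<in> M"
  using M(2) unfolding G0_def
  by (rule subsetD) (intro CollectI exI[of _ "Suc 0"] exI[of _ "0::nat"], auto)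
 then show ?thesis
  using that[of f] f graph_unique[OF M(1)] graph_add[OF M(1)] graph_le[OF M(1)] by blast
qed

end

section \<open>An invariant mean on bounded sequences\<close>

text \<open>The limit superior of the absolute Cesaro means is at most \<open>s\<close>. The
  difference of a bounded sequence and its shift telescopes and has seminorm 0, so every functional
  below this seminorm is shift invariant on bounded sequences.\<close>

definition mean_bound :: "(nat => real) => real => bool" where
 "mean_bound b s \<longleftrightarrow> (\<forall>\<epsilon>>0. \<exists>N. \<forall>n\<ge>N. \<bar>\<Sum>i<n. b i\<bar> <= real n * (s + \<epsilon>))"

lemma seminorm_bound_mean_bound: "seminorm_bound mean_bound"
proof
 show "mean_bound 0 0" by (auto simp: mean_bound_def)
next
 fix b s b' s' assume b: "mean_bound b s" and b': "mean_bound b' s'"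
 show "mean_bound (b + b') (s + s')"
  unfolding mean_bound_def
 proof (intro allI impI)
  fix \<epsilon> :: real assume "\<epsilon> > 0"
  then have e: "\<epsilon> / 2 > 0" by simp
  obtain N where N: "!!n. n >= N ==> \<bar>\<Sum>i<n. b i\<bar> <= real n * (s + \<epsilon>/2)"
   using b e unfolding mean_bound_def by blast
  obtain N' where N': "!!n. n >= N' ==> \<bar>\<Sum>i<n. b' i\<bar> <= real n * (s' + \<epsilon>/2)"
   using b' e unfolding mean_bound_def by blast
  have "\<bar>\<Sum>i<n. (b + b') i\<bar> <= real n * (s + s' + \<epsilon>)" if "n >= max N N'" for n
  proof -
   have "\<bar>\<Sum>i<n. (b + b') i\<bar> <= \<bar>\<Sum>i<n. b i\<bar> + \<bar>\<Sum>i<n. b' i\<bar>" by (simp add: sum.distrib)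
   also have "\<dots> <= real n * (s + \<epsilon>/2) + real n * (s' + \<epsilon>/2)" using N[of n] N'[of n] that by linarith
   also have "\<dots> = real n * (s + s' + \<epsilon>)" by (simp add: algebra_simps)
   finally show ?thesis .
  qed
  then show "\<exists>N. \<forall>n\<ge>N. \<bar>\<Sum>i<n. (b + b') i\<bar> <= real n * (s + s' + \<epsilon>)" by blast
 qed
next
 fix b s assume "mean_bound b s"
 then show "mean_bound (- b) s" by (simp add: mean_bound_def sum_negf)
next
 fix s assume *: "mean_bound 0 s"
 show "0 <= s"
 proof (rule field_le_epsilon)
  fix e :: real assume "e > 0"
  then obtain N where "!!n. n >= N ==> 0 <= real n * (s + e)" using * unfolding mean_bound_def by fastforce
  from this[of "Suc N"] show "0 <= s + e" by (simp add: zero_le_mult_iff)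
 qed
qed

definition bounded_seq :: "(nat => real) => bool" where
 "bounded_seq b \<longleftrightarrow> (\<exists>B. \<forall>i. \<bar>b i\<bar> <= B)"

lemma bounded_seqI: "(!!i. \<bar>b i\<bar> <= B) ==> bounded_seq b"
 by (auto simp: bounded_seq_def)

lemma mean_bound_of_bound:
 assumes "!!i. \<bar>b i\<bar> <= B"
 shows "mean_bound b B"
proof -
 have "\<bar>\<Sum>i<n. b i\<bar> <= real n * (B + \<epsilon>)" if "\<epsilon> > 0" for \<epsilon> n
 proof -
 have "\<bar>\<Sum>i<n. b i\<bar> <= (\<Sum>i<n. B)"
  by (rule order_trans[OF sum_abs]) (intro sum_mono assms)
 also have "\<dots> <= real n * (B + \<epsilon>)" using \<open>\<epsilon> > 0\<close> by (simp add: mult_left_mono)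
 finally show ?thesis .
 qed
 then show ?thesis unfolding mean_bound_def by blast
qed

theorem invariant_mean:
 obtains M :: "(nat => real) => real" where
  "!!b c. M (\<lambda>i. b i + c i) = M b + M c"
  "!!b B c. (!!i. \<bar>b i - c\<bar> <= B) ==> \<bar>M b - c\<bar> <= B"
  "!!b. bounded_seq b ==> M (\<lambda>i. b (Suc i)) = M b"
proof -
 interpret seminorm_bound mean_bound by (rule seminorm_bound_mean_bound)
 have mult_eq: "mult k b = (\<lambda>i. real k * b i)" for k b
  by (induction k) (auto simp: fun_eq_iff algebra_simps)
 obtain M where M: "!!b c. M (b + c) = M b + M c" "!!b s. mean_bound b s ==> M b <= s"
   "M (\<lambda>_. 1) = 1"
 proof (rule hahn_banach[of "\<lambda>_. 1" 1])
  fix k s assume *: "mean_bound (mult k (\<lambda>_. 1)) s"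
  show "real k * 1 <= s"
  proof (rule field_le_epsilon)
   fix e :: real assume "e > 0"
   then obtain N where "!!n. n >= N ==> \<bar>\<Sum>i<n. real k * 1\<bar> <= real n * (s + e)"
    using * unfolding mean_bound_def mult_eq by blast
   from this[of "Suc N"] have "real (Suc N) * real k <= real (Suc N) * (s + e)"
    by (simp del: of_nat_Suc)
   then show "real k * 1 <= s + e"
    by (simp only: mult_le_cancel_left_pos of_nat_0_less_iff zero_less_Suc mult_1_right)
  qed
 qed auto
 have M_0: "M 0 = 0" using M(1)[of 0 0] by simp
 have M_minus: "M (- b) = - M b" for b using M(1)[of b "- b"] M_0 by simp
 have M_abs: "\<bar>M b\<bar> <= s" if "mean_bound b s" for b s
  using M(2)[OF that] M(2)[OF minus[OF that]] M_minus[of b] by linarith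
 have M_diff: "M (b - c) = M b - M c" for b c using M(1)[of b "- c"] M_minus by simp
 have M_mult: "M (mult k b) = real k * M b" for k b
 proof (induction k)
  case 0
  then show ?case using M_0 by (simp only: mult_simps of_nat_0 mult_zero_left)
 next
  case (Suc k)
  then show ?case by (simp only: mult_simps M(1) of_nat_Suc distrib_right mult_1_left) 
 qed
 \<comment> \<open>\<open>M\<close> is only known to be additive. Constants are therefore treated
   first for fractions, by clearing denominators, and then by approximation.\<close>
 have M_const_of_int: "M (\<lambda>_. real_of_int k / real n) = real_of_int k / real n" if "n > 0" for k n
 proof -
  have nat_case: "M (\<lambda>_. real k / real n) = real k / real n" for k
  proof -
   have "mult n (\<lambda>_. real k / real n) = mult k (\<lambda>_. 1)" using that by (simp add: mult_eq)
   then have "real n * M (\<lambda>_. real k / real n) = real k"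
    using M_mult[of n "\<lambda>_. real k / real n"] M_mult[of k "\<lambda>_. 1"] M(3) by simp
   then show ?thesis using that by (simp add: field_simps)
  qed
  show ?thesis
  proof (cases "k >= 0")
   case True
   then show ?thesis using nat_case[of "nat k"] by simp
  next
   case False
   have "M (\<lambda>_. real_of_int k / real n) = - M (\<lambda>_. real (nat (- k)) / real n)"
    using M_minus[of "\<lambda>_. real (nat (- k)) / real n"] False by (simp add: fun_Compl_def)
   then show ?thesis using nat_case[of "nat (- k)"] False by simp
  qed
 qed
 have M_const: "M (\<lambda>_. c) = c" for c
 proof -
  have "\<bar>M (\<lambda>_. c) - c\<bar> <= 2 / real (Suc n)" for n
  proof -
   define k where "k = \<lfloor>c * real (Suc n)\<rfloor>"
   define d where "d = real_of_int k / real (Suc n)"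
   have d: "\<bar>c - d\<bar> <= 1 / real (Suc n)"
   proof -
    have "\<bar>c * real (Suc n) - real_of_int k\<bar> <= 1" unfolding k_def by linarith
    moreover have "c - d = (c * real (Suc n) - real_of_int k) / real (Suc n)"
     by (simp add: d_def field_simps)
    ultimately show ?thesis by (simp add: abs_divide divide_right_mono)
   qed
   have "M (\<lambda>_. c) - d = M ((\<lambda>_. c) - (\<lambda>_. d))"
    using M_const_of_int[of "Suc n" k] by (simp add: M_diff d_def)
   moreover have "\<bar>M ((\<lambda>_. c) - (\<lambda>_. d))\<bar> <= 1 / real (Suc n)"
    by (rule M_abs, rule mean_bound_of_bound) (use d in simp)
   moreover have "2 / real (Suc n) = 1 / real (Suc n) + 1 / real (Suc n)" by simp
   ultimately show ?thesis using d by linarith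
  qed
  then have "\<bar>M (\<lambda>_. c) - c\<bar> <= 0 + e" if "e > 0" for e
  proof -
   obtain n where n: "2 / e < real n" using reals_Archimedean2 by blast
   then have "2 / real (Suc n) <= e" using that by (simp add: field_simps)
   then show ?thesis using \<open>!!n. \<bar>M (\<lambda>_. c) - c\<bar> <= 2 / real (Suc n)\<close>[of n] by linarith
  qed
  then have "\<bar>M (\<lambda>_. c) - c\<bar> <= 0" by (rule field_le_epsilon)
  then show ?thesis by simp
 qed
 show ?thesis
 proof (rule that[of M])
  show "M (\<lambda>i. b i + c i) = M b + M c" for b c
   using M(1)[of b c] by (simp add: plus_fun_def)
 next
  fix b :: "nat => real" and B c assume "!!i. \<bar>b i - c\<bar> <= B"
  then have "\<bar>M (b - (\<lambda>_. c))\<bar> <= B" by (intro M_abs mean_bound_of_bound) auto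
  then show "\<bar>M b - c\<bar> <= B" by (simp add: M_diff M_const)
 next
  fix b :: "nat => real" assume "bounded_seq b"
  then obtain B where B: "!!i. \<bar>b i\<bar> <= B" by (auto simp: bounded_seq_def)
  have "mean_bound ((\<lambda>i. b (Suc i)) - b) 0"
   unfolding mean_bound_def
  proof (intro allI impI)
   fix \<epsilon> :: real assume "\<epsilon> > 0"
   obtain N where N: "2 * B / \<epsilon> < real N" using reals_Archimedean2 by blast
   have "\<bar>\<Sum>i<n. ((\<lambda>i. b (Suc i)) - b) i\<bar> <= real n * (0 + \<epsilon>)" if "n >= N" for n
   proof -
    have "(\<Sum>i<n. ((\<lambda>i. b (Suc i)) - b) i) = b n - b 0"
     by (simp add: sum_lessThan_telescope)
    then have "\<bar>\<Sum>i<n. ((\<lambda>i. b (Suc i)) - b) i\<bar> <= 2 * B" using B[of n] B[of 0] by linarith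
    also have "2 * B <= real N * \<epsilon>" using N \<open>\<epsilon> > 0\<close> by (simp add: field_simps)
    also have "\<dots> <= real n * \<epsilon>" using that \<open>\<epsilon> > 0\<close> by simp
    finally show ?thesis by simp
   qed
   then show "\<exists>N. \<forall>n\<ge>N. \<bar>\<Sum>i<n. ((\<lambda>i. b (Suc i)) - b) i\<bar> <= real n * (0 + \<epsilon>)" by blast
  qed
  then have "\<bar>M ((\<lambda>i. b (Suc i)) - b)\<bar> <= 0" by (rule M_abs)
  then show "M (\<lambda>i. b (Suc i)) = M b" by (simp add: M_diff)
 qed
qed

section \<open>Quasimorphisms\<close>

text \<open>Groups are written additively without commutativity. These rules turn a group word into
  a right-associated sum of generators and inverses; \<open>add_uminus_conv_diff\<close> would undo
  the first of them and is therefore deleted in the calls.\<close>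

lemmas group_add_simps = diff_conv_add_uminus minus_add add.assoc

definition imean :: "(nat => real) => real" where
 "imean = (SOME M. (\<forall>b c. M (\<lambda>i. b i + c i) = M b + M c) \<and>
   (\<forall>b B c. (\<forall>i. \<bar>b i - c\<bar> <= B) --> \<bar>M b - c\<bar> <= B) \<and>
   (\<forall>b. bounded_seq b --> M (\<lambda>i. b (Suc i)) = M b))"

lemma imean:
 "imean (\<lambda>i. b i + c i) = imean b + imean c"
 "(!!i. \<bar>b i - a\<bar> <= B) ==> \<bar>imean b - a\<bar> <= B"
 "bounded_seq b ==> imean (\<lambda>i. b (Suc i)) = imean b"
proof -
 have "\<exists>M. (\<forall>b c. M (\<lambda>i. b i + c i) = M b + M c) \<and>
   (\<forall>b B c. (\<forall>i. \<bar>b i - c\<bar> <= B) --> \<bar>M b - c\<bar> <= B) \<and>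
   (\<forall>b. bounded_seq b --> M (\<lambda>i. b (Suc i)) = M b)"
  by (rule invariant_mean) blast
 from someI_ex[OF this, folded imean_def]
 show "imean (\<lambda>i. b i + c i) = imean b + imean c"
  "(!!i. \<bar>b i - a\<bar> <= B) ==> \<bar>imean b - a\<bar> <= B"
  "bounded_seq b ==> imean (\<lambda>i. b (Suc i)) = imean b"
  by blast+
qed

lemma imean_const [simp]: "imean (\<lambda>_. c) = c"
 using imean(2)[of "\<lambda>_. c" c 0] by simp

lemma imean_minus: "imean (\<lambda>i. - b i) = - imean b"
 using imean(1)[of b "\<lambda>i. - b i"] by simp

lemma imean_diff: "imean (\<lambda>i. b i - c i) = imean b - imean c"
 using imean(1)[of b "\<lambda>i. - c i"] by (simp add: imean_minus)

section \<open>Natural and integral powers\<close>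

primrec npow :: "'g::group_add => nat => 'g" where
 "npow x 0 = 0"
| "npow x (Suc n) = npow x n + x"

lemma npow_add: "npow x (m + n) = npow x m + npow x n"
 by (induction n) (auto simp: add.assoc)

lemma npow_Suc_left: "npow x (Suc n) = x + npow x n"
 using npow_add[of x 1 n] by simp

lemma npow_mult: "npow x (m * n) = npow (npow x m) n"
proof (induction n)
 case (Suc n)
 then show ?case using npow_add[of x "m * n" m] by (simp add: add.commute[of m])
qed simp

lemma npow_conj: "npow (c + x - c) n = c + npow x n - c"
 by (induction n) (auto simp: group_add_simps simp del: add_uminus_conv_diff)

definition ipow :: "'g::group_add => int => 'g" where
 "ipow x k = (if k >= 0 then npow x (nat k) else - npow x (nat (- k)))"

lemma ipow_0 [simp]: "ipow x 0 = 0" and ipow_1 [simp]: "ipow x 1 = x"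
 by (auto simp: ipow_def)

lemma ipow_add_1: "ipow x (k + 1) = ipow x k + x"
proof (cases "k >= 0")
 case True
 then show ?thesis by (simp add: ipow_def nat_add_distrib)
next
 case False
 then obtain n where n: "k = - int (Suc n)"
  by (metis int_cases not_le negative_zle_0 of_nat_0_le_iff)
 have "nat (- k) = Suc n" using n by simp
 then have "ipow x k = - npow x (Suc n)" using False by (simp only: ipow_def if_False)
 moreover have "ipow x (k + 1) = - npow x n"
 proof -
  have "k + 1 = - int n" using n by simp
  show ?thesis unfolding \<open>k + 1 = - int n\<close> by (cases "n = 0") (simp_all add: ipow_def)
 qed
 ultimately show ?thesis
  by (simp add: npow_Suc_left group_add_simps del: npow.simps add_uminus_conv_diff)
qed

lemma ipow_diff_1: "ipow x (k - 1) = ipow x k - x"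
 using ipow_add_1[of x "k - 1"] by (simp add: add_diff_eq)

lemma ipow_add: "ipow x (k + l) = ipow x k + ipow x l"
proof (induction l rule: int_induct[where k = 0])
 case (step1 i)
 have "ipow x (k + (i + 1)) = ipow x (k + i) + x" using ipow_add_1[of x "k + i"] by (simp add: add.assoc)
 then show ?case using step1 ipow_add_1[of x i] by (simp add: add.assoc)
next
 case (step2 i)
 have "ipow x (k + (i - 1)) = ipow x (k + i) - x" using ipow_diff_1[of x "k + i"] by (simp add: add_diff_eq)
 then show ?case using step2 ipow_diff_1[of x i] by (simp add: add_diff_eq)
qed simp

lemma ipow_minus: "ipow x (- k) = - ipow x k"
 using ipow_add[of x k "- k"] by (simp add: minus_unique)

lemma ipow_diff: "ipow x (k - l) = ipow x k - ipow x l"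
 using ipow_add[of x k "- l"] by (simp add: ipow_minus)

text \<open>Antisymmetry costs nothing: \<open>quasi_le_qm\<close> arranges it without raising the
  defect and moves the values by at most 1.\<close>

definition qm :: "('g::group_add => real) => bool" where
 "qm f \<longleftrightarrow> (\<forall>g. f (- g) = - f g) \<and> (\<forall>g h. \<bar>f g + f h - f (g + h)\<bar> <= 1)"

lemma qm_minus: "qm f ==> f (- g) = - f g"
 and qm_add: "qm f ==> \<bar>f g + f h - f (g + h)\<bar> <= 1"
 by (auto simp: qm_def)

lemma qm_0: "qm f ==> f 0 = 0"
 using qm_minus[of f 0] by simp

text \<open>The homogenization, that is, the limit of \<open>f (npow x n) / n\<close>. As a mean of
  bounded increments it exists without a proof of convergence.\<close>

definition homog :: "('g::group_add => real) => 'g => real" where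
 "homog f x = imean (\<lambda>j. f (npow x (Suc j)) - f (npow x j))"

lemma imean_shift: "bounded_seq b ==> imean (\<lambda>j. b (j + k)) = imean b"
proof (induction k)
 case (Suc k)
 then have "bounded_seq (\<lambda>j. b (j + k))" by (auto simp: bounded_seq_def)
 then show ?case using imean(3)[of "\<lambda>j. b (j + k)"] Suc by simp
qed simp

lemma homog_close:
 assumes "qm f"
 shows "\<bar>f (npow x n) - real n * homog f x\<bar> <= 1"
proof -
 define b where "b = (\<lambda>j. f (npow x (Suc j)) - f (npow x j))"
 have bd: "bounded_seq b"
  unfolding b_def
 proof (rule bounded_seqI[of _ "\<bar>f x\<bar> + 1"])
  fix i show "\<bar>f (npow x (Suc i)) - f (npow x i)\<bar> <= \<bar>f x\<bar> + 1"
   using qm_add[OF assms, of "npow x i" x] by simp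
 qed
 \<comment> \<open>Shift invariance collects \<open>n\<close> increments into
   \<open>f (npow x (j + n)) - f (npow x j)\<close>, which for every \<open>j\<close> lies within
   the defect of \<open>f (npow x n)\<close>.\<close>
 have "real n * imean b = imean (\<lambda>j. f (npow x (j + n)) - f (npow x j))"
 proof (induction n)
  case (Suc n)
  have "imean (\<lambda>j. f (npow x (j + Suc n)) - f (npow x j)) =
    imean (\<lambda>j. (f (npow x (j + n)) - f (npow x j)) + b (j + n))"
   by (simp add: b_def)
  then show ?case using Suc imean_shift[OF bd, of n] by (simp only: imean(1)) (simp add: algebra_simps)
 qed simp
 moreover have "\<bar>imean (\<lambda>j. f (npow x (j + n)) - f (npow x j)) - f (npow x n)\<bar> <= 1"
 proof (rule imean(2))
  fix j show "\<bar>f (npow x (j + n)) - f (npow x j) - f (npow x n)\<bar> <= 1"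
   using qm_add[OF assms, of "npow x j" "npow x n"] by (simp add: npow_add)
 qed
 ultimately show ?thesis unfolding homog_def b_def[symmetric] by (simp only: abs_minus_commute)
qed

lemma real_mult_bounded_imp_zero:
 fixes a :: real
 assumes "!!n. real n * a <= C"
 shows "a <= 0"
proof (rule ccontr)
 assume "\<not> a <= 0"
 moreover obtain n where "C / a < real n" using reals_Archimedean2 by blast
 ultimately show False using assms[of n] by (simp add: field_simps)
qed

lemma homog_leI:
 assumes "qm f" "!!n. f (npow x n) <= real n * a + C"
 shows "homog f x <= a"
proof -
 have "real n * (homog f x - a) <= C + 1" for n
  using homog_close[OF assms(1), of x n] assms(2)[of n] by (simp add: algebra_simps abs_le_iff)
 then show ?thesis using real_mult_bounded_imp_zero[of "homog f x - a" "C + 1"] by simp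
qed

lemma homog_eqI:
 assumes "qm f" "!!n. \<bar>f (npow x n) - real n * a\<bar> <= C"
 shows "homog f x = a"
proof -
 have "real n * (homog f x - a) <= C + 1" "real n * (a - homog f x) <= C + 1" for n
  using homog_close[OF assms(1), of x n] assms(2)[of n] by (simp_all add: algebra_simps abs_le_iff)
 then show ?thesis using real_mult_bounded_imp_zero[of "homog f x - a" "C + 1"]
  real_mult_bounded_imp_zero[of "a - homog f x" "C + 1"] by simp
qed

lemma homog_conj:
 assumes "qm f"
 shows "homog f (c + x - c) = homog f x"
proof (rule homog_eqI[OF assms])
 fix n
 have "\<bar>f (c + npow x n - c) - f (npow x n)\<bar> <= 2"
  using qm_add[OF assms, of "c + npow x n" "- c"] qm_add[OF assms, of c "npow x n"] qm_minus[OF assms, of c]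
  by simp
 then show "\<bar>f (npow (c + x - c) n) - real n * homog f x\<bar> <= 3"
  using homog_close[OF assms, of x n] by (simp add: npow_conj)
qed

text \<open>
 Each cusp of a pair of pants with fundamental group \<open>\<langle>a, b\<rangle>\<close> is averaged over, and the pair of
 pants is the union of two ideal triangles, each contributing at most \<open>1\<close>.
\<close>

lemma homog_add_le:
 fixes a b :: "'g::group_add"
 assumes f: "qm f"
 shows "homog f (a + b) <= homog f a + homog f b + 2"
proof -
 define c where "c = a + b"
 define F where "F = (\<lambda>x y. f (- x + y))"
 have F_anti: "F y x = - F x y" for x y
  using qm_minus[OF f, of "- x + y"] by (simp add: F_def group_add_simps del: add_uminus_conv_diff)
 have F_inv: "F (g + x) (g + y) = F x y" for g x y
  by (simp add: F_def group_add_simps del: add_uminus_conv_diff)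
 have F_tri: "\<bar>F x y + F y z - F x z\<bar> <= 1" for x y z
  using qm_add[OF f, of "- x + y" "- y + z"] by (simp add: F_def group_add_simps del: add_uminus_conv_diff)
 define A B C where "A = npow a" and "B = npow b" and "C = npow c"
 have shiftA: "a + A i = A (Suc i)" and shiftB: "b + B i = B (Suc i)" for i
  by (simp_all add: A_def B_def npow_Suc_left del: npow.simps)
 have shiftC: "- a + C (Suc i) = b + C i" for i
  by (simp add: C_def c_def npow_Suc_left group_add_simps del: npow.simps add_uminus_conv_diff)
 \<comment> \<open>The ideal vertices are replaced by points far out in the cusps. The two triangles
   share the side from \<open>A i\<close> to \<open>B j\<close>, which cancels; translations match
   their other sides, up to one step along a cusp.\<close>
 define T where "T = (\<lambda>i j k. F (A i) (B j) + F (B j) (C (Suc k)) + F (C (Suc k)) (A i) -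
   (F (A i) (B j) + F (B j) (- a + C (Suc k)) + F (- a + C (Suc k)) (A i)))"
 have T_le: "\<bar>T i j k\<bar> <= 2" for i j k
 proof -
  have "\<bar>F x y + F y z + F z x\<bar> <= 1" for x y z using F_tri[of x y z] F_anti[of x z] by simp
  from this[of "A i" "B j" "C (Suc k)"] this[of "A i" "B j" "- a + C (Suc k)"]
  show ?thesis unfolding T_def by linarith
 qed
 have T_eq: "T i (Suc j) k = (F (B (Suc j)) (C (Suc k)) - F (B j) (C k)) + (F (C (Suc k)) (A i) - F (C (Suc k)) (A (Suc i)))" for i j k
 proof -
  have "F (B (Suc j)) (- a + C (Suc k)) = F (B j) (C k)"
   unfolding shiftC shiftB[symmetric] F_inv ..
  moreover have "F (- a + C (Suc k)) (A i) = F (C (Suc k)) (A (Suc i))"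
   using F_inv[of a "- a + C (Suc k)" "A i"] shiftA[of i] by (simp add: add.assoc[symmetric])
  ultimately show ?thesis by (simp add: T_def)
 qed
 have key: "real n * (homog f a + homog f b + 2 - homog f c) >= - 10" for n
 proof (cases "n = 0")
  case False
  define N where "N = real n"
  have N: "N > 0" using False by (simp add: N_def)
  \<comment> \<open>There are \<open>n^3\<close> terms of size at most 2. After telescoping,
    \<open>n^2\<close> copies of \<open>f (C n) - f (A n) - f (B n)\<close> remain up to bounded
    errors, so this difference grows at most like \<open>2 n\<close>.\<close>
  define S where "S = (\<Sum>i<n. \<Sum>j<n. \<Sum>k<n. T i (Suc j) k)"
  have "\<bar>S\<bar> <= (\<Sum>i<n. \<Sum>j<n. \<Sum>k<n. 2)"
   unfolding S_def by (intro order_trans[OF sum_abs] sum_mono T_le)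
  then have S1: "\<bar>S\<bar> <= 2 * N * N * N" by (simp add: N_def)
  have "S = (\<Sum>i<n. \<Sum>j<n. \<Sum>k<n. F (B (Suc j)) (C (Suc k)) - F (B j) (C k)) +
    (\<Sum>i<n. \<Sum>j<n. \<Sum>k<n. F (C (Suc k)) (A i) - F (C (Suc k)) (A (Suc i)))"
   unfolding S_def T_eq by (simp only: sum.distrib)
  also have "(\<Sum>i<n. \<Sum>j<n. \<Sum>k<n. F (B (Suc j)) (C (Suc k)) - F (B j) (C k)) =
    N * ((\<Sum>k<n. F (B n) (C (Suc k)) - F (B 0) (C (Suc k))) + (\<Sum>j<n. F (B j) (C n) - F (B j) (C 0)))"
  proof -
   have "(\<Sum>j<n. \<Sum>k<n. F (B (Suc j)) (C (Suc k)) - F (B j) (C k)) =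
    (\<Sum>j<n. \<Sum>k<n. (F (B (Suc j)) (C (Suc k)) - F (B j) (C (Suc k))) + (F (B j) (C (Suc k)) - F (B j) (C k)))"
    by simp
   also have "\<dots> = (\<Sum>j<n. \<Sum>k<n. F (B (Suc j)) (C (Suc k)) - F (B j) (C (Suc k))) +
     (\<Sum>j<n. \<Sum>k<n. F (B j) (C (Suc k)) - F (B j) (C k))"
    by (simp only: sum.distrib)
   also have "(\<Sum>j<n. \<Sum>k<n. F (B (Suc j)) (C (Suc k)) - F (B j) (C (Suc k))) =
     (\<Sum>k<n. F (B n) (C (Suc k)) - F (B 0) (C (Suc k)))"
    by (subst sum.swap) (simp only: sum_lessThan_telescope[of "\<lambda>j. F (B j) (C (Suc _))"])
   also have "(\<Sum>j<n. \<Sum>k<n. F (B j) (C (Suc k)) - F (B j) (C k)) = (\<Sum>j<n. F (B j) (C n) - F (B j) (C 0))"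
    by (simp only: sum_lessThan_telescope[of "\<lambda>k. F (B _) (C k)"])
   finally show ?thesis by (simp add: N_def)
  qed
  also have "(\<Sum>i<n. \<Sum>j<n. \<Sum>k<n. F (C (Suc k)) (A i) - F (C (Suc k)) (A (Suc i))) =
    N * (\<Sum>k<n. F (C (Suc k)) (A 0) - F (C (Suc k)) (A n))"
  proof -
   have "(\<Sum>i<n. \<Sum>j<n. \<Sum>k<n. F (C (Suc k)) (A i) - F (C (Suc k)) (A (Suc i))) =
    N * (\<Sum>i<n. \<Sum>k<n. F (C (Suc k)) (A i) - F (C (Suc k)) (A (Suc i)))"
    by (simp add: N_def sum_distrib_left)
   also have "(\<Sum>i<n. \<Sum>k<n. F (C (Suc k)) (A i) - F (C (Suc k)) (A (Suc i))) =
     (\<Sum>k<n. F (C (Suc k)) (A 0) - F (C (Suc k)) (A n))"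
    by (subst sum.swap) (simp only: sum_lessThan_telescope'[of "\<lambda>i. F (C (Suc _)) (A i)"])
   finally show ?thesis .
  qed
  finally have S2: "S = N * ((\<Sum>k<n. F (B n) (C (Suc k)) - F (B 0) (C (Suc k))) + (\<Sum>j<n. F (B j) (C n) - F (B j) (C 0))
    + (\<Sum>k<n. F (C (Suc k)) (A 0) - F (C (Suc k)) (A n)))"
   by (simp add: algebra_simps)
  have e1: "F (B n) (C (Suc k)) - F (B 0) (C (Suc k)) <= - f (B n) + 1" for k
   using F_tri[of "B 0" "B n" "C (Suc k)"] by (simp add: F_def B_def abs_le_iff)
  have e2: "F (B j) (C n) - F (B j) (C 0) <= f (C n) + 1" for j
   using F_tri[of "B j" "C 0" "C n"] by (simp add: F_def C_def abs_le_iff)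
  have e3: "F (C (Suc k)) (A 0) - F (C (Suc k)) (A n) <= - f (A n) + 1" for k
   using F_tri[of "C (Suc k)" "A 0" "A n"] by (simp add: F_def A_def abs_le_iff)
  have e1': "F (B n) (C (Suc k)) - F (B 0) (C (Suc k)) >= - f (B n) - 1" for k
   using F_tri[of "B 0" "B n" "C (Suc k)"] by (simp add: F_def B_def abs_le_iff)
  have e2': "F (B j) (C n) - F (B j) (C 0) >= f (C n) - 1" for j
   using F_tri[of "B j" "C 0" "C n"] by (simp add: F_def C_def abs_le_iff)
  have e3': "F (C (Suc k)) (A 0) - F (C (Suc k)) (A n) >= - f (A n) - 1" for k
   using F_tri[of "C (Suc k)" "A 0" "A n"] by (simp add: F_def A_def abs_le_iff)
  have "S >= N * ((\<Sum>k<n. - f (B n) - 1) + (\<Sum>j<n. f (C n) - 1) + (\<Sum>k<n. - f (A n) - 1))"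
   unfolding S2 using N e1' e2' e3' by (intro mult_left_mono add_mono sum_mono) auto
  also have "N * ((\<Sum>k<n. - f (B n) - 1) + (\<Sum>j<n. f (C n) - 1) + (\<Sum>k<n. - f (A n) - 1)) =
    N * N * (f (C n) - f (A n) - f (B n) - 3)"
   by (simp add: N_def algebra_simps)
  finally have "N * N * (f (C n) - f (A n) - f (B n) - 3) <= N * N * (2 * N)"
   using S1 by (simp add: mult_ac abs_le_iff)
  then have "f (C n) - f (A n) - f (B n) - 3 <= 2 * N"
   using N by simp
  then show ?thesis
   using homog_close[OF f, of a n] homog_close[OF f, of b n] homog_close[OF f, of c n]
   by (simp add: A_def B_def C_def N_def algebra_simps abs_le_iff)
 qed simp
 have "real n * (homog f c - (homog f a + homog f b + 2)) <= 10" for n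
  using key[of n] by (simp add: algebra_simps)
 then show ?thesis
  using real_mult_bounded_imp_zero[of "homog f c - (homog f a + homog f b + 2)" 10] by (simp add: c_def)
qed

text \<open>An edge from the cusp of \<open>r\<close> to the cusp of \<open>s\<close>, cut off at
  depths \<open>i\<close> and \<open>j\<close>. The linear terms compensate the growth of
  \<open>f\<close> along powers, so all values stay within 4 of \<open>f x\<close>: 1 for each of
  two products and 1 for each of two homogenizations.\<close>

definition cusp_fun :: "('g::group_add => real) => 'g => 'g => 'g => nat => nat => real" where
 "cusp_fun f r s x i j = f (- npow r i + x + npow s j) + real i * homog f r - real j * homog f s"

text \<open>
 The means over the two cusps do not commute. Taking the average of both orders makes the result
 antisymmetric.
\<close>

definition cusp_mean :: "('g::group_add => real) => 'g => 'g => 'g => real" where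
 "cusp_mean f r s x = (imean (\<lambda>i. imean (\<lambda>j. cusp_fun f r s x i j)) +
   imean (\<lambda>j. imean (\<lambda>i. cusp_fun f r s x i j))) / 2"

lemma cusp_fun_minus: "qm f ==> cusp_fun f s r (- x) j i = - cusp_fun f r s x i j"
 using qm_minus[of f "- npow r i + x + npow s j"]
 by (simp add: cusp_fun_def minus_add add.assoc)

lemma cusp_mean_minus:
 assumes "qm f"
 shows "cusp_mean f s r (- x) = - cusp_mean f r s x"
 unfolding cusp_mean_def cusp_fun_minus[OF assms, of s r x] imean_minus
 by (simp only: minus_divide_left minus_add_distrib add.commute)

lemma cusp_fun_bound: 
 assumes "qm f"
 shows "\<bar>cusp_fun f r s x i j - f x\<bar> <= 4"
 using qm_add[OF assms, of "- npow r i + x" "npow s j"] qm_add[OF assms, of "- npow r i" x]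
  qm_minus[OF assms, of "npow r i"] homog_close[OF assms, of r i] homog_close[OF assms, of s j]
 by (simp add: cusp_fun_def)

lemma cusp_fun_triangle:
 assumes "qm f"
 shows "\<bar>cusp_fun f r s x i j + cusp_fun f s t y j k - cusp_fun f r t (x + y) i k\<bar> <= 1"
 using qm_add[OF assms, of "- npow r i + x + npow s j" "- npow s j + y + npow t k"]
 by (simp add: cusp_fun_def add.assoc)

lemma abs_mean_le_1:
 fixes a b c a' b' c' :: real
 shows "\<bar>a + b - c - 0\<bar> <= 1 ==> \<bar>a' + b' - c' - 0\<bar> <= 1 ==> \<bar>(a + a') / 2 + (b + b') / 2 - (c + c') / 2\<bar> <= 1"
 by (simp add: abs_le_iff field_simps)

lemma cusp_mean_triangle:
 assumes f: "qm f"
 shows "\<bar>cusp_mean f r s x + cusp_mean f s t y - cusp_mean f r t (x + y)\<bar> <= 1"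
proof -
 define D where "D = (\<lambda>i j k. cusp_fun f r s x i j + cusp_fun f s t y j k - cusp_fun f r t (x + y) i k)"
 have D: "\<bar>D i j k - 0\<bar> <= 1" for i j k
  using cusp_fun_triangle[OF f] by (simp add: D_def)
 \<comment> \<open>The order \<open>i, j, k\<close> of the means induces on each pair of indices the
   mean with the first index outside, and the reversed order induces the other one. Each half of
   \<open>cusp_mean\<close> thus satisfies the triangle inequality by itself.\<close>
 have 1: "\<bar>imean (\<lambda>i. imean (\<lambda>j. imean (\<lambda>k. D i j k))) - 0\<bar> <= 1"
  by (intro imean(2) D)
 have 2: "imean (\<lambda>i. imean (\<lambda>j. imean (\<lambda>k. D i j k))) =
   imean (\<lambda>i. imean (\<lambda>j. cusp_fun f r s x i j)) + imean (\<lambda>j. imean (\<lambda>k. cusp_fun f s t y j k)) -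
   imean (\<lambda>i. imean (\<lambda>k. cusp_fun f r t (x + y) i k))"
  by (simp add: D_def imean(1) imean_diff)
 have 3: "\<bar>imean (\<lambda>k. imean (\<lambda>j. imean (\<lambda>i. D i j k))) - 0\<bar> <= 1"
  by (intro imean(2) D)
 have 4: "imean (\<lambda>k. imean (\<lambda>j. imean (\<lambda>i. D i j k))) =
   imean (\<lambda>j. imean (\<lambda>i. cusp_fun f r s x i j)) + imean (\<lambda>k. imean (\<lambda>j. cusp_fun f s t y j k)) -
   imean (\<lambda>k. imean (\<lambda>i. cusp_fun f r t (x + y) i k))"
  by (simp add: D_def imean(1) imean_diff)
 show ?thesis
  unfolding cusp_mean_def by (rule abs_mean_le_1) (use 1 3 in \<open>simp_all only: 2 4\<close>)
qed

text \<open>Multiplication by \<open>s\<close> shifts the index \<open>j\<close> by one, which the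
  mean does not notice; only the linear correction remains. The averaging is done for the sake of
  this exact identity.\<close>

lemma cusp_mean_add_right:
 assumes f: "qm f"
 shows "cusp_mean f r s (x + s) = cusp_mean f r s x + homog f s"
proof -
 have bd: "bounded_seq (\<lambda>j. cusp_fun f r s x i j)" for i
 proof (rule bounded_seqI)
  fix j show "\<bar>cusp_fun f r s x i j\<bar> <= \<bar>f x\<bar> + 4" using cusp_fun_bound[OF f, of r s x i j] by simp
 qed
 have bd': "bounded_seq (\<lambda>j. imean (\<lambda>i. cusp_fun f r s x i j))"
 proof (rule bounded_seqI)
  fix j 
  have "\<bar>imean (\<lambda>i. cusp_fun f r s x i j) - f x\<bar> <= 4" by (intro imean(2) cusp_fun_bound f)
  then show "\<bar>imean (\<lambda>i. cusp_fun f r s x i j)\<bar> <= \<bar>f x\<bar> + 4" by simp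
 qed
 have *: "cusp_fun f r s (x + s) i j = cusp_fun f r s x i (Suc j) + homog f s" for i j
  by (simp add: cusp_fun_def npow_Suc_left add.assoc algebra_simps del: npow.simps)
 have "imean (\<lambda>i. imean (\<lambda>j. cusp_fun f r s (x + s) i j)) = imean (\<lambda>i. imean (\<lambda>j. cusp_fun f r s x i j)) + homog f s"
  unfolding * by (simp add: imean(1) imean(3)[OF bd])
 moreover have "imean (\<lambda>j. imean (\<lambda>i. cusp_fun f r s (x + s) i j)) = imean (\<lambda>j. imean (\<lambda>i. cusp_fun f r s x i j)) + homog f s"
  unfolding * using imean(3)[OF bd'] by (simp add: imean(1))
 ultimately show ?thesis by (simp add: cusp_mean_def)
qed

lemma cusp_mean_add_ipow:
 assumes f: "qm f"
 shows "cusp_mean f r s (x + ipow s k) = cusp_mean f r s x + real_of_int k * homog f s"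
proof (induction k rule: int_induct[where k = 0])
 case (step1 i)
 have "x + ipow s (i + 1) = (x + ipow s i) + s" by (simp add: ipow_add_1 add.assoc)
 then show ?case using step1 cusp_mean_add_right[OF f, of r s "x + ipow s i"]
  by (simp add: distrib_right)
next
 case (step2 i)
 have "x + ipow s i = (x + ipow s (i - 1)) + s"
  by (simp add: ipow_diff_1 add.assoc)
 then show ?case using step2 cusp_mean_add_right[OF f, of r s "x + ipow s (i - 1)"]
  by (simp add: left_diff_distrib)
qed simp

lemma cusp_mean_0: "qm f ==> cusp_mean f r r 0 = 0"
 using cusp_mean_minus[of f r r 0] by simp

section \<open>Quasimorphisms on HNN extensions\<close>

text \<open>
 A state \<open>([(c\<^sub>k, e\<^sub>k), \<dots>, (c\<^sub>1, e\<^sub>1)], x, s)\<close> stands for the normal form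
 \<open>c\<^sub>1 t\<^bsup>e\<^sub>1\<^esup> \<dots> c\<^sub>k t\<^bsup>e\<^sub>k\<^esup> x z\<^bsup>s\<^esup>\<close> in a central extension of the HNN extension with
 \<open>J True k \<sqdot> t = t \<sqdot> J False k\<close> up to a power of the central element \<open>z\<close>. The \<open>c\<^sub>i\<close> are coset
 representatives. Multiplying from the right only affects the top of the stack. The argument \<open>p\<close>
 of \<open>F p q x\<close> tells through which of the two kinds of edges a path in the Bass--Serre tree enters
 a vertex, and \<open>q\<close> through which it leaves.
\<close>

type_synonym 'g state = "('g \<times> bool) list \<times> 'g \<times> real"

locale hnn =
 fixes D :: "int set" and J :: "bool => int => 'g::group_add" and \<xi> :: "bool => int => real"
  and F :: "bool => bool => 'g => real"
 assumes D0: "0 \<in> D" and D_diff: "k \<in> D ==> l \<in> D ==> k - l \<in> D"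
  and J_diff: "J e (k - l) = J e k - J e l" and J_inj: "inj_on (J e) D"
  and \<xi>_diff: "\<xi> e (k - l) = \<xi> e k - \<xi> e l"
  and F_minus: "F q p (- x) = - F p q x"
  and F_triangle: "\<bar>F p q x + F q s y - F p s (x + y)\<bar> <= 1"
  and F_right: "k \<in> D ==> F p q (x + J q k) = F p q x + \<xi> q k"
begin

lemma D_minus: "k \<in> D ==> - k \<in> D"
 using D_diff[of 0 k] D0 by simp

lemma D_add: "k \<in> D ==> l \<in> D ==> k + l \<in> D"
 using D_diff[of k "- l"] D_minus[of l] by simp

lemma J_0 [simp]: "J e 0 = 0"
 using J_diff[of e 0 0] by simp

lemma J_minus: "J e (- k) = - J e k"
 using J_diff[of e 0 k] by simp

lemma J_add: "J e (k + l) = J e k + J e l"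
 using J_diff[of e k "- l"] by (simp add: J_minus)

lemma \<xi>_0 [simp]: "\<xi> e 0 = 0"
 using \<xi>_diff[of e 0 0] by simp

lemma \<xi>_add: "\<xi> e (k + l) = \<xi> e k + \<xi> e l"
 using \<xi>_diff[of e k "- l"] \<xi>_diff[of e 0 l] by simp

lemma F_0 [simp]: "F p p 0 = 0"
 using F_minus[of p p 0] by simp

lemma F_left: "k \<in> D ==> F p q (J p k + x) = F p q x + \<xi> p k"
 using F_right[of "- k" q p "- x"] F_minus[of q p "J p k + x"] F_minus[of q p x] D_minus[of k]
  \<xi>_diff[of p 0 k]
 by (simp add: J_minus minus_add)

text \<open>The choice is made from the coset as a set, so elements of the same coset have the same
  representative by construction.\<close>

definition rep :: "bool => 'g => 'g" where
 "rep e x = (SOME c. c \<in> (\<lambda>k. x + J e k) ` D)"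

definition idx :: "bool => 'g => int" where
 "idx e x = (THE k. k \<in> D \<and> x = rep e x + J e k)"

definition ind :: "bool => 'g => int" where
 "ind e x = (THE k. k \<in> D \<and> x = J e k)"

lemma rep_in: "rep e x \<in> (\<lambda>k. x + J e k) ` D"
 unfolding rep_def by (rule someI[of _ x]) (use D0 in \<open>auto intro!: image_eqI[of _ _ 0]\<close>)

lemma idx_ex1: "\<exists>!k. k \<in> D \<and> x = rep e x + J e k"
proof -
 obtain k where k: "k \<in> D" "rep e x = x + J e k" using rep_in[of e x] by auto
 have "- k \<in> D \<and> x = rep e x + J e (- k)"
  using k by (simp add: D_minus J_minus add.assoc)
 moreover have "l = l'" if "l \<in> D" "l' \<in> D" "x = rep e x + J e l" "x = rep e x + J e l'" for l l'
  using that J_inj[of e] by (metis add_left_cancel inj_onD)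
 ultimately show ?thesis by blast
qed

lemma idx: "idx e x \<in> D" "x = rep e x + J e (idx e x)"
 using theI'[OF idx_ex1[of x e]] unfolding idx_def by auto

lemma idx_eqI: "k \<in> D ==> x = rep e x + J e k ==> idx e x = k"
 using idx_ex1[of x e] idx(1)[of e x] idx(2)[of x e] by blast

lemma ind_J [simp]: "k \<in> D ==> ind e (J e k) = k"
 unfolding ind_def using J_inj[of e] by (auto dest: inj_onD)

lemma rep_add: 
 assumes "k \<in> D"
 shows "rep e (x + J e k) = rep e x"
proof -
 have "(\<lambda>l. x + J e k + J e l) ` D = (\<lambda>l. x + J e l) ` D" (is "?A = ?B")
 proof
  show "?A \<subseteq> ?B" using assms by (auto simp: add.assoc J_add[symmetric] intro: D_add)
  show "?B \<subseteq> ?A"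
  proof safe
   fix l assume "l \<in> D"
   then have "x + J e l = x + J e k + J e (l - k)" "l - k \<in> D"
    using assms J_add[of e k "l - k"] by (auto simp: add.assoc intro: D_diff)
   then show "x + J e l \<in> ?A" by blast
  qed
 qed
 then show ?thesis unfolding rep_def by metis
qed

lemma idx_add:
 assumes "k \<in> D"
 shows "idx e (x + J e k) = idx e x + k"
proof (rule idx_eqI)
 show "idx e x + k \<in> D" using assms idx by (intro D_add)
 show "x + J e k = rep e (x + J e k) + J e (idx e x + k)"
  using idx(2)[of x e] by (simp add: rep_add assms J_add add.assoc[symmetric])
qed

lemma rep_rep [simp]: "rep e (rep e x) = rep e x"
proof -
 obtain k where "k \<in> D" "rep e x = x + J e k" using rep_in[of e x] by auto
 then show ?thesis by (metis rep_add)
qed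

lemma idx_rep: "rep e c = c ==> idx e c = 0"
 by (rule idx_eqI) (auto simp: D0)

lemma rep_in_image_iff: "rep e x \<in> J e ` D \<longleftrightarrow> x \<in> J e ` D"
proof
 assume "rep e x \<in> J e ` D"
 then obtain k where "k \<in> D" "rep e x = J e k" by auto
 then have "x = J e (k + idx e x)" using idx(2)[of x e] by (simp add: J_add)
 then show "x \<in> J e ` D" using \<open>k \<in> D\<close> idx(1)[of e x] D_add by blast
next
 assume "x \<in> J e ` D"
 then obtain k l where "k \<in> D" "x = J e k" "l \<in> D" "rep e x = x + J e l" using rep_in[of e x] by auto
 then show "rep e x \<in> J e ` D" by (metis D_add J_add image_eqI)
qed

lemma add_in_image_iff: "k \<in> D ==> x + J e k \<in> J e ` D \<longleftrightarrow> x \<in> J e ` D"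
 by (metis rep_add rep_in_image_iff)

lemma add_in_image_iff': 
 assumes "k \<in> D"
 shows "J e k + x \<in> J e ` D \<longleftrightarrow> x \<in> J e ` D"
proof
 assume "J e k + x \<in> J e ` D"
 then obtain l where "l \<in> D" "J e k + x = J e l" by auto
 moreover have "J e (- k + l) = - J e k + J e l" by (simp only: J_add J_minus)
 ultimately have "x = J e (- k + l)" by (metis minus_add_cancel)
 then show "x \<in> J e ` D" using assms \<open>l \<in> D\<close> D_add D_minus by blast
next
 assume "x \<in> J e ` D"
 then show "J e k + x \<in> J e ` D" using assms by (auto simp: J_add[symmetric] intro: D_add)
qed

section \<open>Normal forms and right multiplication by generators\<close>

fun valid :: "('g \<times> bool) list => bool" where
 "valid [] = True"
| "valid [(c, e)] = (rep e c = c)"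
| "valid ((c, e) # (c', e') # st) =
  (rep e c = c \<and> (e' ~= e --> c \<notin> J e ` D) \<and> valid ((c', e') # st))"

lemma valid_Cons: "valid ((c, e) # st) \<longleftrightarrow> rep e c = c \<and> valid st \<and>
  (st = [] \<or> snd (hd st) = e \<or> c \<notin> J e ` D)"
 by (cases st) auto

fun shift :: "real => 'g state => 'g state" where
 "shift a (st, x, s) = (st, x, s + a)"

fun R :: "'g => 'g state => 'g state" where
 "R y (st, x, s) = (st, x + y, s)"

fun pops :: "bool => ('g \<times> bool) list => 'g => bool" where
 "pops e st x \<longleftrightarrow> st ~= [] \<and> snd (hd st) ~= e \<and> x \<in> J e ` D"

lemma popsE:
 assumes "pops e st x"
 obtains k c st' where "k \<in> D" "x = J e k" "st = (c, \<not> e) # st'"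
proof -
 obtain k where "k \<in> D" "x = J e k" using assms by auto
 moreover obtain ce st' where "st = ce # st'" using assms by (cases st) auto
 moreover from this have "ce = (fst ce, \<not> e)" using assms by (auto simp: prod_eq_iff)
 ultimately show ?thesis using that by metis
qed

text \<open>An edge group element that passes the stable letter changes its contribution to the path
  length \<open>val\<close> from \<open>\<xi> e k\<close> to \<open>\<xi> (\<not> e) k\<close>. The
  scalar compensates this, so rewriting into normal form leaves \<open>val\<close> exact.\<close>

fun T :: "bool => 'g state => 'g state" where
 "T e (st, x, s) =
  (if pops e st x
   then (tl st, fst (hd st) + J (\<not> e) (ind e x), s + \<xi> e (ind e x) - \<xi> (\<not> e) (ind e x))
   else ((rep e x, e) # st, J (\<not> e) (idx e x), s + \<xi> e (idx e x) - \<xi> (\<not> e) (idx e x)))"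

definition Valid :: "'g state => bool" where
 "Valid m \<longleftrightarrow> valid (fst m)"

lemma Valid_shift [simp]: "Valid (shift a m) = Valid m"
 and Valid_R [simp]: "Valid (R x m) = Valid m"
 by (cases m; simp add: Valid_def)+

lemma Valid_T [simp]: 
 assumes "Valid m"
 shows "Valid (T e m)"
proof -
 obtain st x s where m: "m = (st, x, s)" by (cases m) auto
 then have v: "valid st" using assms by (simp add: Valid_def)
 show ?thesis
 proof (cases "pops e st x")
  case True
  then show ?thesis using v m by (cases st) (auto simp: Valid_def valid_Cons)
 next
  case False
  then have "valid ((rep e x, e) # st)"
   unfolding valid_Cons using v by (auto simp: rep_in_image_iff)
  then show ?thesis using False unfolding m Valid_def by (simp del: pops.simps)
 qed
qed

lemma R_R: "R y (R x m) = R (x + y) m"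
 by (cases m) (simp add: add.assoc)

lemma R_0 [simp]: "R 0 m = m"
 by (cases m) simp

lemma shift_shift: "shift a (shift b m) = shift (a + b) m"
 by (cases m) (simp add: algebra_simps)

lemma shift_0 [simp]: "shift 0 m = m"
 by (cases m) simp

lemma R_shift: "R x (shift a m) = shift a (R x m)"
 by (cases m) simp

lemma T_shift: "T e (shift a m) = shift a (T e m)"
 by (cases m) simp

text \<open>The defining relation of the HNN extension, exact up to a recorded central power. It is
  what makes the relator act as a shift in \<open>equivariant_quasimorphism\<close>.\<close>

lemma T_R_J:
 assumes k: "k \<in> D"
 shows "T e (R (J e k) m) = shift (\<xi> e k - \<xi> (\<not> e) k) (R (J (\<not> e) k) (T e m))"
proof -
 obtain st x s where m: "m = (st, x, s)" by (cases m) auto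
 show ?thesis
 proof (cases "pops e st x")
  case True
  then obtain l where l: "l \<in> D" "x = J e l" by auto
  have p: "pops e st (x + J e k)" using True k by (simp add: add_in_image_iff)
  have "ind e (x + J e k) = l + k" "ind e x = l"
   using l k by (simp_all add: J_add[symmetric] D_add)
  then show ?thesis using True p by (simp add: m J_add \<xi>_add add.assoc del: pops.simps)
 next
  case False
  then have p: "\<not> pops e st (x + J e k)" using k by (simp add: add_in_image_iff)
  show ?thesis using False p k
   by (simp add: m rep_add idx_add J_add \<xi>_add del: pops.simps)
 qed
qed

text \<open>Validity is essential in the popping case: it guarantees that the entry just removed is
  pushed back and does not cancel against the entry below it.\<close>

lemma T_T:
 assumes "Valid m"
 shows "T (\<not> e) (T e m) = m"
proof -
 obtain st x s where m: "m = (st, x, s)" by (cases m) auto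
 show ?thesis
 proof (cases "pops e st x")
  case True
  then obtain k c st' where k: "k \<in> D" "x = J e k" and st: "st = (c, \<not> e) # st'"
   by (rule popsE)
  have v: "rep (\<not> e) c = c" "st' = [] \<or> snd (hd st') = (\<not> e) \<or> c \<notin> J (\<not> e) ` D"
   using assms unfolding m Valid_def st by (auto simp: valid_Cons)
  have "T e m = (st', c + J (\<not> e) k, s + \<xi> e k - \<xi> (\<not> e) k)"
   using True k by (simp add: m st)
  moreover have "\<not> pops (\<not> e) st' (c + J (\<not> e) k)"
   using v(2) k by (auto simp: add_in_image_iff)
  ultimately show ?thesis using v(1) k
   by (simp add: m st rep_add idx_add idx_rep k del: pops.simps)
 next
  case False
  have "pops (\<not> e) ((rep e x, e) # st) (J (\<not> e) (idx e x))"
   using idx(1)[of e x] by simp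
  then show ?thesis using False idx(1)[of e x] idx(2)[of x e]
   by (simp add: m del: pops.simps)
 qed
qed

primrec app :: "'g state => ('g \<times> bool) list => 'g state" where
 "app m [] = m"
| "app m (ce # st) = T (snd ce) (R (fst ce) (app m st))"

text \<open>The second normal form is replayed on the first. \<open>star_R\<close> and
  \<open>star_T\<close> say that this left multiplication commutes with right multiplication by
  generators, which takes the place of associativity.\<close>

fun star :: "'g state => 'g state => 'g state" where
 "star m (st, x, s) = shift s (R x (app m st))"

lemma Valid_app [simp]: "Valid m ==> Valid (app m st)"
 by (induction st) auto

lemma star_R: "star m (R y m') = R y (star m m')"
 by (cases m') (simp add: R_R R_shift)

lemma star_T:
 assumes "Valid m"
 shows "star m (T e m') = T e (star m m')"
proof -
 obtain st x s where m': "m' = (st, x, s)" by (cases m') auto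
 have rel: "T e (R (y + J e k) \<upsilon>) = shift (\<xi> e k - \<xi> (\<not> e) k) (R (J (\<not> e) k) (T e (R y \<upsilon>)))"
  if "k \<in> D" for y k \<upsilon>
  using T_R_J[OF that, of e "R y \<upsilon>"] by (simp add: R_R)
 show ?thesis
 proof (cases "pops e st x")
  case True
  then obtain k c st' where k: "k \<in> D" "x = J e k" and st: "st = (c, \<not> e) # st'"
   by (rule popsE)
  have "star m (T e m') = shift (s + \<xi> e k - \<xi> (\<not> e) k) (R (c + J (\<not> e) k) (app m st'))"
   using True k by (simp add: m' st)
  moreover have "T e (star m m') = shift (s + \<xi> e k - \<xi> (\<not> e) k) (R (J (\<not> e) k) (T e (T (\<not> e) (R c (app m st')))))"
   using rel[OF k(1), of 0] by (simp add: m' st k T_shift shift_shift algebra_simps)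
  ultimately show ?thesis
   using T_T[of "R c (app m st')" "\<not> e"] assms by (simp add: R_R)
 next
  case False
  define y k where "y = rep e x" and "k = idx e x"
  have x: "k \<in> D" "x = y + J e k" using idx(1)[of e x] idx(2)[of x e] by (auto simp: y_def k_def)
  have "T e m' = ((y, e) # st, J (\<not> e) k, s + \<xi> e k - \<xi> (\<not> e) k)"
   using False unfolding m' y_def k_def by (simp del: pops.simps)
  then show ?thesis
   using rel[OF x(1), of y "app m st"] unfolding m'
   by (simp add: x(2) T_shift shift_shift algebra_simps)
 qed
qed

definition m0 :: "'g state" where
 "m0 = ([], 0, 0)"

lemma Valid_m0 [simp]: "Valid m0"
 by (simp add: Valid_def m0_def)

lemma star_m0 [simp]: "star m m0 = m"
 by (simp add: m0_def)

text \<open>The stack stores the side on which a vertex is left, and the next vertex is entered from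
  the opposite side. The default for the empty stack is a convention that matches the argument of
  \<open>val True\<close>: paths start and end at the cusp \<open>True\<close>.\<close>

fun dir :: "('g \<times> bool) list => bool" where
 "dir [] = True"
| "dir (ce # st) = (\<not> snd ce)"

primrec sval :: "('g \<times> bool) list => real" where
 "sval [] = 0"
| "sval (ce # st) = sval st + F (dir st) (snd ce) (fst ce)"

fun val :: "bool => 'g state => real" where
 "val p (st, x, s) = sval st + F (dir st) p x + s"

lemma val_shift [simp]: "val p (shift a m) = val p m + a"
 by (cases m) simp

lemma val_T_push:
 assumes "\<not> pops e st x"
 shows "val (\<not> e) (T e (st, x, s)) = sval st + F (dir st) e x + s"
proof -
 have "F (\<not> e) (\<not> e) (J (\<not> e) (idx e x)) = \<xi> (\<not> e) (idx e x)"
  using F_right[OF idx(1)[of e x], of "\<not> e" "\<not> e" 0] by simp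
 moreover have "F (dir st) e x = F (dir st) e (rep e x) + \<xi> e (idx e x)"
  using F_right[OF idx(1)[of e x], of "dir st" e "rep e x"] idx(2)[of x e] by simp
 ultimately show ?thesis using assms by (simp del: pops.simps)
qed

text \<open>Backtracking is free of error, because \<open>x + c\<close> lies in the edge group,
  where \<open>F_right\<close> turns the triangle inequality into an equality.\<close>

lemma val_T_pop:
 assumes "pops e st (x + c)"
 shows "val (\<not> e) (T e (st, x + c, s)) = val q (st, x, s) + F q e c"
proof -
 obtain k c' st' where k: "k \<in> D" "x + c = J e k" and st: "st = (c', \<not> e) # st'"
  using assms by (rule popsE)
 have "c = - x + J e k" unfolding k(2)[symmetric] by (simp add: add.assoc[symmetric])
 then have "F q e c = \<xi> e k - F e q x"
  using F_right[OF k(1), of q e "- x"] F_minus[of q e x] by simp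
 then show ?thesis
  using assms k(1) F_right[OF k(1), of "dir st'" "\<not> e" c'] by (simp add: st k(2) ind_J)
qed

text \<open>
 Multiplying \<open>m\<close> by a normal form first cancels, which is exact, then meets one triangle, and
 from then on only appends.
\<close>

lemma val_app:
 assumes "valid st'"
 obtains st x s where "app m st' = (st, x, s)"
  "val (dir st') (st, x, s) = val True m + sval st' \<or>
   \<bar>val (dir st') (st, x, s) - (val True m + sval st')\<bar> <= 1 \<and> st ~= [] \<and> st' ~= [] \<and>
    snd (hd st) = snd (hd st') \<and> x \<in> J (dir st') ` D"
proof -
 have "\<exists>st x s. app m st' = (st, x, s) \<and>
  (val (dir st') (st, x, s) = val True m + sval st' \<or>
   \<bar>val (dir st') (st, x, s) - (val True m + sval st')\<bar> <= 1 \<and> st ~= [] \<and> st' ~= [] \<and>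
    snd (hd st) = snd (hd st') \<and> x \<in> J (dir st') ` D)"
  using assms
 proof (induction st')
  case Nil
  then show ?case by (cases m) auto
 next
  case (Cons ce st')
  obtain c e where ce: "ce = (c, e)" by (cases ce) auto
  have v: "valid st'" "st' = [] \<or> snd (hd st') = e \<or> c \<notin> J e ` D"
   using Cons.prems by (auto simp: ce valid_Cons)
  obtain st x s where app: "app m st' = (st, x, s)"
   and IH: "val (dir st') (st, x, s) = val True m + sval st' \<or>
     \<bar>val (dir st') (st, x, s) - (val True m + sval st')\<bar> <= 1 \<and> st ~= [] \<and> st' ~= [] \<and>
    snd (hd st) = snd (hd st') \<and> x \<in> J (dir st') ` D"
   using Cons.IH[OF v(1)] by blast
  define q where "q = dir st'"
  obtain st2 x2 s2 where T: "T e (st, x + c, s) = (st2, x2, s2)" by (metis prod_cases3)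
  have push: "st2 ~= [] \<and> snd (hd st2) = e \<and> x2 \<in> J (\<not> e) ` D" if "\<not> pops e st (x + c)"
   using T that idx(1)[of e "x + c"] by (auto simp del: pops.simps)
  have "val (\<not> e) (st2, x2, s2) = val True m + (sval st' + F q e c) \<or>
    \<bar>val (\<not> e) (st2, x2, s2) - (val True m + (sval st' + F q e c))\<bar> <= 1 \<and>
    st2 ~= [] \<and> snd (hd st2) = e \<and> x2 \<in> J (\<not> e) ` D"
   using IH
  proof (elim disjE conjE)
   assume IH: "val (dir st') (st, x, s) = val True m + sval st'"
   show ?thesis
   proof (cases "pops e st (x + c)")
    case True
    have "val (\<not> e) (st2, x2, s2) = val q (st, x, s) + F q e c"
     using val_T_pop[OF True, of s q] unfolding T .
    then show ?thesis using IH by (simp add: q_def)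
   next
    case False
    have "val (\<not> e) (st2, x2, s2) = sval st + F (dir st) e (x + c) + s"
     using val_T_push[OF False, of s] unfolding T .
    then show ?thesis
     using IH F_triangle[of "dir st" q x e c] push[OF False] by (auto simp: q_def)
   qed
  next
   assume IH: "\<bar>val (dir st') (st, x, s) - (val True m + sval st')\<bar> <= 1" "st ~= []" "st' ~= []"
    "snd (hd st) = snd (hd st')" "x \<in> J (dir st') ` D"
   then obtain k where k: "k \<in> D" "x = J q k" by (auto simp: q_def)
   have q: "q = (\<not> snd (hd st'))" "dir st = q" using IH by (cases st; cases st'; auto simp: q_def)+
   have False: "\<not> pops e st (x + c)"
    using v(2) IH q k add_in_image_iff'[OF k(1), of q c] by auto
   have "val (\<not> e) (st2, x2, s2) = sval st + F (dir st) e (x + c) + s"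
    using val_T_push[OF False, of s] unfolding T .
   also have "\<dots> = val q (st, x, s) + F q e c"
    using F_left[OF k(1), of q e c] F_left[OF k(1), of q q 0] by (simp add: q(2) k(2))
   finally have "val (\<not> e) (st2, x2, s2) - (val True m + (sval st' + F q e c)) =
     val q (st, x, s) - (val True m + sval st')" by linarith
   then show ?thesis using IH(1) push[OF False] unfolding q_def by presburger
  qed
  then show ?case using app T by (auto simp: ce q_def)
 qed
 then show ?thesis using that by blast
qed

lemma val_star:
 assumes "Valid m'"
 shows "\<bar>val True m + val True m' - val True (star m m')\<bar> <= 1"
proof -
 obtain st' y a where m': "m' = (st', y, a)" by (cases m') auto
 then have "valid st'" using assms by (simp add: Valid_def)
 then obtain st x s where app: "app m st' = (st, x, s)"
  and *: "val (dir st') (st, x, s) = val True m + sval st' \<or>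
     \<bar>val (dir st') (st, x, s) - (val True m + sval st')\<bar> <= 1 \<and> st ~= [] \<and> st' ~= [] \<and>
    snd (hd st) = snd (hd st') \<and> x \<in> J (dir st') ` D"
  by (rule val_app)
 have val: "val True (star m m') = sval st + F (dir st) True (x + y) + s + a"
  by (simp add: m' app)
 define q where "q = dir st'"
 show ?thesis
  using *
 proof (elim disjE conjE)
  assume "val (dir st') (st, x, s) = val True m + sval st'"
  then show ?thesis using F_triangle[of "dir st" q x True y] val by (simp add: m' q_def)
 next
  assume IH: "\<bar>val (dir st') (st, x, s) - (val True m + sval st')\<bar> <= 1" "st ~= []" "st' ~= []"
    "snd (hd st) = snd (hd st')" "x \<in> J (dir st') ` D"
  then obtain k where k: "k \<in> D" "x = J q k" by (auto simp: q_def)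
  have q: "dir st = q" using IH by (cases st; cases st'; auto simp: q_def)+
  show ?thesis
   using val IH(1) F_left[OF k(1), of q True y] F_left[OF k(1), of q q 0]
   by (simp add: q k(2) m' q_def[symmetric])
 qed
qed

text \<open>Compositions of right multiplications. They commute with \<open>star\<close>, so an
  operator is recovered from its value at \<open>m0\<close>; composition then becomes
  \<open>star\<close>, and \<open>val_star\<close> bounds the defect.\<close>

inductive_set Ops :: "('g state => 'g state) set" where
 Id: "(\<lambda>m. m) \<in> Ops"
| R: "p \<in> Ops ==> (\<lambda>m. R x (p m)) \<in> Ops"
| T: "p \<in> Ops ==> (\<lambda>m. T e (p m)) \<in> Ops"

lemma Ops_comp: "q \<in> Ops ==> p \<in> Ops ==> (\<lambda>m. q (p m)) \<in> Ops"
 by (induction rule: Ops.induct) (auto intro: Ops.intros)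

lemma Ops_R: "R x \<in> Ops" and Ops_T: "T e \<in> Ops"
 using Ops.R[OF Ops.Id, of x] Ops.T[OF Ops.Id, of e] by simp_all

lemma Ops_Valid: "p \<in> Ops ==> Valid m ==> Valid (p m)"
 by (induction rule: Ops.induct) auto

lemma Ops_star: "p \<in> Ops ==> Valid m ==> p (star m m') = star m (p m')"
 by (induction rule: Ops.induct) (auto simp: star_R star_T)

lemma Ops_shift: "p \<in> Ops ==> p (shift a m) = shift a (p m)"
 by (induction rule: Ops.induct) (auto simp: R_shift T_shift)

lemma val_Ops:
 assumes "p \<in> Ops" "q \<in> Ops"
 shows "\<bar>val True (p m0) + val True (q m0) - val True (q (p m0))\<bar> <= 1"
proof -
 have "q (p m0) = star (p m0) (q m0)"
  using Ops_star[OF assms(2) Ops_Valid[OF assms(1) Valid_m0], of m0] by simp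
 then show ?thesis
  using val_star[of "q m0" "p m0"] Ops_Valid[OF assms(2) Valid_m0] by simp
qed

end

section \<open>The free group as a type\<close>

text \<open>As a type, the free group is an instance of \<open>group_add\<close> and everything
  above applies to it. It is free on all letters of the type; the free group on \<open>S\<close>
  reappears as \<open>over S\<close>.\<close>

typedef 'a fg = "{w::('a \<times> bool) list. reduced_word w}" morphisms word Fg
 by (rule exI[of _ "[]"]) simp

lemma reduced_word_word [simp]: "reduced_word (word u)"
 using word[of u] by simp

lemma word_Fg [simp]: "reduced_word w ==> word (Fg w) = w"
 by (rule Fg_inverse) simp

lemma Fg_word [simp]: "Fg (word u) = u"
 by (rule word_inverse)

instantiation fg :: (type) group_add
begin

definition zero_fg :: "'a fg" where
 "zero_fg = Fg []"

definition plus_fg :: "'a fg => 'a fg => 'a fg" where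
 "plus_fg u v = Fg (foldr cancel_cons (word u) (word v))"

definition uminus_fg :: "'a fg => 'a fg" where
 "uminus_fg u = Fg (foldr cancel_cons (rev (map inv_letter (word u))) [])"

definition minus_fg :: "'a fg => 'a fg => 'a fg" where
 "minus_fg u v = u + (- v)"

instance
proof
 fix u v w :: "'a fg"
 show "- u + u = 0"
  using foldr_cancel_cons_left_inverse[of "[]" "word u"]
  by (simp add: zero_fg_def plus_fg_def uminus_fg_def reduced_foldr_cancel_cons
   foldr_cancel_cons_assoc foldr_cancel_cons_Nil)
qed (simp_all add: zero_fg_def plus_fg_def minus_fg_def reduced_foldr_cancel_cons
   foldr_cancel_cons_assoc foldr_cancel_cons_Nil)

end

lemma word_zero [simp]: "word 0 = []"
 by (simp add: zero_fg_def)

lemma word_plus: "word (u + v) = foldr cancel_cons (word u) (word v)"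
 by (simp add: plus_fg_def reduced_foldr_cancel_cons)

lemma word_eq_iff: "u = v \<longleftrightarrow> word u = word v"
 by (metis Fg_word)

lemma Fg_Nil [simp]: "Fg [] = 0"
 by (simp add: zero_fg_def)

abbreviation letter :: "'a \<times> bool => 'a fg" where
 "letter x \<equiv> Fg [x]"

lemma reduced_single [simp]: "reduced_word [x]"
 by (simp add: reduced_word_def)

lemma word_letter_plus: "word (letter x + u) = cancel_cons x (word u)"
 by (simp add: word_plus)

lemma Fg_Cons: "reduced_word (x # w) ==> Fg (x # w) = letter x + Fg w"
 by (simp add: word_eq_iff word_letter_plus cancel_cons_reduced reduced_Cons)

lemma minus_letter: "- letter x = letter (inv_letter x)"
 by (simp add: uminus_fg_def cancel_cons_def)

lemma word_minus: "word (- u) = rev (map inv_letter (word u))"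
proof -
 have "reduced_word (rev (map inv_letter (word u)))"
  using reduced_word_word[of u]
  by (simp add: reduced_word_def successively_map rev_map[symmetric] del: reduced_word_word)
    (erule successively_mono, auto)
 then show ?thesis
  by (simp add: uminus_fg_def foldr_cancel_cons_Nil)
qed

lemma fg_induct [case_names zero Cons]:
 assumes "P 0" "!!x u. P u ==> word (letter x + u) = x # word u ==> P (letter x + u)"
 shows "P u"
proof -
 have "P (Fg w)" if "reduced_word w" for w
  using that
 proof (induction w)
  case (Cons x w)
  then have w: "reduced_word w" by (simp add: reduced_Cons)
  have "word (letter x + Fg w) = x # word (Fg w)"
   using Cons.prems w by (simp add: word_letter_plus cancel_cons_reduced)
  then show ?case using assms(2)[OF Cons.IH[OF w], of x] Fg_Cons[OF Cons.prems] by simp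
 qed (use assms(1) in simp)
 from this[of "word u"] show ?thesis by simp
qed

definition letter_value :: "('a => 'g::group_add) => 'a \<times> bool => 'g" where
 "letter_value \<psi> x = (if snd x then \<psi> (fst x) else - \<psi> (fst x))"

lemma letter_value_inv [simp]: "letter_value \<psi> (inv_letter x) = - letter_value \<psi> x"
 by (simp add: letter_value_def inv_letter_def)

definition lift :: "('a => 'g::group_add) => 'a fg => 'g" where
 "lift \<psi> u = sum_list (map (letter_value \<psi>) (word u))"

lemma sum_list_cancel_cons:
 "sum_list (map (letter_value \<psi>) (cancel_cons x w)) = letter_value \<psi> x + sum_list (map (letter_value \<psi>) w)"
 by (cases w) (auto simp: cancel_cons_def add.assoc[symmetric])

lemma lift_plus: "lift \<psi> (u + v) = lift \<psi> u + lift \<psi> v"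
proof -
 have "sum_list (map (letter_value \<psi>) (foldr cancel_cons w (word v))) =
  sum_list (map (letter_value \<psi>) w) + sum_list (map (letter_value \<psi>) (word v))" for w
  by (induction w) (auto simp: sum_list_cancel_cons add.assoc)
 then show ?thesis by (simp add: lift_def word_plus)
qed

lemma lift_0 [simp]: "lift \<psi> 0 = 0"
 by (simp add: lift_def)

lemma lift_minus: "lift \<psi> (- u) = - lift \<psi> u"
 using lift_plus[of \<psi> u "- u"] by (simp add: minus_unique)

lemma lift_letter [simp]: "lift \<psi> (letter x) = letter_value \<psi> x"
 by (simp add: lift_def)

definition over :: "'a set => 'a fg set" where
 "over S = {u. fst ` set (word u) \<subseteq> S}"

lemma over_plus: "u \<in> over S ==> v \<in> over S ==> u + v \<in> over S"
 using set_foldr_cancel_cons[of "word u" "word v"] by (fastforce simp: over_def word_plus)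

lemma over_minus: "u \<in> over S ==> - u \<in> over S"
 by (auto simp: over_def word_minus)

lemma over_0 [simp]: "0 \<in> over S"
 by (simp add: over_def)

lemma over_npow: "u \<in> over S ==> npow u n \<in> over S"
 by (induction n) (auto intro: over_plus)

lemma over_mono: "S \<subseteq> S' ==> over S \<subseteq> over S'"
 by (auto simp: over_def)

definition retract :: "'a set => 'a fg => 'a fg" where
 "retract S = lift (\<lambda>s. if s \<in> S then letter (s, True) else 0)"

lemma retract_plus: "retract S (u + v) = retract S u + retract S v"
 and retract_minus: "retract S (- u) = - retract S u"
 and retract_0 [simp]: "retract S 0 = 0"
 by (simp_all add: retract_def lift_plus lift_minus)

lemma retract_in_over: "retract S u \<in> over S"
proof (induction u rule: fg_induct)
 case (Cons x u)
 have "retract S (letter x) \<in> over S"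
  by (cases x) (auto simp: retract_def letter_value_def minus_letter inv_letter_def over_def)
 then show ?case using Cons by (simp add: retract_plus over_plus)
qed simp

lemma retract_over: "u \<in> over S ==> retract S u = u"
proof (induction u rule: fg_induct)
 case (Cons x u)
 have "fst x \<in> S" "u \<in> over S" using Cons by (auto simp: over_def)
 moreover from this have "retract S (letter x) = letter x"
  by (cases x) (auto simp: retract_def letter_value_def minus_letter inv_letter_def)
 ultimately show ?case using Cons by (simp add: retract_plus)
qed simp

subsection \<open>Free groups are torsion-free\<close>

lemma foldr_cancel_cons_split:
 assumes "reduced_word u" "reduced_word w"
 obtains p d q where "u = p @ d" "w = rev (map inv_letter d) @ q" "foldr cancel_cons u w = p @ q"
proof -
 have "\<exists>p d q. u = p @ d \<and> w = rev (map inv_letter d) @ q \<and> foldr cancel_cons u w = p @ q"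
  using assms(1)
 proof (induction u)
  case Nil
  then show ?case by simp
 next
  case (Cons x u)
  then obtain p d q where u: "u = p @ d" "w = rev (map inv_letter d) @ q" "foldr cancel_cons u w = p @ q"
   by (auto simp: reduced_Cons)
  show ?case
  proof (cases p)
   case (Cons y ys)
   then have "y ~= inv_letter x" using Cons.prems u(1) by (auto simp: reduced_Cons)
   then have "foldr cancel_cons (x # u) w = (x # p) @ q" using u(3) Cons by (simp add: cancel_cons_def)
   then show ?thesis using u by (metis append_Cons)
  next
   case Nil
   show ?thesis
   proof (cases "q ~= [] \<and> hd q = inv_letter x")
    case True
    then have "foldr cancel_cons (x # u) w = [] @ tl q" using u(3) Nil by (cases q) (auto simp: cancel_cons_def)
    moreover have "w = rev (map inv_letter (x # d)) @ tl q" using True u(2) by (cases q) auto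
    moreover have "x # u = [] @ (x # d)" using u(1) Nil by simp
    ultimately show ?thesis by blast
   next
    case False
    then have "foldr cancel_cons (x # u) w = [x] @ q" using u(3) Nil by (cases q) (auto simp: cancel_cons_def)
    moreover have "x # u = [x] @ d" using u(1) Nil by simp
    ultimately show ?thesis using u(2) by blast
   qed
  qed
 qed
 then show ?thesis using that by blast
qed

text \<open>If squaring does not lengthen the word, the cancellation eats at least half of it. The
  word is then its own reversed inverse around the middle, so either a letter equals its inverse or
  two adjacent letters cancel.\<close>

lemma length_word_double:
 assumes "u ~= (0 :: 'a fg)"
 shows "length (word u) < length (word (u + u))"
proof (rule ccontr)
 define w where "w = word u"
 define n where "n = length w"
 have red: "reduced_word w" by (simp add: w_def)
 have n: "n > 0" using assms by (simp add: n_def w_def word_eq_iff)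
 assume short: "\<not> length (word u) < length (word (u + u))"
 obtain p d q where d: "w = p @ d" "w = rev (map inv_letter d) @ q" "foldr cancel_cons w w = p @ q"
  using foldr_cancel_cons_split[OF red red] .
 have len: "length p + length d = n" "length d + length q = n" 
  using arg_cong[OF d(1), of length] arg_cong[OF d(2), of length] by (simp_all add: n_def)
 have "length (p @ q) <= n" using short d(3) by (simp add: word_plus w_def n_def)
 then have big: "n <= 2 * length d" using len by simp
 have inv: "w ! i = inv_letter (w ! (n - 1 - i))" if "i < length d" for i
 proof -
  have "w ! i = inv_letter (d ! (length d - Suc i))"
   using that by (subst d(2)) (simp add: nth_append rev_nth)
  also have "d ! (length d - Suc i) = w ! (n - 1 - i)"
  proof -
   have "n - 1 - i = length p + (length d - Suc i)" using that len by simp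
   then show ?thesis by (subst d(1)) (simp only: nth_append_length_plus)
  qed
  finally show ?thesis .
 qed
 show False
 proof (cases "odd n")
  case True
  then obtain m where "n = 2 * m + 1" by (rule oddE)
  then show False using inv[of m] big by simp
 next
  case False
  then obtain m where m: "n = 2 * Suc m" using n by (metis evenE gr0_implies_Suc mult_is_0 not_gr_zero)
  then have "w ! m = inv_letter (w ! Suc m)" using inv[of m] big by (simp add: numeral_2_eq_2)
  moreover have "w ! Suc m ~= inv_letter (w ! m)"
   using red m unfolding reduced_word_def n_def by (simp add: successively_conv_nth)
  ultimately show False by simp
 qed
qed

lemma npow_0_left: "npow 0 n = 0"
 by (induction n) auto

text \<open>Repeated squaring yields powers of strictly increasing length, hence infinitely many,
  whereas torsion would leave finitely many.\<close>

lemma npow_neq_0: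
 assumes "u ~= (0 :: 'a fg)" "n > 0"
 shows "npow u n ~= 0"
proof
 assume 0: "npow u n = 0"
 define v where "v = (\<lambda>k. npow u (2 ^ k))"
 have v_Suc: "v (Suc k) = v k + v k" for k by (simp add: v_def npow_add[symmetric] mult_2)
 have v0: "v k ~= 0" for k
 proof (induction k)
  case (Suc k)
  then show ?case using length_word_double[of "v k"] v_Suc[of k] by (metis length_0_conv not_less_zero word_zero)
 qed (simp add: v_def assms)
 have "strict_mono (\<lambda>k. length (word (v k)))"
  unfolding strict_mono_Suc_iff using length_word_double[OF v0] v_Suc by simp
 then have "inj v" by (metis (mono_tags, lifting) injI strict_mono_eq)
 moreover have "range v \<subseteq> npow u ` {..<n}"
 proof safe
  fix k
  have "npow u m = npow u (m mod n)" for m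
  proof -
   have "npow u m = npow u (n * (m div n) + m mod n)" by simp
   also have "\<dots> = npow (npow u n) (m div n) + npow u (m mod n)" by (simp only: npow_add npow_mult)
   also have "npow (npow u n) (m div n) = 0" unfolding 0 by (rule npow_0_left)
   finally show ?thesis by simp
  qed
  then show "v k \<in> npow u ` {..<n}"
   using assms(2) unfolding v_def by (intro image_eqI[of _ _ "2 ^ k mod n"]) auto
 qed
 ultimately show False by (meson finite_imageI finite_lessThan finite_subset infinite_UNIV_nat range_inj_infinite)
qed

lemma ipow_inj:
 assumes "u ~= (0 :: 'a fg)"
 shows "inj (ipow u)"
proof -
 have "ipow u k ~= 0" if "k ~= 0" for k
  using that npow_neq_0[OF assms] by (auto simp: ipow_def)
 then show ?thesis
  by (intro injI) (metis diff_self eq_iff_diff_eq_0 ipow_diff)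
qed

section \<open>Products of commutators\<close>

definition comm :: "'g::group_add => 'g => 'g" where
 "comm a b = a + b - a - b"

primrec cprod :: "nat => 'g::group_add => bool" where
 "cprod 0 g \<longleftrightarrow> g = 0"
| "cprod (Suc k) g \<longleftrightarrow> (\<exists>a b h. g = comm a b + h \<and> cprod k h)"

lemma cprod_add: "cprod k g ==> cprod l h ==> cprod (k + l) (g + h)"
proof (induction k arbitrary: g)
 case (Suc k)
 then obtain a b h' where "g = comm a b + h'" "cprod k h'" by auto
 then show ?case
  using Suc.IH[of h'] Suc.prems(2) by (metis add.assoc add_Suc cprod.simps(2))
qed simp

lemma cprod_comm: "cprod (Suc 0) (comm a b)"
 by auto

lemma comm_conj: "c + comm a b - c = comm (c + a - c) (c + b - c)"
 by (simp add: comm_def group_add_simps del: add_uminus_conv_diff)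

lemma minus_comm: "- comm a b = comm b a"
 by (simp add: comm_def group_add_simps del: add_uminus_conv_diff)

lemma cprod_minus: "cprod k g ==> cprod k (- g)"
proof (induction k arbitrary: g)
 case (Suc k)
 then obtain a b h where g: "g = comm a b + h" "cprod k h" by auto
 then have "cprod (k + Suc 0) (- h + comm b a)" by (intro cprod_add Suc.IH cprod_comm)
 then show ?case by (simp add: g minus_add minus_comm del: add_uminus_conv_diff)
qed simp

lemma cprod_npow: "cprod k g ==> cprod (n * k) (npow g n)"
proof (induction n)
 case (Suc n)
 then show ?case using cprod_add[of "n * k" "npow g n" k g] by (simp add: add.commute)
qed simp

abbreviation eval :: "('g::group_add \<times> bool) list => 'g" where
 "eval w \<equiv> sum_list (map (letter_value (\<lambda>g. g)) w)"

definition net :: "('g \<times> bool) list => 'g => int" where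
 "net w g = int (count_list w (g, True)) - int (count_list w (g, False))"

lemma net_append [simp]: "net (v @ w) g = net v g + net w g"
 by (simp add: net_def)

lemma net_Cons: "net (x # w) g = net [x] g + net w g"
 using net_append[of "[x]" w g] by simp

lemma net_inv_letter: "net [inv_letter x] g = - net [x] g"
 by (cases x) (auto simp: net_def inv_letter_def)

lemma split_at_two:
 assumes "i < j" "j < length w"
 obtains A B C where "w = A @ w ! i # B @ w ! j # C" "length A = i" "length B = j - i - 1"
proof -
 define v where "v = drop (Suc i) w"
 have w: "w = take i w @ w ! i # v" using assms by (simp add: v_def id_take_nth_drop)
 have "j - i - 1 < length v" using assms by (simp add: v_def)
 then have "v = take (j - i - 1) v @ v ! (j - i - 1) # drop (Suc (j - i - 1)) v"
  by (rule id_take_nth_drop)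
 moreover have "v ! (j - i - 1) = w ! j" using assms by (simp add: v_def)
 ultimately have "w = take i w @ w ! i # take (j - i - 1) v @ w ! j # drop (Suc (j - i - 1)) v"
  using w by simp
 then show ?thesis
  by (rule that) (use assms \<open>j - i - 1 < length v\<close> in auto)
qed

lemma split_at_four:
 assumes "i < j" "j < k" "k < l" "l < length w"
 obtains A B C D E where "w = A @ w ! i # B @ w ! j # C @ w ! k # D @ w ! l # E"
proof -
 obtain A B C where 1: "w = A @ w ! i # B @ w ! j # C" "length A = i" "length B = j - i - 1"
  using assms by (auto intro: split_at_two[of i j w])
 have idx: "C ! (n - Suc j) = w ! n" if "n > j" for n
 proof -
  have "n = length (A @ w ! i # B @ [w ! j]) + (n - Suc j)" using that 1(2,3) assms by simp
  then show ?thesis using 1(1) by (metis append.assoc append_Cons append_Nil nth_append_length_plus)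
 qed
 have "length C = length w - Suc j" using arg_cong[OF 1(1), of length] 1(2,3) assms by simp
 then obtain C1 C2 C3 where 2: "C = C1 @ C ! (k - Suc j) # C2 @ C ! (l - Suc j) # C3"
  using assms by (auto intro: split_at_two[of "k - Suc j" "l - Suc j" C])
 have "w = A @ w ! i # B @ w ! j # C1 @ w ! k # C2 @ w ! l # C3"
  using 1(1) 2 idx[of k] idx[of l] assms by simp
 then show ?thesis by (rule that)
qed

text \<open>Two interlaced pairs of edges of a polygon form a handle. Up to conjugation it is a
  single commutator, and cutting it off leaves the arcs between the four edges in reversed
  order.\<close>

lemma handle:
 fixes A B C D E p q :: "'g::group_add"
 shows "\<exists>u v. A + p + B + q + C + - p + D + - q + E = comm u v + (A + D + C + B + E)"
proof -
 define P W K where "P = p + B" and "W = q + C + B" and "K = D + C + B"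
 have "A + p + B + q + C + - p + D + - q + E =
   ((A + K) + comm (- K + P) W - (A + K)) + (A + D + C + B + E)"
  by (simp add: P_def W_def K_def comm_def group_add_simps del: add_uminus_conv_diff)
 then show ?thesis unfolding comm_conj by blast
qed

text \<open>
 A word in which every letter occurs as often as its inverse is the boundary word of a polygon whose
 edges can be glued in pairs.
\<close>

lemma balanced_cprod:
 assumes "!!g. net w g = 0"
 shows "\<exists>k. 4 * k <= length w \<and> cprod k (eval w)"
 using assms
proof (induction "length w" arbitrary: w rule: less_induct)
 case less
 show ?case
 proof (cases "w = []")
  case True
  then show ?thesis by (intro exI[of _ 0]) auto
 next
  case False
  have inv_mem: "inv_letter x \<in> set w" if "x \<in> set w" for x
  proof -
   have "count_list w x > 0" using that by (metis count_list_0_iff gr0I)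
   then have "count_list w (inv_letter x) > 0"
    using less.prems[of "fst x"] by (cases x; cases "snd x") (auto simp: net_def inv_letter_def)
   then show ?thesis by (metis count_notin less_irrefl)
  qed
  define pair where "pair = (\<lambda>i j. i < j \<and> j < length w \<and> w ! j = inv_letter (w ! i))"
  have "\<exists>d i. pair i (i + d)"
  proof -
   obtain j where j: "j < length w" "w ! j = inv_letter (w ! 0)"
    using inv_mem[of "w ! 0"] False by (metis in_set_conv_nth length_greater_0_conv nth_mem)
   then have "pair 0 (0 + j)" by (cases "j = 0") (auto simp: pair_def)
   then show ?thesis by blast
  qed
  \<comment> \<open>A pair of inverse letters at minimal distance. If it is not adjacent, the letter
    after its first member has its inverse outside the pair, so two pairs are interlaced and a
    handle can be cut off.\<close>
  then obtain d where "\<exists>i. pair i (i + d)" and min: "!!d'. d' < d ==> \<not> (\<exists>i. pair i (i + d'))"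
   using exists_least_iff[of "\<lambda>d. \<exists>i. pair i (i + d)"] by blast
  then obtain i where i: "pair i (i + d)" by blast
  have no_pair: "\<not> pair a b" if "b < a + d" for a b
  proof
   assume "pair a b"
   then have "a < b" by (simp add: pair_def)
   then have "pair a (a + (b - a))" "b - a < d" using \<open>pair a b\<close> that by auto
   then show False using min by blast
  qed
  show ?thesis
  proof (cases "d = 1")
   case True
   obtain A B C where "w = A @ w ! i # B @ w ! (i + d) # C" "length B = i + d - i - 1"
   proof (rule split_at_two[of i "i + d" w])
    show "i < i + d" "i + d < length w" using i by (simp_all add: pair_def)
   qed
   then have w: "w = A @ w ! i # inv_letter (w ! i) # C" using i True by (simp add: pair_def)
   define x where "x = w ! i"
   have w: "w = A @ x # inv_letter x # C" using w by (simp add: x_def)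
   have "net (A @ C) g = 0" for g
    using less.prems[of g] unfolding w
    by (simp add: net_Cons[of x "inv_letter x # C"] net_Cons[of "inv_letter x" C] net_inv_letter)
   then obtain k where "4 * k <= length (A @ C)" "cprod k (eval (A @ C))"
    using less.hyps[of "A @ C"] w by auto
   moreover have "eval w = eval (A @ C)"
    unfolding w by (simp add: add.assoc[symmetric])
   ultimately show ?thesis using w by (intro exI[of _ k]) auto
  next
   case False
   have d: "d > 1" using False i by (cases d) (auto simp: pair_def)
   define y where "y = w ! (i + 1)"
   have "i + 1 < length w" using i d by (simp add: pair_def)
   then obtain k where k: "k < length w" "w ! k = inv_letter y"
    using inv_mem[of y] by (metis in_set_conv_nth nth_mem y_def)
   have "k < i \<or> k > i + d"
   proof (rule ccontr)
    assume "\<not> (k < i \<or> k > i + d)"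
    then consider "k = i" | "k = i + 1" | "i + 1 < k" "k < i + 1 + d" by linarith
    then show False
    proof cases
     case 1
     then have "pair i (i + 1)" using k \<open>i + 1 < length w\<close> by (simp add: pair_def y_def)
     then show False using no_pair d by simp
    next
     case 2
     then show False using k by (simp add: y_def)
    next
     case 3
     then have "pair (i + 1) k" using k by (simp add: pair_def y_def)
     then show False using no_pair[of k "i + 1"] 3 by simp
    qed
   qed
   then have "\<exists>A p B q C D E. w = A @ p # B @ q # C @ inv_letter p # D @ inv_letter q # E"
   proof (elim disjE)
    assume "k < i"
    obtain A B C D E where "w = A @ w ! k # B @ w ! i # C @ w ! (i + 1) # D @ w ! (i + d) # E"
    proof (rule split_at_four[of k i "i + 1" "i + d" w])
     show "k < i" "i < i + 1" "i + 1 < i + d" "i + d < length w"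
      using \<open>k < i\<close> i d by (simp_all add: pair_def)
    qed
    moreover have "w ! (i + d) = inv_letter (w ! i)" "w ! (i + 1) = inv_letter (w ! k)"
     using k i by (simp_all add: pair_def y_def)
    ultimately show ?thesis by metis
   next
    assume "i + d < k"
    obtain A B C D E where "w = A @ w ! i # B @ w ! (i + 1) # C @ w ! (i + d) # D @ w ! k # E"
    proof (rule split_at_four[of i "i + 1" "i + d" k w])
     show "i < i + 1" "i + 1 < i + d" "i + d < k" "k < length w"
      using \<open>i + d < k\<close> k d by simp_all
    qed
    moreover have "w ! (i + d) = inv_letter (w ! i)" "w ! k = inv_letter (w ! (i + 1))"
     using k i by (simp_all add: pair_def y_def)
    ultimately show ?thesis by metis
   qed
   then obtain A p B q C D E where w: "w = A @ p # B @ q # C @ inv_letter p # D @ inv_letter q # E"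
    by blast
   define w' where "w' = A @ D @ C @ B @ E"
   have "net w' g = 0" for g
    using less.prems[of g] unfolding w w'_def
    by (simp add: net_Cons[of p "B @ _"] net_Cons[of "inv_letter p" "D @ _"] net_Cons[of q "C @ _"]
      net_Cons[of "inv_letter q" E] net_inv_letter)
   then obtain k where "4 * k <= length w'" "cprod k (eval w')"
    using less.hyps[of w'] w by (auto simp: w'_def)
   moreover obtain u v where "eval w = comm u v + eval w'"
    using handle[of "eval A" "letter_value (\<lambda>g. g) p" "eval B" "letter_value (\<lambda>g. g) q" "eval C" "eval D" "eval E"]
    unfolding w w'_def by (auto simp: add.assoc simp del: add_uminus_conv_diff)
   ultimately show ?thesis
    by (intro exI[of _ "Suc k"]) (auto simp: w'_def w)
  qed
 qed
qed

lemma rotate_zero: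
 fixes a b g :: "'g::group_add"
 assumes "a + g + b = 0"
 shows "b + a = - g"
proof -
 have "b = - (a + g)" using minus_unique[OF assms] by simp
 then show ?thesis by (simp add: group_add_simps del: add_uminus_conv_diff)
qed

text \<open>
 Gluing two polygons along an edge. The quantity \<open>length w - 2\<close> counts the triangles that a polygon
 is made of, hence it is additive.
\<close>

lemma merge_polygons:
 fixes W :: "('g::group_add \<times> bool) list multiset"
 assumes "!!w. w \<in># W ==> eval w = 0 \<and> length w >= 3"
  and "!!g. (\<Sum>w\<in>#W. net w g) = (if g = R then int m else 0)"
  and "(\<Sum>w\<in>#W. length w - 2) = N" and m: "m > 0"
 shows "\<exists>w m'. eval w = 0 \<and> m' > 0 \<and> (\<forall>g. net w g = (if g = R then int m' else 0)) \<and>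
  (length w - 2) * m <= N * m'"
 using assms(1-3)
proof (induction "size W" arbitrary: W rule: less_induct)
 case less
 show ?case
 proof (cases "\<exists>w1 w2 W' g. W = add_mset w1 (add_mset w2 W') \<and> (g, True) \<in> set w1 \<and> (g, False) \<in> set w2")
  case True
  then obtain w1 w2 W' g where W: "W = add_mset w1 (add_mset w2 W')"
   and g: "(g, True) \<in> set w1" "(g, False) \<in> set w2" by blast
  obtain A B where w1: "w1 = A @ (g, True) # B" using g by (meson split_list)
  obtain C D where w2: "w2 = C @ (g, False) # D" using g by (meson split_list)
  define v where "v = B @ A @ D @ C"
  have e: "eval w1 = 0" "eval w2 = 0" and len: "length w1 >= 3" "length w2 >= 3"
   using less.prems(1) W by auto
  have "eval A + g + eval B = 0" using e(1) by (simp add: w1 letter_value_def add.assoc)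
  then have 1: "eval B + eval A = - g" by (rule rotate_zero)
  have "eval C + - g + eval D = 0"
   using e(2) by (simp add: w2 letter_value_def add.assoc del: add_uminus_conv_diff)
  then have 2: "eval D + eval C = g" using rotate_zero[of "eval C" "- g" "eval D"] by simp
  have v: "eval v = 0" using 1 2 by (simp add: v_def add.assoc[symmetric])
  have v3: "length v >= 3" using len by (simp add: v_def w1 w2)
  have v_net: "(\<Sum>w\<in>#add_mset v W'. net w h) = (if h = R then int m else 0)" for h
  proof -
   have "net v h = net w1 h + net w2 h"
    by (simp add: v_def w1 w2 net_Cons[of "(g, True)" B] net_Cons[of "(g, False)" D]) (simp add: net_def)
   then show ?thesis using less.prems(2)[of h] W by simp
  qed
  have v_len: "(\<Sum>w\<in>#add_mset v W'. length w - 2) = N"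
   using less.prems(3) len by (simp add: W v_def w1 w2)
  show ?thesis
  proof (rule less.hyps[of "add_mset v W'"])
   show "size (add_mset v W') < size W" by (simp add: W)
   show "eval w = 0 \<and> 3 <= length w" if "w \<in># add_mset v W'" for w
    using that v v3 less.prems(1)[of w] W by auto
  qed (use v_net v_len in auto)
 next
  case False
  \<comment> \<open>No edge of one polygon can be glued to another polygon any more. So nets of
    different polygons never cancel each other: those of other letters vanish one by one, and those
    of \<open>R\<close> are non-negative.\<close>
  then have sep: "(g, False) \<notin> set w2" if "W = add_mset w1 (add_mset w2 W')" "(g, True) \<in> set w1" for w1 w2 W' g
   using that by blast
  have net_zero: "net w g = 0" if "(g, True) \<notin> set w" "(g, False) \<notin> set w" for w and g :: 'g
   using that by (simp add: net_def count_list_0_iff)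
  have net_pos: "net w g > 0" if "(g, True) \<in> set w" "(g, False) \<notin> set w" for w and g :: 'g
   using that by (simp add: net_def count_list_0_iff) (metis count_list_0_iff gr0I)
  have net_neg: "net w g < 0" if "(g, True) \<notin> set w" "(g, False) \<in> set w" for w and g :: 'g
   using that by (simp add: net_def count_list_0_iff) (metis count_list_0_iff gr0I)
  have net: "if g = R then net w g >= 0 else net w g = 0" if wW: "w \<in># W" for w g
  proof -
   obtain W' where W: "W = add_mset w W'" using wW by (meson mset_add)
   have sep1: "(g, False) \<notin> set v" if "v \<in># W'" "(g, True) \<in> set w" for v
    using sep[of w v _ g] that W by (metis mset_add)
   have sep2: "(g, False) \<notin> set w" if "v \<in># W'" "(g, True) \<in> set v" for v
    using sep[of v w _ g] that W by (metis add_mset_commute mset_add)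
   have total: "net w g + (\<Sum>v\<in>#W'. net v g) = (if g = R then int m else 0)"
    using less.prems(2)[of g] W by simp
   have sum_nonneg: "(\<Sum>v\<in>#W'. net v g) >= 0" if "!!v. v \<in># W' ==> net v g >= 0"
    using that by (induction W') auto
   have sum_nonpos: "(\<Sum>v\<in>#W'. net v g) <= 0" if "!!v. v \<in># W' ==> net v g <= 0"
    using that by (induction W') (auto intro: add_nonpos_nonpos)
   have sum_zero: "(\<Sum>v\<in>#W'. net v g) = 0" if "!!v. v \<in># W' ==> net v g = 0"
    using that by (induction W') auto
   show ?thesis
   proof (cases "(g, True) \<in> set w")
    case T: True
    show ?thesis
    proof (cases "\<exists>v. v \<in># W' \<and> (g, True) \<in> set v")
     case True
     then have "net w g > 0" using sep2 T net_pos by blast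
     moreover have "net v g >= 0" if "v \<in># W'" for v
      using sep1[OF that T] net_pos[of g v] net_zero[of g v] by force
     then have "(\<Sum>v\<in>#W'. net v g) >= 0" by (rule sum_nonneg)
     ultimately show ?thesis using total by (auto split: if_splits)
    next
     case False
     then have "(\<Sum>v\<in>#W'. net v g) = 0" using sum_zero net_zero sep1 T by blast
     then show ?thesis using total by auto
    qed
   next
    case F: False
    show ?thesis
    proof (cases "(g, False) \<in> set w")
     case True
     then have "net w g < 0" using F net_neg by blast
     moreover have "net v g <= 0" if "v \<in># W'" for v
      using sep2[OF that] True net_neg[of g v] net_zero[of g v] by force
     then have "(\<Sum>v\<in>#W'. net v g) <= 0" by (rule sum_nonpos)
     ultimately show ?thesis using total by (auto split: if_splits)
    next
     case False
     then show ?thesis using net_zero[OF F False] by auto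
    qed
   qed
  qed
  \<comment> \<open>Averaging: the ratios of \<open>length w - 2\<close> to \<open>net w R\<close>
    cannot all exceed the ratio \<open>N / m\<close> of the totals.\<close>
  have "\<exists>w. w \<in># W \<and> net w R > 0 \<and> int (length w - 2) * int m <= int N * net w R"
  proof (rule ccontr)
   assume contra: "\<not> ?thesis"
   have "int (length w - 2) * int m >= int N * net w R" if "w \<in># W" for w
    using contra net[OF that, of R] that by (cases "net w R = 0") force+
   then have "(\<Sum>w\<in>#W. int (length w - 2) * int m) >= (\<Sum>w\<in>#W. int N * net w R)"
    by (rule sum_mset_mono)
   moreover have "(\<Sum>w\<in>#W. int N * net w R) = int N * int m"
    using less.prems(2)[of R] by (simp add: sum_mset_distrib_left[symmetric])
   moreover have "(\<Sum>w\<in>#W. int (length w - 2) * int m) = int N * int m"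
   proof -
    have "int (\<Sum>w\<in>#W. length w - 2) = (\<Sum>w\<in>#W. int (length w - 2))"
     by (induction W) auto
    then show ?thesis using less.prems(3) by (simp add: sum_mset_distrib_right[symmetric])
   qed
   moreover have "\<exists>w. w \<in># W \<and> net w R > 0"
   proof (rule ccontr)
    assume "\<not> ?thesis"
    then have "!!w. w \<in># W ==> net w R = 0" using net[of _ R] by (metis less_le)
    then have "(\<Sum>w\<in>#W. net w R) = 0" by (simp cong: image_mset_cong)
    then show False using less.prems(2)[of R] m by simp
   qed
   then obtain w where w: "w \<in># W" "net w R > 0" by blast
   moreover have "int (length w - 2) * int m > int N * net w R" using contra w by force
   moreover obtain W' where "W = add_mset w W'" using w(1) by (meson mset_add)
   moreover have "(\<Sum>w\<in>#W'. int (length w - 2) * int m) >= (\<Sum>w\<in>#W'. int N * net w R)"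
    by (rule sum_mset_mono) (use \<open>!!w. w \<in># W ==> int (length w - 2) * int m >= int N * net w R\<close> \<open>W = _\<close> in auto)
   ultimately show False by simp
  qed
  then obtain w where w: "w \<in># W" "net w R > 0" "int (length w - 2) * int m <= int N * net w R" by blast
  define m' where "m' = nat (net w R)"
  have m': "net w R = int m'" using w(2) by (simp add: m'_def)
  have "(length w - 2) * m <= N * m'" using w(3) unfolding m' by (metis of_nat_le_iff of_nat_mult)
  moreover have "net w g = (if g = R then int m' else 0)" for g using net[OF w(1), of g] m' by auto
  ultimately show ?thesis using less.prems(1)[OF w(1)] w(2) m' by (intro exI[of _ w] exI[of _ m']) auto
 qed
qed

section \<open>Bar chains\<close>

definition bar_boundary :: "('g::group_add \<times> 'g \<Rightarrow>\<^sub>0 int) => 'g \<Rightarrow>\<^sub>0 int" where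
 "bar_boundary = frag_extend (\<lambda>(g, h). frag_of g + frag_of h - frag_of (g + h))"

definition l1 :: "('b \<Rightarrow>\<^sub>0 int) => nat" where
 "l1 c = (\<Sum>x\<in>Poly_Mapping.keys c. nat \<bar>Poly_Mapping.lookup c x\<bar>)"

lemma lookup_frag_extend:
 "Poly_Mapping.lookup (frag_extend b c) k =
  (\<Sum>x\<in>Poly_Mapping.keys c. Poly_Mapping.lookup c x * Poly_Mapping.lookup (b x) k)"
 by (simp add: frag_extend_def lookup_sum)

lemma polygons_of_chain:
 fixes c :: "'g::group_add \<times> 'g \<Rightarrow>\<^sub>0 int"
 shows "\<exists>W. (\<forall>w. w \<in># W --> eval w = 0 \<and> length w = 3) \<and>
  (\<forall>g. (\<Sum>w\<in>#W. net w g) = Poly_Mapping.lookup (bar_boundary c) g) \<and> size W = l1 c"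
proof -
 define n where "n = Poly_Mapping.lookup c"
 define d where "d = (\<lambda>(g, h) k. Poly_Mapping.lookup (frag_of g + frag_of h - frag_of (g + h)) (k :: 'g))"
 define tri :: "int => 'g \<times> 'g => ('g \<times> bool) list" where
  "tri = (\<lambda>i (g, h). if i > 0 then [(g, True), (h, True), (g + h, False)]
   else [(g + h, True), (h, False), (g, False)])"
 have net_tri: "\<bar>i\<bar> * net (tri i x) k = i * d x k" for i x k
  by (cases x; cases "i > 0") (auto simp: tri_def net_def d_def lookup_minus lookup_add lookup_frag_of)
 have tri: "eval (tri i x) = 0 \<and> length (tri i x) = 3" for i x
  by (cases x) (auto simp: tri_def letter_value_def group_add_simps simp del: add_uminus_conv_diff)
 have "\<exists>W. (\<forall>w. w \<in># W --> eval w = 0 \<and> length w = 3) \<and>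
  (\<forall>k. (\<Sum>w\<in>#W. net w k) = (\<Sum>x\<in>K. n x * d x k)) \<and> size W = (\<Sum>x\<in>K. nat \<bar>n x\<bar>)" if "finite K" for K
  using that
 proof (induction K)
  case empty
  then show ?case by (intro exI[of _ "{#}"]) simp
 next
  case (insert x K)
  then obtain W where W: "!!w. w \<in># W ==> eval w = 0 \<and> length w = 3"
   "!!k. (\<Sum>w\<in>#W. net w k) = (\<Sum>x\<in>K. n x * d x k)" "size W = (\<Sum>x\<in>K. nat \<bar>n x\<bar>)" by blast
  have sum_rep: "(\<Sum>w\<in>#replicate_mset i v. net w k) = int i * net v k" for i v and k :: 'g
   by (induction i) (auto simp: algebra_simps)
  show ?case
   using insert W(1) tri
   by (intro exI[of _ "replicate_mset (nat \<bar>n x\<bar>) (tri (n x) x) + W"])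
    (auto simp: W(2,3) net_tri sum_rep)
 qed
 from this[of "Poly_Mapping.keys c"] show ?thesis
  by (simp add: l1_def n_def[symmetric] bar_boundary_def lookup_frag_extend d_def case_prod_beta)
qed

text \<open>The polygon glued from the triangles of \<open>c\<close> is closed up by
  \<open>m'\<close> edges labelled \<open>(R, False)\<close>, after which all its edges pair off. In
  \<open>3 * m\<close>, one \<open>m\<close> accounts for these edges and two for the difference
  between edges and triangles of a polygon, as \<open>m' >= 1\<close>.\<close>

theorem bar_chain_cprod:
 fixes R :: "'g::group_add"
 assumes c: "bar_boundary c = frag_cmul (int m) (frag_of R)" and m: "m > 0"
 obtains k m' where "m' > 0" "cprod k (npow R m')" "4 * k * m <= m' * (l1 c + 3 * m)"
proof -
 obtain W where W: "!!w. w \<in># W ==> eval w = 0 \<and> length w = 3"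
  "!!g. (\<Sum>w\<in>#W. net w g) = Poly_Mapping.lookup (bar_boundary c) g" "size W = l1 c"
  using polygons_of_chain[of c] by blast
 have N: "(\<Sum>w\<in>#W. length w - 2) = l1 c"
 proof -
  have "(\<Sum>w\<in>#W. length w - 2) = (\<Sum>w\<in>#W. 1)" by (intro arg_cong[of _ _ sum_mset] image_mset_cong) (simp add: W(1))
  then show ?thesis using W(3) by simp
 qed
 obtain w m' where w: "eval w = 0" "m' > 0" "!!g. net w g = (if g = R then int m' else 0)"
  "(length w - 2) * m <= l1 c * m'"
 proof -
  have "(\<Sum>w\<in>#W. net w g) = (if g = R then int m else 0)" for g
   by (simp add: W(2) c)
  moreover have "eval w = 0 \<and> length w >= 3" if "w \<in># W" for w using W(1)[OF that] by simp
  ultimately show ?thesis using merge_polygons[of W R m "l1 c"] N m that by blast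
 qed
 define v where "v = w @ replicate m' (R, False)"
 have "net (replicate i (R, False)) g = (if g = R then - int i else 0)" for i g
  by (induction i) (auto simp: net_def)
 then have "net v g = 0" for g by (simp add: v_def w(3))
 then obtain k where k: "4 * k <= length v" "cprod k (eval v)" using balanced_cprod by blast
 have "eval (replicate i (R, False)) = - npow R i" for i
  by (induction i) (auto simp: letter_value_def minus_add simp del: add_uminus_conv_diff)
 then have "eval v = - npow R m'" by (simp add: v_def w(1))
 then have "cprod k (npow R m')" using cprod_minus[OF k(2)] by simp
 moreover have "4 * k * m <= m' * (l1 c + 3 * m)"
 proof -
  have "4 * k <= (length w - 2) + 2 + m'" using k(1) by (simp add: v_def)
  then have "4 * k * m <= ((length w - 2) + 2 + m') * m" by (rule mult_right_mono) simp
  also have "\<dots> = (length w - 2) * m + 2 * m + m' * m" by (simp add: algebra_simps)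
  also have "\<dots> <= l1 c * m' + 2 * m * m' + m' * m" using w(2,4) by (intro add_mono) auto
  finally show ?thesis by (simp add: algebra_simps)
 qed
 ultimately show ?thesis using that w(2) by blast
qed

section \<open>Bavard duality\<close>

text \<open>A commutator is the difference of \<open>a + b\<close> and \<open>b + a\<close>, which
  costs three defects; the fourth is spent on appending it to the rest.\<close>

lemma qm_cprod:
 assumes f: "qm f" and "cprod k g"
 shows "f g <= 4 * real k"
 using assms(2)
proof (induction k arbitrary: g)
 case 0
 then show ?case by (simp add: qm_0[OF f])
next
 case (Suc k)
 then obtain a b h where g: "g = comm a b + h" "cprod k h" by auto
 have "f (comm a b) <= 3"
 proof -
  have "comm a b = (a + b) + - (b + a)"
   by (simp add: comm_def group_add_simps del: add_uminus_conv_diff)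
  then show ?thesis
   using qm_add[OF f, of "a + b" "- (b + a)"] qm_add[OF f, of a b] qm_add[OF f, of b a] qm_minus[OF f, of "b + a"]
   by (simp only: abs_le_iff) linarith
 qed
 then show ?case
  using Suc.IH[OF g(2)] qm_add[OF f, of "comm a b" h] by (simp add: g abs_le_iff)
qed

section \<open>Norms and boundaries of bar chains\<close>

lemma l1_eq_sum: "finite K ==> Poly_Mapping.keys c \<subseteq> K ==> l1 c = (\<Sum>x\<in>K. nat \<bar>Poly_Mapping.lookup c x\<bar>)"
 unfolding l1_def by (rule sum.mono_neutral_left) (auto simp: in_keys_iff)

lemma l1_0 [simp]: "l1 0 = 0"
 by (simp add: l1_def)

lemma l1_minus [simp]: "l1 (- c) = l1 c"
 by (simp add: l1_def)

lemma l1_add: "l1 (c + d) <= l1 c + l1 d"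
proof -
 let ?K = "Poly_Mapping.keys c \<union> Poly_Mapping.keys d"
 have K: "finite ?K" "Poly_Mapping.keys (c + d) \<subseteq> ?K" by (simp_all add: keys_add)
 show ?thesis
  unfolding l1_eq_sum[OF K] l1_eq_sum[OF K(1) Un_upper1] l1_eq_sum[OF K(1) Un_upper2] sum.distrib[symmetric]
  by (intro sum_mono) (simp add: lookup_add)
qed

lemma l1_cmul: "l1 (frag_cmul k c) = nat \<bar>k\<bar> * l1 c"
proof -
 have "Poly_Mapping.keys (frag_cmul k c) \<subseteq> Poly_Mapping.keys c" by (rule keys_cmul)
 then have "l1 (frag_cmul k c) = (\<Sum>x\<in>Poly_Mapping.keys c. nat \<bar>Poly_Mapping.lookup (frag_cmul k c) x\<bar>)"
  by (intro l1_eq_sum) auto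
 then show ?thesis
  by (simp add: l1_def sum_distrib_left abs_mult nat_mult_distrib)
qed

lemma bar_boundary_add: "bar_boundary (c + d) = bar_boundary c + bar_boundary d"
 and bar_boundary_cmul: "bar_boundary (frag_cmul k c) = frag_cmul k (bar_boundary c)"
 and bar_boundary_minus: "bar_boundary (- c) = - bar_boundary c"
 and bar_boundary_0 [simp]: "bar_boundary 0 = 0"
 and bar_boundary_of: "bar_boundary (frag_of (g, h)) = frag_of g + frag_of h - frag_of (g + h)"
 by (simp_all add: bar_boundary_def frag_extend_add frag_extend_cmul frag_extend_minus)

text \<open>The filling norm with rational coefficients, expressed by integral chains: the norm is
  counted per copy of \<open>b\<close>. It is infinite if no positive multiple of \<open>b\<close>
  bounds.\<close>

definition fill_bound :: "('g::group_add \<Rightarrow>\<^sub>0 int) => real => bool" where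
 "fill_bound b s \<longleftrightarrow> (\<exists>m c. m > 0 \<and> bar_boundary c = frag_cmul (int m) b \<and> real (l1 c) <= real m * s)"

lemma fill_boundI: "m > 0 ==> bar_boundary c = frag_cmul (int m) b ==> real (l1 c) <= real m * s ==> fill_bound b s"
 by (auto simp: fill_bound_def)

lemma seminorm_bound_fill_bound: "seminorm_bound fill_bound"
proof
 show "fill_bound 0 0" by (rule fill_boundI[of 1 0]) auto
next
 fix b b' :: "'a \<Rightarrow>\<^sub>0 int" and s s' assume "fill_bound b s" "fill_bound b' s'"
 then obtain m c m' c' where c: "m > 0" "bar_boundary c = frag_cmul (int m) b" "real (l1 c) <= real m * s"
  "m' > 0" "bar_boundary c' = frag_cmul (int m') b'" "real (l1 c') <= real m' * s'"
  by (auto simp: fill_bound_def)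
 show "fill_bound (b + b') (s + s')"
 proof (rule fill_boundI)
  show "0 < m * m'" using c by simp
  show "bar_boundary (frag_cmul (int m') c + frag_cmul (int m) c') = frag_cmul (int (m * m')) (b + b')"
   by (simp add: bar_boundary_add bar_boundary_cmul c frag_cmul_distrib2 mult.commute)
  have "real (l1 (frag_cmul (int m') c + frag_cmul (int m) c')) <= real m' * real (l1 c) + real m * real (l1 c')"
   using l1_add[of "frag_cmul (int m') c" "frag_cmul (int m) c'"]
   by (simp add: l1_cmul of_nat_mono[of _ _, where 'a = real, simplified] flip: of_nat_mult of_nat_add)
  also have "\<dots> <= real m' * (real m * s) + real m * (real m' * s')"
   by (intro add_mono mult_left_mono c) auto
  finally show "real (l1 (frag_cmul (int m') c + frag_cmul (int m) c')) <= real (m * m') * (s + s')"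
   by (simp add: algebra_simps)
 qed
next
 fix b :: "'a \<Rightarrow>\<^sub>0 int" and s assume "fill_bound b s"
 then obtain m c where c: "m > 0" "bar_boundary c = frag_cmul (int m) b" "real (l1 c) <= real m * s"
  by (auto simp: fill_bound_def)
 show "fill_bound (- b) s"
  by (rule fill_boundI[of m "- c"]) (auto simp: c bar_boundary_minus intro!: poly_mapping_eqI)
next
 fix s assume "fill_bound (0 :: 'a \<Rightarrow>\<^sub>0 int) s"
 then obtain m and c :: "'a \<times> 'a \<Rightarrow>\<^sub>0 int" where "m > 0" "real (l1 c) <= real m * s"
  unfolding fill_bound_def by blast
 then have "0 <= real m * s" using of_nat_0_le_iff[of "l1 c"] by linarith
 then show "0 <= s" using \<open>m > 0\<close> by (simp add: zero_le_mult_iff)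
qed

text \<open>A single bar simplex fills its own boundary with norm 1, so a functional below the
  filling norm is a function of defect at most 1 extended additively. The slack is there because the
  filling norm is an infimum that may not be attained.\<close>

lemma fill_duality:
 fixes b :: "'g::group_add \<Rightarrow>\<^sub>0 int"
 assumes fin: "fill_bound b s0"
  and B: "!!f. (!!x y. f (x + y) = f x + f y) ==>
   (!!g h. \<bar>f (frag_of g) + f (frag_of h) - f (frag_of (g + h))\<bar> <= 1) ==> f b <= B"
  and "\<epsilon> > 0"
 shows "fill_bound b (B + \<epsilon>)"
proof -
 interpret seminorm_bound "fill_bound :: ('g \<Rightarrow>\<^sub>0 int) => real => bool" by (rule seminorm_bound_fill_bound)
 define \<mu> where "\<mu> = Inf {s. fill_bound b s}"
 have bdd: "bdd_below {s. fill_bound b s}" by (rule bdd_belowI[of _ 0]) (auto intro: P_nonneg)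
 have ne: "{s. fill_bound b s} ~= {}" using fin by auto
 have mult: "mult k b = frag_cmul (int k) b" for k
  by (induction k) (auto simp: frag_cmul_distrib)
 obtain f where f: "!!x y. f (x + y) = f x + f y" "!!x s. fill_bound x s ==> f x <= s" "f b = \<mu>"
 proof (rule hahn_banach[of b \<mu>])
  fix k s assume ks: "fill_bound (mult k b) s"
  show "real k * \<mu> <= s"
  proof (cases "k = 0")
   case True
   then show ?thesis using P_nonneg[OF ks] by simp
  next
   case False
   obtain m c where c: "m > 0" "bar_boundary c = frag_cmul (int m) (mult k b)" "real (l1 c) <= real m * s"
    using ks by (auto simp: fill_bound_def)
   have "fill_bound b (s / real k)"
    by (rule fill_boundI[of "m * k" c]) (use c False in \<open>auto simp: mult\<close>)
   then have "\<mu> <= s / real k" unfolding \<mu>_def using bdd by (intro cInf_lower) auto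
   then show ?thesis using False by (simp add: field_simps)
  qed
 next
  show "0 <= \<mu>" unfolding \<mu>_def using ne by (intro cInf_greatest) (auto intro: P_nonneg)
 qed blast
 have f_0: "f 0 = 0" using f(1)[of 0 0] by simp
 have f_minus: "f (- x) = - f x" for x using f(1)[of x "- x"] f_0 by simp
 have "\<bar>f (frag_of g) + f (frag_of h) - f (frag_of (g + h))\<bar> <= 1" for g h
 proof -
  let ?b = "frag_of g + frag_of h - frag_of (g + h)"
  have "fill_bound ?b 1"
   by (rule fill_boundI[of 1 "frag_of (g, h)"]) (simp_all add: bar_boundary_of l1_def)
  then have "f ?b <= 1" "f (- ?b) <= 1" using f(2) minus by blast+
  moreover have "f ?b = f (frag_of g) + f (frag_of h) - f (frag_of (g + h))"
   using f(1)[of "frag_of g + frag_of h" "- frag_of (g + h)"] by (simp add: f(1) f_minus)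
  ultimately show ?thesis using f_minus[of ?b] by linarith
 qed
 then have "\<mu> <= B" using B[of f] f by simp
 then have "\<mu> < B + \<epsilon>" using \<open>\<epsilon> > 0\<close> by simp
 then obtain s where "fill_bound b s" "s < B + \<epsilon>"
  unfolding \<mu>_def using ne bdd by (auto simp: cInf_less_iff)
 then obtain m c where "m > 0" "bar_boundary c = frag_cmul (int m) b" "real (l1 c) <= real m * s"
  by (auto simp: fill_bound_def)
 moreover from this have "real m * s <= real m * (B + \<epsilon>)" using \<open>s < B + \<epsilon>\<close> by (intro mult_left_mono) auto
 ultimately show ?thesis by (blast intro: fill_boundI order_trans)
qed

text \<open>Inversion reverses products, so \<open>- f (- g)\<close> has the same defect as
  \<open>f\<close>, and so has the average of the two. The distance is half of
  \<open>\<bar>f g + f (- g)\<bar>\<close>, which is at most 2 because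
  \<open>\<bar>f 0\<bar> <= 1\<close>.\<close>

lemma quasi_le_qm:
 assumes D: "!!g h. \<bar>f g + f h - f (g + h)\<bar> <= (1::real)"
 shows "qm (\<lambda>g. (f g - f (- g)) / 2)" "\<bar>f g - (f g - f (- g)) / 2\<bar> <= 1"
proof -
 have "\<bar>(f g - f (- g)) / 2 + (f h - f (- h)) / 2 - (f (g + h) - f (- (g + h))) / 2\<bar> <= 1" for g h
 proof -
  have "- (g + h) = - h + - g" by (simp only: minus_add)
  then show ?thesis using D[of g h] D[of "- h" "- g"] by (simp only: abs_le_iff) (simp add: field_simps)
 qed
 then show "qm (\<lambda>g. (f g - f (- g)) / 2)" by (simp add: qm_def field_simps)
 show "\<bar>f g - (f g - f (- g)) / 2\<bar> <= 1"
 proof -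
  have "\<bar>f 0\<bar> <= 1" "\<bar>f g + f (- g) - f 0\<bar> <= 1" using D[of 0 0] D[of g "- g"] by simp_all
  then show ?thesis by (simp add: abs_le_iff field_simps)
 qed
qed

lemma fill_npow:
 assumes "fill_bound (frag_of (npow x n)) s0" "!!f. qm f ==> homog f x <= q"
 shows "fill_bound (frag_of (npow x n)) (real n * q + 3)"
proof -
 have "fill_bound (frag_of (npow x n)) ((real n * q + 2) + 1)"
 proof (rule fill_duality[OF assms(1)])
  fix f :: "('a \<Rightarrow>\<^sub>0 int) => real"
  define g where "g = (\<lambda>x. f (frag_of x))"
  define ga where "ga = (\<lambda>x. (g x - g (- x)) / 2)"
  assume "!!x y. \<bar>f (frag_of x) + f (frag_of y) - f (frag_of (x + y))\<bar> <= 1"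
  then have "qm ga" "\<bar>g x - ga x\<bar> <= 1" for x
   unfolding ga_def using quasi_le_qm[of g] by (auto simp: g_def)
  then show "f (frag_of (npow x n)) <= real n * q + 2"
   using homog_close[of ga x n] mult_left_mono[OF assms(2)[of ga], of "real n"]
   by (simp add: g_def abs_le_iff) (smt (verit))
 qed simp
 then show ?thesis by (simp add: add.assoc)
qed

text \<open>Both powers are filled by one chain, since \<open>q\<close> bounds the sum of two values
  of the same quasimorphism. The 5 consists of two errors of size 1 for each power and of the slack
  1 in the duality.\<close>

lemma fill_npow_npow:
 assumes "fill_bound (frag_of (npow x n) + frag_of (npow y n)) s0"
  "!!f. qm f ==> homog f x + homog f y <= q"
 shows "fill_bound (frag_of (npow x n) + frag_of (npow y n)) (real n * q + 5)"
proof -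
 have "fill_bound (frag_of (npow x n) + frag_of (npow y n)) ((real n * q + 4) + 1)"
 proof (rule fill_duality[OF assms(1)])
  fix f :: "('a \<Rightarrow>\<^sub>0 int) => real"
  define g where "g = (\<lambda>x. f (frag_of x))"
  define ga where "ga = (\<lambda>x. (g x - g (- x)) / 2)"
  assume f: "!!x y. f (x + y) = f x + f y"
   "!!x y. \<bar>f (frag_of x) + f (frag_of y) - f (frag_of (x + y))\<bar> <= 1"
  then have ga: "qm ga" "\<bar>g x - ga x\<bar> <= 1" for x
   unfolding ga_def using quasi_le_qm[of g] by (auto simp: g_def)
  have "real n * homog ga x + real n * homog ga y <= real n * q"
   using mult_left_mono[OF assms(2)[OF ga(1)], of "real n"] by (simp add: algebra_simps)
  then show "f (frag_of (npow x n) + frag_of (npow y n)) <= real n * q + 4"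
   using homog_close[OF ga(1), of x n] homog_close[OF ga(1), of y n] ga(2)[of "npow x n"] ga(2)[of "npow y n"]
   unfolding f(1) by (simp add: g_def abs_le_iff)
 qed simp
 then show ?thesis by (simp add: add.assoc)
qed

text \<open>Vanishing in the first integral homology of the group; it serves to show that a filling
  norm is finite.\<close>

definition null_chain :: "('g::group_add \<Rightarrow>\<^sub>0 int) => bool" where
 "null_chain b \<longleftrightarrow> (\<exists>c. bar_boundary c = b)"

lemma null_chain_add: "null_chain b ==> null_chain b' ==> null_chain (b + b')"
 unfolding null_chain_def by (metis bar_boundary_add)

lemma null_chain_minus: "null_chain b ==> null_chain (- b)"
 unfolding null_chain_def by (metis bar_boundary_minus)

lemma null_chain_diff: "null_chain b ==> null_chain b' ==> null_chain (b - b')"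
 using null_chain_add[of b "- b'"] null_chain_minus[of b'] by simp

lemma null_chain_of: "null_chain (frag_of g + frag_of h - frag_of (g + h))"
 unfolding null_chain_def using bar_boundary_of by metis

lemma null_chain_of_add: 
 assumes "null_chain (frag_of g)" "null_chain (frag_of h)"
 shows "null_chain (frag_of (g + h))"
 using null_chain_diff[OF null_chain_add[OF assms] null_chain_of[of g h]] by (simp add: algebra_simps)

lemma null_chain_zero: "null_chain (frag_of (0 :: 'g::group_add))"
 unfolding null_chain_def
 by (rule exI[of _ "frag_of (0, 0)"]) (simp only: bar_boundary_of add_0_left add_diff_cancel_left' add_diff_cancel_right')

lemma null_chain_comm: "null_chain (frag_of (comm a b))"
proof -
 have inv: "null_chain (frag_of g + frag_of (- g))" for g :: 'a
  using null_chain_add[OF null_chain_of[of g "- g"] null_chain_zero]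
  by (simp only: right_minus diff_add_cancel)
 have "null_chain ((frag_of a + frag_of (- a)) + (frag_of b + frag_of (- b)) -
  (frag_of a + frag_of b - frag_of (a + b)) - (frag_of (a + b) + frag_of (- a) - frag_of (a + b + - a)) -
  (frag_of (a + b + - a) + frag_of (- b) - frag_of (a + b + - a + - b)))"
  by (intro null_chain_diff null_chain_add inv null_chain_of)
 then show ?thesis by (simp add: comm_def algebra_simps)
qed

lemma null_chain_cprod: "cprod k g ==> null_chain (frag_of g)"
proof (induction k arbitrary: g)
 case 0
 then show ?case using null_chain_zero by simp
qed (auto intro: null_chain_of_add null_chain_comm)

lemma null_chain_imp_fill_bound: 
 assumes "null_chain b"
 obtains s where "fill_bound b s"
proof -
 obtain c where "bar_boundary c = b" using assms by (auto simp: null_chain_def)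
 then have "fill_bound b (real (l1 c))" by (intro fill_boundI[of 1 c]) auto
 then show ?thesis by (rule that)
qed

definition clen :: "'g::group_add => nat" where
 "clen g = (LEAST k. cprod k g)"

lemma clen: "cprod k g ==> cprod (clen g) g" and clen_le: "cprod k g ==> clen g <= k"
 by (auto simp: clen_def intro: LeastI Least_le)

text \<open>Here the defect is measured before homogenization, which can double it; this accounts
  for the factor 1/4 where the formulation with homogeneous quasimorphisms has 1/2. Below,
  \<open>qm_cprod\<close> uses four defects per commutator; above, a commutator uses up four polygon
  edges.\<close>

theorem bavard_duality:
 fixes r :: "'g::group_add"
 assumes r: "cprod k0 r"
  and le: "!!f. qm f ==> homog f r <= q"
  and ge: "!!\<epsilon>. \<epsilon> > 0 ==> \<exists>f. qm f \<and> homog f r >= q - \<epsilon>"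
 shows "(\<lambda>n. real (clen (npow r n)) / real n) \<longlonglongrightarrow> q / 4"
proof (rule LIMSEQ_I)
 fix \<epsilon> :: real assume e: "\<epsilon> > 0"
 have cp: "cprod (n * k0) (npow r n)" for n using r by (rule cprod_npow)
 obtain f where f: "qm f" "homog f r >= q - \<epsilon>" using ge[OF e] by blast
 have lower: "real n * (q - \<epsilon>) - 1 <= 4 * real (clen (npow r n))" for n
 proof -
  have "real n * (q - \<epsilon>) <= real n * homog f r" using f(2) by (intro mult_left_mono) auto
  then show ?thesis
   using homog_close[OF f(1), of r n] qm_cprod[OF f(1) clen[OF cp[of n]]] by (simp add: abs_le_iff)
 qed
 \<comment> \<open>The 6 is made up of 3 from \<open>fill_npow\<close> and 3 from
   \<open>bar_chain_cprod\<close>; the high power \<open>n0\<close> makes both negligible.\<close>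
 obtain n0 where n0: "6 / \<epsilon> < real n0" using reals_Archimedean2 by blast
 then have n0_pos: "n0 > 0" using e by (cases n0) (auto simp: field_simps)
 obtain s where "fill_bound (frag_of (npow r n0)) s"
  using null_chain_imp_fill_bound[OF null_chain_cprod[OF cp[of n0]]] .
 then have "fill_bound (frag_of (npow r n0)) (real n0 * q + 3)" using le by (rule fill_npow)
 then obtain m c where c: "m > 0" "bar_boundary c = frag_cmul (int m) (frag_of (npow r n0))"
  "real (l1 c) <= real m * (real n0 * q + 3)" by (auto simp: fill_bound_def)
 obtain k m' where k: "m' > 0" "cprod k (npow (npow r n0) m')" "4 * k * m <= m' * (l1 c + 3 * m)"
  using bar_chain_cprod[OF c(2,1)] .
 define N where "N = n0 * m'"
 have N: "N > 0" "cprod k (npow r N)" using k n0_pos by (simp_all add: N_def npow_mult)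
 have kN: "4 * real k <= real N * (q + \<epsilon>)"
 proof -
  have "real (4 * k * m) <= real (m' * (l1 c + 3 * m))" using k(3) by (simp only: of_nat_le_iff)
  then have "4 * real k * real m <= real m' * (real (l1 c) + 3 * real m)" by simp
  also have "\<dots> <= real m' * (real m * (real n0 * q + 3) + 3 * real m)" using c(3) by (intro mult_left_mono) auto
  also have "\<dots> = real m' * (real n0 * q + 6) * real m" by (simp add: algebra_simps)
  finally have "4 * real k <= real m' * (real n0 * q + 6)" using c(1) by simp
  also have "\<dots> <= real m' * (real n0 * q + real n0 * \<epsilon>)"
   using n0 e by (intro mult_left_mono add_left_mono) (auto simp: field_simps)
  finally show ?thesis by (simp add: N_def algebra_simps)
 qed
 have upper: "4 * real (clen (npow r n)) <= real n * (q + \<epsilon>) + (4 * real N * real k0 + real N * \<bar>q + \<epsilon>\<bar>)" for n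
 proof -
  \<comment> \<open>Blocks of length \<open>N\<close> are written efficiently; the remainder has
    fewer than \<open>N\<close> factors, each written with \<open>k0\<close> commutators.\<close>
  define d e' where "d = n div N" and "e' = n mod N"
  have n: "n = N * d + e'" "e' < N" using N by (simp_all add: d_def e'_def)
  have "cprod (d * k + e' * k0) (npow r n)"
   unfolding n(1) npow_add npow_mult by (intro cprod_add cprod_npow N r)
  then have "clen (npow r n) <= d * k + e' * k0" by (rule clen_le)
  then have "real (clen (npow r n)) <= real (d * k + e' * k0)" by (simp only: of_nat_le_iff)
  then have "4 * real (clen (npow r n)) <= real d * (4 * real k) + 4 * (real e' * real k0)" by simp
  also have "\<dots> <= real d * (real N * (q + \<epsilon>)) + 4 * (real N * real k0)"
   using n(2) kN by (intro add_mono mult_left_mono mult_right_mono) auto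
  also have "real d * (real N * (q + \<epsilon>)) = real n * (q + \<epsilon>) - real e' * (q + \<epsilon>)"
   by (simp add: n(1) algebra_simps)
  finally have "4 * real (clen (npow r n)) <= real n * (q + \<epsilon>) - real e' * (q + \<epsilon>) + 4 * (real N * real k0)" .
  moreover have "- (real e' * (q + \<epsilon>)) <= real e' * \<bar>q + \<epsilon>\<bar>"
   by (metis abs_ge_minus_self abs_mult abs_of_nat)
  moreover have "real e' * \<bar>q + \<epsilon>\<bar> <= real N * \<bar>q + \<epsilon>\<bar>" using n(2) by (intro mult_right_mono) auto
  ultimately show ?thesis by linarith
 qed
 define C where "C = 4 * real N * real k0 + real N * \<bar>q + \<epsilon>\<bar> + 1"
 have C: "C >= 1" by (simp add: C_def)
 obtain n1 where n1: "C / \<epsilon> < real n1" using reals_Archimedean2 by blast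
 have "norm (real (clen (npow r n)) / real n - q / 4) < \<epsilon>" if "n >= Suc n1" for n
 proof -
  have n: "real n > 0" "C < real n * \<epsilon>"
  proof -
   show "real n > 0" using that by simp
   have "C < real n1 * \<epsilon>" using n1 e by (simp add: field_simps)
   also have "\<dots> <= real n * \<epsilon>" using that e by (intro mult_right_mono) auto
   finally show "C < real n * \<epsilon>" .
  qed
  have "4 * real (clen (npow r n)) - real n * q <= real n * \<epsilon> + C"
   using upper[of n] by (simp add: C_def algebra_simps)
  moreover have "real n * q - 4 * real (clen (npow r n)) <= real n * \<epsilon> + C"
   using lower[of n] C by (simp add: algebra_simps)
  ultimately have "\<bar>4 * real (clen (npow r n)) - real n * q\<bar> < 4 * (real n * \<epsilon>)"
   using n by (simp add: abs_less_iff)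
  then have "\<bar>4 * real (clen (npow r n)) - real n * q\<bar> / (4 * real n) < \<epsilon>"
   using n(1) by (simp add: field_simps)
  moreover have "real (clen (npow r n)) / real n - q / 4 = (4 * real (clen (npow r n)) - real n * q) / (4 * real n)"
   using n(1) by (simp add: field_simps)
  ultimately show ?thesis using n(1) by (simp add: abs_divide)
 qed
 then show "\<exists>no. \<forall>n\<ge>no. norm (real (clen (npow r n)) / real n - q / 4) < \<epsilon>" by blast
qed

section \<open>Decomposable relators\<close>

text \<open>The first letter acts first, as states are multiplied from the right.\<close>

primrec opw :: "('b => 's => 's) => 'b list => 's => 's" where
 "opw act [] m = m"
| "opw act (x # w) m = opw act w (act x m)"

locale hnn_action = hnn D J \<xi> F
 for D :: "int set" and J :: "bool => int => 'g::group_add" and \<xi> F +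
 fixes act :: "'a \<times> bool => 'g state => 'g state"
 assumes act_Ops: "act x \<in> Ops"
  and act_inv: "Valid m ==> act (inv_letter x) (act x m) = m"
begin

lemma opw_Ops: "opw act w \<in> Ops"
proof (induction w)
 case Nil
 then show ?case by (auto intro: Ops.Id)
next
 case (Cons x w)
 then show ?case using Ops_comp[OF Cons act_Ops] by simp
qed

lemma opw_cancel_cons: "Valid m ==> opw act (cancel_cons x w) m = opw act w (act x m)"
 by (cases w) (auto simp: cancel_cons_def act_inv)

lemma opw_foldr_cancel_cons: "Valid m ==> opw act (foldr cancel_cons u v) m = opw act v (opw act u m)"
proof (induction u arbitrary: m)
 case (Cons x u)
 then show ?case using Ops_Valid[OF act_Ops] by (simp add: opw_cancel_cons)
qed simp

definition ev :: "'a fg => 'g state => 'g state" where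
 "ev g = opw act (word g)"

lemma ev_Ops: "ev g \<in> Ops"
 by (simp add: ev_def opw_Ops)

lemma ev_Valid: "Valid m ==> Valid (ev g m)"
 using Ops_Valid[OF ev_Ops] .

lemma ev_0 [simp]: "ev 0 m = m"
 by (simp add: ev_def)

lemma ev_letter [simp]: "ev (letter x) m = act x m"
 by (simp add: ev_def)

lemma ev_plus: "Valid m ==> ev (g + h) m = ev h (ev g m)"
 by (simp add: ev_def word_plus opw_foldr_cancel_cons)

lemma ev_minus_letter: "ev (- letter x) m = act (inv_letter x) m"
 by (simp add: minus_letter)

definition quasi :: "'a fg => real" where
 "quasi g = val True (ev g m0)"

lemma quasi_add: "\<bar>quasi g + quasi h - quasi (g + h)\<bar> <= 1"
 using val_Ops[OF ev_Ops ev_Ops, of g h] by (simp add: quasi_def ev_plus)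

lemma quasi_central:
 assumes "!!m. Valid m ==> ev r m = shift q m"
 shows "quasi (g + (h + r - h)) = quasi g + q"
proof -
 define m where "m = ev g m0"
 have v: "Valid m" by (simp add: m_def ev_Valid)
 have "ev (g + (h + r + - h)) m0 = ev (- h) (ev r (ev h m))"
  by (simp add: ev_plus ev_Valid m_def del: add_uminus_conv_diff)
 also have "\<dots> = shift q (ev (- h) (ev h m))"
  by (simp add: assms ev_Valid v Ops_shift[OF ev_Ops])
 also have "ev (- h) (ev h m) = m" using ev_plus[OF v, of h "- h"] by simp
 finally show ?thesis by (simp add: quasi_def m_def)
qed

end

definition decomposable :: "'a fg => 'a fg => 'a fg => bool" where
 "decomposable r r1 r2 \<longleftrightarrow>
  (\<exists>S1 S2. S1 \<inter> S2 = {} \<and> r1 \<in> over S1 \<and> r2 \<in> over S2 \<and> r = r1 + r2) \<or>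
  (\<exists>S' t. t \<notin> S' \<and> r1 \<in> over S' \<and> r2 \<in> over S' \<and> r = r1 + letter (t, True) + r2 - letter (t, True))"

lemma snd_inv_letter [simp]: "snd (inv_letter x) = (\<not> snd x)"
 by (simp add: inv_letter_def)

text \<open>
 In the first case, \<open>S1\<close> acts through the inclusion and \<open>S2\<close> through its conjugate by \<open>t\<close>. In both
 cases, the relator acts as \<open>r1 t r2 t\<inverse>\<close>.
\<close>

lemma (in hnn) relator_action:
 fixes r r1 r2 :: "'a fg" and j :: "'a fg => 'g"
 assumes dec: "decomposable r r1 r2"
  and j: "!!u v. j (u + v) = j u + j v" 
 obtains act :: "'a \<times> bool => 'g state => 'g state" where "hnn_action D J \<xi> F act"
  "!!m. Valid m ==> opw act (word r) m = T False (R (j r2) (T True (R (j r1) m)))"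
proof -
 have j0: "j 0 = 0" using j[of 0 0] by (metis add_0 add_minus_cancel left_minus)
 have jm: "j (- u) = - j u" for u using j[of u "- u"] j0 by (simp add: minus_unique)
 have ji: "j (letter (inv_letter x)) = - j (letter x)" for x by (simp add: minus_letter[symmetric] jm)
 have T1: "T False (T True m) = m" and T2: "T True (T False m) = m" if "Valid m" for m
  using T_T[OF that, of True] T_T[OF that, of False] by simp_all
 consider (free) S1 S2 where "S1 \<inter> S2 = {}" "r1 \<in> over S1" "r2 \<in> over S2" "r = r1 + r2"
  | (hnn) S' t where "t \<notin> S'" "r1 \<in> over S'" "r2 \<in> over S'" "r = r1 + letter (t, True) + r2 - letter (t, True)"
  using dec by (auto simp: decomposable_def)
 then show ?thesis
 proof cases
  case free
  define act where "act = (\<lambda>x m. if fst x \<in> S2 then T False (R (j (letter x)) (T True m)) else R (j (letter x)) m)"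
  interpret hnn_action D J \<xi> F act
  proof
   fix x show "act x \<in> Ops"
    using Ops_comp[OF Ops_T Ops_comp[OF Ops_R Ops_T]] Ops_R by (cases "fst x \<in> S2") (simp_all add: act_def)
  next
   fix m x assume "Valid m"
   then show "act (inv_letter x) (act x m) = m"
    by (auto simp: act_def T1 T2 R_R ji)
  qed
  have 1: "u \<in> over S1 ==> ev u m = R (j u) m" for u m
  proof (induction u arbitrary: m rule: fg_induct)
   case (Cons x u)
   then have "fst x \<notin> S2" "u \<in> over S1" using free(1) by (auto simp: over_def)
   moreover have "ev (letter x + u) m = ev u (act x m)" using Cons.hyps by (simp add: ev_def)
   ultimately show ?case using Cons.IH by (simp add: act_def R_R j)
  qed (simp add: j0)
  have 2: "u \<in> over S2 ==> Valid m ==> ev u m = T False (R (j u) (T True m))" for u m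
  proof (induction u arbitrary: m rule: fg_induct)
   case (Cons x u)
   then have "fst x \<in> S2" "u \<in> over S2" by (auto simp: over_def)
   moreover have "ev (letter x + u) m = ev u (act x m)" using Cons.hyps by (simp add: ev_def)
   ultimately show ?case using Cons.IH[of "act x m"] Cons.prems(2) by (simp add: act_def R_R j T2)
  qed (simp add: j0 T1)
  show ?thesis
  proof (rule that)
   show "hnn_action D J \<xi> F act" by unfold_locales
   show "opw act (word r) m = T False (R (j r2) (T True (R (j r1) m)))" if "Valid m" for m
    unfolding ev_def[symmetric] free(4) using that free by (simp add: ev_plus 1 2)
  qed
 next
  case hnn
  define act where "act = (\<lambda>x m. if fst x = t then T (snd x) m else R (j (letter x)) m)"
  interpret hnn_action D J \<xi> F act
  proof
   fix x show "act x \<in> Ops"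
    using Ops_R Ops_T by (cases "fst x = t") (simp_all add: act_def)
  next
   fix m x assume "Valid m"
   then show "act (inv_letter x) (act x m) = m"
    using T_T[of m "snd x"] by (auto simp: act_def R_R ji snd_inv_letter)
  qed
  have 1: "u \<in> over S' ==> ev u m = R (j u) m" for u m
  proof (induction u arbitrary: m rule: fg_induct)
   case (Cons x u)
   then have "fst x ~= t" "u \<in> over S'" using hnn(1) by (auto simp: over_def)
   moreover have "ev (letter x + u) m = ev u (act x m)" using Cons.hyps by (simp add: ev_def)
   ultimately show ?case using Cons.IH by (simp add: act_def R_R j)
  qed (simp add: j0)
  have 2: "ev (- letter (t, True)) m = T False m" "ev (letter (t, True)) m = T True m" for m
   by (simp_all add: ev_minus_letter, simp_all add: act_def inv_letter_def)
  show ?thesis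
  proof (rule that)
   show "hnn_action D J \<xi> F act" by unfold_locales
   show "opw act (word r) m = T False (R (j r2) (T True (R (j r1) m)))" if "Valid m" for m
    unfolding ev_def[symmetric] hnn(4) diff_conv_add_uminus
    using that hnn by (simp add: ev_plus 1 2 del: ev_letter add_uminus_conv_diff)
  qed
 qed
qed

lemma homog_decomposable:
 assumes "decomposable r r1 r2"
 obtains b where "r = r1 + b" "!!f. qm f ==> homog f b = homog f r2" "!!k. cprod k r2 ==> cprod k b"
proof -
 consider "r = r1 + r2" | t where "r = r1 + letter (t, True) + r2 - letter (t, True)"
  using assms unfolding decomposable_def by blast
 then show ?thesis
 proof cases
  case 1
  then show ?thesis using that[of r2] by simp
 next
  case 2
  have "cprod k (c + g - c)" if "cprod k g" for k and c g :: "'a fg"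
   using that
  proof (induction k arbitrary: g)
   case (Suc k)
   then obtain a b h where g: "g = comm a b + h" "cprod k h" by auto
   have "c + g - c = (c + comm a b - c) + (c + h - c)"
    by (simp add: g group_add_simps del: add_uminus_conv_diff)
   then show ?case using Suc.IH[OF g(2)] unfolding comm_conj by auto
  qed simp
  then show ?thesis
  proof (intro that[of "letter (t, True) + r2 - letter (t, True)"])
   show "r = r1 + (letter (t, True) + r2 - letter (t, True))"
    by (simp add: 2 group_add_simps del: add_uminus_conv_diff)
  qed (simp_all add: homog_conj)
 qed
qed

text \<open>The edge group is infinite cyclic and identifies the inverse of \<open>r1\<close> with
  \<open>r2\<close> across the stable letter. In the HNN extension the relator is trivial, and in
  the central extension it is the shift by \<open>homog f r1 + homog f r2\<close>. Torsion-freeness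
  provides the injectivity of \<open>J\<close>.\<close>

theorem equivariant_quasimorphism:
 assumes dec: "decomposable r r1 r2" and ne: "r1 ~= 0" "r2 ~= 0" and f: "qm f"
 obtains Q where "qm Q" "!!g h. Q (g + (h + r - h)) = Q g + Q r" "Q r = homog f r1 + homog f r2"
proof -
 define \<rho> where "\<rho> = (\<lambda>e. if e then r1 else r2)"
 \<comment> \<open>With this sign the edge relation reads \<open>r1^-1 t = t r2\<close> for
   \<open>k = 1\<close>, that is, \<open>r1 t r2 t^-1 = 1\<close>.\<close>
 define J where "J = (\<lambda>e k. ipow (\<rho> e) (if e then - k else k))"
 define \<xi> where "\<xi> = (\<lambda>e k. real_of_int (if e then - k else k) * homog f (\<rho> e))"
 define F where "F = (\<lambda>p q. cusp_mean f (\<rho> p) (\<rho> q))"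
 interpret hnn UNIV J \<xi> F
 proof
  fix e k l
  show "J e (k - l) = J e k - J e l"
   by (cases e) (simp_all add: J_def ipow_diff[symmetric])
  have "inj (ipow (\<rho> e))" using ne by (intro ipow_inj) (simp add: \<rho>_def)
  then show "inj_on (J e) UNIV" unfolding J_def by (intro inj_onI) (auto dest!: injD split: if_splits)
  show "\<xi> e (k - l) = \<xi> e k - \<xi> e l" by (cases e) (simp_all add: \<xi>_def algebra_simps)
 next
  fix p q s x y k
  show "F q p (- x) = - F p q x" unfolding F_def by (rule cusp_mean_minus[OF f])
  show "\<bar>F p q x + F q s y - F p s (x + y)\<bar> <= 1" unfolding F_def by (rule cusp_mean_triangle[OF f])
  show "F p q (x + J q k) = F p q x + \<xi> q k"
   unfolding F_def J_def \<xi>_def by (rule cusp_mean_add_ipow[OF f])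
 qed auto
 obtain act where "hnn_action UNIV J \<xi> F act"
  and act: "!!m. Valid m ==> opw act (word r) m = T False (R (id r2) (T True (R (id r1) m)))"
  using relator_action[OF dec, of id] by auto
 then interpret hnn_action UNIV J \<xi> F act by simp
 define q where "q = homog f r1 + homog f r2"
 have ev_r: "ev r m = shift q m" if v: "Valid m" for m
 proof -
  have "T True (R (J True (- 1)) m) = shift (\<xi> True (- 1) - \<xi> False (- 1)) (R (J False (- 1)) (T True m))"
   using T_R_J[of "- 1" True m] by simp
  then have "T True (R r1 m) = shift q (R (- r2) (T True m))"
   by (simp add: J_def \<xi>_def \<rho>_def q_def ipow_minus)
  then have "T False (R r2 (T True (R r1 m))) = shift q (T False (T True m))"
   by (simp add: R_shift T_shift R_R)
  then show ?thesis using act[OF v] T_T[OF v, of True] by (simp add: ev_def)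
 qed
 define Q where "Q = (\<lambda>g. (quasi g - quasi (- g)) / 2)"
 have qm: "qm Q" unfolding Q_def by (rule quasi_le_qm(1)) (rule quasi_add)
 have qc: "quasi (g + (h + r - h)) = quasi g + q" for g h
  by (rule quasi_central) (rule ev_r)
 have aux: "(x - y) / 2 = (a - b) / 2 + q" if "b = y + q" "x = a + q" for x y a b :: real
  using that by (simp add: field_simps)
 have Q_r: "Q (g + (h + r - h)) = Q g + q" for g h
 proof -
  have "quasi (- (g + (h + r - h)) + ((g + h) + r - (g + h))) = quasi (- (g + (h + r - h))) + q"
   by (rule qc)
  moreover have "- (g + (h + r - h)) + ((g + h) + r - (g + h)) = - g"
   by (simp add: group_add_simps del: add_uminus_conv_diff)
  ultimately have "quasi (- g) = quasi (- (g + (h + r - h))) + q" by simp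
  then show ?thesis
   unfolding Q_def by (rule aux) (rule qc)
 qed
 have "Q r = q" using Q_r[of 0 0] qm_0[OF qm] by simp
 then show ?thesis using that[of Q] qm Q_r by (simp add: q_def)
qed

definition power_sign :: "'g::group_add => 'g => real" where
 "power_sign r x = (if x \<in> range (ipow r) then sgn (real_of_int (inv_into UNIV (ipow r) x)) else 0)"

lemma power_sign_ipow: "inj (ipow r) ==> power_sign r (ipow r k) = sgn (real_of_int k)"
 unfolding power_sign_def using inv_into_f_f[of "ipow r" UNIV k] by simp

lemma power_sign_minus:
 assumes "inj (ipow r)"
 shows "power_sign r (- x) = - power_sign r x"
proof (cases "x \<in> range (ipow r)")
 case True
 then obtain k where "x = ipow r k" by auto
 then show ?thesis using power_sign_ipow[OF assms, of k] power_sign_ipow[OF assms, of "- k"]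
  by (simp add: ipow_minus sgn_minus)
next
 case False
 have "- x \<notin> range (ipow r)"
 proof
  assume "- x \<in> range (ipow r)"
  then obtain k where "- x = ipow r k" by blast
  then have "x = ipow r (- k)" unfolding ipow_minus by (metis minus_minus)
  then show False using False by blast
 qed
 then show ?thesis using False by (simp add: power_sign_def)
qed

text \<open>
 Adding \<open>power_sign\<close> does not increase the defect, because the defect of \<open>cusp_mean\<close> vanishes
 on all triangles that \<open>power_sign\<close> contributes to.
\<close>

lemma cusp_mean_sign_triangle:
 assumes f: "qm f" and inj: "!!p. inj (ipow (\<rho> p))"
 defines "G \<equiv> \<lambda>p q x. cusp_mean f (\<rho> p) (\<rho> q) x + (if p = q then power_sign (\<rho> p) x else 0)"
 shows "\<bar>G p q x + G q s y - G p s (x + y)\<bar> <= 1"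
proof -
 define C where "C = (\<lambda>p q x. cusp_mean f (\<rho> p) (\<rho> q) x)"
 define A where "A = (\<lambda>p q x. p = q \<and> x \<in> range (ipow (\<rho> p)))"
 have C_minus: "C q p (- x) = - C p q x" for p q x
  unfolding C_def by (rule cusp_mean_minus[OF f])
 have C_right: "C p q (x + ipow (\<rho> q) k) = C p q x + real_of_int k * homog f (\<rho> q)" for p q x k
  unfolding C_def by (rule cusp_mean_add_ipow[OF f])
 have C_left: "C p q (ipow (\<rho> p) k + x) = C p q x + real_of_int k * homog f (\<rho> p)" for p q x k
  using C_right[of q p "- x" "- k"] C_minus[of q p "ipow (\<rho> p) k + x"] C_minus[of q p x]
  by (simp add: ipow_minus minus_add)
 have C_pow: "C p p (ipow (\<rho> p) k) = real_of_int k * homog f (\<rho> p)" for p k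
  using C_right[of p p 0 k] C_minus[of p p 0] by simp
 have tri: "\<bar>C p q x + C q s y - C p s (x + y)\<bar> <= 1"
  unfolding C_def by (rule cusp_mean_triangle[OF f])
 have inactive: "G p q x = C p q x" if "\<not> A p q x" for p q x
  using that by (auto simp: G_def C_def A_def power_sign_def)
 have active: "\<exists>k. p = q \<and> x = ipow (\<rho> p) k \<and> G p q x = real_of_int k * homog f (\<rho> p) + sgn (real_of_int k)"
  if "A p q x" for p q x
  using that C_pow power_sign_ipow[OF inj] by (auto simp: G_def C_def A_def)
 have sgn_le: "\<bar>sgn (real_of_int k)\<bar> <= 1" for k by (simp add: sgn_if)
 have sgn_tri: "\<bar>sgn (real_of_int k) + sgn (real_of_int l) - sgn (real_of_int (k + l))\<bar> <= 1" for k l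
  by (auto simp: sgn_if)
 have closed: "A p s y \<longleftrightarrow> A p s (x + y)" if Ax: "A p p x" for p s x y
 proof -
  obtain k where k: "x = ipow (\<rho> p) k" using Ax by (auto simp: A_def)
  have "y = ipow (\<rho> p) l \<longleftrightarrow> x + y = ipow (\<rho> p) (k + l)" for l
   by (simp add: k ipow_add)
  moreover have "x + y = ipow (\<rho> p) l \<longleftrightarrow> y = ipow (\<rho> p) (- k + l)" for l
   using ipow_add[of "\<rho> p" "-k" l] ipow_minus[of "\<rho> p" k] k
   by (metis add_minus_cancel minus_add_cancel)
  ultimately show ?thesis unfolding A_def by blast
 qed
 show ?thesis
 proof (cases "A p q x")
  case True
  then obtain k where k: "p = q" "x = ipow (\<rho> p) k" "G p q x = real_of_int k * homog f (\<rho> p) + sgn (real_of_int k)"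
   using active by blast
  show ?thesis
  proof (cases "A q s y")
   case Ay: True
   then obtain l where l: "q = s" "y = ipow (\<rho> q) l" "G q s y = real_of_int l * homog f (\<rho> q) + sgn (real_of_int l)"
    using active by blast
   have "G p s (x + y) = C p p (ipow (\<rho> p) (k + l)) + sgn (real_of_int (k + l))"
    using k(1,2) l(1,2) by (simp add: G_def C_def ipow_add[symmetric] power_sign_ipow[OF inj])
   then show ?thesis using sgn_tri[of k l] k l by (simp add: C_pow algebra_simps)
  next
   case False
   then have "\<not> A p s (x + y)" using closed[of p x s y] True k(1) by simp
   then have "G p s (x + y) = C p s y + real_of_int k * homog f (\<rho> p)"
    using inactive C_left[of p s k y] k(2) by simp
   then show ?thesis using inactive[OF False] k sgn_le[of k] by simp
  qed
 next
  case Ax: False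
  show ?thesis
  proof (cases "A q s y")
   case True
   then obtain l where l: "q = s" "y = ipow (\<rho> q) l" "G q s y = real_of_int l * homog f (\<rho> q) + sgn (real_of_int l)"
    using active by blast
   have "\<not> A p s (x + y)"
   proof
    assume *: "A p s (x + y)"
    then have "p = q" using l(1) by (simp add: A_def)
    moreover have "A p p (- (x + y))" using * \<open>p = q\<close> l(1) by (auto simp: A_def) (metis ipow_minus minus_add rangeI)
    ultimately have "A p p (- (x + y) + x)  \<longleftrightarrow> A p p x" using closed[of p "- (x + y)" p x] by simp
    moreover have "- (x + y) + x = - y + - x + x" by (simp only: minus_add)
    moreover have "A p p (- y)" using True \<open>p = q\<close> l(1) by (auto simp: A_def) (metis ipow_minus rangeI)
    ultimately show False using Ax \<open>p = q\<close> by (simp add: add.assoc)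
   qed
   then have "G p s (x + y) = C p q x + real_of_int l * homog f (\<rho> q)"
    using inactive C_right[of p q x l] l by simp
   then show ?thesis using inactive[OF Ax] l sgn_le[of l] by simp
  next
   case Ay: False
   show ?thesis
   proof (cases "A p s (x + y)")
    case True
    then obtain k where k: "p = s" "x + y = ipow (\<rho> p) k" "G p s (x + y) = real_of_int k * homog f (\<rho> p) + sgn (real_of_int k)"
     using active by blast
    have "y = - x + ipow (\<rho> p) k" unfolding k(2)[symmetric] by (simp add: add.assoc[symmetric])
    then have "C q s y = - C p q x + real_of_int k * homog f (\<rho> p)"
     using C_right[of q p "- x" k] C_minus[of p q x] C_minus[of q p x] k(1) by simp
    then show ?thesis using inactive[OF Ax] inactive[OF Ay] k sgn_le[of k] by simp
   next
    case False
    then show ?thesis using tri inactive[OF Ax] inactive[OF Ay] inactive[OF False] by simp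
   qed
  qed
 qed
qed

text \<open>With trivial edge groups nothing is identified, so powers of the relator remain reduced
  and \<open>val\<close> adds up their syllables exactly. Each syllable contributes
  \<open>homog f (\<rho> p)\<close> and 1 more from \<open>power_sign\<close>, which is the origin
  of the summand 2.\<close>

theorem decomposable_quasimorphism:
 assumes dec: "decomposable r r1 r2" and ne: "r1 ~= 0" "r2 ~= 0" and f: "qm f"
 obtains Q where "qm Q" "homog Q r = homog f r1 + homog f r2 + 2"
proof -
 define \<rho> where "\<rho> = (\<lambda>e. if e then r1 else r2)"
 have inj: "inj (ipow (\<rho> p))" for p using ne by (intro ipow_inj) (simp add: \<rho>_def)
 define F where "F = (\<lambda>p q x. cusp_mean f (\<rho> p) (\<rho> q) x + (if p = q then power_sign (\<rho> p) x else 0))"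
 define J0 :: "bool => int => 'a fg" where "J0 = (\<lambda>_ _. 0)"
 define \<xi>0 :: "bool => int => real" where "\<xi>0 = (\<lambda>_ _. 0)"
 interpret hnn "{0}" J0 \<xi>0 F
 proof
  fix p q s x y
  show "F q p (- x) = - F p q x"
   using cusp_mean_minus[OF f, of "\<rho> q" "\<rho> p" x] power_sign_minus[OF inj, of p x] by (auto simp: F_def)
  show "\<bar>F p q x + F q s y - F p s (x + y)\<bar> <= 1"
   unfolding F_def by (rule cusp_mean_sign_triangle[OF f inj])
 qed (auto simp: J0_def \<xi>0_def)
 obtain act where "hnn_action {0} J0 \<xi>0 F act"
  and act: "!!m. Valid m ==> opw act (word r) m = T False (R (id r2) (T True (R (id r1) m)))"
 proof (rule relator_action[OF dec, of id])
  show "id (u + v) = id u + id v" for u v :: "'a fg" by simp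
 qed (rule that)
 then interpret hnn_action "{0}" J0 \<xi>0 F act by simp
 define q where "q = homog f r1 + homog f r2 + 2"
 have rep: "rep e x = x" for e x using rep_in[of e x] by (simp add: J0_def)
 have J0: "J0 e k = 0" for e k by (simp add: J0_def)
 have \<xi>0: "\<xi>0 e k = 0" for e k by (simp add: \<xi>0_def)
 have F_diag: "F p p (\<rho> p) = homog f (\<rho> p) + 1" for p
  using cusp_mean_add_right[OF f, of "\<rho> p" "\<rho> p" 0] cusp_mean_0[OF f, of "\<rho> p"]
   power_sign_ipow[OF inj, of p 1] by (simp add: F_def)
 \<comment> \<open>Each letter \<open>t\<close> is pushed: popping would require the preceding
   syllable to be 0, but \<open>r1\<close> and \<open>r2\<close> are non-trivial.\<close>
 have ev_r: "\<exists>st. dir st \<and> valid st \<and> sval st = real n * q \<and> ev (npow r n) m0 = (st, 0, 0)" for n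
 proof (induction n)
  case 0
  show ?case by (intro exI[of _ "[]"]) (simp add: m0_def)
 next
  case (Suc n)
  then obtain st where st: "dir st" "valid st" "sval st = real n * q" "ev (npow r n) m0 = (st, 0, 0)" by blast
  have v: "Valid (st, 0, 0)" using st(2) by (simp add: Valid_def)
  have "ev (npow r (Suc n)) m0 = ev r (st, 0, 0)" by (simp add: ev_plus st(4))
  also have "\<dots> = T False (R r2 (T True (st, r1, 0)))" using act[OF v] by (simp add: ev_def)
  also have "T True (st, r1, 0) = ((r1, True) # st, 0, 0)" using ne by (simp add: rep J0 \<xi>0)
  also have "T False (R r2 \<dots>) = ((r2, False) # (r1, True) # st, 0, 0)" using ne by (simp add: rep J0 \<xi>0)
  finally have "ev (npow r (Suc n)) m0 = ((r2, False) # (r1, True) # st, 0, 0)" .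
  moreover have "sval ((r2, False) # (r1, True) # st) = real (Suc n) * q"
   using st(1,3) F_diag[of True] F_diag[of False] by (simp add: \<rho>_def q_def algebra_simps)
  moreover have "valid ((r2, False) # (r1, True) # st)"
   unfolding valid_Cons using st(1,2) ne by (auto simp: rep J0)
  ultimately show ?case by (intro exI[of _ "(r2, False) # (r1, True) # st"]) simp
 qed
 have quasi_npow: "quasi (npow r n) = real n * q" for n
 proof -
  obtain st where "dir st" "sval st = real n * q" "ev (npow r n) m0 = (st, 0, 0)" using ev_r by blast
  then show ?thesis by (simp add: quasi_def)
 qed
 define Q where "Q = (\<lambda>g. (quasi g - quasi (- g)) / 2)"
 have Q: "qm Q" unfolding Q_def by (rule quasi_le_qm(1)) (rule quasi_add)
 have "homog Q r = q"
 proof (rule homog_eqI[OF Q])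
  fix n show "\<bar>Q (npow r n) - real n * q\<bar> <= 1"
   using quasi_le_qm(2)[OF quasi_add, of "npow r n"] unfolding Q_def quasi_npow by linarith
 qed
 then show ?thesis using that Q by (simp add: q_def)
qed

text \<open>The supremum \<open>q\<close> is finite because a large value at \<open>r1\<close> and
  \<open>r2\<close> is transferred to \<open>r\<close> by \<open>decomposable_quasimorphism\<close>,
  and there the commutator length bounds it.\<close>

theorem clen_decomposable:
 assumes dec: "decomposable r r1 r2" and ne: "r1 ~= 0" "r2 ~= 0" and cp: "cprod k1 r1" "cprod k2 r2"
 obtains q where "!!f. qm f ==> homog f r1 + homog f r2 <= q"
  "!!\<epsilon>. \<epsilon> > 0 ==> \<exists>f. qm f \<and> homog f r1 + homog f r2 >= q - \<epsilon>"
  "(\<lambda>n. real (clen (npow r n)) / real n) \<longlonglongrightarrow> (q + 2) / 4"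
proof -
 obtain b where b: "r = r1 + b" "!!f. qm f ==> homog f b = homog f r2" "!!k. cprod k r2 ==> cprod k b"
  using homog_decomposable[OF dec] by metis
 define k0 where "k0 = k1 + k2"
 have k0: "cprod k0 r" unfolding k0_def b(1) by (intro cprod_add cp b)
 define H where "H = {homog f r1 + homog f r2 |f. qm f}"
 define q where "q = Sup H"
 have bound: "homog Q r <= 4 * real k0" if "qm Q" for Q
 proof (rule homog_leI[OF that, where C = 0])
  fix n show "Q (npow r n) <= real n * (4 * real k0) + 0"
   using qm_cprod[OF that cprod_npow[OF k0, of n]] by simp
 qed
 have bdd: "bdd_above H"
 proof (rule bdd_aboveI[of _ "4 * real k0"])
  fix x assume "x \<in> H"
  then obtain f where f: "qm f" "x = homog f r1 + homog f r2" by (auto simp: H_def)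
  obtain Q where "qm Q" "homog Q r = homog f r1 + homog f r2 + 2"
   using decomposable_quasimorphism[OF dec ne f(1)] .
  then show "x <= 4 * real k0" using bound[of Q] f by simp
 qed
 have ne: "H ~= {}"
 proof -
  have "qm (\<lambda>_ :: 'a fg. 0)" by (simp add: qm_def)
  then show ?thesis by (auto simp: H_def)
 qed
 have 1: "homog f r1 + homog f r2 <= q" if "qm f" for f
  unfolding q_def using that by (intro cSup_upper bdd) (auto simp: H_def)
 have 2: "\<exists>f. qm f \<and> homog f r1 + homog f r2 >= q - \<epsilon>" if "\<epsilon> > 0" for \<epsilon>
 proof -
  have "q - \<epsilon> < Sup H" using that by (simp add: q_def)
  then obtain x where "x \<in> H" "q - \<epsilon> < x" using ne bdd by (auto simp: less_cSup_iff)
  then show ?thesis by (force simp: H_def)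
 qed
 \<comment> \<open>The two estimates for \<open>homog f r\<close> have the same summand 2:
   \<open>homog_add_le\<close> from above and \<open>decomposable_quasimorphism\<close> from
   below.\<close>
 have "(\<lambda>n. real (clen (npow r n)) / real n) \<longlonglongrightarrow> (q + 2) / 4"
 proof (rule bavard_duality[OF k0])
  fix f :: "'a fg => real" assume f: "qm f"
  show "homog f r <= q + 2"
   using homog_add_le[OF f, of r1 b] 1[OF f] b(2)[OF f] by (simp add: b(1))
 next
  fix \<epsilon> :: real assume "\<epsilon> > 0"
  then obtain f where f: "qm f" "homog f r1 + homog f r2 >= q - \<epsilon>" using 2 by blast
  obtain Q where "qm Q" "homog Q r = homog f r1 + homog f r2 + 2"
   using decomposable_quasimorphism[OF dec assms(2,3) f(1)] .
  then show "\<exists>f. qm f \<and> homog f r >= q + 2 - \<epsilon>" using f(2) by force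
 qed
 then show ?thesis using that 1 2 by blast
qed

section \<open>Stable commutator length of decomposable relators\<close>

lemma carrier_free_group_iff: "u \<in> carrier (free_group S) \<longleftrightarrow> reduced_word u \<and> Fg u \<in> over S"
 by (cases "reduced_word u") (auto simp: free_group_def over_def)

lemma one_free_group: "\<one>\<^bsub>free_group S\<^esub> = []"
 by (simp add: free_group_def)

lemma Fg_mult: 
 assumes "u \<in> carrier (free_group S)" "v \<in> carrier (free_group S')"
 shows "Fg (u \<otimes>\<^bsub>free_group S''\<^esub> v) = Fg u + Fg v"
 using assms by (simp add: carrier_free_group_iff word_eq_iff word_plus free_group_def reduced_foldr_cancel_cons)

lemma Fg_inv:
 assumes "u \<in> carrier (free_group S)"
 shows "Fg (inv\<^bsub>free_group S\<^esub> u) = - Fg u"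
proof -
 interpret group "free_group S" by (rule group_free_group)
 have "Fg u + Fg (inv\<^bsub>free_group S\<^esub> u) = 0"
  using assms Fg_mult[of u S "inv\<^bsub>free_group S\<^esub> u" S S] by (simp add: one_free_group)
 then show ?thesis using minus_unique by metis
qed

lemma Fg_eqI: "u \<in> carrier (free_group S) ==> v \<in> carrier (free_group S) ==> Fg u = Fg v ==> u = v"
 by (metis carrier_free_group_iff word_Fg)

lemma word_in_carrier: "g \<in> over S ==> word g \<in> carrier (free_group S)"
 by (simp add: carrier_free_group_iff)

lemma Fg_pow: "u \<in> carrier (free_group S) ==> Fg (u [^]\<^bsub>free_group S\<^esub> n) = npow (Fg u) n"
proof (induction n)
 case 0
 then show ?case by (simp add: one_free_group)
next
 case (Suc n)
 interpret group "free_group S" by (rule group_free_group)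
 show ?case using Suc Fg_mult[of "u [^]\<^bsub>free_group S\<^esub> n" S u S S] by simp
qed

lemma Fg_derived_set:
 assumes "u \<in> derived_set (free_group S) (carrier (free_group S))"
 shows "u \<in> carrier (free_group S)" "\<exists>a b. Fg u = comm a b"
proof -
 interpret group "free_group S" by (rule group_free_group)
 obtain a b where u: "a \<in> carrier (free_group S)" "b \<in> carrier (free_group S)"
  "u = a \<otimes>\<^bsub>free_group S\<^esub> b \<otimes>\<^bsub>free_group S\<^esub> inv\<^bsub>free_group S\<^esub> a \<otimes>\<^bsub>free_group S\<^esub> inv\<^bsub>free_group S\<^esub> b"
  using assms by auto
 show "u \<in> carrier (free_group S)" using u by simp
 have "Fg u = Fg a + Fg b + - Fg a + - Fg b"
  using u by (simp add: Fg_mult[where S = S and S' = S] Fg_inv)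
 then show "\<exists>a b. Fg u = comm a b" by (auto simp: comm_def)
qed

lemma free_commutator_subgroup_cprod:
 assumes "u \<in> free_commutator_subgroup S"
 shows "u \<in> carrier (free_group S)" "\<exists>k. cprod k (Fg u)"
proof -
 interpret group "free_group S" by (rule group_free_group)
 let ?H = "derived_set (free_group S) (carrier (free_group S))"
 have H: "?H \<subseteq> carrier (free_group S)" using Fg_derived_set(1) by blast
 have "u \<in> generate (free_group S) ?H" using assms by (simp add: derived_def)
 then show "u \<in> carrier (free_group S)" using generate_incl[OF H] by blast
 show "\<exists>k. cprod k (Fg u)" using \<open>u \<in> generate (free_group S) ?H\<close>
 proof (induction rule: generate.induct)
  case one
  then show ?case by (intro exI[of _ 0]) (simp add: one_free_group)
 next
  case (incl h)
  then obtain a b where "Fg h = comm a b" using Fg_derived_set(2) by blast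
  then show ?case by (intro exI[of _ "Suc 0"]) (metis cprod_comm)
 next
  case (inv h)
  then obtain a b where "Fg h = comm a b" using Fg_derived_set(2) by blast
  then have "cprod (Suc 0) (- Fg h)" by (metis cprod_comm cprod_minus)
  moreover have "h \<in> carrier (free_group S)" using inv by (rule Fg_derived_set(1))
  ultimately show ?case by (intro exI[of _ "Suc 0"]) (simp only: Fg_inv)
 next
  case (eng h1 h2)
  then have "Fg (h1 \<otimes>\<^bsub>free_group S\<^esub> h2) = Fg h1 + Fg h2"
   using generate_incl[OF H] by (intro Fg_mult) (rule subsetD, assumption+)+
  moreover obtain k1 k2 where "cprod k1 (Fg h1)" "cprod k2 (Fg h2)" using eng.IH by (elim exE)
  ultimately show ?case using cprod_add[of k1 "Fg h1" k2 "Fg h2"] by (intro exI[of _ "k1 + k2"]) simp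
 qed
qed

text \<open>Products of commutators in the type may involve letters outside \<open>S\<close>. The
  retraction onto \<open>over S\<close> maps them to products of equally many commutators over
  \<open>S\<close> and fixes \<open>u\<close>.\<close>

lemma cl_eq_clen:
 assumes "u \<in> carrier (free_group S)"
 shows "cl S u = clen (Fg u)"
proof -
 interpret group "free_group S" by (rule group_free_group)
 let ?H = "derived_set (free_group S) (carrier (free_group S))"
 have prod_carrier: "foldr (\<otimes>\<^bsub>free_group S\<^esub>) cs \<one>\<^bsub>free_group S\<^esub> \<in> carrier (free_group S)" if "set cs \<subseteq> ?H" for cs
  using that
 proof (induction cs)
  case (Cons c cs)
  then have "c \<in> carrier (free_group S)" using Fg_derived_set(1) by auto
  then show ?case using Cons by (simp del: UN_iff)
 qed simp
 have 1: "cprod (length cs) (Fg (foldr (\<otimes>\<^bsub>free_group S\<^esub>) cs \<one>\<^bsub>free_group S\<^esub>))" if "set cs \<subseteq> ?H" for cs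
  using that
 proof (induction cs)
  case Nil
  then show ?case by (simp add: one_free_group)
 next
  case (Cons c cs)
  then have c: "c \<in> ?H" "set cs \<subseteq> ?H" by (simp_all del: UN_iff)
  then obtain a b where "Fg c = comm a b" using Fg_derived_set(2) by blast
  moreover have "Fg (foldr (\<otimes>\<^bsub>free_group S\<^esub>) (c # cs) \<one>\<^bsub>free_group S\<^esub>) =
    Fg c + Fg (foldr (\<otimes>\<^bsub>free_group S\<^esub>) cs \<one>\<^bsub>free_group S\<^esub>)"
   using Fg_mult[OF Fg_derived_set(1)[OF c(1)] prod_carrier[OF c(2)], of S] by simp
  ultimately show ?case using Cons.IH[OF c(2)] by auto
 qed
 have 2: "\<exists>cs. length cs = n \<and> set cs \<subseteq> ?H \<and>
   retract S g = Fg (foldr (\<otimes>\<^bsub>free_group S\<^esub>) cs \<one>\<^bsub>free_group S\<^esub>)" if "cprod n g" for n g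
  using that
 proof (induction n arbitrary: g)
  case 0
  then show ?case by (simp add: one_free_group)
 next
  case (Suc n)
  then obtain a b h where g: "g = comm a b + h" "cprod n h" by auto
  obtain cs where cs: "length cs = n" "set cs \<subseteq> ?H" "retract S h = Fg (foldr (\<otimes>\<^bsub>free_group S\<^esub>) cs \<one>\<^bsub>free_group S\<^esub>)"
   using Suc.IH[OF g(2)] by blast
  define x y where "x = word (retract S a)" and "y = word (retract S b)"
  have xy: "x \<in> carrier (free_group S)" "y \<in> carrier (free_group S)"
   by (simp_all add: x_def y_def word_in_carrier retract_in_over)
  define c where "c = x \<otimes>\<^bsub>free_group S\<^esub> y \<otimes>\<^bsub>free_group S\<^esub> inv\<^bsub>free_group S\<^esub> x \<otimes>\<^bsub>free_group S\<^esub> inv\<^bsub>free_group S\<^esub> y"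
  have c: "c \<in> ?H" unfolding c_def using xy by blast
  have "Fg c = Fg x + Fg y + - Fg x + - Fg y"
   unfolding c_def using xy by (simp add: Fg_mult[where S = S and S' = S] Fg_inv)
  also have "\<dots> = retract S (comm a b)"
   by (simp add: x_def y_def comm_def retract_plus retract_minus diff_conv_add_uminus del: add_uminus_conv_diff)
  finally have "Fg c = retract S (comm a b)" .
  then have "retract S g = Fg (foldr (\<otimes>\<^bsub>free_group S\<^esub>) (c # cs) \<one>\<^bsub>free_group S\<^esub>)"
   using Fg_mult[OF Fg_derived_set(1)[OF c] prod_carrier[OF cs(2)], of S] cs(3)
   by (simp add: g retract_plus)
  moreover have "set (c # cs) \<subseteq> ?H" using c cs(2) by (simp del: UN_iff)
  ultimately show ?case using cs(1) by (intro exI[of _ "c # cs"]) (simp del: UN_iff)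
 qed
 have "(\<exists>cs. length cs = n \<and> set cs \<subseteq> ?H \<and> u = foldr (\<otimes>\<^bsub>free_group S\<^esub>) cs \<one>\<^bsub>free_group S\<^esub>) \<longleftrightarrow> cprod n (Fg u)" for n
 proof
  assume "\<exists>cs. length cs = n \<and> set cs \<subseteq> ?H \<and> u = foldr (\<otimes>\<^bsub>free_group S\<^esub>) cs \<one>\<^bsub>free_group S\<^esub>"
  then show "cprod n (Fg u)" using 1 by blast
 next
  assume u: "cprod n (Fg u)"
  obtain cs where cs: "length cs = n" "set cs \<subseteq> ?H" "retract S (Fg u) = Fg (foldr (\<otimes>\<^bsub>free_group S\<^esub>) cs \<one>\<^bsub>free_group S\<^esub>)"
   using 2[OF u] by (elim exE conjE)
  have "retract S (Fg u) = Fg u" using assms by (simp add: carrier_free_group_iff retract_over)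
  then have "u = foldr (\<otimes>\<^bsub>free_group S\<^esub>) cs \<one>\<^bsub>free_group S\<^esub>"
   using cs(3) Fg_eqI[OF assms prod_carrier[OF cs(2)]] by simp
  then show "\<exists>cs. length cs = n \<and> set cs \<subseteq> ?H \<and> u = foldr (\<otimes>\<^bsub>free_group S\<^esub>) cs \<one>\<^bsub>free_group S\<^esub>"
   using cs(1,2) by (intro exI[of _ cs] conjI)
 qed
 then show ?thesis unfolding cl_def clen_def by simp
qed

lemma scl_eqI:
 assumes "u \<in> carrier (free_group S)" "(\<lambda>n. real (clen (npow (Fg u) n)) / real n) \<longlonglongrightarrow> l"
 shows "scl S u = l"
proof -
 interpret group "free_group S" by (rule group_free_group)
 have "cl S (u [^]\<^bsub>free_group S\<^esub> n) = clen (npow (Fg u) n)" for n :: nat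
  using cl_eq_clen[of "u [^]\<^bsub>free_group S\<^esub> n" S] assms(1) by (simp add: Fg_pow)
 then show ?thesis unfolding scl_def using assms(2) by (simp add: limI)
qed

lemma bar_boundary_diff: "bar_boundary (c - d) = bar_boundary c - bar_boundary d"
 by (simp add: bar_boundary_def frag_extend_diff)

text \<open>The interface to the topological part: both forms of the relator are reduced to a
  product \<open>a + b\<close>, and all that is kept of quasimorphisms and fillings is expressed
  through the number \<open>q\<close>.\<close>

theorem decomposable_relator:
 assumes "r \<in> free_commutator_subgroup S"
  and "(\<exists>S1 S2 r1 r2.
      S = S1 \<union> S2 \<and> S1 \<inter> S2 = {} \<and>
      r1 \<in> free_commutator_subgroup S1 \<and> r1 ~= \<one>\<^bsub>free_group S1\<^esub> \<and>
      r2 \<in> free_commutator_subgroup S2 \<and> r2 ~= \<one>\<^bsub>free_group S2\<^esub> \<and>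
      r = r1 \<otimes>\<^bsub>free_group S\<^esub> r2)
    \<or> (\<exists>S' t r1 r2.
      S = S' \<union> {t} \<and> t \<notin> S' \<and>
      r1 \<in> free_commutator_subgroup S' \<and> r1 ~= \<one>\<^bsub>free_group S'\<^esub> \<and>
      r2 \<in> free_commutator_subgroup S' \<and> r2 ~= \<one>\<^bsub>free_group S'\<^esub> \<and>
      r = r1 \<otimes>\<^bsub>free_group S\<^esub> [(t, True)] \<otimes>\<^bsub>free_group S\<^esub> r2
         \<otimes>\<^bsub>free_group S\<^esub> inv\<^bsub>free_group S\<^esub> [(t, True)])"
 obtains a b k q where "a \<in> over S" "b \<in> over S" "Fg r = a + b" "cprod k (Fg r)"
  "scl S r = (q + 2) / 4"
  "!!\<epsilon>. \<epsilon> > 0 ==> \<exists>Q. qm Q \<and> (\<forall>g h. Q (g + (h + Fg r - h)) = Q g + Q (Fg r)) \<and> Q (Fg r) >= q - \<epsilon>"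
  "!!n. fill_bound (frag_of (npow a n) + frag_of (npow b n)) (real n * q + 5)"
proof -
 have r: "r \<in> carrier (free_group S)" "Fg r \<in> over S"
  using free_commutator_subgroup_cprod(1)[OF assms(1)] by (auto simp: carrier_free_group_iff)
 obtain k where k: "cprod k (Fg r)" using free_commutator_subgroup_cprod(2)[OF assms(1)] by blast
 have nz: "Fg u ~= 0" if "u \<in> free_commutator_subgroup T" "u ~= \<one>\<^bsub>free_group T\<^esub>" for u and T :: "'a set"
  using free_commutator_subgroup_cprod(1)[OF that(1)] that(2)
  by (metis carrier_free_group_iff one_free_group word_Fg word_zero)
 have "\<exists>r1 r2 k1 k2. decomposable (Fg r) r1 r2 \<and> r1 ~= 0 \<and> r2 ~= 0 \<and> cprod k1 r1 \<and> cprod k2 r2 \<and> r1 \<in> over S"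
  using assms(2)
 proof (elim disjE exE conjE)
  fix S1 S2 r1 r2
  assume S: "S = S1 \<union> S2" "S1 \<inter> S2 = {}"
   and 1: "r1 \<in> free_commutator_subgroup S1" "r1 ~= \<one>\<^bsub>free_group S1\<^esub>"
   and 2: "r2 \<in> free_commutator_subgroup S2" "r2 ~= \<one>\<^bsub>free_group S2\<^esub>"
   and eq: "r = r1 \<otimes>\<^bsub>free_group S\<^esub> r2"
  note c1 = free_commutator_subgroup_cprod[OF 1(1)] and c2 = free_commutator_subgroup_cprod[OF 2(1)]
  have o: "Fg r1 \<in> over S1" "Fg r2 \<in> over S2" using c1(1) c2(1) by (auto simp: carrier_free_group_iff)
  then have "decomposable (Fg r) (Fg r1) (Fg r2)"
   unfolding decomposable_def using S(2) Fg_mult[OF c1(1) c2(1), of S] by (auto simp: eq)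
  moreover have "Fg r1 \<in> over S" using o(1) over_mono[of S1 S] S(1) by blast
  ultimately show ?thesis using c1(2) c2(2) nz[OF 1] nz[OF 2] by blast
 next
  fix S' t r1 r2
  assume S: "S = S' \<union> {t}" "t \<notin> S'"
   and 1: "r1 \<in> free_commutator_subgroup S'" "r1 ~= \<one>\<^bsub>free_group S'\<^esub>"
   and 2: "r2 \<in> free_commutator_subgroup S'" "r2 ~= \<one>\<^bsub>free_group S'\<^esub>"
   and eq: "r = r1 \<otimes>\<^bsub>free_group S\<^esub> [(t, True)] \<otimes>\<^bsub>free_group S\<^esub> r2 \<otimes>\<^bsub>free_group S\<^esub> inv\<^bsub>free_group S\<^esub> [(t, True)]"
  interpret group "free_group S" by (rule group_free_group)
  note c1 = free_commutator_subgroup_cprod[OF 1(1)] and c2 = free_commutator_subgroup_cprod[OF 2(1)]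
  have o: "Fg r1 \<in> over S'" "Fg r2 \<in> over S'" using c1(1) c2(1) by (auto simp: carrier_free_group_iff)
  have oS: "Fg r1 \<in> over S" "Fg r2 \<in> over S" using o over_mono[of S' S] S(1) by auto
  have c: "r1 \<in> carrier (free_group S)" "r2 \<in> carrier (free_group S)" "[(t, True)] \<in> carrier (free_group S)"
   using c1(1) c2(1) oS S(1) by (auto simp: carrier_free_group_iff over_def)
  have "Fg r = Fg r1 + letter (t, True) + Fg r2 - letter (t, True)"
   using c by (simp add: eq Fg_mult[where S = S and S' = S] Fg_inv)
  then have "decomposable (Fg r) (Fg r1) (Fg r2)"
   unfolding decomposable_def using S(2) o by blast
  then show ?thesis using c1(2) c2(2) nz[OF 1] nz[OF 2] oS by blast
 qed
 then obtain a r2 k1 k2 where dec: "decomposable (Fg r) a r2" "a ~= 0" "r2 ~= 0" "cprod k1 a" "cprod k2 r2"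
  and a: "a \<in> over S" by blast
 obtain q where q: "!!f. qm f ==> homog f a + homog f r2 <= q"
  "!!\<epsilon>. \<epsilon> > 0 ==> \<exists>f. qm f \<and> homog f a + homog f r2 >= q - \<epsilon>"
  "(\<lambda>n. real (clen (npow (Fg r) n)) / real n) \<longlonglongrightarrow> (q + 2) / 4"
 proof (rule clen_decomposable[OF dec])
  fix q
  assume "!!f. qm f ==> homog f a + homog f r2 <= q"
   "!!\<epsilon>. \<epsilon> > 0 ==> \<exists>f. qm f \<and> homog f a + homog f r2 >= q - \<epsilon>"
   "(\<lambda>n. real (clen (npow (Fg r) n)) / real n) \<longlonglongrightarrow> (q + 2) / 4"
  then show thesis by (rule that)
 qed
 obtain b where b: "Fg r = a + b" "!!f. qm f ==> homog f b = homog f r2" "!!k. cprod k r2 ==> cprod k b"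
 proof (rule homog_decomposable[OF dec(1)])
  fix b
  assume "Fg r = a + b" "!!f. qm f ==> homog f b = homog f r2" "!!k. cprod k r2 ==> cprod k b"
  then show thesis by (rule that)
 qed
 have "b = - a + Fg r" unfolding b(1) by (simp add: add.assoc[symmetric])
 then have bS: "b \<in> over S" using over_plus[OF over_minus[OF a] r(2)] by simp
 show ?thesis
 proof (rule that[OF a bS b(1) k scl_eqI[OF r(1) q(3)]])
  fix \<epsilon> :: real assume "\<epsilon> > 0"
  then obtain f where f: "qm f" "homog f a + homog f r2 >= q - \<epsilon>" using q(2) by blast
  obtain Q where "qm Q" "!!g h. Q (g + (h + Fg r - h)) = Q g + Q (Fg r)" "Q (Fg r) = homog f a + homog f r2"
  proof (rule equivariant_quasimorphism[OF dec(1-3) f(1)])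
   fix Q
   assume "qm Q" "!!g h. Q (g + (h + Fg r - h)) = Q g + Q (Fg r)" "Q (Fg r) = homog f a + homog f r2"
   then show thesis by (rule that)
  qed
  then show "\<exists>Q. qm Q \<and> (\<forall>g h. Q (g + (h + Fg r - h)) = Q g + Q (Fg r)) \<and> Q (Fg r) >= q - \<epsilon>"
   using f(2) by (intro exI[of _ Q]) simp
 next
  fix n
  have "null_chain (frag_of (npow a n) + frag_of (npow b n))"
   by (rule null_chain_add[OF null_chain_cprod[OF cprod_npow[OF dec(4)]]
      null_chain_cprod[OF cprod_npow[OF b(3)[OF dec(5)]]]])
  then obtain s where "fill_bound (frag_of (npow a n) + frag_of (npow b n)) s"
   by (rule null_chain_imp_fill_bound)
  then show "fill_bound (frag_of (npow a n) + frag_of (npow b n)) (real n * q + 5)"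
   by (rule fill_npow_npow) (use q(1) b(2) in simp)
 qed
qed

section \<open>Locally trivial cocycles\<close>

text \<open>
 A local cocycle \<open>\<gamma>\<close> with values in a group encodes a covering space: \<open>\<gamma> x y\<close> is the holonomy
 of any short path from \<open>x\<close> to \<open>y\<close>. It has no meaning if \<open>x\<close> and \<open>y\<close> are far apart. A development
 of a map \<open>u\<close> is a lift of \<open>u\<close> to that covering.
\<close>

definition strict :: "('x => 'x => 'h::group_add) => 'x set => bool" where
 "strict \<gamma> W \<longleftrightarrow> (\<forall>x\<in>W. \<forall>y\<in>W. \<forall>z\<in>W. \<gamma> x y + \<gamma> y z = \<gamma> x z)"

lemma strictD: "strict \<gamma> W ==> x \<in> W ==> y \<in> W ==> z \<in> W ==> \<gamma> x y + \<gamma> y z = \<gamma> x z"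
 by (auto simp: strict_def)

lemma strict_refl: 
 assumes "strict \<gamma> W" "x \<in> W"
 shows "\<gamma> x x = 0"
proof -
 have "- \<gamma> x x + (\<gamma> x x + \<gamma> x x) = - \<gamma> x x + \<gamma> x x"
  using strictD[OF assms assms(2) assms(2)] by simp
 then show ?thesis by simp
qed

lemma strict_minus: "strict \<gamma> W ==> x \<in> W ==> y \<in> W ==> - \<gamma> x y = \<gamma> y x"
 using strictD[of \<gamma> W x y x] strict_refl[of \<gamma> W x] by (intro minus_unique) simp

definition subgroup_set :: "'h::group_add set => bool" where
 "subgroup_set R \<longleftrightarrow> 0 \<in> R \<and> (\<forall>x\<in>R. \<forall>y\<in>R. x + y \<in> R) \<and> (\<forall>x\<in>R. - x \<in> R)"

lemma subgroup_setD: 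
 assumes "subgroup_set R"
 shows "0 \<in> R" "x \<in> R ==> y \<in> R ==> x + y \<in> R" "x \<in> R ==> - x \<in> R" "x \<in> R ==> y \<in> R ==> x - y \<in> R"
proof -
 show 1: "0 \<in> R" "x \<in> R ==> y \<in> R ==> x + y \<in> R" "x \<in> R ==> - x \<in> R" for x y
  using assms by (auto simp: subgroup_set_def)
 show "x \<in> R ==> y \<in> R ==> x - y \<in> R"
  using 1(2)[of x "- y"] 1(3)[of y] by simp
qed

text \<open>The values are confined to a subgroup because the structure group used later is a
  quotient group, which is realized as a subgroup of a permutation group.\<close>

locale holonomy =
 fixes R :: "'h::group_add set"
 assumes R: "subgroup_set R"
begin

definition local_cocycle :: "'x topology => ('x => 'x => 'h) => bool" where
 "local_cocycle Y \<gamma> \<longleftrightarrow> (\<forall>x y. \<gamma> x y \<in> R) \<and> (\<forall>p\<in>topspace Y. \<exists>W. openin Y W \<and> p \<in> W \<and> strict \<gamma> W)"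

definition development :: "'z topology => ('z => 'x) => ('x => 'x => 'h) => ('z => 'h) => bool" where
 "development Z u \<gamma> \<kappa> \<longleftrightarrow> (\<forall>z\<in>topspace Z. \<kappa> z \<in> R) \<and>
   (\<forall>z\<in>topspace Z. \<exists>V. openin Z V \<and> z \<in> V \<and> (\<forall>x\<in>V. \<forall>y\<in>V. \<gamma> (u x) (u y) = - \<kappa> x + \<kappa> y))"

lemma local_cocycleE:
 assumes "local_cocycle Y \<gamma>" "p \<in> topspace Y"
 obtains W where "openin Y W" "p \<in> W" "strict \<gamma> W"
proof -
 have "\<exists>W. openin Y W \<and> p \<in> W \<and> strict \<gamma> W" using assms by (simp add: local_cocycle_def)
 then show ?thesis using that by blast
qed

lemma developmentE:
 assumes "development Z u \<gamma> \<kappa>" "z \<in> topspace Z"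
 obtains V where "openin Z V" "z \<in> V" "!!x y. x \<in> V ==> y \<in> V ==> \<gamma> (u x) (u y) = - \<kappa> x + \<kappa> y"
proof -
 have "\<exists>V. openin Z V \<and> z \<in> V \<and> (\<forall>x\<in>V. \<forall>y\<in>V. \<gamma> (u x) (u y) = - \<kappa> x + \<kappa> y)"
  using assms by (simp add: development_def)
 then show ?thesis using that by (elim exE conjE) (rule that, assumption+, simp)
qed

lemma development_cong:
 assumes "development Z u \<gamma> \<kappa>" 
  "!!z. z \<in> topspace Z ==> u' z = u z" "!!z. z \<in> topspace Z ==> \<kappa>' z = \<kappa> z"
  "!!x y. x \<in> u ` topspace Z ==> y \<in> u ` topspace Z ==> \<gamma>' x y = \<gamma> x y"
 shows "development Z u' \<gamma>' \<kappa>'"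
 unfolding development_def
proof (intro conjI ballI)
 fix z assume z: "z \<in> topspace Z"
 then show "\<kappa>' z \<in> R" using assms by (simp add: development_def)
 obtain V where V: "openin Z V" "z \<in> V" "!!x y. x \<in> V ==> y \<in> V ==> \<gamma> (u x) (u y) = - \<kappa> x + \<kappa> y"
  using developmentE[OF assms(1) z] by metis
 have "V \<subseteq> topspace Z" using V(1) by (rule openin_subset)
 have "\<gamma>' (u' x) (u' y) = - \<kappa>' x + \<kappa>' y" if "x \<in> V" "y \<in> V" for x y
 proof -
  have "x \<in> topspace Z" "y \<in> topspace Z" using that \<open>V \<subseteq> topspace Z\<close> by auto
  then show ?thesis
   using V(3)[OF that] assms(2,3)[of x] assms(2,3)[of y] assms(4)[of "u x" "u y"] by simp
 qed
 then show "\<exists>V. openin Z V \<and> z \<in> V \<and> (\<forall>x\<in>V. \<forall>y\<in>V. \<gamma>' (u' x) (u' y) = - \<kappa>' x + \<kappa>' y)"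
  using V by blast
qed

lemma development_compose:
 assumes "development Z u \<gamma> \<kappa>" "continuous_map Z' Z f"
 shows "development Z' (u \<circ> f) \<gamma> (\<kappa> \<circ> f)"
 unfolding development_def
proof (intro conjI ballI)
 fix z assume z: "z \<in> topspace Z'"
 then have fz: "f z \<in> topspace Z" using assms(2) by (auto simp: continuous_map_def)
 then show "(\<kappa> \<circ> f) z \<in> R" using assms(1) by (simp add: development_def)
 obtain V where V: "openin Z V" "f z \<in> V" "!!x y. x \<in> V ==> y \<in> V ==> \<gamma> (u x) (u y) = - \<kappa> x + \<kappa> y"
  using developmentE[OF assms(1) fz] by metis
 have "openin Z' {x \<in> topspace Z'. f x \<in> V}" using assms(2) V(1) by (rule openin_continuous_map_preimage)
 then show "\<exists>V. openin Z' V \<and> z \<in> V \<and> (\<forall>x\<in>V. \<forall>y\<in>V. \<gamma> ((u \<circ> f) x) ((u \<circ> f) y) = - (\<kappa> \<circ> f) x + (\<kappa> \<circ> f) y)"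
  using z V(2,3) by (intro exI[of _ "{x \<in> topspace Z'. f x \<in> V}"]) auto
qed

lemma development_translate:
 assumes "development Z u \<gamma> \<kappa>" "c \<in> R"
 shows "development Z u \<gamma> (\<lambda>z. c + \<kappa> z)"
proof -
 have "- (c + x) + (c + y) = - x + y" for x y
  by (simp add: group_add_simps del: add_uminus_conv_diff)
 then show ?thesis using assms subgroup_setD(2)[OF R] unfolding development_def by simp
qed

text \<open>Two lifts of the same map differ by a left translation that is locally constant, hence
  constant on a connected space.\<close>

lemma development_unique:
 assumes "development Z u \<gamma> \<kappa>" "development Z u \<gamma> \<kappa>'" "connected_space Z"
  "x \<in> topspace Z" "y \<in> topspace Z"
 shows "- \<kappa> x + \<kappa> y = - \<kappa>' x + \<kappa>' y"
proof -
 define c where "c = (\<lambda>z. \<kappa>' z - \<kappa> z)"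
 have loc: "\<exists>V. openin Z V \<and> z \<in> V \<and> (\<forall>w\<in>V. c w = c z)" if z: "z \<in> topspace Z" for z
 proof -
  obtain V where V: "openin Z V" "z \<in> V" "!!x y. x \<in> V ==> y \<in> V ==> \<gamma> (u x) (u y) = - \<kappa> x + \<kappa> y"
   using developmentE[OF assms(1) z] by metis
  obtain V' where V': "openin Z V'" "z \<in> V'" "!!x y. x \<in> V' ==> y \<in> V' ==> \<gamma> (u x) (u y) = - \<kappa>' x + \<kappa>' y"
   using developmentE[OF assms(2) z] by metis
  have "c w = c z" if "w \<in> V \<inter> V'" for w
  proof -
   have e: "- \<kappa> z + \<kappa> w = - \<kappa>' z + \<kappa>' w" using V(3)[of z w] V'(3)[of z w] V(2) V'(2) that by simp
   have "c w = \<kappa>' z + (- \<kappa>' z + \<kappa>' w) - \<kappa> w" by (simp add: c_def add.assoc[symmetric])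
   also have "\<dots> = c z" unfolding e[symmetric] by (simp add: c_def group_add_simps del: add_uminus_conv_diff)
   finally show ?thesis .
  qed
  moreover have "openin Z (V \<inter> V')" "z \<in> V \<inter> V'" using V V' by auto
  ultimately show ?thesis by blast
 qed
 have op: "openin Z {z \<in> topspace Z. c z \<in> A}" for A
 proof (subst openin_subopen, intro ballI)
  fix z assume z: "z \<in> {z \<in> topspace Z. c z \<in> A}"
  then obtain V where V: "openin Z V" "z \<in> V" "!!w. w \<in> V ==> c w = c z" using loc[of z] by blast
  have "V \<subseteq> {z \<in> topspace Z. c z \<in> A}"
  proof
   fix w assume w: "w \<in> V"
   then have "w \<in> topspace Z" using openin_subset[OF V(1)] by blast
   then show "w \<in> {z \<in> topspace Z. c z \<in> A}" using z V(3)[OF w] by simp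
  qed
  then show "\<exists>T. openin Z T \<and> z \<in> T \<and> T \<subseteq> {z \<in> topspace Z. c z \<in> A}"
   using V(1,2) by (intro exI[of _ V] conjI)
 qed
 have "openin Z {z \<in> topspace Z. c z = c x}" "openin Z {z \<in> topspace Z. c z ~= c x}"
  using op[of "{c x}"] op[of "- {c x}"] by simp_all
 moreover have "{z \<in> topspace Z. c z = c x} \<inter> {z \<in> topspace Z. c z ~= c x} = {}" by auto
 moreover have "topspace Z \<subseteq> {z \<in> topspace Z. c z = c x} \<union> {z \<in> topspace Z. c z ~= c x}" by auto
 ultimately have "{z \<in> topspace Z. c z ~= c x} = {}"
  using assms(3,4) unfolding connected_space_def by blast
 then have "c y = c x" using assms(5) by auto
 then have "\<kappa>' x - \<kappa> x = \<kappa>' y - \<kappa> y" by (simp add: c_def)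
 then have "- \<kappa>' x + (\<kappa>' x - \<kappa> x) + \<kappa> y = - \<kappa>' x + (\<kappa>' y - \<kappa> y) + \<kappa> y" by simp
 then show ?thesis by (simp add: group_add_simps del: add_uminus_conv_diff)
qed

text \<open>Developments are glued along maps \<open>f i\<close> for which \<open>Z\<close> has the
  final topology, such as a quotient map or the inclusions of a closed cover. Whether \<kappa> and
  \<gamma> agree near \<open>p\<close> is an openness statement, and openness can be tested on the
  pieces.\<close>

lemma development_final:
 assumes \<gamma>: "local_cocycle Y \<gamma>" and u: "continuous_map Z Y u"
  and final: "!!V. V \<subseteq> topspace Z ==> (!!i. i \<in> I ==> openin (Z' i) {z \<in> topspace (Z' i). f i z \<in> V}) ==> openin Z V"
  and f: "!!i. i \<in> I ==> continuous_map (Z' i) Z (f i)"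
  and dev: "!!i. i \<in> I ==> development (Z' i) (u \<circ> f i) \<gamma> (\<kappa> \<circ> f i)"
  and \<kappa>: "!!z. z \<in> topspace Z ==> \<kappa> z \<in> R"
 shows "development Z u \<gamma> \<kappa>"
 unfolding development_def
proof (intro conjI ballI)
 fix p assume p: "p \<in> topspace Z"
 show "\<kappa> p \<in> R" using \<kappa>[OF p] .
 have "u p \<in> topspace Y" using u p by (auto simp: continuous_map_def)
 then obtain W where W: "openin Y W" "u p \<in> W" "strict \<gamma> W" by (rule local_cocycleE[OF \<gamma>])
 define V where "V = {z \<in> topspace Z. u z \<in> W \<and> \<gamma> (u p) (u z) = - \<kappa> p + \<kappa> z}"
 have "openin Z V"
 proof (rule final)
  show "V \<subseteq> topspace Z" by (auto simp: V_def)
 next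
  fix i assume i: "i \<in> I"
  show "openin (Z' i) {z \<in> topspace (Z' i). f i z \<in> V}"
  proof (subst openin_subopen, intro ballI)
   fix z assume z: "z \<in> {z \<in> topspace (Z' i). f i z \<in> V}"
   then obtain V' where V': "openin (Z' i) V'" "z \<in> V'"
    "!!x y. x \<in> V' ==> y \<in> V' ==> \<gamma> ((u \<circ> f i) x) ((u \<circ> f i) y) = - (\<kappa> \<circ> f i) x + (\<kappa> \<circ> f i) y"
    using developmentE[OF dev[OF i], of z] by auto
   define V'' where "V'' = V' \<inter> {z \<in> topspace (Z' i). u (f i z) \<in> W}"
   have "continuous_map (Z' i) Y (u \<circ> f i)" using f[OF i] u by (rule continuous_map_compose)
   then have "openin (Z' i) V''" unfolding V''_def
    using V'(1) openin_continuous_map_preimage[OF _ W(1), of "Z' i" "u \<circ> f i"] by auto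
   moreover have "z \<in> V''" using z V'(2) by (auto simp: V''_def V_def)
   moreover have "V'' \<subseteq> {z \<in> topspace (Z' i). f i z \<in> V}"
   proof
    fix y assume y: "y \<in> V''"
    have "\<gamma> (u p) (u (f i y)) = \<gamma> (u p) (u (f i z)) + \<gamma> (u (f i z)) (u (f i y))"
     using y z W(2) by (intro strictD[OF W(3), symmetric]) (auto simp: V''_def V_def)
    also have "\<gamma> (u p) (u (f i z)) = - \<kappa> p + \<kappa> (f i z)" using z by (auto simp: V_def)
    also have "\<gamma> (u (f i z)) (u (f i y)) = - \<kappa> (f i z) + \<kappa> (f i y)"
     using V'(3)[of z y] V'(2) y by (simp add: V''_def)
    also have "- \<kappa> p + \<kappa> (f i z) + (- \<kappa> (f i z) + \<kappa> (f i y)) = - \<kappa> p + \<kappa> (f i y)"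
     by (simp add: group_add_simps del: add_uminus_conv_diff)
    finally show "y \<in> {z \<in> topspace (Z' i). f i z \<in> V}"
     using y f[OF i] by (auto simp: V_def V''_def continuous_map_def)
   qed
   ultimately show "\<exists>T. openin (Z' i) T \<and> z \<in> T \<and> T \<subseteq> {z \<in> topspace (Z' i). f i z \<in> V}" by blast
  qed
 qed
 moreover have "p \<in> V" using p W(2) strict_refl[OF W(3,2)] by (simp add: V_def)
 moreover have "\<gamma> (u x) (u y) = - \<kappa> x + \<kappa> y" if "x \<in> V" "y \<in> V" for x y
 proof -
  have "\<gamma> (u x) (u y) = \<gamma> (u x) (u p) + \<gamma> (u p) (u y)"
   using that W(2) by (intro strictD[OF W(3), symmetric]) (auto simp: V_def)
  also have "\<gamma> (u x) (u p) = - \<gamma> (u p) (u x)"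
   using that W(2) by (intro strict_minus[OF W(3), symmetric]) (auto simp: V_def)
  also have "- \<gamma> (u p) (u x) + \<gamma> (u p) (u y) = - (- \<kappa> p + \<kappa> x) + (- \<kappa> p + \<kappa> y)"
   using that by (simp add: V_def)
  also have "\<dots> = - \<kappa> x + \<kappa> y" by (simp add: group_add_simps del: add_uminus_conv_diff)
  finally show ?thesis .
 qed
 ultimately show "\<exists>V. openin Z V \<and> p \<in> V \<and> (\<forall>x\<in>V. \<forall>y\<in>V. \<gamma> (u x) (u y) = - \<kappa> x + \<kappa> y)"
  by (intro exI[of _ V]) simp
qed

subsection \<open>Homotopy lifting\<close>

definition good :: "('x => 'x => 'h) => (real \<times> 'z => 'x) => nat => 'z set => bool" where
 "good \<gamma> h N V \<longleftrightarrow> N > 0 \<and> (\<forall>i<N. \<exists>W. strict \<gamma> W \<and>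
   (\<forall>t z. real i / real N <= t --> t <= real (Suc i) / real N --> z \<in> V --> h (t, z) \<in> W))"

primrec transport :: "('x => 'x => 'h) => (real \<times> 'z => 'x) => nat => nat => 'z => 'h" where
 "transport \<gamma> h N 0 z = 0"
| "transport \<gamma> h N (Suc i) z = transport \<gamma> h N i z + \<gamma> (h (real i / real N, z)) (h (real (Suc i) / real N, z))"

lemma good_exists:
 fixes h :: "real \<times> 'z => 'x"
 assumes \<gamma>: "local_cocycle Y \<gamma>"
  and h: "continuous_map (prod_topology (top_of_set {0..1}) Z) Y h" and z: "z \<in> topspace Z"
 obtains N V where "openin Z V" "z \<in> V" "good \<gamma> h N V"
proof -
 define P where "P = (\<lambda>t e V W. e > 0 \<and> openin Z V \<and> z \<in> V \<and> strict \<gamma> W \<and>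
   (\<forall>s\<in>ball t e \<inter> {0..1}. \<forall>y\<in>V. h (s, y) \<in> W))"
 have "\<exists>e V W. P t e V W" if t: "t \<in> {0..1}" for t
 proof -
  have "h (t, z) \<in> topspace Y" using h t z by (auto simp: continuous_map_def)
  then obtain W where W: "openin Y W" "h (t, z) \<in> W" "strict \<gamma> W" by (rule local_cocycleE[OF \<gamma>])
  have op: "openin (prod_topology (top_of_set {0..1}) Z) {x \<in> topspace (prod_topology (top_of_set {0..1}) Z). h x \<in> W}"
   using h W(1) by (rule openin_continuous_map_preimage)
  have tz: "(t, z) \<in> {x \<in> topspace (prod_topology (top_of_set {0..1}) Z). h x \<in> W}" using W(2) t z by simp
  obtain A V where A: "openin (top_of_set {0..1}) A" "openin Z V" "t \<in> A" "z \<in> V"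
   and AV: "A \<times> V \<subseteq> {x \<in> topspace (prod_topology (top_of_set {0..1}) Z). h x \<in> W}"
   using op[unfolded openin_prod_topology_alt, rule_format, OF tz] by blast
  obtain e where "e > 0" "ball t e \<inter> {0..1} \<subseteq> A"
   using A(1,3) unfolding openin_contains_ball by blast
  then show ?thesis using A(2,4) AV W(3) unfolding P_def by (intro exI[of _ e] exI[of _ V] exI[of _ W]) blast
 qed
 then obtain e V W where P: "!!t. t \<in> {0..1} ==> P t (e t) (V t) (W t)"
  by metis
 then have e: "!!t. t \<in> {0..1} ==> e t > 0"
  and V: "!!t. t \<in> {0..1} ==> openin Z (V t)" "!!t. t \<in> {0..1} ==> z \<in> V t"
  and W: "!!t. t \<in> {0..1} ==> strict \<gamma> (W t)"
  and VW: "!!t s y. t \<in> {0..1} ==> s \<in> ball t (e t) ==> s \<in> {0..1} ==> y \<in> V t ==> h (s, y) \<in> W t"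
  unfolding P_def by blast+
 have "{0..1::real} \<subseteq> (\<Union>t\<in>{0..1}. ball t (e t))" using e by force
 then obtain T where T: "T \<subseteq> {0..1}" "finite T" "{0..1} \<subseteq> (\<Union>t\<in>T. ball t (e t))"
  using compactE_image[OF compact_Icc, of "{0..1}" "\<lambda>t. ball t (e t)"] by (metis open_ball)
 have T0: "T ~= {}" using T(3) by auto
 obtain d where d: "d > 0" "!!x. x \<in> {0..1} ==> \<exists>G\<in>(\<lambda>t. ball t (e t)) ` T. ball x d \<subseteq> G"
 proof (rule Heine_Borel_lemma[OF compact_Icc[of 0 "1::real"], of "(\<lambda>t. ball t (e t)) ` T"])
  show "{0..1} \<subseteq> \<Union> ((\<lambda>t. ball t (e t)) ` T)" using T(3) by auto
  show "open G" if "G \<in> (\<lambda>t. ball t (e t)) ` T" for G using that by auto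
 next
  fix d :: real
  assume "d > 0" "!!x. x \<in> {0..1} ==> \<exists>G\<in>(\<lambda>t. ball t (e t)) ` T. ball x d \<subseteq> G"
  then show thesis by (rule that)
 qed
 obtain N where N: "1 / d < real N" using reals_Archimedean2 by blast
 have Npos: "N > 0" using N d(1) by (metis divide_pos_pos less_trans of_nat_0_less_iff zero_less_one)
 have Nd: "1 / real N < d" using N d(1) Npos by (simp add: field_simps)
 define V0 where "V0 = (\<Inter>t\<in>T. V t)"
 have "openin Z V0" unfolding V0_def using T V(1) T0 by (intro openin_INT2) auto
 moreover have "z \<in> V0" using T V(2) by (auto simp: V0_def)
 moreover have "good \<gamma> h N V0"
  unfolding good_def
 proof (intro conjI allI impI Npos)
  fix i assume i: "i < N"
  have "real i / real N \<in> {0..1}" using i by (auto simp: field_simps)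
  then obtain t where t: "t \<in> T" "ball (real i / real N) d \<subseteq> ball t (e t)" using d(2) by blast
  have "h (s, y) \<in> W t" if s: "real i / real N <= s" "s <= real (Suc i) / real N" and y: "y \<in> V0" for s y
  proof (rule VW)
   show "t \<in> {0..1}" using t(1) T(1) by blast
   have "s <= real i / real N + 1 / real N" using s(2) by (simp add: add_divide_distrib add.commute)
   then have "s \<in> ball (real i / real N) d" using s(1) Nd by (simp add: dist_real_def)
   then show "s \<in> ball t (e t)" using t by auto
   have "real (Suc i) / real N <= 1" using i by (simp add: field_simps)
   then have "s <= 1" by (rule order_trans[OF s(2)])
   moreover have "0 <= s" by (rule order_trans[OF _ s(1)]) simp
   ultimately show "s \<in> {0..1}" by simp
   show "y \<in> V t" using y t(1) by (simp add: V0_def)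
  qed
  moreover have "strict \<gamma> (W t)" using W[of t] t(1) T(1) by blast
  ultimately show "\<exists>W. strict \<gamma> W \<and> (\<forall>t z. real i / real N <= t --> t <= real (Suc i) / real N --> z \<in> V0 --> h (t, z) \<in> W)"
   by blast
 qed
 ultimately show ?thesis using that by blast
qed

text \<open>Makes the transport independent of the subdivision: two numbers of steps are compared
  through their product.\<close>

lemma transport_refine:
 assumes "good \<gamma> h N V" "z \<in> V" "M > 0"
 shows "transport \<gamma> h (N * M) (N * M) z = transport \<gamma> h N N z"
proof -
 have N: "N > 0" using assms(1) by (simp add: good_def)
 have "transport \<gamma> h (N * M) (i * M) z = transport \<gamma> h N i z" if "i <= N" for i
  using that
 proof (induction i)
  case (Suc i)
  then obtain W where W: "strict \<gamma> W"
   "!!t. real i / real N <= t ==> t <= real (Suc i) / real N ==> h (t, z) \<in> W"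
   using assms(1,2) unfolding good_def by (metis Suc_le_lessD)
  have inW: "h (real (i * M + j) / real (N * M), z) \<in> W" if "j <= M" for j
  proof (rule W(2))
   have "real i * real M <= real i * real M + real j" by simp
   then show "real i / real N <= real (i * M + j) / real (N * M)"
    using N assms(3) by (simp add: field_simps)
   have "real j <= real M" using that by simp
   then show "real (i * M + j) / real (N * M) <= real (Suc i) / real N"
    using N assms(3) by (simp add: field_simps)
  qed
  have "transport \<gamma> h (N * M) (i * M + j) z = transport \<gamma> h (N * M) (i * M) z +
    \<gamma> (h (real (i * M) / real (N * M), z)) (h (real (i * M + j) / real (N * M), z))" if "j <= M" for j
   using that
  proof (induction j)
   case 0
   then show ?case using strict_refl[OF W(1) inW[of 0]] by simp
  next
   case (Suc j)
   have "\<gamma> (h (real (i * M) / real (N * M), z)) (h (real (i * M + j) / real (N * M), z)) +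
     \<gamma> (h (real (i * M + j) / real (N * M), z)) (h (real (i * M + Suc j) / real (N * M), z)) =
     \<gamma> (h (real (i * M) / real (N * M), z)) (h (real (i * M + Suc j) / real (N * M), z))"
    using inW[of 0] inW[of j] inW[of "Suc j"] Suc.prems by (intro strictD[OF W(1)]) auto
   then show ?case using Suc by (simp add: add.assoc del: of_nat_Suc of_nat_add of_nat_mult)
  qed
  from this[of M] have "transport \<gamma> h (N * M) (Suc i * M) z = transport \<gamma> h (N * M) (i * M) z +
    \<gamma> (h (real (i * M) / real (N * M), z)) (h (real (Suc i * M) / real (N * M), z))"
   by (simp add: add.commute)
  moreover have "real (k * M) / real (N * M) = real k / real N" for k using assms(3) by simp
  ultimately show ?case using Suc by (simp del: of_nat_Suc of_nat_mult mult_Suc)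
 qed simp
 from this[of N] show ?thesis by simp
qed

lemma transport_in_R: "local_cocycle Y \<gamma> ==> transport \<gamma> h N i z \<in> R"
 by (induction i) (auto intro: subgroup_setD[OF R] simp: local_cocycle_def)

text \<open>Two neighbouring rungs lie in one strict set, so the square between them commutes; the
  squares are stacked along the path.\<close>

lemma transport_ladder:
 assumes "good \<gamma> h N V" "x \<in> V" "y \<in> V" "i <= N"
 shows "transport \<gamma> h N i x + \<gamma> (h (real i / real N, x)) (h (real i / real N, y)) =
  \<gamma> (h (0, x)) (h (0, y)) + transport \<gamma> h N i y"
 using assms(4)
proof (induction i)
 case (Suc i)
 then obtain W where W: "strict \<gamma> W"
  "!!t z. real i / real N <= t ==> t <= real (Suc i) / real N ==> z \<in> V ==> h (t, z) \<in> W"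
  using assms(1) unfolding good_def by (metis Suc_le_lessD)
 let ?a = "real i / real N" and ?b = "real (Suc i) / real N"
 have ab: "?a <= ?b" by (simp add: divide_right_mono)
 have inW: "h (?a, x) \<in> W" "h (?b, x) \<in> W" "h (?a, y) \<in> W" "h (?b, y) \<in> W"
  using W(2)[of ?a] W(2)[of ?b] ab assms(2,3) by auto
 have "transport \<gamma> h N (Suc i) x + \<gamma> (h (?b, x)) (h (?b, y)) =
   transport \<gamma> h N i x + (\<gamma> (h (?a, x)) (h (?b, x)) + \<gamma> (h (?b, x)) (h (?b, y)))"
  by (simp add: add.assoc)
 also have "\<gamma> (h (?a, x)) (h (?b, x)) + \<gamma> (h (?b, x)) (h (?b, y)) = \<gamma> (h (?a, x)) (h (?a, y)) + \<gamma> (h (?a, y)) (h (?b, y))"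
  using inW strictD[OF W(1)] by metis
 also have "transport \<gamma> h N i x + \<dots> = \<gamma> (h (0, x)) (h (0, y)) + transport \<gamma> h N (Suc i) y"
  using Suc by (simp add: add.assoc[symmetric])
 finally show ?case .
qed simp

theorem homotopy_lifting:
 fixes h :: "real \<times> 'z => 'x"
 assumes \<gamma>: "local_cocycle Y \<gamma>"
  and h: "continuous_map (prod_topology (top_of_set {0..1}) Z) Y h"
  and dev: "development Z (\<lambda>z. h (0, z)) \<gamma> \<kappa>"
 obtains \<kappa>' where "development Z (\<lambda>z. h (1, z)) \<gamma> \<kappa>'"
proof -
 \<comment> \<open>The chosen number of steps varies from point to point. \<open>S_eq\<close> allows
   one number to be used on a whole neighbourhood, which is what a development needs.\<close>
 define N where "N = (\<lambda>z. SOME N. \<exists>V. z \<in> V \<and> good \<gamma> h N V)"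
 define S where "S = (\<lambda>z. transport \<gamma> h (N z) (N z) z)"
 have S_eq: "S z = transport \<gamma> h M M z" if "z \<in> V" "good \<gamma> h M V" for z M V
 proof -
  have "\<exists>V. z \<in> V \<and> good \<gamma> h (N z) V" unfolding N_def by (rule someI[of _ M]) (use that in blast)
  then obtain V' where V': "z \<in> V'" "good \<gamma> h (N z) V'" by blast
  then have pos: "N z > 0" "M > 0" using that(2) by (auto simp: good_def)
  have "S z = transport \<gamma> h (N z * M) (N z * M) z"
   unfolding S_def using transport_refine[OF V'(2,1) pos(2)] by simp
  also have "\<dots> = transport \<gamma> h M M z"
   using transport_refine[OF that(2,1) pos(1)] by (simp add: mult.commute)
  finally show ?thesis .
 qed
 have "development Z (\<lambda>z. h (1, z)) \<gamma> (\<lambda>z. \<kappa> z + S z)"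
  unfolding development_def
 proof (intro conjI ballI)
  fix z assume z: "z \<in> topspace Z"
  have "\<kappa> z \<in> R" using dev z by (simp add: development_def)
  then show "\<kappa> z + S z \<in> R"
   unfolding S_def by (rule subgroup_setD(2)[OF R _ transport_in_R[OF \<gamma>]])
  obtain M V where V: "openin Z V" "z \<in> V" "good \<gamma> h M V" using good_exists[OF \<gamma> h z] .
  obtain V' where V': "openin Z V'" "z \<in> V'" "!!x y. x \<in> V' ==> y \<in> V' ==> \<gamma> (h (0, x)) (h (0, y)) = - \<kappa> x + \<kappa> y"
   using developmentE[OF dev z] by metis
  have "\<gamma> (h (1, x)) (h (1, y)) = - (\<kappa> x + S x) + (\<kappa> y + S y)" if "x \<in> V \<inter> V'" "y \<in> V \<inter> V'" for x y
  proof -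
   have M: "M > 0" using V(3) by (simp add: good_def)
   have "S x + \<gamma> (h (1, x)) (h (1, y)) = (- \<kappa> x + \<kappa> y) + S y"
    using transport_ladder[OF V(3), of x y M] that V'(3)[of x y] S_eq[OF _ V(3)] M by simp
   then have "- S x + (S x + \<gamma> (h (1, x)) (h (1, y))) = - S x + (- \<kappa> x + \<kappa> y + S y)" by simp
   then show ?thesis by (simp add: group_add_simps del: add_uminus_conv_diff)
  qed
  then show "\<exists>V. openin Z V \<and> z \<in> V \<and> (\<forall>x\<in>V. \<forall>y\<in>V. \<gamma> (h (1, x)) (h (1, y)) = - (\<kappa> x + S x) + (\<kappa> y + S y))"
   using V V' by (intro exI[of _ "V \<inter> V'"]) auto
 qed
 then show ?thesis by (rule that)
qed

corollary development_contractible: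
 assumes \<gamma>: "local_cocycle Y \<gamma>" and u: "continuous_map Z Y u" and Z: "contractible_space Z"
 obtains \<kappa> where "development Z u \<gamma> \<kappa>"
proof -
 obtain a where "homotopic_with (\<lambda>x. True) Z Z (\<lambda>x. a) id"
  using Z unfolding contractible_space_def by (meson homotopic_with_symD)
 then have "\<exists>h. continuous_map (prod_topology (top_of_set {0..1::real}) Z) Z h \<and> (\<forall>x. h (0, x) = a) \<and> (\<forall>x. h (1, x) = x)"
  by (auto simp: homotopic_with_def)
 then obtain h where h: "continuous_map (prod_topology (top_of_set {0..1::real}) Z) Z h"
  "!!x. h (0, x) = a" "!!x. h (1, x) = x" by metis
 have uh: "continuous_map (prod_topology (top_of_set {0..1}) Z) Y (u \<circ> h)"
  using h(1) u by (rule continuous_map_compose)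
 have "development Z (\<lambda>z. (u \<circ> h) (0, z)) \<gamma> (\<lambda>_. 0)"
  unfolding development_def
 proof (intro conjI ballI)
  fix z assume z: "z \<in> topspace Z"
  have "h (0, z) \<in> topspace Z" using h(1) z by (auto simp: continuous_map_def)
  then have "u a \<in> topspace Y" using u h(2) by (auto simp: continuous_map_def)
  then obtain W where W: "u a \<in> W" "strict \<gamma> W" by (rule local_cocycleE[OF \<gamma>])
  show "\<exists>V. openin Z V \<and> z \<in> V \<and> (\<forall>x\<in>V. \<forall>y\<in>V. \<gamma> ((u \<circ> h) (0, x)) ((u \<circ> h) (0, y)) = - 0 + 0)"
   using z strict_refl[OF W(2,1)] by (intro exI[of _ "topspace Z"]) (simp add: h(2))
 qed (simp add: subgroup_setD[OF R])
 then obtain \<kappa> where "development Z (\<lambda>z. (u \<circ> h) (1, z)) \<gamma> \<kappa>"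
  by (rule homotopy_lifting[OF \<gamma> uh])
 then show ?thesis using that[of \<kappa>] h(3) by (simp add: o_def)
qed

end

section \<open>Attaching cells and local cocycles\<close>

lemma openin_attaches_cells:
 assumes "attaches_cells n A Y I \<phi>" "n >= 1"
 shows "openin Y W \<longleftrightarrow> W \<subseteq> topspace Y \<and> openin A (W \<inter> topspace A) \<and>
   (\<forall>i\<in>I. openin (disc n) {x \<in> topspace (disc n). \<phi> i x \<in> W})"
proof (cases "W \<subseteq> topspace Y")
 case True
 have AY: "topspace A \<subseteq> topspace Y" using assms(1) by (simp add: attaches_cells_def)
 have cl: "closedin Y (topspace Y - W) \<longleftrightarrow> closedin A ((topspace Y - W) \<inter> topspace A) \<and>
   (\<forall>i\<in>I. closedin (disc n) {x \<in> topspace (disc n). \<phi> i x \<in> topspace Y - W})"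
  using assms(1) by (simp add: attaches_cells_def)
 have "(topspace Y - W) \<inter> topspace A = topspace A - W \<inter> topspace A" using AY by auto
 moreover have "{x \<in> topspace (disc n). \<phi> i x \<in> topspace Y - W} =
   topspace (disc n) - {x \<in> topspace (disc n). \<phi> i x \<in> W}" if "i \<in> I" for i
  using attaches_cells_continuous_map[OF assms that] by (auto simp: continuous_map_def)
 ultimately show ?thesis
  using True cl by (simp add: openin_closedin_eq openin_closedin)
next
 case False
 then show ?thesis using openin_subset by blast
qed

section \<open>Polar coordinates on the disc\<close>

definition rad :: "nat => (nat => real) => real" where
 "rad n x = sqrt (\<Sum>i<n. (x i)\<^sup>2)"

text \<open>At the centre the division gives the zero vector, which is off the sphere; hence the
  guards \<open>rad n x ~= 0\<close> below.\<close>

definition unit_dir :: "nat => (nat => real) => nat => real" where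
 "unit_dir n x = (\<lambda>i. x i / rad n x)"

lemma topspace_Euclidean: "topspace (Euclidean_space n) = {x. \<forall>i\<ge>n. x i = 0}"
 by (simp add: topspace_Euclidean_space)

lemma disc_iff: "x \<in> topspace (disc n) \<longleftrightarrow> (\<forall>i\<ge>n. x i = 0) \<and> rad n x <= 1"
 by (simp add: topspace_disc topspace_Euclidean rad_def)

lemma open_disc_iff: "x \<in> open_disc n \<longleftrightarrow> (\<forall>i\<ge>n. x i = 0) \<and> rad n x < 1"
 by (simp add: open_disc_def topspace_Euclidean rad_def)

definition bsphere :: "nat => (nat => real) topology" where
 "bsphere n = nsphere (n - 1)"

lemma bsphere_iff: "n >= 1 ==> x \<in> topspace (bsphere n) \<longleftrightarrow> (\<forall>i\<ge>n. x i = 0) \<and> rad n x = 1"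
 by (cases n) (auto simp: bsphere_def nsphere_def topspace_Euclidean rad_def lessThan_Suc_atMost)

lemma rad_nonneg [simp]: "rad n x >= 0"
 by (simp add: rad_def sum_nonneg)

lemma rad_unit_dir: "rad n x ~= 0 ==> rad n (unit_dir n x) = 1"
proof -
 assume r: "rad n x ~= 0"
 have "(\<Sum>i<n. (unit_dir n x i)\<^sup>2) = (\<Sum>i<n. (x i)\<^sup>2) / (rad n x)\<^sup>2"
  by (simp add: unit_dir_def power_divide sum_divide_distrib)
 also have "(rad n x)\<^sup>2 = (\<Sum>i<n. (x i)\<^sup>2)" by (simp add: rad_def sum_nonneg)
 finally show ?thesis using r by (simp add: rad_def)
qed

lemma unit_dir_in_bsphere:
 "n >= 1 ==> x \<in> topspace (disc n) ==> rad n x ~= 0 ==> unit_dir n x \<in> topspace (bsphere n)"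
proof -
 assume n: "n >= 1" and x: "x \<in> topspace (disc n)" "rad n x ~= 0"
 have "\<forall>i\<ge>n. unit_dir n x i = 0" using x(1) by (simp add: unit_dir_def disc_iff)
 then show ?thesis using rad_unit_dir[OF x(2)] by (simp add: bsphere_iff[OF n])
qed

lemma disc_cases: "n >= 1 ==> x \<in> topspace (disc n) ==> x \<in> open_disc n \<or> x \<in> topspace (bsphere n)"
 using disc_eq_open_disc_Un_nsphere[of n] by (auto simp: bsphere_def)

lemma unit_dir_id: "rad n x = 1 ==> unit_dir n x = x"
 by (simp add: unit_dir_def)

lemma disc_eq_subtopology: "disc n = subtopology (powertop_real UNIV) (topspace (disc n))"
 by (simp add: disc_def Euclidean_space_def subtopology_subtopology topspace_Euclidean_space)

lemma continuous_map_disc_coord: "continuous_map (disc n) euclideanreal (\<lambda>x. x i)"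
 by (subst disc_eq_subtopology)
  (rule continuous_map_from_subtopology, use continuous_map_product_projection[of i UNIV "\<lambda>_. euclideanreal"] in simp)

lemma continuous_map_rad: "continuous_map (disc n) euclideanreal (rad n)"
 unfolding rad_def by (intro continuous_intros continuous_map_disc_coord) auto

lemma continuous_map_unit_dir:
 assumes "n >= 1"
 shows "continuous_map (subtopology (disc n) {x. rad n x ~= 0}) (bsphere n) (unit_dir n)"
proof -
 have "continuous_map (subtopology (disc n) {x. rad n x ~= 0}) (powertop_real UNIV) (unit_dir n)"
  unfolding continuous_map_componentwise_UNIV unit_dir_def
  by (intro allI continuous_map_real_divide continuous_map_from_subtopology
    continuous_map_disc_coord continuous_map_rad) auto
 moreover have "bsphere n = subtopology (powertop_real UNIV) (topspace (bsphere n))"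
  by (simp add: bsphere_def nsphere)
 moreover have "unit_dir n \<in> topspace (subtopology (disc n) {x. rad n x ~= 0}) \<rightarrow> topspace (bsphere n)"
  using unit_dir_in_bsphere[OF assms] by auto
 ultimately show ?thesis using continuous_map_into_subtopology by metis
qed

lemma openin_rad:
 "openin (disc n) {x \<in> topspace (disc n). rad n x > a}" "openin (disc n) {x \<in> topspace (disc n). rad n x < a}"
proof -
 have "{x \<in> topspace (disc n). rad n x > a} = {x \<in> topspace (disc n). rad n x \<in> {a<..}}"
  "{x \<in> topspace (disc n). rad n x < a} = {x \<in> topspace (disc n). rad n x \<in> {..<a}}" by auto
 then show "openin (disc n) {x \<in> topspace (disc n). rad n x > a}" "openin (disc n) {x \<in> topspace (disc n). rad n x < a}"
  by (simp_all only: openin_continuous_map_preimage[OF continuous_map_rad] open_openin[symmetric] open_greaterThan open_lessThan)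
qed

lemma openin_cone:
 assumes "n >= 1" "openin (bsphere n) N" "a >= 0"
 shows "openin (disc n) {x \<in> topspace (disc n). rad n x > a \<and> unit_dir n x \<in> N}"
proof -
 have "openin (subtopology (disc n) {x. rad n x ~= 0})
   {x \<in> topspace (subtopology (disc n) {x. rad n x ~= 0}). unit_dir n x \<in> N}"
  using continuous_map_unit_dir[OF assms(1)] assms(2) by (rule openin_continuous_map_preimage)
 then obtain U where U: "openin (disc n) U"
  "{x \<in> topspace (subtopology (disc n) {x. rad n x ~= 0}). unit_dir n x \<in> N} = U \<inter> {x. rad n x ~= 0}"
  by (auto simp: openin_subtopology)
 have "{x \<in> topspace (disc n). rad n x > a \<and> unit_dir n x \<in> N} = U \<inter> {x \<in> topspace (disc n). rad n x > a}" (is "?L = ?R")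
 proof (rule Set.set_eqI)
  fix x
  have "rad n x ~= 0" if "rad n x > a" using that assms(3) by auto
  then show "x \<in> ?L \<longleftrightarrow> x \<in> ?R" using U(2) unfolding set_eq_iff by auto
 qed
 moreover have "openin (disc n) ?R" using U(1) openin_rad(1) by (rule openin_Int)
 ultimately show ?thesis by simp
qed

lemma openin_cell_image:
 assumes att: "attaches_cells n A Y I \<phi>" and n: "n >= 1" and i: "i \<in> I"
  and N: "openin (disc n) N" "N \<subseteq> open_disc n"
 shows "openin Y (\<phi> i ` N)"
 unfolding openin_attaches_cells[OF att n]
proof (intro conjI ballI)
 have bij: "bij_betw (\<lambda>(i, x). \<phi> i x) (I \<times> open_disc n) (topspace Y - topspace A)"
  using att by (simp add: attaches_cells_def)
 have cell: "\<phi> j x \<in> topspace Y - topspace A" if "j \<in> I" "x \<in> open_disc n" for j x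
  using bij_betwE[OF bij] that by force
 show "\<phi> i ` N \<subseteq> topspace Y" using cell[OF i] N(2) by auto
 have "\<phi> i ` N \<inter> topspace A = {}" using cell[OF i] N(2) by auto
 then show "openin A (\<phi> i ` N \<inter> topspace A)" by simp
 fix j assume j: "j \<in> I"
 have "{x \<in> topspace (disc n). \<phi> j x \<in> \<phi> i ` N} = (if j = i then N else {})"
 proof -
  have "j = i \<and> x \<in> N" if x: "x \<in> topspace (disc n)" "\<phi> j x \<in> \<phi> i ` N" for x
  proof -
   obtain y where y: "y \<in> N" "\<phi> j x = \<phi> i y" using x(2) by auto
   then have "\<phi> j x \<notin> topspace A" using cell[OF i, of y] N(2) by auto
   moreover have "\<phi> j x \<in> topspace A" if "x \<in> topspace (bsphere n)"
    using att j that by (auto simp: attaches_cells_def bsphere_def continuous_map_def)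
   ultimately have "x \<in> open_disc n" using disc_cases[OF n x(1)] by blast
   then have "(j, x) = (i, y)"
    using inj_onD[OF bij_betw_imp_inj_on[OF bij], of "(j, x)" "(i, y)"] y N(2) i j by auto
   then show ?thesis using y(1) by simp
  qed
  then show ?thesis using openin_subset[OF N(1)] by auto
 qed
 then show "openin (disc n) {x \<in> topspace (disc n). \<phi> j x \<in> \<phi> i ` N}" using N(1) by simp
qed

context holonomy
begin

text \<open>A covering extends over a cell as soon as it is trivial over the attaching sphere, and a
  development of the attaching map is such a trivialization. The third conclusion prolongs strict
  open sets without changing them on \<open>A\<close>; this is what survives the passage to a union
  of infinitely many skeleta.\<close>

lemma extend_over_cells:
 fixes A Y :: "'x topology"
 assumes att: "attaches_cells n A Y I \<phi>" and n: "n >= 1" and \<gamma>: "local_cocycle A \<gamma>"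
  and k: "!!i. i \<in> I ==> development (bsphere n) (\<phi> i) \<gamma> (k i)"
 obtains \<gamma>' where "local_cocycle Y \<gamma>'"
  "!!x y. x \<in> topspace A ==> y \<in> topspace A ==> \<gamma>' x y = \<gamma> x y"
  "!!W. openin A W ==> strict \<gamma> W ==> \<exists>W'. openin Y W' \<and> W' \<inter> topspace A = W \<and> strict \<gamma>' W'"
  "!!i. i \<in> I ==> \<exists>K. development (disc n) (\<phi> i) \<gamma>' K \<and> (\<forall>x\<in>topspace (bsphere n). K x = k i x)"
proof -
 have AY: "topspace A \<subseteq> topspace Y" using att by (simp add: attaches_cells_def)
 have bij: "bij_betw (\<lambda>(i, x). \<phi> i x) (I \<times> open_disc n) (topspace Y - topspace A)"
  using att by (simp add: attaches_cells_def)
 have cm: "continuous_map (bsphere n) A (\<phi> i)" if "i \<in> I" for i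
  using att that by (simp add: attaches_cells_def bsphere_def)
 have sphere_A: "\<phi> i x \<in> topspace A" if "i \<in> I" "x \<in> topspace (bsphere n)" for i x
  using cm[OF that(1)] that(2) by (auto simp: continuous_map_def)
 have \<gamma>R: "\<gamma> x y \<in> R" for x y using \<gamma> by (simp add: local_cocycle_def)
 define cell where "cell = inv_into (I \<times> open_disc n) (\<lambda>(i, x). \<phi> i x)"
 have cell: "cell (\<phi> i x) = (i, x)" "\<phi> i x \<in> topspace Y" "\<phi> i x \<notin> topspace A" if "i \<in> I" "x \<in> open_disc n" for i x
  using bij that unfolding cell_def bij_betw_def by (auto simp: inv_into_f_eq)
 have cell_E: "\<exists>i x. i \<in> I \<and> x \<in> open_disc n \<and> y = \<phi> i x" if "y \<in> topspace Y" "y \<notin> topspace A" for y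
 proof -
  have "y \<in> (\<lambda>(i, x). \<phi> i x) ` (I \<times> open_disc n)" using bij that by (simp add: bij_betw_def)
  then show ?thesis by auto
 qed
 define ret where "ret = (\<lambda>y. if y \<in> topspace A then y else \<phi> (fst (cell y)) (unit_dir n (snd (cell y))))"
 define inner where "inner = (\<lambda>y. y \<in> topspace Y \<and> y \<notin> topspace A \<and> rad n (snd (cell y)) <= 1/2)"
 \<comment> \<open>The potential is constant along radii, with an arbitrary value at the centre. Its
   jump there is harmless: cocycles and developments have to satisfy algebraic identities locally
   but need not be continuous.\<close>
 define \<kappa> where "\<kappa> = (\<lambda>i x. if rad n x = 0 then 0 else k i (unit_dir n x))"
 define pot where "pot = (\<lambda>y. \<kappa> (fst (cell y)) (snd (cell y)))"
 \<comment> \<open>In the inner half of a cell only the potential is used. Elsewhere points are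
   pushed to \<open>A\<close>, which allows nearby points of different cells to be compared. Values
   on pairs of distant points carry no meaning.\<close>
 define \<gamma>' where "\<gamma>' = (\<lambda>x y. if x \<in> topspace Y - topspace A \<and> y \<in> topspace Y - topspace A \<and> (inner x \<or> inner y)
   then - pot x + pot y else \<gamma> (ret x) (ret y))"
 have \<kappa>R: "\<kappa> i x \<in> R" if "i \<in> I" "x \<in> topspace (disc n)" for i x
  using k[OF that(1)] unit_dir_in_bsphere[OF n that(2)] subgroup_setD(1)[OF R]
  by (auto simp: \<kappa>_def development_def)
 have od: "x \<in> topspace (disc n)" if "x \<in> open_disc n" for x
  using that by (simp add: disc_iff open_disc_iff)
 have pot_cell: "pot (\<phi> i x) = \<kappa> i x" "ret (\<phi> i x) = \<phi> i (unit_dir n x)" "inner (\<phi> i x) \<longleftrightarrow> rad n x <= 1/2"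
  if "i \<in> I" "x \<in> open_disc n" for i x
  using cell[OF that] by (auto simp: pot_def ret_def inner_def)
 have ret_disc: "ret (\<phi> i x) = \<phi> i (unit_dir n x)" if i: "i \<in> I" and x: "x \<in> topspace (disc n)" "rad n x ~= 0" for i x
 proof (cases "rad n x < 1")
  case True
  then have "x \<in> open_disc n" using x by (simp add: disc_iff open_disc_iff)
  then show ?thesis using pot_cell(2)[OF i] by blast
 next
  case False
  then have "rad n x = 1" using x by (simp add: disc_iff)
  then have "x \<in> topspace (bsphere n)" using x n by (simp add: bsphere_iff disc_iff)
  then show ?thesis using sphere_A[OF i] \<open>rad n x = 1\<close> by (simp add: ret_def unit_dir_id)
 qed
 have cocycle_A: "\<gamma>' x y = \<gamma> x y" if "x \<in> topspace A" "y \<in> topspace A" for x y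
  using that by (simp add: \<gamma>'_def ret_def)
 have \<gamma>'R: "\<gamma>' x y \<in> R" for x y
 proof -
  have "pot y \<in> R" if "y \<in> topspace Y" "y \<notin> topspace A" for y
   using cell_E[OF that] pot_cell(1) \<kappa>R od by metis
  then show ?thesis using \<gamma>R subgroup_setD(2,3)[OF R] unfolding \<gamma>'_def by auto
 qed
 \<comment> \<open>\<open>W'\<close> is the collar over \<open>W\<close> outside the inner halves of
   the cells. There \<gamma>' is pulled back along \<open>ret\<close>, so strictness is
   inherited.\<close>
 have extend: "\<exists>W'. openin Y W' \<and> W' \<inter> topspace A = W \<and> strict \<gamma>' W'" if W: "openin A W" "strict \<gamma> W" for W
 proof -
  define W' where "W' = {y \<in> topspace Y. ret y \<in> W \<and> \<not> inner y}"
  have WA: "W \<subseteq> topspace A" using W(1) by (rule openin_subset)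
  have W'A: "W' \<inter> topspace A = W" using WA AY by (auto simp: W'_def ret_def inner_def)
  have "openin Y W'"
   unfolding openin_attaches_cells[OF att n]
  proof (intro conjI ballI)
   show "W' \<subseteq> topspace Y" by (auto simp: W'_def)
   show "openin A (W' \<inter> topspace A)" using W'A W(1) by simp
   fix i assume i: "i \<in> I"
   have "{x \<in> topspace (disc n). \<phi> i x \<in> W'} =
    {x \<in> topspace (disc n). rad n x > 1/2 \<and> unit_dir n x \<in> {x \<in> topspace (bsphere n). \<phi> i x \<in> W}}"
    (is "?L = ?R")
   proof (rule Set.set_eqI)
    fix x
    show "x \<in> ?L \<longleftrightarrow> x \<in> ?R"
    proof (cases "x \<in> topspace (disc n) \<and> rad n x > 1/2")
     case True
     then have r: "rad n x ~= 0" by auto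
     have "\<phi> i x \<in> topspace Y"
      using attaches_cells_continuous_map[OF att n i] True by (auto simp: continuous_map_def)
     moreover have "\<not> inner (\<phi> i x)"
     proof (cases "x \<in> open_disc n")
      case True': True
      then show ?thesis using pot_cell(3)[OF i True'] True by simp
     next
      case False
      then have "x \<in> topspace (bsphere n)"
       using True n by (auto simp: bsphere_iff disc_iff open_disc_iff)
      then show ?thesis using sphere_A[OF i] by (simp add: inner_def)
     qed
     ultimately show ?thesis
      using True ret_disc[OF i _ r] unit_dir_in_bsphere[OF n _ r] by (simp add: W'_def)
    next
     case False
     have "x \<notin> ?L"
     proof
      assume x: "x \<in> ?L"
      then have "x \<in> open_disc n" using False by (auto simp: disc_iff open_disc_iff)
      then show False using x False pot_cell(3)[OF i, of x] by (auto simp: W'_def)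
     qed
     then show ?thesis using False by auto
    qed
   qed
   moreover have "openin (disc n) ?R"
    by (intro openin_cone[OF n] openin_continuous_map_preimage[OF cm[OF i] W(1)]) simp
   ultimately show "openin (disc n) ?L" by simp
  qed
  moreover have "strict \<gamma>' W'"
  proof -
   have "\<gamma>' x y = \<gamma> (ret x) (ret y)" if "x \<in> W'" "y \<in> W'" for x y
    using that by (simp add: \<gamma>'_def W'_def)
   then show ?thesis using W(2) unfolding strict_def by (simp add: W'_def)
  qed
  ultimately show ?thesis using W'A by blast
 qed
 have cone: "\<exists>V. openin (disc n) V \<and> x \<in> V \<and>
   (\<forall>y\<in>V. \<forall>z\<in>V. \<gamma>' (\<phi> i y) (\<phi> i z) = - \<kappa> i y + \<kappa> i z)"
  if i: "i \<in> I" and x: "x \<in> topspace (disc n)" for i x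
 proof (cases "rad n x = 0")
  case True
  let ?V = "{x \<in> topspace (disc n). rad n x < 1/2}"
  have "\<gamma>' (\<phi> i y) (\<phi> i z) = - \<kappa> i y + \<kappa> i z" if "y \<in> ?V" "z \<in> ?V" for y z
  proof -
   have "y \<in> open_disc n" "z \<in> open_disc n" using that by (auto simp: disc_iff open_disc_iff)
   then show ?thesis using that pot_cell[OF i] cell[OF i] by (simp add: \<gamma>'_def)
  qed
  then show ?thesis using openin_rad(2)[of n "1/2"] x True by (intro exI[of _ ?V]) auto
 next
  case False
  have "unit_dir n x \<in> topspace (bsphere n)" using unit_dir_in_bsphere[OF n x False] .
  then obtain N where N: "openin (bsphere n) N" "unit_dir n x \<in> N"
   "!!y z. y \<in> N ==> z \<in> N ==> \<gamma> (\<phi> i y) (\<phi> i z) = - k i y + k i z"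
   using developmentE[OF k[OF i]] by metis
  let ?V = "{x \<in> topspace (disc n). rad n x > 0 \<and> unit_dir n x \<in> N}"
  have "\<gamma>' (\<phi> i y) (\<phi> i z) = - \<kappa> i y + \<kappa> i z" if y: "y \<in> ?V" and z: "z \<in> ?V" for y z
  proof (cases "\<phi> i y \<in> topspace Y - topspace A \<and> \<phi> i z \<in> topspace Y - topspace A \<and> (inner (\<phi> i y) \<or> inner (\<phi> i z))")
   case True
   have "y \<in> open_disc n" if "y \<in> ?V" "\<phi> i y \<notin> topspace A" for y
    using that sphere_A[OF i, of y] disc_cases[OF n, of y] by auto
   then have "y \<in> open_disc n" "z \<in> open_disc n" using True y z by auto
   then show ?thesis using True pot_cell(1)[OF i] by (simp add: \<gamma>'_def)
  next
   case False
   then have "\<gamma>' (\<phi> i y) (\<phi> i z) = \<gamma> (ret (\<phi> i y)) (ret (\<phi> i z))" unfolding \<gamma>'_def by (rule if_not_P)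
   also have "\<dots> = - k i (unit_dir n y) + k i (unit_dir n z)"
    using y z N(3) ret_disc[OF i] by simp
   finally show ?thesis using y z by (simp add: \<kappa>_def)
  qed
  moreover have "openin (disc n) ?V" by (rule openin_cone[OF n N(1)]) simp
  moreover have "x \<in> ?V" using x False N(2) rad_nonneg[of n x] by (simp add: less_le)
  ultimately show ?thesis by (intro exI[of _ ?V]) blast
 qed
 have "local_cocycle Y \<gamma>'"
  unfolding local_cocycle_def
 proof (intro conjI allI ballI \<gamma>'R)
  fix p assume p: "p \<in> topspace Y"
  show "\<exists>W. openin Y W \<and> p \<in> W \<and> strict \<gamma>' W"
  proof (cases "p \<in> topspace A")
   case True
   then obtain W where "openin A W" "p \<in> W" "strict \<gamma> W" by (rule local_cocycleE[OF \<gamma>])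
   then show ?thesis using extend by blast
  next
   case False
   then obtain i x where ix: "i \<in> I" "x \<in> open_disc n" "p = \<phi> i x" using cell_E[OF p] by blast
   obtain V where V: "openin (disc n) V" "x \<in> V"
    "!!y z. y \<in> V ==> z \<in> V ==> \<gamma>' (\<phi> i y) (\<phi> i z) = - \<kappa> i y + \<kappa> i z"
    using cone[OF ix(1) od[OF ix(2)]] by blast
   define O' where "O' = V \<inter> {x \<in> topspace (disc n). rad n x < 1}"
   have O: "openin (disc n) O'" unfolding O'_def using V(1) openin_rad(2) by auto
   have O_disc: "O' \<subseteq> open_disc n" by (auto simp: O'_def disc_iff open_disc_iff)
   have "openin Y (\<phi> i ` O')" by (rule openin_cell_image[OF att n ix(1) O O_disc])
   moreover have "p \<in> \<phi> i ` O'" using V(2) ix od[OF ix(2)] by (auto simp: O'_def open_disc_iff)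
   moreover have "strict \<gamma>' (\<phi> i ` O')"
    unfolding strict_def
   proof (safe)
    fix x y z assume "x \<in> O'" "y \<in> O'" "z \<in> O'"
    then have xyz: "x \<in> V" "y \<in> V" "z \<in> V" by (simp_all add: O'_def)
    show "\<gamma>' (\<phi> i x) (\<phi> i y) + \<gamma>' (\<phi> i y) (\<phi> i z) = \<gamma>' (\<phi> i x) (\<phi> i z)"
     unfolding V(3)[OF xyz(1,2)] V(3)[OF xyz(2,3)] V(3)[OF xyz(1,3)]
     by (simp add: group_add_simps del: add_uminus_conv_diff)
   qed
   ultimately show ?thesis by blast
  qed
 qed
 moreover have "\<exists>K. development (disc n) (\<phi> i) \<gamma>' K \<and> (\<forall>x\<in>topspace (bsphere n). K x = k i x)" if i: "i \<in> I" for i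
 proof (intro exI[of _ "\<kappa> i"] conjI ballI)
  show "development (disc n) (\<phi> i) \<gamma>' (\<kappa> i)"
   unfolding development_def using \<kappa>R[OF i] cone[OF i] by blast
  show "\<kappa> i x = k i x" if "x \<in> topspace (bsphere n)" for x
   using that n by (simp add: \<kappa>_def bsphere_iff unit_dir_id)
 qed
 ultimately show ?thesis using that[of \<gamma>'] cocycle_A extend by blast
qed

lemma connected_space_nsphere: "connected_space (nsphere (Suc m))"
proof -
 let ?U = "topspace (subtopology (nsphere (Suc m)) {x. x (Suc m) >= 0})"
 let ?L = "topspace (subtopology (nsphere (Suc m)) {x. x (Suc m) <= 0})"
 have "connectedin (nsphere (Suc m)) ?U" "connectedin (nsphere (Suc m)) ?L"
  using contractible_space_upper_hemisphere[of "Suc m" "Suc m"] contractible_space_lower_hemisphere[of "Suc m" "Suc m"]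
  by (auto simp: connectedin_def subtopology_subtopology[symmetric] Int_commute
    dest!: contractible_imp_path_connected_space path_connected_imp_connected_space
    simp: subtopology_restrict)
 moreover have "(\<lambda>i. if i = 0 then 1 else 0) \<in> ?U \<inter> ?L"
  using in_topspace_nsphere[of "Suc m"] by simp
 ultimately have "connectedin (nsphere (Suc m)) (?U \<union> ?L)"
  by (intro connectedin_Un) auto
 moreover have "?U \<union> ?L = topspace (nsphere (Suc m))" by auto
 ultimately show ?thesis by (simp add: connectedin_topspace)
qed

text \<open>The reason is simple connectivity in dimension at least 2. The two hemispheres are
  contractible, and their developments differ by a constant on the equator because the equator is
  connected; a translation makes them match.\<close>

lemma development_nsphere:
 assumes \<gamma>: "local_cocycle Y \<gamma>" and u: "continuous_map (nsphere (Suc (Suc m))) Y u"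
 obtains \<kappa> where "development (nsphere (Suc (Suc m))) u \<gamma> \<kappa>"
proof -
 let ?S = "nsphere (Suc (Suc m))"
 define H where "H = (\<lambda>b. if b then {x. x (Suc (Suc m)) >= (0::real)} else {x. x (Suc (Suc m)) <= 0})"
 define Z where "Z = (\<lambda>b. subtopology ?S (H b))"
 have "contractible_space (Z b)" for b
  using contractible_space_upper_hemisphere[of "Suc (Suc m)" "Suc (Suc m)"]
   contractible_space_lower_hemisphere[of "Suc (Suc m)" "Suc (Suc m)"] by (auto simp: Z_def H_def)
 moreover have cu: "continuous_map (Z b) Y u" for b
  unfolding Z_def using u by (rule continuous_map_from_subtopology)
 ultimately have "\<exists>\<kappa>. development (Z b) u \<gamma> \<kappa>" for b
  by (metis development_contractible[OF \<gamma>])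
 then obtain \<kappa> where \<kappa>: "!!b. development (Z b) u \<gamma> (\<kappa> b)" by metis
 define E where "E = nsphere (Suc m)"
 have E: "E = subtopology ?S {x. x (Suc (Suc m)) = 0}" by (simp add: E_def subtopology_nsphere_equator)
 have inc: "continuous_map E (Z b) (\<lambda>x. x)" for b
  unfolding Z_def E by (auto simp: continuous_map_in_subtopology H_def continuous_map_from_subtopology)
 have dE: "development E u \<gamma> (\<kappa> b)" for b
  using development_compose[OF \<kappa> inc, of b] by (simp add: o_def)
 define e where "e = (\<lambda>i::nat. if i = 0 then (1::real) else 0)"
 have e: "e \<in> topspace E" unfolding E_def e_def by (rule in_topspace_nsphere)
 have \<kappa>R: "\<kappa> b z \<in> R" if "z \<in> topspace (Z b)" for b z using \<kappa>[of b] that by (simp add: development_def)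
 have eZ: "e \<in> topspace (Z b)" for b using inc[of b] e by (auto simp: continuous_map_def)
 define c where "c = \<kappa> True e - \<kappa> False e"
 have cR: "c \<in> R" unfolding c_def using \<kappa>R[OF eZ] subgroup_setD(4)[OF R] by blast
 define \<kappa>' where "\<kappa>' = (\<lambda>x. if x \<in> H True then \<kappa> True x else c + \<kappa> False x)"
 have agree: "\<kappa> True x = c + \<kappa> False x" if "x \<in> topspace E" for x
 proof -
  have "- \<kappa> True e + \<kappa> True x = - \<kappa> False e + \<kappa> False x"
   using development_unique[OF dE dE _ e that] connected_space_nsphere[of m] by (simp add: E_def)
  then have "\<kappa> True e + (- \<kappa> True e + \<kappa> True x) = \<kappa> True e + (- \<kappa> False e + \<kappa> False x)" by simp
  then show ?thesis by (simp add: c_def group_add_simps del: add_uminus_conv_diff)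
 qed
 have \<kappa>'_False: "\<kappa>' x = c + \<kappa> False x" if "x \<in> topspace (Z False)" for x
  using agree[of x] that by (auto simp: \<kappa>'_def E Z_def H_def)
 have d: "development (Z b) u \<gamma> \<kappa>'" for b
 proof (cases b)
  case True
  have "development (Z True) u \<gamma> \<kappa>'"
   by (rule development_cong[OF \<kappa>[of True]]) (auto simp: \<kappa>'_def Z_def)
  then show ?thesis using True by simp
 next
  case False
  then show ?thesis using \<kappa>'_False
   by (auto intro!: development_cong[OF development_translate[OF \<kappa>[of False] cR]])
 qed
 have cover: "x \<in> topspace (Z True) \<or> x \<in> topspace (Z False)" if "x \<in> topspace ?S" for x
  using that by (auto simp: Z_def H_def)
 have closed: "closedin ?S (topspace ?S \<inter> H b)" for b
 proof -
  have "closedin ?S {x \<in> topspace ?S. x (Suc (Suc m)) \<in> (if b then {0..} else {..0})}"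
   by (rule closedin_continuous_map_preimage[OF continuous_map_nsphere_projection]) auto
  moreover have "{x \<in> topspace ?S. x (Suc (Suc m)) \<in> (if b then {0..} else {..0})} = topspace ?S \<inter> H b"
   by (cases b) (auto simp: H_def)
  ultimately show ?thesis by simp
 qed
 have "development ?S u \<gamma> \<kappa>'"
 proof (rule development_final[OF \<gamma> u, where Z' = Z and f = "\<lambda>_ x. x" and I = UNIV])
  fix V assume V: "V \<subseteq> topspace ?S" "!!b. b \<in> UNIV ==> openin (Z b) {z \<in> topspace (Z b). z \<in> V}"
  have "closedin ?S (topspace (Z b) - V)" for b
  proof -
   have "closedin (Z b) (topspace (Z b) - {z \<in> topspace (Z b). z \<in> V})" using V(2)[of b] by (simp add: openin_closedin_eq)
   moreover have "topspace (Z b) - {z \<in> topspace (Z b). z \<in> V} = topspace (Z b) - V" by blast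
   ultimately have "closedin (Z b) (topspace (Z b) - V)" by simp
   then show ?thesis
    using closedin_trans_full[of ?S "topspace ?S \<inter> H b", OF _ closed]
    by (simp add: Z_def subtopology_restrict)
  qed
  then have "closedin ?S ((topspace (Z True) - V) \<union> (topspace (Z False) - V))" by blast
  moreover have "(topspace (Z True) - V) \<union> (topspace (Z False) - V) = topspace ?S - V"
   using cover by (auto simp: Z_def)
  ultimately show "openin ?S V" using V(1) by (simp add: openin_closedin_eq)
 next
  fix b show "continuous_map (Z b) ?S (\<lambda>x. x)" unfolding Z_def by (simp add: continuous_map_from_subtopology)
  show "development (Z b) (u \<circ> (\<lambda>x. x)) \<gamma> (\<kappa>' \<circ> (\<lambda>x. x))" using d[of b] by (simp add: o_def)
 next
  fix z assume "z \<in> topspace ?S"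
  then obtain b where "z \<in> topspace (Z b)" using cover by blast
  then show "\<kappa>' z \<in> R" using d[of b] by (simp add: development_def)
 qed
 then show ?thesis by (rule that)
qed

end

section \<open>Inclusions of skeleta\<close>

lemma attaches_cells_subset: "attaches_cells n A Y I \<phi> ==> topspace A \<subseteq> topspace Y"
 by (simp add: attaches_cells_def)

lemma continuous_map_closedin_Int:
 assumes "topspace A \<subseteq> topspace Y" "!!C. closedin Y C ==> closedin A (C \<inter> topspace A)"
 shows "continuous_map A Y (\<lambda>x. x)"
 unfolding continuous_map_closedin
proof (intro conjI allI impI)
 show "(\<lambda>x. x) \<in> topspace A \<rightarrow> topspace Y" using assms(1) by auto
 fix C assume "closedin Y C"
 then have "closedin A (C \<inter> topspace A)" by (rule assms(2))
 then show "closedin A {x \<in> topspace A. x \<in> C}" by (simp add: Int_def conj_commute)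
qed

lemma attaches_cells_inclusion:
 assumes "attaches_cells n A Y I \<phi>"
 shows "continuous_map A Y (\<lambda>x. x)"
proof (rule continuous_map_closedin_Int[OF attaches_cells_subset[OF assms]])
 fix C assume "closedin Y C"
 then show "closedin A (C \<inter> topspace A)"
  using assms closedin_subset[of Y C] unfolding attaches_cells_def by blast
qed

lemma attaches_cells_subtopology:
 assumes "attaches_cells n A Y I \<phi>" "n >= 1"
 shows "subtopology Y (topspace A) = A"
proof -
 have AY: "topspace A \<subseteq> topspace Y" by (rule attaches_cells_subset[OF assms(1)])
 have "closedin (subtopology Y (topspace A)) C \<longleftrightarrow> closedin A C" for C
 proof
  assume "closedin (subtopology Y (topspace A)) C"
  then obtain D where "closedin Y D" "C = D \<inter> topspace A" by (auto simp: closedin_subtopology)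
  then show "closedin A C"
   using assms(1) closedin_subset[of Y D] unfolding attaches_cells_def by blast
 next
  assume C: "closedin A C"
  then have CA: "C \<subseteq> topspace A" by (rule closedin_subset)
  have "closedin (disc n) {x \<in> topspace (disc n). \<phi> i x \<in> C}" if i: "i \<in> I" for i
  proof -
   have cm: "continuous_map (bsphere n) A (\<phi> i)"
    using assms(1) i by (simp add: attaches_cells_def bsphere_def)
   have eq: "{x \<in> topspace (disc n). \<phi> i x \<in> C} = {x \<in> topspace (bsphere n). \<phi> i x \<in> C}"
   proof -
    have "\<phi> i x \<notin> C" if "x \<in> open_disc n" for x
     using assms(1) i that CA bij_betwE[of "\<lambda>(i, x). \<phi> i x" "I \<times> open_disc n" "topspace Y - topspace A"]
     by (fastforce simp: attaches_cells_def)
    then show ?thesis using disc_eq_open_disc_Un_nsphere[OF assms(2)] by (auto simp: bsphere_def)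
   qed
   have b: "bsphere n = subtopology (disc n) (topspace (bsphere n))"
   proof -
    obtain m where m: "n = Suc m" using assms(2) by (cases n) auto
    have "nsphere m = subtopology (Euclidean_space n) (topspace (nsphere m))"
     unfolding nsphere_def m by (simp add: subtopology_restrict)
    moreover have "topspace (nsphere m) \<subseteq> topspace (disc n)"
     using disc_eq_open_disc_Un_nsphere[OF assms(2)] m by auto
    moreover have "disc n = subtopology (Euclidean_space n) (topspace (disc n))"
     unfolding disc_def by (simp add: subtopology_restrict)
    ultimately show ?thesis
     by (metis bsphere_def diff_Suc_1 inf.absorb_iff2 m subtopology_subtopology)
   qed
   have "closedin (disc n) (topspace (bsphere n))"
   proof -
    have "closedin (disc n) {x \<in> topspace (disc n). rad n x \<in> {1}}"
     by (rule closedin_continuous_map_preimage[OF continuous_map_rad]) auto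
    moreover have "{x \<in> topspace (disc n). rad n x \<in> {1}} = topspace (bsphere n)"
     using assms(2) by (auto simp: bsphere_iff disc_iff)
    ultimately show ?thesis by simp
   qed
   moreover have "closedin (bsphere n) {x \<in> topspace (bsphere n). \<phi> i x \<in> C}"
    by (rule closedin_continuous_map_preimage[OF cm C])
   ultimately show ?thesis unfolding eq using closedin_trans_full b by metis
  qed
  moreover have "C \<inter> topspace A = C" using CA by auto
  moreover have "C \<subseteq> topspace Y" using CA AY by auto
  ultimately have "closedin Y C" using assms(1) C unfolding attaches_cells_def by simp
  then show "closedin (subtopology Y (topspace A)) C"
   using \<open>C \<inter> topspace A = C\<close> by (metis closedin_subtopology)
 qed
 moreover have "topspace (subtopology Y (topspace A)) = topspace A" using AY by auto
 ultimately show ?thesis by (simp add: topology_eq openin_closedin_eq)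
qed

lemma attaches_high_cells_inclusion:
 assumes "attaches_high_cells P X"
 shows "continuous_map P X (\<lambda>x. x)"
proof -
 obtain K where K: "K 2 = P" "topspace X = (\<Union>m\<in>{2::nat..}. topspace (K m))"
  and cl: "!!C. C \<subseteq> topspace X ==> closedin X C \<longleftrightarrow> (\<forall>m\<ge>2. closedin (K m) (C \<inter> topspace (K m)))"
  using assms unfolding attaches_high_cells_def by metis
 show ?thesis
 proof (rule continuous_map_closedin_Int)
  show "topspace P \<subseteq> topspace X" unfolding K(2) using K(1) by blast
  show "closedin P (C \<inter> topspace P)" if "closedin X C" for C
   using cl[OF closedin_subset[OF that]] that K(1) by auto
 qed
qed

context holonomy
begin

lemma extend_over_high_cell:
 assumes att: "attaches_cells (Suc m) A Y J (\<lambda>f. f)" and m: "m >= 2" and \<gamma>: "local_cocycle A \<gamma>"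
 obtains \<gamma>' where "local_cocycle Y \<gamma>'"
  "!!x y. x \<in> topspace A ==> y \<in> topspace A ==> \<gamma>' x y = \<gamma> x y"
  "!!W. openin A W ==> strict \<gamma> W ==> \<exists>W'. openin Y W' \<and> W' \<inter> topspace A = W \<and> strict \<gamma>' W'"
proof -
 obtain m' where m': "m = Suc (Suc m')" using m by (metis Suc_le_D numeral_2_eq_2 le_Suc_ex add_Suc)
 have "\<exists>k. development (bsphere (Suc m)) f \<gamma> k" if "f \<in> J" for f
 proof -
  have "continuous_map (nsphere (Suc (Suc m'))) A f"
   using att that by (simp add: attaches_cells_def m')
  then show ?thesis
   using development_nsphere[OF \<gamma>] by (metis bsphere_def diff_Suc_1 m')
 qed
 then obtain k where k: "!!f. f \<in> J ==> development (bsphere (Suc m)) f \<gamma> (k f)" by metis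
 show ?thesis
  by (rule extend_over_cells[OF att _ \<gamma> k]) (simp, assumption, rule that)
qed

text \<open>Cells of dimension at least 3 have simply connected attaching spheres, so every
  extension step is possible. The work lies in the limit: local triviality at a point needs one open
  set of the colimit.\<close>

theorem extend_over_high_cells:
 assumes X: "attaches_high_cells P X" and \<gamma>: "local_cocycle P \<gamma>"
 obtains \<gamma>' where "local_cocycle X \<gamma>'"
  "!!x y. x \<in> topspace P ==> y \<in> topspace P ==> \<gamma>' x y = \<gamma> x y"
proof -
 obtain K' where K': "K' 2 = P" "topspace X = (\<Union>m\<in>{2::nat..}. topspace (K' m))"
  and att': "\<forall>m\<ge>2. \<exists>J. attaches_cells (Suc m) (K' m) (K' (Suc m)) J (\<lambda>f. f)"
  and cl': "!!C. C \<subseteq> topspace X ==> closedin X C \<longleftrightarrow> (\<forall>m\<ge>2. closedin (K' m) (C \<inter> topspace (K' m)))"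
  using X unfolding attaches_high_cells_def by metis
 define K where "K = (\<lambda>n. K' (n + 2))"
 have att: "\<exists>J. attaches_cells (Suc (n + 2)) (K n) (K (Suc n)) J (\<lambda>f. f)" for n
  using att'[rule_format, of "n + 2"] by (simp add: K_def)
 have TX: "topspace X = (\<Union>n. topspace (K n))"
  unfolding K'(2) K_def
 proof (intro equalityI subsetI)
  fix x assume "x \<in> (\<Union>m\<in>{2..}. topspace (K' m))"
  then obtain m where "m >= 2" "x \<in> topspace (K' m)" by auto
  then show "x \<in> (\<Union>n. topspace (K' (n + 2)))" by (intro UN_I[of "m - 2"]) (auto simp: le_add_diff_inverse2 simp del: add_2_eq_Suc')
 qed auto
 have K_mono: "topspace (K n) \<subseteq> topspace (K (Suc n))" for n
 proof -
  obtain J where "attaches_cells (Suc (n + 2)) (K n) (K (Suc n)) J (\<lambda>f. f)" using att by blast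
  then show ?thesis by (rule attaches_cells_subset)
 qed
 have K_le: "topspace (K m) \<subseteq> topspace (K n)" if "m <= n" for m n
  by (rule lift_Suc_mono_le[of "\<lambda>n. topspace (K n)", OF K_mono that])
 have op: "openin X W" if W: "W \<subseteq> topspace X" "!!n. openin (K n) (W \<inter> topspace (K n))" for W
 proof -
  have "closedin (K' m) ((topspace X - W) \<inter> topspace (K' m))" if m: "m >= 2" for m
  proof -
   have "K' m = K (m - 2)" using m by (simp add: K_def del: add_2_eq_Suc')
   moreover have "(topspace X - W) \<inter> topspace (K n) = topspace (K n) - W \<inter> topspace (K n)" for n
    using TX by auto
   moreover have "closedin (K n) (topspace (K n) - W \<inter> topspace (K n))" for n
    using W(2)[of n] by blast
   ultimately show ?thesis by simp
  qed
  then have "closedin X (topspace X - W)" using cl'[of "topspace X - W"] by blast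
  then show ?thesis using W(1) by (simp add: openin_closedin_eq)
 qed
 define ext where "ext = (\<lambda>n (\<gamma> :: _ => _ => 'h) \<gamma>'. (\<forall>x\<in>topspace (K n). \<forall>y\<in>topspace (K n). \<gamma>' x y = \<gamma> x y) \<and>
   (\<forall>W. openin (K n) W --> strict \<gamma> W --> (\<exists>W'. openin (K (Suc n)) W' \<and> W' \<inter> topspace (K n) = W \<and> strict \<gamma>' W')))"
 have "\<exists>G. \<forall>n. (local_cocycle (K n) (G n) \<and> (n = 0 --> G n = \<gamma>)) \<and> ext n (G n) (G (Suc n))"
 proof (rule dependent_nat_choice)
  show "\<exists>g. local_cocycle (K 0) g \<and> (0 = 0 --> g = \<gamma>)" using \<gamma> K'(1) by (simp add: K_def numeral_2_eq_2)
  fix g n assume g: "local_cocycle (K n) g \<and> (n = (0::nat) --> g = \<gamma>)"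
  obtain J where J: "attaches_cells (Suc (n + 2)) (K n) (K (Suc n)) J (\<lambda>f. f)" using att by blast
  obtain g' where g': "local_cocycle (K (Suc n)) g'"
   "!!x y. x \<in> topspace (K n) ==> y \<in> topspace (K n) ==> g' x y = g x y"
   "!!W. openin (K n) W ==> strict g W ==> \<exists>W'. openin (K (Suc n)) W' \<and> W' \<inter> topspace (K n) = W \<and> strict g' W'"
   by (rule extend_over_high_cell[OF J _ conjunct1[OF g]]) auto
  show "\<exists>g'. (local_cocycle (K (Suc n)) g' \<and> (Suc n = 0 --> g' = \<gamma>)) \<and> ext n g g'"
   unfolding ext_def using g' by (intro exI[of _ g']) simp
 qed
 then obtain G where G: "!!n. local_cocycle (K n) (G n)" "G 0 = \<gamma>" and ext: "!!n. ext n (G n) (G (Suc n))"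
  by blast
 have G_le: "G n x y = G m x y" if "m <= n" "x \<in> topspace (K m)" "y \<in> topspace (K m)" for m n x y
  using that(1)
 proof (induction rule: dec_induct)
  case (step k)
  then have "x \<in> topspace (K k)" "y \<in> topspace (K k)" using K_le[of m k] that by auto
  then show ?case using step ext[of k] by (simp add: ext_def)
 qed simp
 \<comment> \<open>By \<open>G_le\<close> any later stage gives the same value, so the least stage
   is merely a definite choice.\<close>
 define g where "g = (\<lambda>x y. if x \<in> topspace X \<and> y \<in> topspace X
  then G (LEAST n. x \<in> topspace (K n) \<and> y \<in> topspace (K n)) x y else 0)"
 have g: "g x y = G n x y" if "x \<in> topspace (K n)" "y \<in> topspace (K n)" for n x y
 proof -
  define l where "l = (LEAST n. x \<in> topspace (K n) \<and> y \<in> topspace (K n))"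
  have "x \<in> topspace (K l) \<and> y \<in> topspace (K l)" unfolding l_def by (rule LeastI[of _ n]) (use that in blast)
  moreover have "l <= n" unfolding l_def by (rule Least_le) (use that in blast)
  moreover have "x \<in> topspace X" "y \<in> topspace X" using that TX by auto
  ultimately show ?thesis using G_le[of l n x y] by (simp add: g_def l_def[symmetric])
 qed
 have gR: "g x y \<in> R" for x y
  using G(1) subgroup_setD(1)[OF R] by (simp add: g_def local_cocycle_def)
 have "local_cocycle X g"
  unfolding local_cocycle_def
 proof (intro conjI allI ballI gR)
  fix p assume "p \<in> topspace X"
  then obtain m where m: "p \<in> topspace (K m)" using TX by blast
  obtain W0 where W0: "openin (K m) W0" "p \<in> W0" "strict (G m) W0" using local_cocycleE[OF G(1) m] by metis
  \<comment> \<open>A strict neighbourhood is prolonged from skeleton to skeleton. It meets each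
    earlier skeleton in the set chosen there, so the union has open traces on all skeleta and is
    open.\<close>
  have "\<exists>W. \<forall>n. ((openin (K (m + n)) (W n) \<and> strict (G (m + n)) (W n)) \<and> (n = 0 --> W n = W0)) \<and>
    W (Suc n) \<inter> topspace (K (m + n)) = W n"
  proof (rule dependent_nat_choice)
   show "\<exists>W. (openin (K (m + 0)) W \<and> strict (G (m + 0)) W) \<and> (0 = 0 --> W = W0)" using W0 by auto
   fix W n assume "(openin (K (m + n)) W \<and> strict (G (m + n)) W) \<and> (n = 0 --> W = W0)"
   then obtain W' where "openin (K (Suc (m + n))) W'" "W' \<inter> topspace (K (m + n)) = W" "strict (G (Suc (m + n))) W'"
    using ext[of "m + n"] unfolding ext_def by metis
   then show "\<exists>W'. ((openin (K (m + Suc n)) W' \<and> strict (G (m + Suc n)) W') \<and> (Suc n = 0 --> W' = W0)) \<and>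
     W' \<inter> topspace (K (m + n)) = W" by auto
  qed
  then obtain W where W: "!!n. openin (K (m + n)) (W n)" "!!n. strict (G (m + n)) (W n)" "W 0 = W0"
   and WS: "!!n. W (Suc n) \<inter> topspace (K (m + n)) = W n" by blast
  have Wmono: "W i \<subseteq> W j" if "i <= j" for i j
   using lift_Suc_mono_le[of W, OF _ that] WS by blast
  have WK: "W i \<subseteq> topspace (K (m + i))" for i using W(1)[of i] by (rule openin_subset)
  have Wle: "W j \<inter> topspace (K (m + i)) = W i" if "i <= j" for i j
   using that
  proof (induction rule: dec_induct)
   case base
   show ?case using WK[of i] by blast
  next
   case (step j)
   have "topspace (K (m + i)) \<subseteq> topspace (K (m + j))" using K_le step by simp
   then show ?case using WS[of j] step by blast
  qed
  have "openin X (\<Union>n. W n)"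
  proof (rule op)
   show "(\<Union>n. W n) \<subseteq> topspace X" using WK TX by blast
   fix n
   have main: "openin (K (m + i)) ((\<Union>n. W n) \<inter> topspace (K (m + i)))" for i
   proof -
    have "W j \<inter> topspace (K (m + i)) \<subseteq> W i" for j
     using Wle[of i j] Wmono[of j i] by (cases "i <= j") auto
    then have "(\<Union>n. W n) \<inter> topspace (K (m + i)) = W i" using WK[of i] by blast
    then show ?thesis using W(1) by simp
   qed
   show "openin (K n) ((\<Union>n. W n) \<inter> topspace (K n))"
   proof (cases "m <= n")
    case True
    then show ?thesis using main[of "n - m"] by simp
   next
    case False
    have "continuous_map (K n) (K m) (\<lambda>x. x)"
     using False
    proof (induction m rule: nat_induct)
     case (Suc m)
     obtain J where "attaches_cells (Suc (m + 2)) (K m) (K (Suc m)) J (\<lambda>f. f)" using att by blast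
     then have i: "continuous_map (K m) (K (Suc m)) (\<lambda>x. x)" by (rule attaches_cells_inclusion)
     show ?case
     proof (cases "n = m")
      case False
      then have "continuous_map (K n) (K m) (\<lambda>x. x)" using Suc by simp
      then show ?thesis using i continuous_map_compose[of "K n" "K m" "\<lambda>x. x" "K (Suc m)" "\<lambda>x. x"] by (simp add: o_def)
     qed (use i in simp)
    qed simp
    from openin_continuous_map_preimage[OF this main[of 0, simplified]]
    have "openin (K n) {x \<in> topspace (K n). x \<in> (\<Union>n. W n) \<inter> topspace (K m)}" .
    moreover have "{x \<in> topspace (K n). x \<in> (\<Union>n. W n) \<inter> topspace (K m)} = (\<Union>n. W n) \<inter> topspace (K n)"
     using K_le[of n m] False by auto
    ultimately show ?thesis by simp
   qed
  qed
  moreover have "p \<in> (\<Union>n. W n)" using W0(2) W(3) by blast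
  moreover have "strict g (\<Union>n. W n)"
   unfolding strict_def
  proof (intro ballI)
   fix x y z assume "x \<in> (\<Union>n. W n)" "y \<in> (\<Union>n. W n)" "z \<in> (\<Union>n. W n)"
   then obtain i j k where "x \<in> W i" "y \<in> W j" "z \<in> W k" by blast
   then have in_W: "x \<in> W (i + j + k)" "y \<in> W (i + j + k)" "z \<in> W (i + j + k)"
    using Wmono[of i "i + j + k"] Wmono[of j "i + j + k"] Wmono[of k "i + j + k"] by auto
   define l where "l = i + j + k"
   have "x \<in> topspace (K (m + l))" "y \<in> topspace (K (m + l))" "z \<in> topspace (K (m + l))"
    using in_W WK[of l] by (auto simp: l_def)
   then show "g x y + g y z = g x z"
    using strictD[OF W(2)[of l], of x y z] in_W by (simp add: g l_def)
  qed
  ultimately show "\<exists>W. openin X W \<and> p \<in> W \<and> strict g W" by blast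
 qed
 moreover have "g x y = \<gamma> x y" if "x \<in> topspace P" "y \<in> topspace P" for x y
  using g[of x 0 y] that K'(1) G(2) by (simp add: K_def numeral_2_eq_2)
 ultimately show ?thesis by (rule that)
qed

end

section \<open>Holonomy of singular simplices\<close>

abbreviation simplex_top :: "nat => (nat => real) topology" where
 "simplex_top p \<equiv> subtopology (powertop_real UNIV) (standard_simplex p)"

definition vert :: "nat => nat => real" where
 "vert i = (\<lambda>j. if j = i then 1 else 0)"

lemma vert_in [simp]: "i <= p ==> vert i \<in> standard_simplex p"
 by (simp add: vert_def)

lemma simplical_face_vert: "simplical_face k (vert i) = vert (if i < k then i else Suc i)"
 by (rule ext) (auto simp: simplical_face_def vert_def)

lemma continuous_map_coord: "continuous_map (subtopology (powertop_real UNIV) A) euclideanreal (\<lambda>x. x i)"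
 by (rule continuous_map_from_subtopology) (rule continuous_map_product_projection, simp)

lemma continuous_map_simplical_face:
 assumes "1 <= p" "k <= p"
 shows "continuous_map (simplex_top (p - Suc 0)) (simplex_top p) (simplical_face k)"
proof -
 have "continuous_map (simplex_top (p - Suc 0)) euclideanreal (\<lambda>x. simplical_face k x i)" for i
  by (simp add: simplical_face_def continuous_map_coord)
 then show ?thesis
  using simplical_face_in_standard_simplex[OF assms]
  by (auto simp: continuous_map_in_subtopology continuous_map_componentwise_UNIV Pi_iff)
qed

lemma contractible_convex:
 assumes A: "a \<in> A" "!!x t. x \<in> A ==> 0 <= t ==> t <= 1 ==> (\<lambda>i. (1 - t) * x i + t * a i) \<in> A"
 shows "contractible_space (subtopology (powertop_real UNIV) A)"
proof -
 let ?Z = "subtopology (powertop_real UNIV) A"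
 let ?h = "\<lambda>(t::real, x) i. (1 - t) * x i + t * a i"
 have "continuous_map (prod_topology (top_of_set {0..1::real}) ?Z) euclideanreal
    (\<lambda>z. (1 - fst z) * snd z i + fst z * a i)" for i
 proof -
  have "continuous_map (prod_topology (top_of_set {0..1::real}) ?Z) euclideanreal fst"
   using continuous_map_fst[of "top_of_set {0..1::real}" ?Z] by (simp add: continuous_map_in_subtopology)
  moreover have "continuous_map (prod_topology (top_of_set {0..1}) ?Z) euclideanreal (\<lambda>z. snd z i)"
   using continuous_map_compose[OF continuous_map_snd continuous_map_coord] by (simp add: o_def)
  ultimately show ?thesis by (intro continuous_intros) auto
 qed
 then have "continuous_map (prod_topology (top_of_set {0..1::real}) ?Z) ?Z ?h"
  using A(2) by (auto simp: continuous_map_in_subtopology continuous_map_componentwise_UNIV Pi_iff case_prod_unfold)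
 then have "homotopic_with (\<lambda>x. True) ?Z ?Z id (\<lambda>x. a)"
  unfolding homotopic_with_def by (intro exI[of _ ?h]) auto
 then show ?thesis unfolding contractible_space_def by blast
qed

lemma contractible_simplex_top: "contractible_space (simplex_top p)"
 by (rule contractible_convex[of "vert 0"]) (auto intro: convex_standard_simplex)

lemma connected_simplex_top: "connected_space (simplex_top p)"
 using connectedin_standard_simplex[of p] by (simp add: connectedin_def)

lemma simplex1_eqI:
 assumes "x \<in> standard_simplex 1"
 shows "x = (\<lambda>i. if i = 0 then 1 - x 1 else if i = 1 then x 1 else 0)" "0 <= x 1" "x 1 <= 1"
proof -
 have "x 0 + x 1 = 1" "!!i. i > 1 ==> x i = 0" using assms by (auto simp: standard_simplex_def)
 then show "x = (\<lambda>i. if i = 0 then 1 - x 1 else if i = 1 then x 1 else 0)" by (auto simp: fun_eq_iff)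
 show "0 <= x 1" "x 1 <= 1" using assms by (auto simp: standard_simplex_def)
qed

lemma singular_face_apply:
 "x \<in> standard_simplex (p - Suc 0) ==> singular_face p k f x = f (simplical_face k x)"
 by (simp add: singular_face_def)

lemma singular_face_face:
 assumes "2 <= p" "k <= p - 1" "l <= k"
 shows "singular_face (p - Suc 0) k (singular_face p l f) = singular_face (p - Suc 0) l (singular_face p (Suc k) f)"
proof
 fix x :: "nat => real"
 show "singular_face (p - Suc 0) k (singular_face p l f) x = singular_face (p - Suc 0) l (singular_face p (Suc k) f) x"
 proof (cases "x \<in> standard_simplex (p - Suc 0 - Suc 0)")
  case True
  have "simplical_face l (simplical_face k x) = simplical_face (Suc k) (simplical_face l x)"
   using assms(3) by (auto simp: simplical_face_def fun_eq_iff)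
  moreover have "simplical_face k x \<in> standard_simplex (p - Suc 0)" "simplical_face l x \<in> standard_simplex (p - Suc 0)"
   using assms True by (auto intro!: simplical_face_in_standard_simplex)
  ultimately show ?thesis using True by (simp add: singular_face_apply)
 qed (simp add: singular_face_def)
qed

context holonomy
begin

definition hol :: "('x => 'x => 'h) => ((nat => real) => 'x) => 'h" where
 "hol \<gamma> \<sigma> = (THE g. \<exists>\<kappa>. development (simplex_top 1) \<sigma> \<gamma> \<kappa> \<and> g = - \<kappa> (vert 0) + \<kappa> (vert 1))"

lemma hol_eq:
 assumes "development (simplex_top 1) \<sigma> \<gamma> \<kappa>"
 shows "hol \<gamma> \<sigma> = - \<kappa> (vert 0) + \<kappa> (vert 1)"
 unfolding hol_def
proof (rule the_equality)
 show "\<exists>\<kappa>'. development (simplex_top 1) \<sigma> \<gamma> \<kappa>' \<and> - \<kappa> (vert 0) + \<kappa> (vert 1) = - \<kappa>' (vert 0) + \<kappa>' (vert 1)"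
  using assms by blast
 fix g assume "\<exists>\<kappa>'. development (simplex_top 1) \<sigma> \<gamma> \<kappa>' \<and> g = - \<kappa>' (vert 0) + \<kappa>' (vert 1)"
 then obtain \<kappa>' where "development (simplex_top 1) \<sigma> \<gamma> \<kappa>'" "g = - \<kappa>' (vert 0) + \<kappa>' (vert 1)" by blast
 then show "g = - \<kappa> (vert 0) + \<kappa> (vert 1)"
  using development_unique[OF _ assms connected_simplex_top] by simp
qed

lemma development_simplex:
 assumes "local_cocycle Y \<gamma>" "singular_simplex p Y \<sigma>"
 obtains \<kappa> where "development (simplex_top p) \<sigma> \<gamma> \<kappa>"
 using assms(2) development_contractible[OF assms(1) _ contractible_simplex_top] that
 unfolding singular_simplex_def by blast

lemma hol_in_R:
 assumes "local_cocycle Y \<gamma>" "singular_simplex 1 Y \<sigma>"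
 shows "hol \<gamma> \<sigma> \<in> R"
proof -
 obtain \<kappa> where \<kappa>: "development (simplex_top 1) \<sigma> \<gamma> \<kappa>" by (rule development_simplex[OF assms])
 then have "\<kappa> (vert 0) \<in> R" "\<kappa> (vert 1) \<in> R" by (auto simp: development_def)
 then show ?thesis unfolding hol_eq[OF \<kappa>] by (intro subgroup_setD(2,3)[OF R])
qed

lemma development_restrict:
 "development (simplex_top p) (restrict u (standard_simplex p)) \<gamma> \<kappa> \<longleftrightarrow> development (simplex_top p) u \<gamma> \<kappa>"
 by (intro iffI; erule development_cong; simp)

lemma hol_face:
 assumes "development (simplex_top 2) \<sigma> \<gamma> \<kappa>" "k <= 2"
 shows "hol \<gamma> (singular_face 2 k \<sigma>) = - \<kappa> (simplical_face k (vert 0)) + \<kappa> (simplical_face k (vert 1))"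
proof -
 have c: "continuous_map (simplex_top 1) (simplex_top 2) (simplical_face k)"
  using continuous_map_simplical_face[of 2 k] assms(2) by simp
 have "development (simplex_top 1) (singular_face 2 k \<sigma>) \<gamma> (\<kappa> \<circ> simplical_face k)"
  using development_compose[OF assms(1) c] by (simp add: singular_face_def development_restrict)
 then show ?thesis by (simp add: hol_eq)
qed

text \<open>The faces 2, 0 and 1 run from vertex 0 to 1, from 1 to 2 and from 0 to 2. One
  development on the contractible simplex computes all three.\<close>

lemma hol_triangle:
 assumes "local_cocycle Y \<gamma>" "singular_simplex 2 Y \<sigma>"
 shows "hol \<gamma> (singular_face 2 2 \<sigma>) + hol \<gamma> (singular_face 2 0 \<sigma>) = hol \<gamma> (singular_face 2 1 \<sigma>)"
proof -
 obtain \<kappa> where \<kappa>: "development (simplex_top 2) \<sigma> \<gamma> \<kappa>" by (rule development_simplex[OF assms])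
 show ?thesis
  by (simp add: hol_face[OF \<kappa>] simplical_face_vert group_add_simps del: add_uminus_conv_diff)
qed

lemma hol_const:
 assumes "local_cocycle Y \<gamma>" "y \<in> topspace Y"
 shows "hol \<gamma> (restrict (\<lambda>_. y) (standard_simplex 1)) = 0"
proof -
 obtain W where W: "y \<in> W" "strict \<gamma> W" by (rule local_cocycleE[OF assms])
 have "development (simplex_top 1) (\<lambda>_. y) \<gamma> (\<lambda>_. 0)"
  unfolding development_def
  using strict_refl[OF W(2,1)] subgroup_setD(1)[OF R]
  by (intro conjI ballI exI[of _ "topspace (simplex_top 1)"] openin_topspace) auto
 then have "development (simplex_top 1) (restrict (\<lambda>_. y) (standard_simplex 1)) \<gamma> (\<lambda>_. 0)"
  by (simp only: development_restrict)
 then show ?thesis by (simp add: hol_eq)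
qed

end

section \<open>Evaluating cochains on real chains\<close>

definition chain_eval :: "(((nat => real) => 'x) => real) => 'x real_chain => real" where
 "chain_eval f c = (\<Sum>\<sigma>\<in>Poly_Mapping.keys c. Poly_Mapping.lookup c \<sigma> * f \<sigma>)"

text \<open>Indexed by the degree of the result, so that it is dual to the boundary of degree
  \<open>p\<close> without a sign.\<close>

definition coboundary :: "nat => (((nat => real) => 'x) => real) => ((nat => real) => 'x) => real" where
 "coboundary p f \<sigma> = (\<Sum>k\<le>p. (- 1) ^ k * f (singular_face p k \<sigma>))"

lemma chain_eval_superset:
 assumes "finite A" "Poly_Mapping.keys c \<subseteq> A"
 shows "chain_eval f c = (\<Sum>\<sigma>\<in>A. Poly_Mapping.lookup c \<sigma> * f \<sigma>)"
 unfolding chain_eval_def by (rule sum.mono_neutral_left[OF assms]) (auto simp: in_keys_iff)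

lemma chain_eval_add: "chain_eval f (c + d) = chain_eval f c + chain_eval f d"
proof -
 let ?A = "Poly_Mapping.keys c \<union> Poly_Mapping.keys d"
 have "Poly_Mapping.keys (c + d) \<subseteq> ?A" by (rule Poly_Mapping.keys_add)
 then show ?thesis
  using chain_eval_superset[of ?A "c + d" f] chain_eval_superset[of ?A c f] chain_eval_superset[of ?A d f]
  by (simp add: lookup_add algebra_simps sum.distrib)
qed

lemma chain_eval_0 [simp]: "chain_eval f 0 = 0"
 by (simp add: chain_eval_def)

lemma chain_eval_minus: "chain_eval f (- c) = - chain_eval f c"
 using chain_eval_add[of f c "- c"] by simp

lemma chain_eval_diff: "chain_eval f (c - d) = chain_eval f c - chain_eval f d"
 using chain_eval_add[of f c "- d"] by (simp add: chain_eval_minus)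

lemma chain_eval_sum: "chain_eval f (\<Sum>i\<in>I. c i) = (\<Sum>i\<in>I. chain_eval f (c i))"
 by (induction I rule: infinite_finite_induct) (auto simp: chain_eval_add)

lemma chain_eval_single [simp]: "chain_eval f (Poly_Mapping.single \<sigma> a) = a * f \<sigma>"
 by (simp add: chain_eval_def)

lemma chain_eval_boundary:
 "p > 0 ==> chain_eval f (real_chain_boundary p c) = chain_eval (coboundary p f) c"
 unfolding real_chain_boundary_def chain_eval_def[of "coboundary p f"]
 by (simp add: chain_eval_sum coboundary_def sum_distrib_left mult_ac)

lemma chain_eval_cong:
 "(!!\<sigma>. \<sigma> \<in> Poly_Mapping.keys c ==> f \<sigma> = g \<sigma>) ==> chain_eval f c = chain_eval g c"
 by (simp add: chain_eval_def)

lemma chain_eval_bound: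
 assumes "!!\<sigma>. \<sigma> \<in> Poly_Mapping.keys c ==> \<bar>f \<sigma>\<bar> <= 1"
 shows "\<bar>chain_eval f c\<bar> <= l1_norm c"
proof -
 have "\<bar>chain_eval f c\<bar> <= (\<Sum>\<sigma>\<in>Poly_Mapping.keys c. \<bar>Poly_Mapping.lookup c \<sigma> * f \<sigma>\<bar>)"
  unfolding chain_eval_def by (rule sum_abs)
 also have "\<dots> <= l1_norm c"
  unfolding l1_norm_def
  by (rule sum_mono) (use assms in \<open>simp add: abs_mult mult_left_le\<close>)
 finally show ?thesis .
qed

abbreviation real_of_chain :: "'x chain => 'x real_chain" where
 "real_of_chain \<equiv> Poly_Mapping.map real_of_int"

lemma lookup_real_of_chain [simp]: "Poly_Mapping.lookup (real_of_chain c) \<sigma> = real_of_int (Poly_Mapping.lookup c \<sigma>)"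
 by (simp add: Poly_Mapping.map.rep_eq when_def)

lemma keys_real_of_chain [simp]: "Poly_Mapping.keys (real_of_chain c) = Poly_Mapping.keys c"
 by (auto simp: in_keys_iff)

lemma real_of_chain_add: "real_of_chain (c + d) = real_of_chain c + real_of_chain d"
 by (rule poly_mapping_eqI) (simp add: lookup_add)

lemma real_of_chain_diff: "real_of_chain (c - d) = real_of_chain c - real_of_chain d"
 by (rule poly_mapping_eqI) (simp add: lookup_minus)

definition int_eval :: "(((nat => real) => 'x) => real) => 'x chain => real" where
 "int_eval f c = chain_eval f (real_of_chain c)"

lemma int_eval_0 [simp]: "int_eval f 0 = 0"
 by (simp add: int_eval_def chain_eval_def)

lemma int_eval_add: "int_eval f (c + d) = int_eval f c + int_eval f d"
 by (simp add: int_eval_def real_of_chain_add chain_eval_add)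

lemma int_eval_diff: "int_eval f (c - d) = int_eval f c - int_eval f d"
 by (simp add: int_eval_def real_of_chain_diff chain_eval_diff)

lemma int_eval_cmul: "int_eval f (frag_cmul k c) = of_int k * int_eval f c"
proof -
 have "Poly_Mapping.keys (frag_cmul k c) \<subseteq> Poly_Mapping.keys c" by (auto simp: in_keys_iff)
 then have "int_eval f (frag_cmul k c) = (\<Sum>\<sigma>\<in>Poly_Mapping.keys c. Poly_Mapping.lookup (real_of_chain (frag_cmul k c)) \<sigma> * f \<sigma>)"
  unfolding int_eval_def by (intro chain_eval_superset) auto
 then show ?thesis by (simp add: int_eval_def chain_eval_def sum_distrib_left mult.assoc)
qed

lemma int_eval_of [simp]: "int_eval f (frag_of \<sigma>) = f \<sigma>"
 by (simp add: int_eval_def chain_eval_def)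

lemma int_eval_boundary: "p > 0 ==> int_eval f (chain_boundary p c) = int_eval (coboundary p f) c"
 unfolding int_eval_def real_chain_boundary_of_int[symmetric] by (rule chain_eval_boundary)

lemma int_eval_cong:
 "(!!\<sigma>. \<sigma> \<in> Poly_Mapping.keys c ==> f \<sigma> = g \<sigma>) ==> int_eval f c = int_eval g c"
 by (simp add: int_eval_def chain_eval_def)

lemma int_eval_Ints:
 assumes "!!\<sigma>. \<sigma> \<in> Poly_Mapping.keys c ==> f \<sigma> \<in> \<int>"
 shows "int_eval f c \<in> \<int>"
 using assms unfolding int_eval_def chain_eval_def by (auto intro!: Ints_sum Ints_mult)

lemma coboundary_2: "coboundary 2 f \<sigma> = f (singular_face 2 0 \<sigma>) - f (singular_face 2 1 \<sigma>) + f (singular_face 2 2 \<sigma>)"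
 by (simp add: coboundary_def numeral_2_eq_2)

lemma coboundary_3: "coboundary 3 f \<sigma> = f (singular_face 3 0 \<sigma>) - f (singular_face 3 1 \<sigma>)
  + f (singular_face 3 2 \<sigma>) - f (singular_face 3 3 \<sigma>)"
 by (simp add: coboundary_def numeral_3_eq_3 numeral_2_eq_2)

context holonomy
begin

text \<open>The holonomies of the edges turn singular simplices into bar simplices, so a 2-cocycle
  on the group pulls back to a singular one.\<close>

lemma hol_cocycle:
 assumes \<gamma>: "local_cocycle Y \<gamma>" and s: "singular_simplex 3 Y s"
  and b: "!!g h k. g \<in> R ==> h \<in> R ==> k \<in> R ==> b h k - b (g + h) k + b g (h + k) - b g h = 0"
 shows "coboundary 3 (\<lambda>\<sigma>. b (hol \<gamma> (singular_face 2 2 \<sigma>)) (hol \<gamma> (singular_face 2 0 \<sigma>))) s = 0"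
proof -
 have ff: "singular_face 2 k (singular_face 3 l s) = singular_face 2 l (singular_face 3 (Suc k) s)"
  if "l <= k" "k <= 2" for k l
  using singular_face_face[of 3 k l s] that by simp
 have sk: "singular_simplex 2 Y (singular_face 3 k s)" if "k <= 3" for k
  using singular_simplex_singular_face[OF s, of k] that by simp
 have "singular_simplex 1 Y (singular_face 2 k (singular_face 3 l s))" if "k <= 2" "l <= 3" for k l
  using singular_simplex_singular_face[OF sk[OF that(2)], of k] that by simp
 then have R': "hol \<gamma> (singular_face 2 k (singular_face 3 l s)) \<in> R" if "k <= 2" "l <= 3" for k l
  using hol_in_R[OF \<gamma>] that by blast
 let ?h = "\<lambda>k l. hol \<gamma> (singular_face 2 k (singular_face 3 l s))"
 have "?h 2 1 = ?h 1 3" "?h 2 2 = ?h 2 3" "?h 2 0 = ?h 0 3" "?h 0 1 = ?h 0 0" "?h 1 0 = ?h 0 2"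
  using ff[of 1 2] ff[of 2 2] ff[of 0 2] ff[of 0 0] ff[of 0 1] by (simp_all add: numeral_3_eq_3 numeral_2_eq_2)
 moreover have "?h 2 3 + ?h 0 3 = ?h 1 3" "?h 2 0 + ?h 0 0 = ?h 1 0"
  using hol_triangle[OF \<gamma> sk[of 3]] hol_triangle[OF \<gamma> sk[of 0]] by simp_all
 ultimately show ?thesis
  unfolding coboundary_3 using b[of "?h 2 3" "?h 0 3" "?h 0 0"] R'[of 2 3] R'[of 0 3] R'[of 0 0]
  by simp
qed

end

section \<open>Orientations of the disc\<close>

lemma homologous_rel_set_mult:
 "homologous_rel_set p X T a \<otimes>\<^bsub>relative_homology_group (int p) X T\<^esub> homologous_rel_set p X T b =
   homologous_rel_set p X T (a + b)"
 unfolding mult_relative_homology_group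
proof (intro equalityI subsetI)
 fix x assume "x \<in> (\<Union>r\<in>homologous_rel_set p X T a. \<Union>s\<in>homologous_rel_set p X T b. {r + s})"
 then show "x \<in> homologous_rel_set p X T (a + b)" by (auto intro: homologous_rel_add)
next
 fix x assume "x \<in> homologous_rel_set p X T (a + b)"
 then have "homologous_rel p X T b (x - a)" by (simp add: homologous_rel_def algebra_simps)
 then show "x \<in> (\<Union>r\<in>homologous_rel_set p X T a. \<Union>s\<in>homologous_rel_set p X T b. {r + s})"
  by (intro UN_I[of a] UN_I[of "x - a"]) auto
qed

lemma frag_cmul_diff: "frag_cmul k (a - b) = frag_cmul k a - frag_cmul k b"
 by (rule poly_mapping_eqI) (simp add: lookup_minus algebra_simps)

lemma homologous_rel_cmul:
 "homologous_rel p X T a b ==> homologous_rel p X T (frag_cmul k a) (frag_cmul k b)"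
 using singular_relboundary_cmul[of p X T "a - b" k] by (simp add: homologous_rel_def frag_cmul_diff)

text \<open>Translates generation of the homology group by one class into a statement about cycles;
  the multiples of \<open>w\<close> form a subgroup.\<close>

lemma homologous_rel_generator:
 assumes w: "singular_relcycle p X T w" and c: "singular_relcycle p X T c"
  and gen: "subgroup_generated (relative_homology_group (int p) X T) {homologous_rel_set p X T w} =
   relative_homology_group (int p) X T"
 obtains k where "homologous_rel p X T c (frag_cmul k w)"
proof -
 let ?H = "relative_homology_group (int p) X T"
 let ?C = "range (\<lambda>k. homologous_rel_set p X T (frag_cmul k w))"
 have car: "homologous_rel_set p X T a \<in> carrier ?H" if "singular_relcycle p X T a" for a
  using that by (simp add: carrier_relative_homology_group)
 have wk: "singular_relcycle p X T (frag_cmul k w)" for k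
  using w by (rule singular_relcycle_cmul)
 have "subgroup ?C ?H"
 proof (rule group.subgroupI)
  show "?C \<subseteq> carrier ?H" using car[OF wk] by blast
  show "inv\<^bsub>?H\<^esub> a \<in> ?C" if "a \<in> ?C" for a
  proof -
   obtain k where a: "a = homologous_rel_set p X T (frag_cmul k w)" using \<open>a \<in> ?C\<close> by blast
   have "homologous_rel_set p X T (frag_cmul (- k) w) \<otimes>\<^bsub>?H\<^esub> a = \<one>\<^bsub>?H\<^esub>"
    unfolding a homologous_rel_set_mult
    by (simp add: homologous_rel_set_eq_relboundary frag_cmul_distrib[symmetric])
   then have "inv\<^bsub>?H\<^esub> a = homologous_rel_set p X T (frag_cmul (- k) w)"
    unfolding a by (intro group.inv_equality car[OF wk]) auto
   then show ?thesis by blast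
  qed
  show "a \<otimes>\<^bsub>?H\<^esub> b \<in> ?C" if ab: "a \<in> ?C" "b \<in> ?C" for a b
  proof -
   obtain k l where "a = homologous_rel_set p X T (frag_cmul k w)" "b = homologous_rel_set p X T (frag_cmul l w)"
    using ab by blast
   then have "a \<otimes>\<^bsub>?H\<^esub> b = homologous_rel_set p X T (frag_cmul (k + l) w)"
    by (simp only: homologous_rel_set_mult frag_cmul_distrib)
   then show ?thesis by blast
  qed
 qed auto
 moreover have "homologous_rel_set p X T w \<in> ?C" by (rule range_eqI[of _ _ 1]) simp
 ultimately have "carrier ?H \<subseteq> ?C"
  using group.subgroup_generated_minimal[OF group_relative_homology_group, of ?C p X T "{homologous_rel_set p X T w}"]
  unfolding gen by blast
 then obtain k where "homologous_rel_set p X T c = homologous_rel_set p X T (frag_cmul k w)"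
  using car[OF c] by blast
 then show ?thesis using that by (simp add: homologous_rel_set_eq)
qed

interpretation full: holonomy "UNIV :: 'h::group_add set"
 by standard (simp add: subgroup_set_def)

text \<open>The universal covering of the circle, cut along the ray where the second coordinate is 0
  and the first is positive. Crossing this ray upwards counts 1, and the ray itself belongs to the
  upper side.\<close>

definition winding_cocycle :: "(nat => real) => (nat => real) => int" where
 "winding_cocycle x y =
   (if x 0 > 0 \<and> y 0 > 0 then (if y 1 >= 0 then 1 else 0) - (if x 1 >= 0 then 1 else 0) else 0)"

lemma openin_nsphere_coord:
 "open A ==> openin (nsphere n) {x \<in> topspace (nsphere n). x i \<in> A}"
 by (rule openin_continuous_map_preimage[OF continuous_map_nsphere_projection]) auto

lemma topspace_circle: "x \<in> topspace (nsphere 1) \<longleftrightarrow> (x 0)\<^sup>2 + (x 1)\<^sup>2 = 1 \<and> (\<forall>i>1. x i = 0)"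
 by (auto simp: nsphere topspace_Euclidean_space)

lemma local_cocycle_winding: "full.local_cocycle (nsphere 1) winding_cocycle"
 unfolding full.local_cocycle_def
proof (intro conjI allI ballI UNIV_I)
 fix p assume p: "p \<in> topspace (nsphere 1)"
 define N where "N = (\<lambda>i A. {x \<in> topspace (nsphere 1). x i \<in> A})"
 have s: "strict winding_cocycle (N 0 {0<..})" "strict winding_cocycle (N 0 {..<0})"
  "strict winding_cocycle (N 1 {0<..})" "strict winding_cocycle (N 1 {..<0})"
  unfolding strict_def winding_cocycle_def N_def by auto
 have "p 0 ~= 0 \<or> p 1 ~= 0" using p unfolding topspace_circle by auto
 then have "p \<in> N 0 {0<..} \<or> p \<in> N 0 {..<0} \<or> p \<in> N 1 {0<..} \<or> p \<in> N 1 {..<0}"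
  using p by (auto simp: N_def)
 moreover have "openin (nsphere 1) (N i A)" if "open A" for i A
  unfolding N_def using that by (rule openin_nsphere_coord)
 ultimately show "\<exists>W. openin (nsphere 1) W \<and> p \<in> W \<and> strict winding_cocycle W"
  using s by (elim disjE; blast intro: open_greaterThan open_lessThan)
qed

definition loop_simplex :: "(nat => real) => nat => real" where
 "loop_simplex = restrict (\<lambda>x. circle_point (x 1)) (standard_simplex 1)"

definition const_simplex :: "nat => 'x => (nat => real) => 'x" where
 "const_simplex p v = restrict (\<lambda>_. v) (standard_simplex p)"

lemma circle_point_01 [simp]: "circle_point 1 = circle_point 0"
 by (auto simp: circle_point_def fun_eq_iff)

lemma circle_point_in: "circle_point t \<in> topspace (nsphere 1)"
 unfolding topspace_circle circle_point_def by simp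

lemma continuous_map_circle_point:
 assumes "continuous_map Z euclideanreal f"
 shows "continuous_map Z (nsphere 1) (\<lambda>z. circle_point (f z))"
proof -
 have "continuous_map Z euclideanreal (\<lambda>z. circle_point (f z) i)" for i
 proof -
  have "continuous_on UNIV (\<lambda>t. circle_point t i)"
   unfolding circle_point_def by (cases "i = 0"; cases "i = 1") (auto intro!: continuous_intros)
  then have "continuous_map euclideanreal euclideanreal (\<lambda>t. circle_point t i)" by simp
  from continuous_map_compose[OF assms this] show ?thesis by (simp add: o_def)
 qed
 moreover have "circle_point (f z) \<in> topspace (nsphere 1)" for z by (rule circle_point_in)
 ultimately show ?thesis
  by (auto simp: nsphere Euclidean_space_def continuous_map_in_subtopology continuous_map_componentwise_UNIV topspace_Euclidean_space)
qed

lemma winding_loop: "full.hol winding_cocycle loop_simplex = 1"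
proof -
 \<comment> \<open>The potential jumps at the final parameter only: the loop starts on the ray and
   leaves it upwards, which counts nothing, and it arrives from below.\<close>
 let ?u = "\<lambda>x. circle_point (x 1)" and ?\<kappa> = "\<lambda>x. if x 1 = (1::real) then 1 else (0::int)"
 have cos_neg: "cos (2 * pi * t) <= 0" if "1/4 <= t" "t <= 3/4" for t
 proof -
  have "cos (2 * pi * t) = - cos (2 * pi * t - pi)" by simp
  moreover have "cos (2 * pi * t - pi) >= 0"
  proof (rule cos_ge_zero)
   have "pi * (1/4) <= pi * t" "pi * t <= pi * (3/4)" using that by (auto intro: mult_left_mono)
   then show "- (pi / 2) <= 2 * pi * t - pi" "2 * pi * t - pi <= pi / 2"
    unfolding mult.assoc by linarith+
  qed
  ultimately show ?thesis by simp
 qed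
 have sin_pos: "sin (2 * pi * t) >= 0" if "0 <= t" "t <= 1/4" for t
 proof (rule sin_ge_zero)
  have "pi * t <= pi * (1/4)" using that by (intro mult_left_mono) auto
  then show "2 * pi * t <= pi" using pi_gt_zero by linarith
  show "0 <= 2 * pi * t" using that by simp
 qed
 have sin_neg: "sin (2 * pi * t) < 0" if "3/4 <= t" "t < 1" for t
 proof -
  have "sin (2 * pi * t) = - sin (2 * pi * (1 - t))" using sin_2pi_minus[of "2 * pi * t"] by (simp add: right_diff_distrib)
  moreover have "sin (2 * pi * (1 - t)) > 0"
  proof (rule sin_gt_zero)
   have "pi * (1 - t) <= pi * (1/4)" using that by (intro mult_left_mono) auto
   then show "2 * pi * (1 - t) < pi" using pi_gt_zero by linarith
   show "0 < 2 * pi * (1 - t)" using that by simp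
  qed
  ultimately show ?thesis by simp
 qed
 have "full.development (simplex_top 1) ?u winding_cocycle ?\<kappa>"
  unfolding full.development_def
 proof (intro conjI ballI UNIV_I)
  fix z assume z: "z \<in> topspace (simplex_top 1)"
  define V where "V = (\<lambda>A. {x \<in> topspace (simplex_top 1). x 1 \<in> A})"
  have op: "openin (simplex_top 1) (V A)" if "open A" for A
   unfolding V_def by (rule openin_continuous_map_preimage[OF continuous_map_coord]) (use that in auto)
  have 01: "0 <= x 1 \<and> x 1 <= 1" if "x \<in> topspace (simplex_top 1)" for x
   using that simplex1_eqI(2,3)[of x] by simp
  show "\<exists>V. openin (simplex_top 1) V \<and> z \<in> V \<and> (\<forall>x\<in>V. \<forall>y\<in>V. winding_cocycle (?u x) (?u y) = - ?\<kappa> x + ?\<kappa> y)"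
  \<comment> \<open>Three overlapping intervals cover the loop: below 3/4, between 1/4 and 1, and
    above 3/4. On each of them the sign of the second coordinate is known wherever the first is
    positive.\<close>
  proof (cases "z 1 < 3/4")
   case True
   have "winding_cocycle (?u x) (?u y) = - ?\<kappa> x + ?\<kappa> y" if "x \<in> V {..<3/4}" "y \<in> V {..<3/4}" for x y
   proof -
    have x: "0 <= x 1" "x 1 < 3/4" and y: "0 <= y 1" "y 1 < 3/4" using that 01 by (auto simp: V_def)
    have "cos (2 * pi * t) > 0 ==> sin (2 * pi * t) >= 0" if "0 <= t" "t < 3/4" for t
     using cos_neg[of t] sin_pos[of t] that by force
    then show ?thesis using x y by (simp add: winding_cocycle_def circle_point_def)
   qed
   then show ?thesis using op[of "{..<3/4}"] z True by (intro exI[of _ "V {..<3/4}"]) (auto simp: V_def)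
  next
   case False
   have c1: "winding_cocycle (?u x) (?u y) = - ?\<kappa> x + ?\<kappa> y" if "x \<in> V {1/4<..<1}" "y \<in> V {1/4<..<1}" for x y
   proof -
    have "cos (2 * pi * t) > 0 ==> sin (2 * pi * t) < 0" if "1/4 < t" "t < 1" for t
     using cos_neg[of t] sin_neg[of t] that by force
    from this[of "x 1"] this[of "y 1"] that show ?thesis
     by (auto simp: winding_cocycle_def circle_point_def V_def)
   qed
   have c2: "winding_cocycle (?u x) (?u y) = - ?\<kappa> x + ?\<kappa> y" if "x \<in> V {3/4<..}" "y \<in> V {3/4<..}" for x y
   proof -
    have *: "cos (2 * pi * t) > 0 \<and> (sin (2 * pi * t) >= 0 \<longleftrightarrow> t = 1)" if "3/4 < t" "t <= 1" for t
    proof -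
     have "pi * (3/4) < pi * t" "pi * t <= pi * 1" using that by (auto intro: mult_left_mono)
     then have "cos (2 * pi * t - 2 * pi) > 0"
      unfolding mult.assoc using pi_gt_zero by (intro cos_gt_zero_pi) linarith+
     moreover have "cos (2 * pi * t - 2 * pi) = cos (2 * pi * t)" by (simp add: cos_diff)
     moreover have "sin (2 * pi * t) >= 0 \<longleftrightarrow> t = 1"
     proof (cases "t = 1")
      case False
      then show ?thesis using sin_neg[of t] that by simp
     qed simp
     ultimately show ?thesis by simp
    qed
    have "x 1 <= 1" "y 1 <= 1" "3/4 < x 1" "3/4 < y 1" using that 01 by (auto simp: V_def)
    then show ?thesis using *[of "x 1"] *[of "y 1"]
     unfolding winding_cocycle_def circle_point_def by simp
   qed
   have "z 1 < 1 \<or> z 1 = 1" using 01[OF z] by auto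
   then show ?thesis
   proof
    assume "z 1 < 1"
    then show ?thesis using op[of "{1/4<..<1}"] z False c1 by (intro exI[of _ "V {1/4<..<1}"]) (auto simp: V_def)
   next
    assume "z 1 = 1"
    then show ?thesis using op[of "{3/4<..}"] z c2 by (intro exI[of _ "V {3/4<..}"]) (auto simp: V_def)
   qed
  qed
 qed
 then have "full.development (simplex_top 1) loop_simplex winding_cocycle ?\<kappa>"
  unfolding loop_simplex_def full.development_restrict .
 then show ?thesis by (simp add: full.hol_eq vert_def)
qed

text \<open>
 A 2-simplex in the disc with boundary (constant, loop, constant): the straight line homotopy
 \<open>(s, t)\<close> from the constant loop, composed with a map from the simplex to the square which sends
 the sides \<open>x 1 = 0\<close> and \<open>x 2 = 0\<close> to the part of the boundary where the homotopy is constant.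
\<close>

definition disc_simplex :: "(nat => real) => nat => real" where
 "disc_simplex = restrict (\<lambda>x i. (1 - max 0 (1 - 2 * x 0)) * circle_point 0 i +
   max 0 (1 - 2 * x 0) * circle_point (min 1 (max 0 (1/2 + (x 2 - x 1) * (1 + 2 * x 0) / 2))) i) (standard_simplex 2)"

lemma simplex2_eqI:
 assumes "x \<in> standard_simplex 2"
 shows "x 0 + x 1 + x 2 = 1" "x 0 >= 0" "x 1 >= 0" "x 2 >= 0"
 using assms by (auto simp: standard_simplex_def numeral_2_eq_2)

lemma singular_simplex_disc: "singular_simplex 2 (disc 2) disc_simplex"
proof -
 let ?s = "\<lambda>x :: nat => real. max 0 (1 - 2 * x 0)"
 let ?t = "\<lambda>x :: nat => real. min 1 (max 0 (1/2 + (x 2 - x 1) * (1 + 2 * x 0) / 2))"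
 let ?f = "\<lambda>x i. (1 - ?s x) * circle_point 0 i + ?s x * circle_point (?t x) i"
 have t: "continuous_map (simplex_top 2) euclideanreal ?t"
  by (intro continuous_intros continuous_map_coord) auto
 have s: "continuous_map (simplex_top 2) euclideanreal ?s"
  by (intro continuous_intros continuous_map_coord) auto
 have "continuous_map (simplex_top 2) euclideanreal (\<lambda>x. circle_point (?t x) i)" for i
  using continuous_map_compose[OF continuous_map_circle_point[OF t] continuous_map_nsphere_projection[of 1 i]]
  by (simp add: o_def)
 then have c: "continuous_map (simplex_top 2) euclideanreal (\<lambda>x. ?f x i)" for i
  using s by (intro continuous_intros) auto
 have "?f x \<in> topspace (disc 2)" if "x \<in> standard_simplex 2" for x
 proof -
  define s where "s = ?s x"
  define t where "t = ?t x"
  have *: "(1 - s + s * c)\<^sup>2 + (s * d)\<^sup>2 = (1 - s)\<^sup>2 + 2 * (s * (1 - s)) * c + s\<^sup>2 * (d\<^sup>2 + c\<^sup>2)" for c d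
   by (simp add: power2_eq_square algebra_simps)
  have "0 <= s" "s <= 1" using simplex2_eqI(2)[OF that] by (auto simp: s_def)
  have "(?f x 0)\<^sup>2 + (?f x 1)\<^sup>2 = (1 - s + s * cos (2 * pi * t))\<^sup>2 + (s * sin (2 * pi * t))\<^sup>2"
   unfolding s_def[symmetric] t_def[symmetric] by (simp add: circle_point_def)
  also have "\<dots> = (1 - s)\<^sup>2 + 2 * (s * (1 - s)) * cos (2 * pi * t) + s\<^sup>2 * ((sin (2 * pi * t))\<^sup>2 + (cos (2 * pi * t))\<^sup>2)"
   by (rule *)
  also have "\<dots> <= (1 - s)\<^sup>2 + 2 * (s * (1 - s)) * 1 + s\<^sup>2 * 1"
   using \<open>0 <= s\<close> \<open>s <= 1\<close> by (intro add_mono mult_left_mono) (auto intro: cos_le_one)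
  also have "\<dots> = 1" by (simp add: power2_eq_square algebra_simps)
  finally have "(?f x 0)\<^sup>2 + (?f x 1)\<^sup>2 <= 1" .
  moreover have "?f x i = 0" if "i >= 2" for i using that by (simp add: circle_point_def)
  ultimately show ?thesis by (auto simp: disc_iff rad_def numeral_2_eq_2)
 qed
 then have "continuous_map (simplex_top 2) (disc 2) ?f"
  using c by (subst disc_eq_subtopology) (auto simp: continuous_map_in_subtopology continuous_map_componentwise_UNIV Pi_iff)
 then show ?thesis by (simp add: singular_simplex_def disc_simplex_def)
qed

lemma disc_simplex_faces:
 "singular_face 2 0 disc_simplex = loop_simplex"
 "singular_face 2 1 disc_simplex = const_simplex 1 (circle_point 0)"
 "singular_face 2 2 disc_simplex = const_simplex 1 (circle_point 0)"
proof -
 have in2: "simplical_face k x \<in> standard_simplex 2" if "x \<in> standard_simplex (Suc 0)" "k <= 2" for k x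
  using simplical_face_in_standard_simplex[of 2 k x] that by simp
 have e: "disc_simplex x i = (1 - max 0 (1 - 2 * x 0)) * circle_point 0 i +
   max 0 (1 - 2 * x 0) * circle_point (min 1 (max 0 (1/2 + (x 2 - x 1) * (1 + 2 * x 0) / 2))) i"
  if "x \<in> standard_simplex 2" for x i using that by (simp add: disc_simplex_def)
 have x01: "x 0 = 1 - x 1" "0 <= x 1" "x 1 <= 1" if "x \<in> standard_simplex (Suc 0)" for x
  using that by (auto simp: standard_simplex_def)
 have "disc_simplex (simplical_face 0 x) = circle_point (x 1)" if x: "x \<in> standard_simplex (Suc 0)" for x
 proof -
  have "1/2 + (x 1 - x 0) / 2 = x 1" using x01(1)[OF x] by (simp add: field_simps)
  then show ?thesis using x01(2,3)[OF x] e[OF in2[OF x, of 0]] by (auto simp: simplical_face_def fun_eq_iff)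
 qed
 then show "singular_face 2 0 disc_simplex = loop_simplex"
  by (auto simp: singular_face_def loop_simplex_def restrict_def fun_eq_iff)
 \<comment> \<open>This inequality is the purpose of the factor \<open>1 + 2 * x 0\<close> in
   \<open>disc_simplex\<close>: on the faces 1 and 2 the parameter is cut off at 1 or 0 as long as
   the homotopy has not reached the constant loop.\<close>
 have *: "1 / 2 <= (1 - u) * (1 + 2 * u) / 2" if "0 <= u" "u < 1/2" for u :: real
 proof -
  have "(1 - u) * (1 + 2 * u) - 1 = u * (1 - 2 * u)" by (simp add: algebra_simps)
  also have "\<dots> >= 0" using that by (intro mult_nonneg_nonneg) auto
  finally show ?thesis by simp
 qed
 have "disc_simplex (simplical_face 1 x) = circle_point 0" if x: "x \<in> standard_simplex (Suc 0)" for x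
 proof (cases "x 0 < 1/2")
  case True
  have "x 1 = 1 - x 0" using x01[OF x] by simp
  then have "1/2 + x 1 * (1 + 2 * x 0) / 2 >= 1" using *[of "x 0"] True x01[OF x] by simp
  then show ?thesis using e[OF in2[OF x, of 1]] 
   by (auto simp: simplical_face_def fun_eq_iff algebra_simps min_def max_def)
 next
  case False
  then show ?thesis using e[OF in2[OF x, of 1]] by (auto simp: simplical_face_def fun_eq_iff)
 qed
 then show "singular_face 2 1 disc_simplex = const_simplex 1 (circle_point 0)"
  by (auto simp: singular_face_def const_simplex_def restrict_def fun_eq_iff)
 have "disc_simplex (simplical_face 2 x) = circle_point 0" if x: "x \<in> standard_simplex (Suc 0)" for x
 proof (cases "x 0 < 1/2")
  case True
  have "x 1 = 1 - x 0" using x01[OF x] by simp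
  then have "1/2 <= x 1 * (1 + 2 * x 0) / 2" using *[of "x 0"] True x01[OF x] by simp
  moreover have "(0 - x 1) * (1 + 2 * x 0) / 2 = - (x 1 * (1 + 2 * x 0) / 2)" by simp
  ultimately have "1/2 + (0 - x 1) * (1 + 2 * x 0) / 2 <= 0" by linarith
  then have t0: "min 1 (max 0 (1/2 + (0 - x 1) * (1 + 2 * x 0) / 2)) = 0" by linarith
  have v: "simplical_face 2 x 0 = x 0" "simplical_face 2 x 1 = x 1" "simplical_face 2 x 2 = 0"
   by (simp_all add: simplical_face_def)
  have "simplical_face 2 x \<in> standard_simplex 2" by (rule in2[OF x]) simp
  then show ?thesis by (intro ext) (simp only: e v t0, simp add: algebra_simps)
 next
  case False
  then show ?thesis using e[OF in2[OF x, of 2]] by (auto simp: simplical_face_def fun_eq_iff)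
 qed
 then show "singular_face 2 2 disc_simplex = const_simplex 1 (circle_point 0)"
  by (auto simp: singular_face_def const_simplex_def restrict_def fun_eq_iff)
qed

lemma chain_boundary_2:
 "chain_boundary 2 (frag_of \<sigma>) =
   frag_of (singular_face 2 0 \<sigma>) - frag_of (singular_face 2 1 \<sigma>) + frag_of (singular_face 2 2 \<sigma>)"
 by (simp add: chain_boundary_of numeral_2_eq_2 frag_cmul_minus_one)

lemma chain_boundary_3:
 "chain_boundary 3 (frag_of \<sigma>) =
   frag_of (singular_face 3 0 \<sigma>) - frag_of (singular_face 3 1 \<sigma>) + frag_of (singular_face 3 2 \<sigma>) - frag_of (singular_face 3 3 \<sigma>)"
 by (simp add: chain_boundary_of numeral_3_eq_3 numeral_2_eq_2 frag_cmul_minus_one)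

lemma nsphere_subtopology_disc: "subtopology (disc 2) (topspace (nsphere 1)) = nsphere 1"
proof -
 have "topspace (nsphere 1) \<subseteq> topspace (disc 2)"
  using disc_eq_open_disc_Un_nsphere[of 2] by auto
 moreover have "nsphere 1 = subtopology (Euclidean_space 2) (topspace (nsphere 1))"
  unfolding nsphere_def by (simp add: subtopology_restrict numeral_2_eq_2)
 moreover have "disc 2 = subtopology (Euclidean_space 2) (topspace (disc 2))"
  unfolding disc_def by (simp add: subtopology_restrict)
 ultimately show ?thesis by (metis inf.absorb_iff2 subtopology_subtopology)
qed

lemma boundary_disc_simplex: "chain_boundary 2 (frag_of disc_simplex) = frag_of loop_simplex"
 by (simp add: chain_boundary_2 disc_simplex_faces del: One_nat_def)

lemma singular_simplex_loop: "singular_simplex 1 (nsphere 1) loop_simplex"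
 unfolding singular_simplex_def loop_simplex_def
 by (simp add: continuous_map_circle_point continuous_map_coord del: One_nat_def)

lemma relcycle_disc_simplex: "singular_relcycle 2 (disc 2) (topspace (nsphere 1)) (frag_of disc_simplex)"
 using singular_simplex_disc singular_simplex_loop[unfolded One_nat_def[symmetric]]
 unfolding singular_relcycle_def mod_subset_def boundary_disc_simplex nsphere_subtopology_disc
 by (simp add: singular_chain_of)

text \<open>If \<open>w\<close> generates, then \<open>disc_simplex\<close> is homologous to
  \<open>k w\<close>. The winding number of the boundary is an integer for \<open>w\<close> and 1
  for \<open>disc_simplex\<close>, so \<open>k\<close> divides 1.\<close>

lemma cell_orientationE:
 assumes "cell_orientation \<omega>"
 obtains e where "e = 1 \<or> e = - 1"
  "\<omega> = homologous_rel_set 2 (disc 2) (topspace (nsphere 1)) (frag_cmul e (frag_of disc_simplex))"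
proof -
 let ?D = "disc 2" and ?S = "topspace (nsphere 1)"
 obtain w where w: "singular_relcycle 2 ?D ?S w" "\<omega> = homologous_rel_set 2 ?D ?S w"
  using assms carrier_relative_homology_group[of 2 ?D ?S] by (auto simp: cell_orientation_def Let_def)
 have gen: "subgroup_generated (relative_homology_group (int 2) ?D ?S) {homologous_rel_set 2 ?D ?S w} =
   relative_homology_group (int 2) ?D ?S"
  using assms by (simp add: cell_orientation_def Let_def w(2))
 obtain k where k: "homologous_rel 2 ?D ?S (frag_of disc_simplex) (frag_cmul k w)"
  by (rule homologous_rel_generator[OF w(1) relcycle_disc_simplex gen])
 define W where "W = (\<lambda>\<sigma>. real_of_int (full.hol winding_cocycle \<sigma>))"
 obtain d e where d: "singular_chain 3 ?D d" and e: "singular_chain 2 (nsphere 1) e"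
  and de: "chain_boundary 3 d = frag_of disc_simplex - frag_cmul k w + e"
  using k unfolding homologous_rel_def singular_relboundary_alt nsphere_subtopology_disc by auto
 have "int_eval (coboundary 2 W) e = int_eval (\<lambda>_. 0) e"
 proof (rule int_eval_cong)
  fix \<sigma> assume "\<sigma> \<in> Poly_Mapping.keys e"
  then have "singular_simplex 2 (nsphere 1) \<sigma>" using e by (auto simp: singular_chain_def)
  from full.hol_triangle[OF local_cocycle_winding this, symmetric]
  show "coboundary 2 W \<sigma> = 0" by (simp add: coboundary_2 W_def)
 qed
 then have "int_eval (coboundary 2 W) e = 0" by (simp add: int_eval_def chain_eval_def)
 moreover have "int_eval W (chain_boundary 2 (chain_boundary 3 d)) = 0"
  using chain_boundary_boundary[OF d] by (simp add: numeral_3_eq_3 numeral_2_eq_2)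
 ultimately have "int_eval W (chain_boundary 2 (frag_of disc_simplex)) = of_int k * int_eval W (chain_boundary 2 w)"
  unfolding de by (simp add: chain_boundary_add chain_boundary_diff chain_boundary_cmul int_eval_add int_eval_diff int_eval_cmul int_eval_boundary)
 then have "of_int k * int_eval W (chain_boundary 2 w) = 1"
  by (simp add: boundary_disc_simplex W_def winding_loop)
 moreover have "int_eval W (chain_boundary 2 w) \<in> \<int>"
  by (rule int_eval_Ints) (simp add: W_def)
 then obtain l where "int_eval W (chain_boundary 2 w) = of_int l" by (rule Ints_cases)
 ultimately have "real_of_int (k * l) = real_of_int 1" by simp
 then have "k * l = 1" by (simp only: of_int_eq_iff)
 then have k1: "k = 1 \<or> k = - 1" using zmult_eq_1_iff by blast
 then have "frag_cmul k (frag_cmul k w) = w" by auto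
 then have "homologous_rel 2 ?D ?S (frag_cmul k (frag_of disc_simplex)) w"
  using homologous_rel_cmul[OF k, of k] by simp
 then have "\<omega> = homologous_rel_set 2 ?D ?S (frag_cmul k (frag_of disc_simplex))"
  unfolding w(2) by (metis homologous_rel_set_eq)
 then show ?thesis using k1 that by blast
qed

section \<open>Word paths in the 1-skeleton\<close>

definition line_point :: "real => nat => real" where
 "line_point u = (\<lambda>i. if i = 0 then u else 0)"

lemma topspace_bsphere_1: "topspace (bsphere 1) = {line_point 1, line_point (- 1)}"
proof -
 have "x \<in> topspace (bsphere 1) \<longleftrightarrow> (x 0)\<^sup>2 = 1 \<and> (\<forall>i\<ge>1. x i = 0)" for x
  by (auto simp: bsphere_iff rad_def power2_eq_1_iff abs_if)
 moreover have "(x 0)\<^sup>2 = 1 \<and> (\<forall>i\<ge>1. x i = 0) \<longleftrightarrow> x = line_point 1 \<or> x = line_point (- 1)" for x :: "nat => real"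
  by (auto simp: line_point_def fun_eq_iff power2_eq_1_iff Suc_le_eq)
 ultimately show ?thesis by blast
qed

lemma line_point_disc: "\<bar>u\<bar> <= 1 ==> line_point u \<in> topspace (disc 1)"
 by (simp add: disc_iff rad_def line_point_def)

lemma continuous_map_line_point:
 assumes "continuous_map Z euclideanreal f" "!!z. z \<in> topspace Z ==> \<bar>f z\<bar> <= 1"
 shows "continuous_map Z (disc 1) (\<lambda>z. line_point (f z))"
 using assms line_point_disc
 by (subst disc_eq_subtopology)
   (auto simp: continuous_map_in_subtopology continuous_map_componentwise_UNIV Pi_iff line_point_def)

text \<open>
 A filled triangle of words stands for the relation \<open>u v = w\<close> in the fundamental groupoid.
\<close>

definition triangle :: "'x topology => ((nat => real) => 'x) => ((nat => real) => 'x) => ((nat => real) => 'x) =>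
  ((nat => real) => 'x) => bool" where
 "triangle Y \<sigma> e f g \<longleftrightarrow> singular_simplex 2 Y \<sigma> \<and> singular_face 2 2 \<sigma> = e \<and> singular_face 2 0 \<sigma> = f \<and> singular_face 2 1 \<sigma> = g"

locale presentation =
 fixes S :: "'a set" and r :: "('a \<times> bool) list" and v :: 'x and \<phi> :: "'a => (nat => real) => 'x"
  and P1 :: "'x topology" and \<Phi> :: "(nat => real) => 'x" and P :: "'x topology"
 assumes pc: "presentation_complex S r v \<phi> P1 \<Phi> P" and r_over: "fst ` set r \<subseteq> S"
begin

lemma att1: "attaches_cells 1 (discrete_topology {v}) P1 S \<phi>"
 and att2: "attaches_cells 2 P1 P {()} (\<lambda>_. \<Phi>)"
 and relator_path: "t \<in> {0..1} ==> \<Phi> (circle_point t) = word_path v \<phi> r t"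
 using pc by (simp_all add: presentation_complex_def)

lemma v_in_P1: "v \<in> topspace P1"
 using attaches_cells_subset[OF att1] by simp

lemma \<phi>_end:
 assumes "s \<in> S"
 shows "\<phi> s (line_point 1) = v" "\<phi> s (line_point (- 1)) = v"
proof -
 have "continuous_map (bsphere 1) (discrete_topology {v}) (\<phi> s)"
  using att1 assms by (simp add: attaches_cells_def bsphere_def)
 then have "\<phi> s ` topspace (bsphere 1) \<subseteq> {v}" by (auto simp: continuous_map_def)
 then show "\<phi> s (line_point 1) = v" "\<phi> s (line_point (- 1)) = v" unfolding topspace_bsphere_1 by auto
qed

lemma letter_path_line_point: "letter_path \<phi> l u = \<phi> (fst l) (line_point (if snd l then 2 * u - 1 else 1 - 2 * u))"
 by (simp add: letter_path_def line_point_def)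

lemma letter_path_end:
 assumes "fst l \<in> S"
 shows "letter_path \<phi> l 0 = v" "letter_path \<phi> l 1 = v"
 using \<phi>_end[OF assms] by (simp_all add: letter_path_line_point)

lemma letter_path_inv: "letter_path \<phi> (inv_letter l) u = letter_path \<phi> l (1 - u)"
 by (simp add: letter_path_line_point inv_letter_def algebra_simps)

lemma continuous_map_letter_path:
 assumes "fst l \<in> S" "continuous_map Z euclideanreal f" "!!z. z \<in> topspace Z ==> 0 <= f z \<and> f z <= 1"
 shows "continuous_map Z P1 (\<lambda>z. letter_path \<phi> l (f z))"
proof -
 have "continuous_map Z (disc 1) (\<lambda>z. line_point (if snd l then 2 * f z - 1 else 1 - 2 * f z))"
 proof (rule continuous_map_line_point)
  show "continuous_map Z euclideanreal (\<lambda>z. if snd l then 2 * f z - 1 else 1 - 2 * f z)"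
   by (cases "snd l") (auto intro!: continuous_intros assms(2))
  show "\<bar>if snd l then 2 * f z - 1 else 1 - 2 * f z\<bar> <= 1" if "z \<in> topspace Z" for z
   using assms(3)[OF that] by auto
 qed
 from continuous_map_compose[OF this attaches_cells_continuous_map[OF att1 _ assms(1)]]
 show ?thesis by (simp add: letter_path_line_point o_def)
qed

lemma word_path_Nil [simp]: "word_path v \<phi> [] t = v"
 by (simp add: word_path_def)

lemma word_path_end:
 assumes "fst ` set w \<subseteq> S"
 shows "word_path v \<phi> w 0 = v" "word_path v \<phi> w 1 = v"
 using assms by (cases w; auto simp: word_path_def letter_path_end)+

lemma word_path_single:
 assumes "fst x \<in> S" "0 <= t" "t <= 1"
 shows "word_path v \<phi> [x] t = letter_path \<phi> x t"
proof (cases "t = 1")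
 case True
 then show ?thesis using letter_path_end[OF assms(1)] by (simp add: word_path_def)
next
 case False
 then have "\<lfloor>t\<rfloor> = 0" using assms by (simp add: floor_eq_iff)
 then show ?thesis by (simp add: word_path_def)
qed

text \<open>Splits off the first letter, so that continuity can be shown by induction; where the two
  formulas meet, both give the vertex.\<close>

lemma word_path_Cons:
 assumes x: "fst x \<in> S" and w: "fst ` set w \<subseteq> S" and t: "0 <= t" "t <= 1"
 shows "word_path v \<phi> (x # w) t =
  (if (1 + real (length w)) * t <= 1 then letter_path \<phi> x ((1 + real (length w)) * t)
   else word_path v \<phi> w (((1 + real (length w)) * t - 1) / real (length w)))"
proof (cases "(1 + real (length w)) * t < 1")
 case True
 then have "\<lfloor>(1 + real (length w)) * t\<rfloor> = 0" using t by (simp add: floor_eq_iff)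
 then show ?thesis using True by (simp add: word_path_def)
next
 case False
 define u where "u = (1 + real (length w)) * t"
 define m where "m = nat \<lfloor>u - 1\<rfloor>"
 have u: "u >= 1" using False by (simp add: u_def)
 then have "\<lfloor>u\<rfloor> = 1 + \<lfloor>u - 1\<rfloor>" "\<lfloor>u - 1\<rfloor> >= 0" by simp_all
 then have fl: "nat \<lfloor>u\<rfloor> = Suc m" unfolding m_def by linarith
 have *: "word_path v \<phi> (x # w) t = (if m < length w then letter_path \<phi> (w ! m) (u - 1 - m) else v)"
  unfolding word_path_def using fl by (simp add: u_def algebra_simps)
 show ?thesis
 proof (cases "u = 1")
  case True
  have "letter_path \<phi> (w ! 0) 0 = v" if "length w > 0"
   using w that by (intro letter_path_end) auto
  then show ?thesis using True letter_path_end(2)[OF x] * by (simp add: u_def[symmetric] m_def)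
 next
  case False': False
  have w0: "length w > 0"
  proof (rule ccontr)
   assume "\<not> length w > 0"
   then have "u = t" by (simp add: u_def)
   then show False using False' u t by simp
  qed
  then have "real (length w) * ((u - 1) / length w) = u - 1" by simp
  then have "word_path v \<phi> w ((u - 1) / length w) = (if m < length w then letter_path \<phi> (w ! m) (u - 1 - m) else v)"
   unfolding word_path_def Let_def m_def by simp
  then show ?thesis using * False' u by (simp add: u_def[symmetric])
 qed
qed

lemma continuous_map_word_path:
 assumes "fst ` set w \<subseteq> S" "continuous_map Z euclideanreal f" "!!z. z \<in> topspace Z ==> 0 <= f z \<and> f z <= 1"
 shows "continuous_map Z P1 (\<lambda>z. word_path v \<phi> w (f z))"
 using assms
proof (induction w arbitrary: Z f)
 case Nil
 then show ?case using v_in_P1 by simp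
next
 case (Cons x w)
 let ?k = "1 + real (length w)"
 have x: "fst x \<in> S" and w: "fst ` set w \<subseteq> S" using Cons.prems(1) by auto
 have kf: "continuous_map Z euclideanreal (\<lambda>z. ?k * f z)"
  by (intro continuous_intros Cons.prems(2)) auto
 have "continuous_map Z P1 (\<lambda>z. if ?k * f z <= 1 then letter_path \<phi> x (?k * f z) else word_path v \<phi> w ((?k * f z - 1) / length w))"
 proof (rule continuous_map_cases_le)
  show "continuous_map Z euclideanreal (\<lambda>z. ?k * f z)" by (rule kf)
  show "continuous_map (subtopology Z {z \<in> topspace Z. ?k * f z <= 1}) P1 (\<lambda>z. letter_path \<phi> x (?k * f z))"
   using Cons.prems(3) by (intro continuous_map_letter_path x continuous_map_from_subtopology kf) auto
  show "continuous_map (subtopology Z {z \<in> topspace Z. 1 <= ?k * f z}) P1 (\<lambda>z. word_path v \<phi> w ((?k * f z - 1) / length w))"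
  proof (cases "length w = 0")
   case True
   then show ?thesis using v_in_P1 by simp
  next
   case False
   show ?thesis
   proof (rule Cons.IH[OF w])
    show "continuous_map (subtopology Z {z \<in> topspace Z. 1 <= ?k * f z}) euclideanreal (\<lambda>z. (?k * f z - 1) / length w)"
     using False by (intro continuous_intros continuous_map_from_subtopology kf) auto
    fix z assume z: "z \<in> topspace (subtopology Z {z \<in> topspace Z. 1 <= ?k * f z})"
    then have "?k * f z <= ?k * 1" using Cons.prems(3)[of z] by (intro mult_left_mono) auto
    then show "0 <= (?k * f z - 1) / length w \<and> (?k * f z - 1) / length w <= 1"
     using z False by (simp add: field_simps)
   qed
  qed
  fix z assume "z \<in> topspace Z" "?k * f z = 1"
  then show "letter_path \<phi> x (?k * f z) = word_path v \<phi> w ((?k * f z - 1) / length w)"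
   using letter_path_end[OF x] word_path_end[OF w] by simp
 qed simp
 then show ?case
  by (rule continuous_map_eq) (use word_path_Cons[OF x w] Cons.prems(3) in simp)
qed

definition word_simplex :: "nat => ('a \<times> bool) list => ((nat => real) => real) => (nat => real) => 'x" where
 "word_simplex p w f = restrict (\<lambda>z. word_path v \<phi> w (f z)) (standard_simplex p)"

definition edge :: "('a \<times> bool) list => (nat => real) => 'x" where
 "edge w = word_simplex 1 w (\<lambda>z. z 1)"

lemma singular_simplex_word:
 assumes "fst ` set w \<subseteq> S" "continuous_map (simplex_top p) euclideanreal f"
  "!!z. z \<in> standard_simplex p ==> 0 <= f z \<and> f z <= 1"
 shows "singular_simplex p P1 (word_simplex p w f)"
 using continuous_map_word_path[OF assms(1,2)] assms(3) by (simp add: singular_simplex_def word_simplex_def)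

lemma singular_simplex_edge: "fst ` set w \<subseteq> S ==> singular_simplex 1 P1 (edge w)"
 unfolding edge_def using simplex1_eqI
 by (intro singular_simplex_word continuous_map_coord) auto

lemma edge_Nil: "edge [] = const_simplex 1 v"
 by (simp add: edge_def word_simplex_def const_simplex_def)

lemma singular_face_word:
 assumes "k <= 2" "!!z. z \<in> standard_simplex 1 ==> word_path v \<phi> w (f (simplical_face k z)) = word_path v \<phi> w' (z 1)"
 shows "singular_face 2 k (word_simplex 2 w f) = edge w'"
proof
 fix z :: "nat => real"
 show "singular_face 2 k (word_simplex 2 w f) z = edge w' z"
  using simplical_face_in_standard_simplex[of 2 k z] assms
  by (simp add: singular_face_def edge_def word_simplex_def restrict_def)
qed

lemma simplex1_0: "z \<in> standard_simplex 1 ==> z 0 = 1 - z 1"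
 by (simp add: standard_simplex_def)

lemma triangle_Cons:
 assumes x: "fst x \<in> S" and w: "fst ` set w \<subseteq> S"
 obtains \<sigma> where "triangle P1 \<sigma> (edge [x]) (edge w) (edge (x # w))"
proof
 let ?k = "1 + real (length w)"
 \<comment> \<open>The path is composed with the affine function that takes the values 0,
   \<open>1 / ?k\<close> and 1 at the vertices; the first letter ends at parameter
   \<open>1 / ?k\<close>.\<close>
 let ?f = "\<lambda>z::nat => real. z 1 / ?k + z 2"
 note z01 = simplex1_eqI(2,3) simplex1_0
 have "continuous_map (simplex_top 2) euclideanreal ?f"
  by (intro continuous_intros continuous_map_coord) auto
 moreover have "0 <= ?f z \<and> ?f z <= 1" if "z \<in> standard_simplex 2" for z
 proof -
  have "z 1 / ?k <= z 1" using simplex2_eqI[OF that] by (simp add: field_simps mult_nonneg_nonneg)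
  then show ?thesis using simplex2_eqI[OF that] by auto
 qed
 ultimately have "singular_simplex 2 P1 (word_simplex 2 (x # w) ?f)"
  using x w by (intro singular_simplex_word) auto
 moreover have "singular_face 2 2 (word_simplex 2 (x # w) ?f) = edge [x]"
 proof (rule singular_face_word)
  fix z assume z: "z \<in> standard_simplex 1"
  have "0 <= z 1 / ?k" "z 1 / ?k <= 1" "?k * (z 1 / ?k) = z 1"
   using z01(1,2)[OF z] by (auto simp: field_simps)
  then show "word_path v \<phi> (x # w) (?f (simplical_face 2 z)) = word_path v \<phi> [x] (z 1)"
   using word_path_Cons[OF x w, of "z 1 / ?k"] word_path_single[OF x] z01(1,2)[OF z]
   by (simp add: simplical_face_def)
 qed simp
 moreover have "singular_face 2 0 (word_simplex 2 (x # w) ?f) = edge w"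
 proof (rule singular_face_word)
  fix z assume z: "z \<in> standard_simplex 1"
  let ?t = "z 0 / ?k + z 1"
  have "?k * ?t = (z 0 + z 1) + length w * z 1" by (simp add: field_simps)
  then have kt: "?k * ?t = 1 + length w * z 1" using z01(3)[OF z] by simp
  have t1: "?t <= 1"
  proof -
   have "?k * ?t <= ?k * 1" unfolding kt using z01(2)[OF z] by (simp add: mult_left_le)
   then show ?thesis by (simp only: mult_le_cancel_left_pos add_pos_nonneg zero_less_one of_nat_0_le_iff)
  qed
  have t0: "0 <= ?t" using z01[OF z] by simp
  have "word_path v \<phi> (x # w) ?t = word_path v \<phi> w (z 1)"
  proof (cases "real (length w) * z 1 = 0")
   case True
   then have "w = [] \<or> z 1 = 0" by simp
   then show ?thesis
    using word_path_Cons[OF x w t0 t1] True letter_path_end(2)[OF x] word_path_end(1)[OF w] unfolding kt by auto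
  next
   case False
   then have "\<not> 1 + real (length w) * z 1 <= 1" using z01(1)[OF z] mult_nonneg_nonneg[of "real (length w)" "z 1"] by linarith
   then show ?thesis using word_path_Cons[OF x w t0 t1] False unfolding kt by simp
  qed
  then show "word_path v \<phi> (x # w) (?f (simplical_face 0 z)) = word_path v \<phi> w (z 1)"
   by (simp add: simplical_face_def)
 qed simp
 moreover have "singular_face 2 1 (word_simplex 2 (x # w) ?f) = edge (x # w)"
  by (rule singular_face_word) (simp_all add: simplical_face_def)
 ultimately show "triangle P1 (word_simplex 2 (x # w) ?f) (edge [x]) (edge w) (edge (x # w))"
  unfolding triangle_def by blast
qed

lemma triangle_inverse:
 assumes x: "fst x \<in> S"
 obtains \<sigma> where "triangle P1 \<sigma> (edge [x]) (edge [inv_letter x]) (edge [])"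
proof
 \<comment> \<open>The vertices go to the parameters 0, 1 and 0, so the path runs forth and
   back.\<close>
 let ?f = "\<lambda>z::nat => real. z 1"
 note z01 = simplex1_eqI(2,3) simplex1_0
 have "singular_simplex 2 P1 (word_simplex 2 [x] ?f)"
  using x simplex2_eqI by (intro singular_simplex_word continuous_map_coord) fastforce+
 moreover have "singular_face 2 2 (word_simplex 2 [x] ?f) = edge [x]"
  by (rule singular_face_word) (simp_all add: simplical_face_def)
 moreover have "singular_face 2 0 (word_simplex 2 [x] ?f) = edge [inv_letter x]"
 proof (rule singular_face_word)
  fix z assume z: "z \<in> standard_simplex 1"
  then show "word_path v \<phi> [x] (?f (simplical_face 0 z)) = word_path v \<phi> [inv_letter x] (z 1)"
   using x z01[OF z] word_path_single[of x "z 0"] word_path_single[of "inv_letter x" "z 1"]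
   by (simp add: simplical_face_def letter_path_inv)
 qed simp
 moreover have "singular_face 2 1 (word_simplex 2 [x] ?f) = edge []"
  using word_path_end(1)[of "[x]"] x by (intro singular_face_word) (simp_all add: simplical_face_def)
 ultimately show "triangle P1 (word_simplex 2 [x] ?f) (edge [x]) (edge [inv_letter x]) (edge [])"
  unfolding triangle_def by blast
qed

lemma triangle_degenerate:
 assumes w: "fst ` set w \<subseteq> S"
 obtains \<sigma> \<sigma>' where "triangle P1 \<sigma> (edge []) (edge w) (edge w)" "triangle P1 \<sigma>' (edge w) (edge []) (edge w)"
proof
 \<comment> \<open>The two functions take the values 0, 0, 1 and 0, 1, 1 at the vertices.\<close>
 note z01 = simplex1_eqI(2,3) simplex1_0
 have "singular_simplex 2 P1 (word_simplex 2 w (\<lambda>z. z 2))" "singular_simplex 2 P1 (word_simplex 2 w (\<lambda>z. z 1 + z 2))"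
  using w simplex2_eqI by (intro singular_simplex_word continuous_map_coord continuous_intros; fastforce)+
 moreover have "singular_face 2 2 (word_simplex 2 w (\<lambda>z. z 2)) = edge []"
  "singular_face 2 0 (word_simplex 2 w (\<lambda>z. z 2)) = edge w" "singular_face 2 1 (word_simplex 2 w (\<lambda>z. z 2)) = edge w"
  "singular_face 2 2 (word_simplex 2 w (\<lambda>z. z 1 + z 2)) = edge w"
  "singular_face 2 0 (word_simplex 2 w (\<lambda>z. z 1 + z 2)) = edge []"
  "singular_face 2 1 (word_simplex 2 w (\<lambda>z. z 1 + z 2)) = edge w"
  using word_path_end[OF w] by (intro singular_face_word; simp add: simplical_face_def z01(3)[unfolded One_nat_def])+
 ultimately show "triangle P1 (word_simplex 2 w (\<lambda>z. z 2)) (edge []) (edge w) (edge w)"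
  "triangle P1 (word_simplex 2 w (\<lambda>z. z 1 + z 2)) (edge w) (edge []) (edge w)"
  unfolding triangle_def by blast+
qed

lemma relator_simplex: "simplex_map 1 \<Phi> loop_simplex = edge r"
 unfolding simplex_map_def edge_def word_simplex_def loop_simplex_def restrict_def
 using simplex1_eqI(2,3) relator_path by (intro ext) simp

lemma relator_base: "simplex_map 1 \<Phi> (const_simplex 1 (circle_point 0)) = edge []"
 unfolding edge_Nil simplex_map_def const_simplex_def restrict_def
 using relator_path[of 0] word_path_end[OF r_over] by (intro ext) simp

end

section \<open>Horn filling\<close>

definition delete_coord :: "nat => (nat => 'b) => nat => 'b" where
 "delete_coord j y = (\<lambda>i. if i < j then y i else y (Suc i))"

lemma delete_simplical_face [simp]: "delete_coord j (simplical_face j z) = z"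
 by (auto simp: delete_coord_def simplical_face_def fun_eq_iff)

lemma simplical_face_delete: "y j = 0 ==> simplical_face j (delete_coord j y) = y"
proof
 fix i assume "y j = 0"
 then show "simplical_face j (delete_coord j y) i = y i"
  by (cases "i < j"; cases "i = j"; cases i) (auto simp: delete_coord_def simplical_face_def)
qed

lemma delete_coord_delete_coord:
 assumes "i < j"
 shows "delete_coord (j - 1) (delete_coord i y) = delete_coord i (delete_coord j y)"
 using assms by (auto simp: delete_coord_def fun_eq_iff less_diff_conv)

lemma standard_simplex_3: "x \<in> standard_simplex 3 \<longleftrightarrow>
  0 <= x 0 \<and> 0 <= x 1 \<and> 0 <= x 2 \<and> 0 <= x 3 \<and> x 0 + x 1 + x 2 + x 3 = 1 \<and> (\<forall>i>3. x i = 0)"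
 (is "?L \<longleftrightarrow> ?R")
proof -
 have "{..3::nat} = {0, 1, 2, 3}" by auto
 then have *: "(\<Sum>i\<le>3. x i) = x 0 + x 1 + x 2 + x 3" by simp
 show ?thesis
 proof
  show ?R if ?L using that unfolding standard_simplex_def mem_Collect_eq * by blast
  assume R: ?R
  have "0 <= x i \<and> x i <= 1" for i
  proof -
   have "i = 0 \<or> i = 1 \<or> i = 2 \<or> i = 3 \<or> i > 3" by arith
   then show ?thesis using R by (elim disjE) simp_all
  qed
  then show ?L using R unfolding standard_simplex_def mem_Collect_eq * by blast
 qed
qed

lemma standard_simplex_2: "x \<in> standard_simplex 2 \<longleftrightarrow>
  0 <= x 0 \<and> 0 <= x 1 \<and> 0 <= x 2 \<and> x 0 + x 1 + x 2 = 1 \<and> (\<forall>i>2. x i = 0)"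
 (is "?L \<longleftrightarrow> ?R")
proof -
 have "{..2::nat} = {0, 1, 2}" by auto
 then have *: "(\<Sum>i\<le>2. x i) = x 0 + x 1 + x 2" by simp
 show ?thesis
 proof
  show ?R if ?L using that unfolding standard_simplex_def mem_Collect_eq * by blast
  assume R: ?R
  have "0 <= x i \<and> x i <= 1" for i
  proof -
   have "i = 0 \<or> i = 1 \<or> i = 2 \<or> i > 2" by arith
   then show ?thesis using R by (elim disjE) simp_all
  qed
  then show ?L using R unfolding standard_simplex_def mem_Collect_eq * by blast
 qed
qed

lemma standard_simplex_1: "x \<in> standard_simplex 1 \<longleftrightarrow>
  0 <= x 0 \<and> 0 <= x 1 \<and> x 0 + x 1 = 1 \<and> (\<forall>i>1. x i = 0)"
 (is "?L \<longleftrightarrow> ?R")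
proof -
 have "{..1::nat} = {0, 1}" by auto
 then have *: "(\<Sum>i\<le>1. x i) = x 0 + x 1" by simp
 show ?thesis
 proof
  show ?R if ?L using that unfolding standard_simplex_def mem_Collect_eq * by blast
  assume R: ?R
  have "0 <= x i \<and> x i <= 1" for i
  proof -
   have "i = 0 \<or> i = 1 \<or> i > 1" by arith
   then show ?thesis using R by (elim disjE) simp_all
  qed
  then show ?L using R unfolding standard_simplex_def mem_Collect_eq * by blast
 qed
qed

lemma delete_coord_values:
 "delete_coord j y 0 = (if 0 < j then y 0 else y 1)"
 "delete_coord j y 1 = (if 1 < j then y 1 else y 2)"
 "delete_coord j y 2 = (if 2 < j then y 2 else y 3)"
 by (simp_all add: delete_coord_def numeral_2_eq_2 numeral_3_eq_3)

lemma delete_coord_simplex_3: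
 assumes "j < 4" "y \<in> standard_simplex 3" "y j = 0"
 shows "delete_coord j y \<in> standard_simplex 2"
proof -
 have "j = 0 \<or> j = 1 \<or> j = 2 \<or> j = 3" using assms(1) by arith
 moreover have "delete_coord j y i = 0" if "i > 2" for i
  using assms that by (auto simp: delete_coord_def standard_simplex_3)
 ultimately show ?thesis
  using assms(2,3) unfolding standard_simplex_2 standard_simplex_3 delete_coord_values
  by (elim disjE) simp_all
qed

lemma delete_coord_simplex_2:
 assumes "j < 3" "y \<in> standard_simplex 2" "y j = 0"
 shows "delete_coord j y \<in> standard_simplex 1"
proof -
 have "j = 0 \<or> j = 1 \<or> j = 2" using assms(1) by arith
 moreover have "delete_coord j y i = 0" if "i > 1" for i
  using assms that by (auto simp: delete_coord_def standard_simplex_2)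
 ultimately show ?thesis
  using assms(2,3) unfolding standard_simplex_1 standard_simplex_2 delete_coord_values
  by (elim disjE) simp_all
qed

lemma index3: "j < 4 ==> j = 0 \<or> j = 1 \<or> j = 2 \<or> j = (3::nat)"
 by arith

text \<open>
 The horn opposite to the \<open>k\<close>-th face is a retract of the simplex: subtract the minimum of the
 other three coordinates from them and add it to the \<open>k\<close>-th coordinate.
\<close>

lemma horn_filler:
 assumes k: "k < 4"
  and f: "!!j. j < 4 ==> j ~= k ==> singular_simplex 2 Y (f j)"
  and compat: "!!i j. i < j ==> j < 4 ==> i ~= k ==> j ~= k ==> singular_face 2 (j - 1) (f i) = singular_face 2 i (f j)"
 obtains s where "singular_simplex 3 Y s" "!!j. j < 4 ==> j ~= k ==> singular_face 3 j s = f j"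
proof -
 define push where "push = (\<lambda>j (x::nat => real) i. if i = k then x k + 3 * x j else if i < 4 then x i - x j else 0)"
 define F where "F = (\<lambda>j x. f j (delete_coord j (push j x)))"
 define M where "M = (\<lambda>j. {x \<in> standard_simplex 3. \<forall>i<4. i ~= k --> x j <= x i})"
 have push: "push j x \<in> standard_simplex 3" "push j x j = 0" if j: "j < 4" "j ~= k" "x \<in> M j" for j x
 proof -
  have x: "x \<in> standard_simplex 3" "!!i. i < 4 ==> i ~= k ==> x j <= x i" using j by (auto simp: M_def)
  have "0 <= x i" for i using x(1) by (simp add: standard_simplex_def)
  then have nn: "0 <= push j x i" for i using x(2)[of i] by (simp add: push_def)
  have "push j x 0 + push j x 1 + push j x 2 + push j x 3 = x 0 + x 1 + x 2 + x 3"
   using index3[OF k] by (elim disjE) (simp_all add: push_def)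
  moreover have "\<forall>i>3. push j x i = 0" using k by (simp add: push_def)
  ultimately show "push j x \<in> standard_simplex 3"
   using nn x(1) unfolding standard_simplex_3 by simp
  show "push j x j = 0" using j by (simp add: push_def)
 qed
 note del = delete_coord_simplex_3
 have cF: "continuous_map (subtopology (powertop_real UNIV) (M j)) Y (F j)" if j: "j < 4" "j ~= k" for j
 proof -
  have "continuous_map (subtopology (powertop_real UNIV) (M j)) euclideanreal (\<lambda>x. push j x i)" for i
   unfolding push_def
   by (cases "i = k"; cases "i < 4") (auto intro!: continuous_intros continuous_map_coord)
  then have "continuous_map (subtopology (powertop_real UNIV) (M j)) euclideanreal (\<lambda>x. delete_coord j (push j x) i)" for i
   by (cases "i < j") (simp_all add: delete_coord_def)
  then have "continuous_map (subtopology (powertop_real UNIV) (M j)) (simplex_top 2) (\<lambda>x. delete_coord j (push j x))"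
   using del[OF j(1) push[OF j]]
   by (auto simp: continuous_map_in_subtopology continuous_map_componentwise_UNIV Pi_iff)
  moreover have "continuous_map (simplex_top 2) Y (f j)" using f[OF j] by (simp add: singular_simplex_def)
  ultimately have "continuous_map (subtopology (powertop_real UNIV) (M j)) Y (f j \<circ> (\<lambda>x. delete_coord j (push j x)))"
   by (rule continuous_map_compose)
  then show ?thesis by (simp add: F_def o_def)
 qed
 \<comment> \<open>If two coordinates are both minimal, both pushes yield the same point. It lies on
   the common edge of two faces, where \<open>compat\<close> applies.\<close>
 have agree_less: "F i x = F j x" if ij: "i < j" "j < 4" "i ~= k" "j ~= k" and x: "x \<in> M i" "x \<in> M j" for i j x
 proof -
  have i4: "i < 4" using ij by simp
  have "x i = x j" using x ij i4 by (auto simp: M_def intro: order_antisym)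
  then have pe: "push i x = push j x" unfolding push_def by (simp only:)
  define y where "y = push j x"
  have y: "y \<in> standard_simplex 3" "y j = 0" "y i = 0"
   using push[OF ij(2,4) x(2)] push[OF i4 ij(3) x(1)] by (auto simp: y_def pe)
  define z where "z = delete_coord i (delete_coord j y)"
  have z': "z = delete_coord (j - 1) (delete_coord i y)"
   unfolding z_def delete_coord_delete_coord[OF ij(1)] ..
  have di: "delete_coord i y \<in> standard_simplex 2" "delete_coord j y \<in> standard_simplex 2"
   using del[OF i4 y(1,3)] del[OF ij(2) y(1,2)] .
  have e1: "simplical_face (j - 1) z = delete_coord i y"
   unfolding z' by (rule simplical_face_delete) (use ij y in \<open>auto simp: delete_coord_def\<close>)
  have e2: "simplical_face i z = delete_coord j y"
   unfolding z_def by (rule simplical_face_delete) (use ij y in \<open>auto simp: delete_coord_def\<close>)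
  have z1: "z \<in> standard_simplex 1"
   unfolding z_def by (rule delete_coord_simplex_2[OF _ di(2)]) (use ij y in \<open>auto simp: delete_coord_def\<close>)
  have "F i x = f i (simplical_face (j - 1) z)" by (simp only: F_def pe e1 y_def[symmetric])
  also have "\<dots> = f j (simplical_face i z)"
   using fun_cong[OF compat[OF ij], of z] singular_face_apply[of z 2 "j - 1" "f i"] singular_face_apply[of z 2 i "f j"] z1
   by (simp add: numeral_2_eq_2)
  also have "\<dots> = F j x" by (simp only: F_def e2 y_def[symmetric])
  finally show ?thesis .
 qed
 have agree: "F i x = F j x" if "i < 4" "j < 4" "i ~= k" "j ~= k" "x \<in> M i" "x \<in> M j" for i j x
  using agree_less[of i j x] agree_less[of j i x] that by (metis linorder_neqE_nat)
 obtain a b c where abc: "a < 4" "b < 4" "c < 4" "a ~= k" "b ~= k" "c ~= k"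
  "!!j. j < 4 ==> j ~= k ==> j = a \<or> j = b \<or> j = c"
 proof -
  consider "k = 0" | "k = 1" | "k = 2" | "k = 3" using index3[OF k] by blast
  then show thesis
  proof cases
   case 1 then show ?thesis using that[of 1 2 3] index3 by auto
  next
   case 2 then show ?thesis using that[of 0 2 3] index3 by auto
  next
   case 3 then show ?thesis using that[of 0 1 3] index3 by auto
  next
   case 4 then show ?thesis using that[of 0 1 2] index3 by auto
  qed
 qed
 have Ma: "x \<in> M j" if "x \<in> standard_simplex 3" "x j <= x a" "x j <= x b" "x j <= x c" for x j
  using that abc(7) by (auto simp: M_def)
 \<comment> \<open>The smallest of the three coordinates decides to which face \<open>x\<close> is
   pushed. By \<open>agree\<close> the order in which ties are resolved does not matter.\<close>
 define s' where "s' = (\<lambda>x. if x a <= min (x b) (x c) then F a x else if x b <= x c then F b x else F c x)"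
 have s': "s' x = F j x" if "j < 4" "j ~= k" "x \<in> M j" for j x
 proof -
  have x3: "x \<in> standard_simplex 3" using that(3) by (simp add: M_def)
  have "\<exists>i<4. i ~= k \<and> x \<in> M i \<and> s' x = F i x"
  proof (cases "x a <= min (x b) (x c)")
   case True
   then show ?thesis using Ma[OF x3, of a] abc by (intro exI[of _ a]) (auto simp: s'_def)
  next
   case False
   show ?thesis
   proof (cases "x b <= x c")
    case True
    then show ?thesis using False Ma[OF x3, of b] abc by (intro exI[of _ b]) (auto simp: s'_def)
   next
    case F': False
    then show ?thesis using False Ma[OF x3, of c] abc by (intro exI[of _ c]) (auto simp: s'_def)
   qed
  qed
  then show ?thesis using agree that by metis
 qed
 have "continuous_map (simplex_top 3) Y s'"
  unfolding s'_def
 proof (rule continuous_map_cases_le)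
  show "continuous_map (simplex_top 3) euclideanreal (\<lambda>x. min (x b) (x c))"
   by (intro continuous_intros continuous_map_coord)
  have sub: "continuous_map (subtopology (powertop_real UNIV) A) Y (F j)" if "A \<subseteq> M j" "j < 4" "j ~= k" for A j
   using continuous_map_from_subtopology_mono[OF cF[OF that(2,3)] that(1)] .
  show "continuous_map (subtopology (simplex_top 3) {x \<in> topspace (simplex_top 3). x a <= min (x b) (x c)}) Y (F a)"
   unfolding subtopology_subtopology using abc Ma by (intro sub) auto
  show "continuous_map (subtopology (simplex_top 3) {x \<in> topspace (simplex_top 3). min (x b) (x c) <= x a}) Y
    (\<lambda>x. if x b <= x c then F b x else F c x)"
  proof (rule continuous_map_cases_le)
   let ?X = "subtopology (simplex_top 3) {x \<in> topspace (simplex_top 3). min (x b) (x c) <= x a}"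
   show "continuous_map (subtopology ?X {x \<in> topspace ?X. x b <= x c}) Y (F b)"
    "continuous_map (subtopology ?X {x \<in> topspace ?X. x c <= x b}) Y (F c)"
    unfolding subtopology_subtopology using abc Ma by (intro sub; auto)+
   show "F b x = F c x" if "x \<in> topspace ?X" "x b = x c" for x
    using that abc Ma by (intro agree) auto
  qed (simp_all add: continuous_map_from_subtopology continuous_map_coord)
  show "F a x = (if x b <= x c then F b x else F c x)"
   if "x \<in> topspace (simplex_top 3)" "x a = min (x b) (x c)" for x
  proof (cases "x b <= x c")
   case True
   then have "F a x = F b x" using that abc Ma by (intro agree) auto
   then show ?thesis using True by simp
  next
   case False
   then have "F a x = F c x" using that abc Ma by (intro agree) auto
   then show ?thesis using False by simp
  qed
 qed (rule continuous_map_coord)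
 then have 1: "singular_simplex 3 Y (restrict s' (standard_simplex 3))"
  by (simp add: singular_simplex_def)
 have 2: "singular_face 3 j (restrict s' (standard_simplex 3)) = f j" if j: "j < 4" "j ~= k" for j
 proof
  fix z
  show "singular_face 3 j (restrict s' (standard_simplex 3)) z = f j z"
  proof (cases "z \<in> standard_simplex 2")
   case True
   let ?x = "simplical_face j z"
   have x3: "?x \<in> standard_simplex 3" using simplical_face_in_standard_simplex[of 3 j z] True j by simp
   have xj: "?x j = 0" by (simp add: simplical_face_def)
   have "?x i >= 0" for i using x3 by (simp add: standard_simplex_def)
   then have xM: "?x \<in> M j" using x3 xj by (simp add: M_def)
   have "?x i = 0" if "i >= 4" for i using x3 that by (simp add: standard_simplex_3)
   then have "push j ?x = ?x" by (auto simp: push_def xj fun_eq_iff)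
   then show ?thesis using s'[OF j xM] x3 True by (simp add: singular_face_def F_def)
  next
   case False
   then show ?thesis using f[OF j] by (simp add: singular_face_def singular_simplex_def extensional_def)
  qed
 qed
 show ?thesis using that[OF 1 2] by blast
qed

text \<open>The lemmas are named after the vertices of the missing face of the horn.\<close>

lemma triangle_013:
 assumes "triangle Y a e01 e12 e02" "triangle Y b e02 e23 e03" "triangle Y c e12 e23 e13"
 obtains d s where "triangle Y d e01 e13 e03" "singular_simplex 3 Y s"
  "chain_boundary 3 (frag_of s) = frag_of c - frag_of b + frag_of d - frag_of a"
proof -
 let ?f = "\<lambda>j::nat. if j = 0 then c else if j = 1 then b else a"
 obtain s where s: "singular_simplex 3 Y s" "!!j. j < 4 ==> j ~= 2 ==> singular_face 3 j s = ?f j"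
 proof (rule horn_filler[of 2 Y ?f])
  show "singular_simplex 2 Y (?f j)" for j using assms by (auto simp: triangle_def)
  show "singular_face 2 (j - 1) (?f i) = singular_face 2 i (?f j)" if "i < j" "j < 4" "i ~= 2" "j ~= 2" for i j
  proof -
   have "(i = 0 \<and> j = 1) \<or> (i = 0 \<and> j = 3) \<or> (i = 1 \<and> j = 3)" using that by arith
   then show ?thesis using assms by (auto simp: triangle_def)
  qed
 qed auto
 let ?d = "singular_face 3 2 s"
 have faces: "singular_face 3 0 s = c" "singular_face 3 1 s = b" "singular_face 3 3 s = a"
  using s(2)[of 0] s(2)[of 1] s(2)[of 3] by auto
 have "singular_simplex 2 Y ?d" using singular_simplex_singular_face[OF s(1), of 2] by simp
 moreover have "singular_face 2 2 ?d = singular_face 2 2 (singular_face 3 3 s)"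
  "singular_face 2 1 ?d = singular_face 2 1 (singular_face 3 1 s)" "singular_face 2 0 ?d = singular_face 2 1 (singular_face 3 0 s)"
  using singular_face_face[of 3 2 2 s] singular_face_face[of 3 1 1 s] singular_face_face[of 3 1 0 s]
  by (simp_all add: numeral_3_eq_3 numeral_2_eq_2)
 ultimately have "triangle Y ?d e01 e13 e03"
  unfolding faces using assms by (simp add: triangle_def)
 then show ?thesis using s(1) faces by (intro that[of ?d s]) (auto simp: chain_boundary_3)
qed

lemma triangle_023:
 assumes "triangle Y a e01 e12 e02" "triangle Y d e01 e13 e03" "triangle Y c e12 e23 e13"
 obtains b s where "triangle Y b e02 e23 e03" "singular_simplex 3 Y s"
  "chain_boundary 3 (frag_of s) = frag_of c - frag_of b + frag_of d - frag_of a"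
proof -
 let ?f = "\<lambda>j::nat. if j = 0 then c else if j = 2 then d else a"
 obtain s where s: "singular_simplex 3 Y s" "!!j. j < 4 ==> j ~= 1 ==> singular_face 3 j s = ?f j"
 proof (rule horn_filler[of 1 Y ?f])
  show "singular_simplex 2 Y (?f j)" for j using assms by (auto simp: triangle_def)
  show "singular_face 2 (j - 1) (?f i) = singular_face 2 i (?f j)" if "i < j" "j < 4" "i ~= 1" "j ~= 1" for i j
  proof -
   have "(i = 0 \<and> j = 2) \<or> (i = 0 \<and> j = 3) \<or> (i = 2 \<and> j = 3)" using that by arith
   then show ?thesis using assms by (auto simp: triangle_def)
  qed
 qed auto
 let ?b = "singular_face 3 1 s"
 have faces: "singular_face 3 0 s = c" "singular_face 3 2 s = d" "singular_face 3 3 s = a"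
  using s(2)[of 0] s(2)[of 2] s(2)[of 3] by auto
 have "singular_simplex 2 Y ?b" using singular_simplex_singular_face[OF s(1), of 1] by simp
 moreover have "singular_face 2 2 ?b = singular_face 2 1 (singular_face 3 3 s)"
  "singular_face 2 1 ?b = singular_face 2 1 (singular_face 3 2 s)" "singular_face 2 0 ?b = singular_face 2 0 (singular_face 3 0 s)"
  using singular_face_face[of 3 2 1 s] singular_face_face[of 3 1 1 s] singular_face_face[of 3 0 0 s]
  by (simp_all add: numeral_3_eq_3 numeral_2_eq_2)
 ultimately have "triangle Y ?b e02 e23 e03"
  unfolding faces using assms by (simp add: triangle_def)
 then show ?thesis using s(1) faces by (intro that[of ?b s]) (auto simp: chain_boundary_3)
qed

context presentation
begin

text \<open>If the letter cancels, \<open>x (x^-1 w) = w\<close> follows from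
  \<open>x x^-1 = 1\<close> and \<open>1 w = w\<close> by filling a horn.\<close>

lemma triangle_letter:
 assumes x: "fst x \<in> S" and u: "u \<in> over S"
 obtains \<sigma> where "triangle P1 \<sigma> (edge [x]) (edge (word u)) (edge (word (letter x + u)))"
proof (cases "word (letter x + u) = x # word u")
 case True
 have w: "fst ` set (word u) \<subseteq> S" using u by (simp add: over_def)
 show ?thesis
  by (rule triangle_Cons[OF x w]) (use that True in simp)
next
 case False
 then obtain w where w: "word u = inv_letter x # w" "word (letter x + u) = w"
  by (auto simp: word_letter_plus cancel_cons_def split: list.splits if_splits)
 have x': "fst (inv_letter x) \<in> S" and wS: "fst ` set w \<subseteq> S"
  using x u w by (auto simp: over_def)
 obtain \<sigma>1 where 1: "triangle P1 \<sigma>1 (edge [x]) (edge [inv_letter x]) (edge [])" by (rule triangle_inverse[OF x])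
 obtain \<sigma>2 where 2: "triangle P1 \<sigma>2 (edge []) (edge w) (edge w)" by (rule triangle_degenerate[OF wS])
 obtain \<sigma>3 where 3: "triangle P1 \<sigma>3 (edge [inv_letter x]) (edge w) (edge (word u))"
  using triangle_Cons[OF x' wS] unfolding w(1) by metis
 show ?thesis by (rule triangle_013[OF 1 2 3]) (use that w(2) in simp)
qed

text \<open>The inductive step is associativity in the form of a horn: the faces for
  \<open>x u\<close>, \<open>x (u u')\<close> and \<open>u u'\<close> determine the one for
  \<open>(x u) u'\<close>.\<close>

lemma triangle_words:
 assumes "u \<in> over S" "u' \<in> over S"
 obtains \<sigma> where "triangle P1 \<sigma> (edge (word u)) (edge (word u')) (edge (word (u + u')))"
proof -
 have "\<exists>\<sigma>. triangle P1 \<sigma> (edge (word u)) (edge (word u')) (edge (word (u + u')))"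
  using assms
 proof (induction u rule: fg_induct)
  case zero
  then have "fst ` set (word u') \<subseteq> S" by (simp add: over_def)
  then show ?case by (rule triangle_degenerate) auto
 next
  case (Cons x u)
  then have x: "fst x \<in> S" and u: "u \<in> over S" by (auto simp: over_def)
  obtain \<sigma>1 where 1: "triangle P1 \<sigma>1 (edge [x]) (edge (word u)) (edge (word (letter x + u)))"
   by (rule triangle_letter[OF x u])
  obtain \<sigma>2 where 2: "triangle P1 \<sigma>2 (edge (word u)) (edge (word u')) (edge (word (u + u')))"
   using Cons.IH[OF u Cons.prems(2)] by blast
  obtain \<sigma>3 where 3: "triangle P1 \<sigma>3 (edge [x]) (edge (word (u + u'))) (edge (word (letter x + (u + u'))))"
   by (rule triangle_letter[OF x over_plus[OF u Cons.prems(2)]])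
  show ?case by (rule triangle_023[OF 1 3 2]) (auto simp: add.assoc)
 qed
 then show ?thesis using that by blast
qed

end

section \<open>Second homology of a graph\<close>

lemma openin_open_disc: "openin (disc n) (open_disc n)"
proof -
 have "open_disc n = {x \<in> topspace (disc n). rad n x < 1}" by (auto simp: disc_iff open_disc_iff)
 then show ?thesis using openin_rad(2) by simp
qed

lemma cell_homeomorphic:
 assumes att: "attaches_cells n A Y I \<phi>" and n: "n >= 1" and i: "i \<in> I" and B: "B \<subseteq> open_disc n"
 shows "subtopology (disc n) B homeomorphic_space subtopology Y (\<phi> i ` B)"
proof (rule homeomorphic_map_imp_homeomorphic_space)
 have bij: "bij_betw (\<lambda>(i, x). \<phi> i x) (I \<times> open_disc n) (topspace Y - topspace A)"
  using att by (simp add: attaches_cells_def)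
 have inj: "inj_on (\<phi> i) (open_disc n)"
  using inj_onD[OF bij_betw_imp_inj_on[OF bij], of "(i, _)" "(i, _)"] i by (intro inj_onI) auto
 have BD: "B \<subseteq> topspace (disc n)" using B by (auto simp: disc_iff open_disc_iff)
 have BY: "\<phi> i ` B \<subseteq> topspace Y" using bij_betwE[OF bij] B i by force
 show "homeomorphic_map (subtopology (disc n) B) (subtopology Y (\<phi> i ` B)) (\<phi> i)"
 proof (rule bijective_open_imp_homeomorphic_map)
  show "continuous_map (subtopology (disc n) B) (subtopology Y (\<phi> i ` B)) (\<phi> i)"
   using attaches_cells_continuous_map[OF att n i]
   by (auto simp: continuous_map_in_subtopology continuous_map_from_subtopology)
  show "open_map (subtopology (disc n) B) (subtopology Y (\<phi> i ` B)) (\<phi> i)"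
   unfolding open_map_def
  proof (intro allI impI)
   fix U assume "openin (subtopology (disc n) B) U"
   then obtain V where V: "openin (disc n) V" "U = V \<inter> B" by (auto simp: openin_subtopology)
   let ?V = "V \<inter> open_disc n"
   have "openin Y (\<phi> i ` ?V)"
    by (rule openin_cell_image[OF att n i]) (use V(1) openin_open_disc in auto)
   moreover have "\<phi> i ` U = \<phi> i ` ?V \<inter> \<phi> i ` B"
    using B inj by (auto simp: V(2) inj_on_def)
   ultimately show "openin (subtopology Y (\<phi> i ` B)) (\<phi> i ` U)" by (auto simp: openin_subtopology)
  qed
  show "\<phi> i ` topspace (subtopology (disc n) B) = topspace (subtopology Y (\<phi> i ` B))"
   using BD BY by auto
  show "inj_on (\<phi> i) (topspace (subtopology (disc n) B))"
   using B by (intro inj_on_subset[OF inj]) auto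
 qed
qed

lemma trivial_homology_bounds:
 assumes "trivial_group (homology_group (int p) X)" "singular_relcycle p X {} c"
 shows "singular_relboundary p X {} c"
proof -
 have "homologous_rel_set p X {} c \<in> carrier (homology_group (int p) X)"
  using assms(2) by (simp add: carrier_relative_homology_group)
 then have "homologous_rel_set p X {} c = singular_relboundary_set p X {}"
  using assms(1) by (simp add: trivial_group_def)
 then show ?thesis using homologous_rel_refl[of p X "{}" c] by blast
qed

lemma contractible_bounds:
 assumes "contractible_space X" "p > 0" "singular_relcycle p X {} c"
 shows "singular_relboundary p X {} c"
 using trivial_reduced_homology_group_contractible_space[OF assms(1), of "int p"] assms(2,3)
 by (intro trivial_homology_bounds) (auto simp: un_reduced_homology_group)

text \<open>There may be infinitely many pieces, one or two for each letter; the additivity of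
  homology reduces the claim to single contractible pieces.\<close>

lemma disjoint_union_bounds:
 assumes disj: "pairwise disjnt \<U>" and op: "!!T. T \<in> \<U> ==> openin X T"
  and con: "!!T. T \<in> \<U> ==> contractible_space (subtopology X T)"
  and p: "p > 0" and c: "singular_relcycle p (subtopology X (\<Union>\<U>)) {} c"
 shows "singular_relboundary p (subtopology X (\<Union>\<U>)) {} c"
proof -
 let ?X = "subtopology X (\<Union>\<U>)"
 let ?G = "\<lambda>T. homology_group (int p) (subtopology ?X T)"
 have sub: "subtopology ?X T = subtopology X T" if "T \<in> \<U>" for T
  using that by (simp add: subtopology_subtopology Int_absorb1 Sup_upper)
 have op': "openin ?X T" if "T \<in> \<U>" for T
  using op[OF that] that by (auto simp: openin_subtopology intro!: exI[of _ T])
 have "(\<lambda>x. gfinprod (homology_group (int p) ?X)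
      (\<lambda>V. hom_induced (int p) (subtopology ?X V) {} ?X {} id (x V)) \<U>) \<in> iso (sum_group \<U> ?G) (homology_group (int p) ?X)"
 proof (rule homology_additivity_axiom_gen[OF disj])
  show "\<Union>\<U> = topspace ?X" using op openin_subset by fastforce
  fix C T assume C: "compactin ?X C" "path_connectedin ?X C" "T \<in> \<U>" "\<not> disjnt C T"
  show "C \<subseteq> T"
  proof (rule ccontr)
   assume "\<not> C \<subseteq> T"
   have "C \<subseteq> \<Union>\<U>" using compactin_subset_topspace[OF C(1)] by simp
   then have CT: "C \<subseteq> T \<union> \<Union>(\<U> - {T})" by blast
   then have "(\<Union>(\<U> - {T})) \<inter> C ~= {}" using \<open>\<not> C \<subseteq> T\<close> by blast
   moreover have "T \<inter> \<Union>(\<U> - {T}) \<inter> C = {}" using disj C(3) by (auto simp: pairwise_def disjnt_def)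
   moreover have "T \<inter> C ~= {}" using C(4) by (auto simp: disjnt_def)
   moreover have "openin ?X (\<Union>(\<U> - {T}))" using op' by (intro openin_Union) auto
   ultimately show False
    using connectedinD[OF path_connectedin_imp_connectedin[OF C(2)] op'[OF C(3)]] CT by blast
  qed
 qed
 then have "homology_group (int p) ?X \<cong> sum_group \<U> ?G"
  by (meson group.iso_sym is_isoI sum_group group_relative_homology_group)
 moreover have "trivial_group (sum_group \<U> ?G)"
 proof -
  have "trivial_group (product_group \<U> ?G)"
   unfolding trivial_product_group
  proof
   fix T assume T: "T \<in> \<U>"
   show "trivial_group (?G T)"
    using trivial_reduced_homology_group_contractible_space[OF con[OF T], of "int p"] p sub[OF T]
    by (simp add: un_reduced_homology_group)
  qed
  then have "carrier (product_group \<U> ?G) = {\<one>\<^bsub>product_group \<U> ?G\<^esub>}" by (simp add: trivial_group_def)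
  moreover have "carrier (sum_group \<U> ?G) \<subseteq> carrier (product_group \<U> ?G)"
   by (auto simp: carrier_sum_group)
  ultimately have sub1: "carrier (sum_group \<U> ?G) \<subseteq> {\<one>\<^bsub>product_group \<U> ?G\<^esub>}" by simp
  have G: "group (sum_group \<U> ?G)" by simp
  then have "\<one>\<^bsub>sum_group \<U> ?G\<^esub> \<in> carrier (sum_group \<U> ?G)" by (rule monoid.one_closed[OF group.is_monoid])
  moreover have "A = {x}" if "x \<in> A" "A \<subseteq> {y}" for A and x y :: "'b set => 'b chain set"
   using that by blast
  from this[OF calculation sub1] have "carrier (sum_group \<U> ?G) = {\<one>\<^bsub>sum_group \<U> ?G\<^esub>}" .
  then show ?thesis using G by (simp only: trivial_group_def)
 qed
 ultimately have "trivial_group (homology_group (int p) ?X)"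
  using isomorphic_group_triviality[of "homology_group (int p) ?X" "sum_group \<U> ?G"] by simp
 then show ?thesis using c by (rule trivial_homology_bounds)
qed

lemma singular_chain_subtopologyI:
 assumes "singular_chain p X c" "!!f. f \<in> Poly_Mapping.keys c ==> f \<in> standard_simplex p \<rightarrow> T"
 shows "singular_chain p (subtopology X T) c"
 unfolding singular_chain_subtopology using assms by (auto simp: Pi_iff image_subset_iff)

text \<open>The Mayer--Vietoris argument on the level of chains: after subdivision the cycle is
  \<open>u + w\<close>. The common boundary of the parts is filled by \<open>y\<close> in the
  intersection, so that \<open>u - y\<close> and \<open>w + y\<close> are cycles in the two open
  sets.\<close>

lemma cycle_bounds_Mayer_Vietoris:
 assumes U: "openin X U" "!!c. singular_relcycle (Suc p) (subtopology X U) {} c ==> singular_relboundary (Suc p) (subtopology X U) {} c"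
  and W: "openin X W" "!!c. singular_relcycle (Suc p) (subtopology X W) {} c ==> singular_relboundary (Suc p) (subtopology X W) {} c"
  and UW: "topspace X = U \<union> W"
   "!!c. singular_relcycle p (subtopology X (U \<inter> W)) {} c ==> singular_relboundary p (subtopology X (U \<inter> W)) {} c"
  and z: "singular_relcycle (Suc p) X {} z"
 shows "singular_relboundary (Suc p) X {} z"
proof -
 obtain z' where z': "singular_relcycle (Suc p) X {} z'" "homologous_rel (Suc p) X {} z z'"
  "!!f. f \<in> Poly_Mapping.keys z' ==> \<exists>V\<in>{U, W}. f \<in> standard_simplex (Suc p) \<rightarrow> V"
  by (rule small_homologous_rel_relcycle_exists[of "{U, W}" X "Suc p" "{}" z]) (use U W UW z in auto)
 let ?K = "\<lambda>V. {f. singular_simplex (Suc p) X f \<and> f \<in> standard_simplex (Suc p) \<rightarrow> V}"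
 have zc: "singular_chain (Suc p) X z'" "chain_boundary (Suc p) z' = 0"
  using z'(1) by (auto simp: singular_cycle)
 then have "Poly_Mapping.keys z' \<subseteq> ?K U \<union> ?K W"
  using z'(3) by (auto simp: singular_chain_def)
 then obtain u w where uw: "Poly_Mapping.keys u \<subseteq> ?K U" "Poly_Mapping.keys w \<subseteq> ?K W" "u + w = z'"
  by (rule frag_split)
 have uc: "singular_chain (Suc p) (subtopology X U) u" and wc: "singular_chain (Suc p) (subtopology X W) w"
  using uw(1,2) by (intro singular_chain_subtopologyI; force simp: singular_chain_def)+
 have uX: "singular_chain (Suc p) X u" using uc by (simp add: singular_chain_subtopology)
 have dw: "chain_boundary (Suc p) w = - chain_boundary (Suc p) u"
  using zc(2) uw(3) by (metis add.commute add_eq_0_iff chain_boundary_add)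
 have "singular_chain p (subtopology X U) (chain_boundary (Suc p) u)"
  using singular_chain_boundary[OF uc] by simp
 moreover have "singular_chain p (subtopology X W) (chain_boundary (Suc p) u)"
  using singular_chain_minus[THEN iffD2, OF singular_chain_boundary[OF wc]] by (simp add: dw)
 ultimately have "singular_chain p (subtopology X (U \<inter> W)) (chain_boundary (Suc p) u)"
  by (auto simp: singular_chain_subtopology)
 then have "singular_relcycle p (subtopology X (U \<inter> W)) {} (chain_boundary (Suc p) u)"
  using chain_boundary_boundary[OF uX] by (simp add: singular_cycle)
 then have "singular_relboundary p (subtopology X (U \<inter> W)) {} (chain_boundary (Suc p) u)" by (rule UW(2))
 then obtain y where y: "singular_chain (Suc p) (subtopology X (U \<inter> W)) y" "chain_boundary (Suc p) y = chain_boundary (Suc p) u"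
  by (auto simp: singular_boundary)
 have yU: "singular_chain (Suc p) (subtopology X U) y" and yW: "singular_chain (Suc p) (subtopology X W) y"
  using y(1) by (auto simp: singular_chain_subtopology)
 have "singular_relboundary (Suc p) (subtopology X U) {} (u - y)"
  by (rule U(2)) (use uc yU y(2) in \<open>simp add: singular_cycle singular_chain_diff chain_boundary_diff\<close>)
 moreover have "singular_relboundary (Suc p) (subtopology X W) {} (w + y)"
  by (rule W(2)) (use wc yW y(2) in \<open>simp add: singular_cycle singular_chain_add chain_boundary_add dw\<close>)
 moreover have "singular_relboundary (Suc p) X {} c" if "singular_relboundary (Suc p) (subtopology X V) {} c" "V \<subseteq> topspace X" for V c
  using singular_boundary_mono[OF that(2,1)] by simp
 moreover have "U \<subseteq> topspace X" "W \<subseteq> topspace X" using UW(1) by auto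
 ultimately have "singular_relboundary (Suc p) X {} (u - y)" "singular_relboundary (Suc p) X {} (w + y)" by blast+
 then have "singular_relboundary (Suc p) X {} ((u - y) + (w + y))" by (rule singular_relboundary_add)
 then have "singular_relboundary (Suc p) X {} z'" using uw(3) by (simp add: algebra_simps)
 then have "homologous_rel (Suc p) X {} z' 0" by (simp add: homologous_rel_def)
 then show ?thesis
  using homologous_rel_trans[OF _ z'(2)] by (fastforce simp: homologous_rel_def)
qed

context presentation
begin

definition cells :: "((nat => real) => bool) => 'x set" where
 "cells Q = {\<phi> s x |s x. s \<in> S \<and> x \<in> open_disc 1 \<and> Q x}"

lemma bij_cells: "bij_betw (\<lambda>(i, x). \<phi> i x) (S \<times> open_disc 1) (topspace P1 - {v})"
 using att1 by (simp add: attaches_cells_def)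

lemma cell1: "s \<in> S ==> x \<in> open_disc 1 ==> \<phi> s x \<in> topspace P1 \<and> \<phi> s x ~= v"
 using bij_betwE[OF bij_cells, rule_format, of "(s, x)"] by simp

lemma cell1_inj: "s \<in> S ==> x \<in> open_disc 1 ==> s' \<in> S ==> x' \<in> open_disc 1 ==> \<phi> s x = \<phi> s' x' ==> s = s' \<and> x = x'"
 using inj_onD[OF bij_betw_imp_inj_on[OF bij_cells], of "(s, x)" "(s', x')"] by simp

lemma cell1_E:
 assumes "y \<in> topspace P1" "y ~= v"
 obtains s x where "s \<in> S" "x \<in> open_disc 1" "y = \<phi> s x"
proof -
 have "y \<in> (\<lambda>(i, x). \<phi> i x) ` (S \<times> open_disc 1)"
  using assms bij_betw_imp_surj_on[OF bij_cells] by simp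
 then obtain z where "z \<in> S \<times> open_disc 1" "y = (\<lambda>(i, x). \<phi> i x) z" by (rule imageE)
 then show ?thesis by (intro that[of "fst z" "snd z"]) (simp_all add: mem_Times_iff case_prod_unfold)
qed

lemma disc1: "x \<in> topspace (disc 1) \<longleftrightarrow> (\<exists>u. \<bar>u\<bar> <= 1 \<and> x = line_point u)"
 and open_disc1: "x \<in> open_disc 1 \<longleftrightarrow> (\<exists>u. \<bar>u\<bar> < 1 \<and> x = line_point u)"
proof -
 have "(\<forall>i\<ge>1. x i = 0) \<longleftrightarrow> x = line_point (x 0)"
  by (auto simp: line_point_def fun_eq_iff)
 moreover have "rad 1 x = \<bar>x 0\<bar>" by (simp add: rad_def)
 ultimately show "x \<in> topspace (disc 1) \<longleftrightarrow> (\<exists>u. \<bar>u\<bar> <= 1 \<and> x = line_point u)"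
  "x \<in> open_disc 1 \<longleftrightarrow> (\<exists>u. \<bar>u\<bar> < 1 \<and> x = line_point u)"
  unfolding disc_iff open_disc_iff by (auto simp: line_point_def)
qed

lemma line_point_0 [simp]: "line_point u 0 = u"
 by (simp add: line_point_def)

text \<open>The index \<open>b\<close> covers two cases: equal intervals describe the open 1-cells,
  different ones the two halves of each 1-cell. This is why disjointness is only demanded for
  different sets.\<close>

lemma cells_contractible_pieces:
 assumes "p > 0" "!!b. open (Q b)" "!!b. Q b ~= {}" "!!b. Q b \<subseteq> {-1<..<1}" "!!b. convex (Q b)"
  and disj: "!!b b' :: bool. b ~= b' ==> Q b ~= Q b' ==> Q b \<inter> Q b' = {}"
  and c: "singular_relcycle p (subtopology P1 (cells (\<lambda>x. \<exists>b. x 0 \<in> Q b))) {} c"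
 shows "singular_relboundary p (subtopology P1 (cells (\<lambda>x. \<exists>b. x 0 \<in> Q b))) {} c"
proof -
 define D where "D = (\<lambda>b. line_point ` Q b)"
 let ?\<U> = "{\<phi> s ` D b |s b. s \<in> S}"
 have mem_D: "x \<in> D b \<longleftrightarrow> x \<in> open_disc 1 \<and> x 0 \<in> Q b" for x b
 proof
  assume "x \<in> D b"
  then obtain u where u: "u \<in> Q b" "x = line_point u" by (auto simp: D_def)
  moreover have "u \<in> {-1<..<1}" using u(1) assms(4)[of b] by blast
  then have "\<bar>u\<bar> < 1" by auto
  ultimately show "x \<in> open_disc 1 \<and> x 0 \<in> Q b" unfolding open_disc1 by auto
 next
  assume x: "x \<in> open_disc 1 \<and> x 0 \<in> Q b"
  then obtain u where "x = line_point u" unfolding open_disc1 by blast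
  then show "x \<in> D b" using x by (simp add: D_def)
 qed
 then have D: "D b \<subseteq> open_disc 1" for b by blast
 have eq: "\<Union>?\<U> = cells (\<lambda>x. \<exists>b. x 0 \<in> Q b)"
  unfolding cells_def by (safe; use mem_D in blast)
 have D_alt: "D b = {x \<in> topspace (disc 1). x 0 \<in> Q b}" for b
 proof (intro Set.set_eqI)
  fix x
  have "x \<in> open_disc 1" if "x \<in> topspace (disc 1)" "x 0 \<in> Q b"
  proof -
   obtain u where u: "x = line_point u" using \<open>x \<in> topspace (disc 1)\<close> unfolding disc1 by blast
   then have "u \<in> {-1<..<1}" using that(2) assms(4)[of b] by auto
   then have "\<bar>u\<bar> < 1" by auto
   then show ?thesis using u unfolding open_disc1 by blast
  qed
  moreover have "x \<in> topspace (disc 1)" if "x \<in> open_disc 1"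
   using that openin_subset[OF openin_open_disc] by blast
  ultimately show "x \<in> D b \<longleftrightarrow> x \<in> {x \<in> topspace (disc 1). x 0 \<in> Q b}" unfolding mem_D by blast
 qed
 have "singular_relboundary p (subtopology P1 (\<Union>?\<U>)) {} c"
 proof (rule disjoint_union_bounds)
  show "pairwise disjnt ?\<U>"
  proof (rule pairwiseI)
   fix A B assume "A \<in> ?\<U>" "B \<in> ?\<U>" "A ~= B"
   then obtain s b s' b' where AB: "A = \<phi> s ` D b" "B = \<phi> s' ` D b'" "s \<in> S" "s' \<in> S" by blast
   show "disjnt A B"
   proof (rule ccontr)
    assume "\<not> disjnt A B"
    then obtain x x' where x: "x \<in> D b" "x' \<in> D b'" "\<phi> s x = \<phi> s' x'" unfolding AB disjnt_iff by blast
    then have "s = s'" "x = x'" using cell1_inj[of s x s' x'] D AB by blast+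
    moreover have "Q b = Q b'" using x(1,2) \<open>x = x'\<close> disj[of b b'] unfolding mem_D by blast
    ultimately show False using \<open>A ~= B\<close> by (simp add: AB D_def)
   qed
  qed
  fix T assume "T \<in> ?\<U>"
  then obtain s b where T: "T = \<phi> s ` D b" "s \<in> S" by blast
  have "openin (disc 1) (D b)"
   unfolding D_alt by (rule openin_continuous_map_preimage[OF continuous_map_disc_coord]) (use assms(2) in auto)
  then show "openin P1 T" unfolding T by (intro openin_cell_image[OF att1 _ T(2)] D) auto
  obtain u where u: "u \<in> Q b" using assms(3) by blast
  have "contractible_space (subtopology (powertop_real UNIV) (D b))"
  proof (rule contractible_convex)
   show "line_point u \<in> D b" using u by (simp add: D_def)
   fix x t assume "x \<in> D b" and t: "0 <= t" "t <= (1::real)"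
   then obtain w where w: "x = line_point w" "w \<in> Q b" by (auto simp: D_def)
   have "(1 - t) *\<^sub>R w + t *\<^sub>R u \<in> Q b" using assms(5)[of b] u w(2) t by (simp add: convex_alt)
   moreover have "(\<lambda>i. (1 - t) * x i + t * line_point u i) = line_point ((1 - t) *\<^sub>R w + t *\<^sub>R u)"
    by (auto simp: w(1) line_point_def fun_eq_iff)
   ultimately show "(\<lambda>i. (1 - t) * x i + t * line_point u i) \<in> D b" by (simp add: D_def)
  qed
  moreover have "subtopology (disc 1) (D b) = subtopology (powertop_real UNIV) (D b)"
   using D_alt by (subst disc_eq_subtopology) (simp add: subtopology_subtopology Int_absorb1 subset_iff)
  ultimately show "contractible_space (subtopology P1 T)"
   using homeomorphic_space_contractibility[OF cell_homeomorphic[OF att1 _ T(2) D, of b]] by (simp add: T(1))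
 qed (use assms(1) c eq in auto)
 then show ?thesis by (simp only: eq)
qed

end

context presentation
begin

text \<open>The graph without the midpoints of its 1-cells, that is, an open star of the
  vertex.\<close>

definition punctured :: "'x set" where
 "punctured = {y \<in> topspace P1. \<forall>s\<in>S. y ~= \<phi> s (line_point 0)}"

lemma \<phi>_punctured:
 assumes "s \<in> S" "x \<in> topspace (disc 1)"
 shows "\<phi> s x \<in> punctured \<longleftrightarrow> x 0 ~= 0"
proof -
 obtain u where u: "x = line_point u" "\<bar>u\<bar> <= 1" using assms(2) unfolding disc1 by blast
 have 0: "line_point 0 \<in> open_disc 1" unfolding open_disc1 by (intro exI[of _ 0]) simp
 show ?thesis
 proof (cases "\<bar>u\<bar> < 1")
  case True
  then have x: "x \<in> open_disc 1" unfolding open_disc1 u(1) by blast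
  show ?thesis
  proof (cases "u = 0")
   case True
   then show ?thesis using assms(1) u(1) by (auto simp: punctured_def)
  next
   case False
   then have "x ~= line_point 0" using u(1) by (metis line_point_0)
   then have "\<phi> s x ~= \<phi> s' (line_point 0)" if "s' \<in> S" for s'
    using cell1_inj[OF assms(1) x that 0] by blast
   then show ?thesis using False u(1) cell1[OF assms(1) x] by (simp add: punctured_def)
  qed
 next
  case False
  then have "u = 1 \<or> u = - 1" using u(2) by auto
  then have "\<phi> s x = v" using \<phi>_end[OF assms(1)] u(1) by auto
  moreover have "v \<in> punctured" using cell1[OF _ 0] v_in_P1 by (force simp: punctured_def)
  ultimately show ?thesis using \<open>u = 1 \<or> u = - 1\<close> u(1) by auto
 qed
qed

lemma v_punctured: "v \<in> punctured"
proof -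
 have "line_point 0 \<in> open_disc 1" unfolding open_disc1 by (intro exI[of _ 0]) simp
 then show ?thesis using cell1 v_in_P1 by (force simp: punctured_def)
qed

lemma openin_coord: "open A ==> openin (disc 1) {x \<in> topspace (disc 1). x 0 \<in> A}"
 by (rule openin_continuous_map_preimage[OF continuous_map_disc_coord]) simp

lemma openin_P1_iff:
 assumes "N \<subseteq> topspace P1"
 shows "openin P1 N \<longleftrightarrow> (\<forall>s\<in>S. openin (disc 1) {x \<in> topspace (disc 1). \<phi> s x \<in> N})"
 using openin_attaches_cells[OF att1, of N] assms by simp

lemma openin_punctured: "openin P1 punctured"
proof (subst openin_P1_iff)
 show "punctured \<subseteq> topspace P1" by (auto simp: punctured_def)
 show "\<forall>s\<in>S. openin (disc 1) {x \<in> topspace (disc 1). \<phi> s x \<in> punctured}"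
 proof
  fix s assume "s \<in> S"
  then have "{x \<in> topspace (disc 1). \<phi> s x \<in> punctured} = {x \<in> topspace (disc 1). x 0 \<in> - {0}}"
   using \<phi>_punctured by auto
  then show "openin (disc 1) {x \<in> topspace (disc 1). \<phi> s x \<in> punctured}" using openin_coord[of "- {0}"] by (simp add: open_Compl)
 qed
qed

text \<open>Each half of a 1-cell is pushed linearly to its end. Away from the vertex this happens
  inside one cell; the delicate point is continuity at the vertex, where infinitely many cells may
  meet.\<close>

lemma contractible_punctured: "contractible_space (subtopology P1 punctured)"
proof -
 let ?I = "top_of_set {0..1::real}" and ?U = "subtopology P1 punctured"
 define g where "g = (\<lambda>t (x :: nat => real). line_point ((1 - t) * x 0 + t * sgn (x 0)))"
 define H where "H = (\<lambda>(t, y). if y = v then v else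
   (let (s, x) = inv_into (S \<times> open_disc 1) (\<lambda>(i, x). \<phi> i x) y in \<phi> s (g t x)))"
 define D where "D = subtopology (disc 1) {x. x 0 ~= 0}"
 have topD: "topspace D = {x \<in> topspace (disc 1). x 0 ~= 0}" by (auto simp: D_def)
 have openD: "openin (disc 1) N" if "openin D N" for N
 proof -
  have "{x \<in> topspace (disc 1). x 0 \<in> - {0}} = topspace (disc 1) \<inter> {x. x 0 ~= 0}" by auto
  then have "openin (disc 1) (topspace (disc 1) \<inter> {x. x 0 ~= 0})" using openin_coord[of "- {0}"] by (simp add: open_Compl)
  moreover have "openin (subtopology (disc 1) (topspace (disc 1) \<inter> {x. x 0 ~= 0})) N"
   using that by (simp add: D_def subtopology_restrict)
  ultimately show ?thesis by (rule openin_trans_full[rotated])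
 qed
 have H_\<phi>: "H (t, \<phi> s x) = \<phi> s (g t x)" if s: "s \<in> S" and x: "x \<in> topspace (disc 1)" for s x t
 proof (cases "x \<in> open_disc 1")
  case True
  have "inv_into (S \<times> open_disc 1) (\<lambda>(i, x). \<phi> i x) (\<phi> s x) = (s, x)"
   using inv_into_f_f[OF bij_betw_imp_inj_on[OF bij_cells], of "(s, x)"] s True by simp
  then show ?thesis using cell1[OF s True] by (simp add: H_def)
 next
  case False
  obtain u where u: "x = line_point u" "\<bar>u\<bar> <= 1" using x unfolding disc1 by blast
  then have "\<not> \<bar>u\<bar> < 1" using False unfolding open_disc1 by blast
  then have "u = 1 \<or> u = - 1" using u(2) by auto
  then have "g t x = x \<and> \<phi> s x = v" using \<phi>_end[OF s] u(1) by (auto simp: g_def)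
  then show ?thesis by (simp add: H_def)
 qed
 have g_bound: "\<bar>(1 - t) * u + t * sgn u\<bar> <= 1 \<and> (1 - t) * u + t * sgn u ~= 0"
  if "0 <= t" "t <= 1" "\<bar>u\<bar> <= 1" "u ~= 0" for t u :: real
 proof (cases "u > 0")
  case True
  have "0 < (1 - t) * u + t"
  proof (cases "t = 0")
   case False
   then show ?thesis using that True by (intro add_nonneg_pos mult_nonneg_nonneg) auto
  qed (use True in simp)
  moreover have "(1 - t) * u <= (1 - t) * 1" using that by (intro mult_left_mono) auto
  ultimately show ?thesis using True by simp
 next
  case False
  then have u: "u < 0" using that by simp
  have "0 < (1 - t) * (- u) + t"
  proof (cases "t = 0")
   case False
   then show ?thesis using that u by (intro add_nonneg_pos mult_nonneg_nonneg) auto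
  qed (use u in simp)
  moreover have "(1 - t) * (- u) <= (1 - t) * 1" using that by (intro mult_left_mono) auto
  ultimately show ?thesis using u by simp
 qed
 have gD: "g t x \<in> topspace D" if t: "t \<in> {0..1}" and x: "x \<in> topspace D" for t x
 proof -
  obtain u where u: "x = line_point u" "\<bar>u\<bar> <= 1" "u ~= 0" using x unfolding topD disc1 by auto
  have "\<bar>(1 - t) * u + t * sgn u\<bar> <= 1 \<and> (1 - t) * u + t * sgn u ~= 0"
   using g_bound[of t u] t u by simp
  then show ?thesis unfolding topD disc1 by (auto simp: g_def u(1))
 qed
 have cg: "continuous_map (prod_topology ?I D) P1 (\<lambda>(t, x). \<phi> s (g t x))" if s: "s \<in> S" for s
 proof -
  have f: "continuous_map (prod_topology ?I D) euclideanreal fst"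
   using continuous_map_fst[of ?I D] by (simp add: continuous_map_in_subtopology)
  have "continuous_map D euclideanreal (\<lambda>x. x 0)"
   unfolding D_def by (rule continuous_map_from_subtopology[OF continuous_map_disc_coord])
  from continuous_map_compose[OF continuous_map_snd this]
  have c: "continuous_map (prod_topology ?I D) euclideanreal (\<lambda>z. snd z 0)" by (simp add: o_def)
  have "continuous_map (prod_topology ?I D) euclideanreal (\<lambda>z. (1 - fst z) * snd z 0 + fst z * (snd z 0 / \<bar>snd z 0\<bar>))"
   by (intro continuous_intros f c) (auto simp: topD)
  then have "continuous_map (prod_topology ?I D) euclideanreal (\<lambda>z. (1 - fst z) * snd z 0 + fst z * sgn (snd z 0))"
   unfolding real_sgn_eq[symmetric] .
  then have "continuous_map (prod_topology ?I D) (disc 1) (\<lambda>z. line_point ((1 - fst z) * snd z 0 + fst z * sgn (snd z 0)))"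
  proof (rule continuous_map_line_point)
   fix z assume "z \<in> topspace (prod_topology ?I D)"
   then have z: "fst z \<in> {0..1}" "snd z 0 ~= 0" "snd z \<in> topspace (disc 1)" by (auto simp: topD)
   then have "\<bar>snd z 0\<bar> <= 1" unfolding disc1 by auto
   then show "\<bar>(1 - fst z) * snd z 0 + fst z * sgn (snd z 0)\<bar> <= 1"
    using g_bound[of "fst z" "snd z 0"] z(1,2) by simp
  qed
  then have "continuous_map (prod_topology ?I D) (disc 1) (\<lambda>z. g (fst z) (snd z))" by (simp only: g_def)
  from continuous_map_compose[OF this attaches_cells_continuous_map[OF att1 _ s]]
  show ?thesis by (simp add: o_def case_prod_unfold)
 qed
 have H_U: "H (t, y) \<in> punctured" if t: "t \<in> {0..1}" and y: "y \<in> punctured" for t y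
 proof (cases "y = v")
  case True
  then show ?thesis using v_punctured by (simp add: H_def)
 next
  case False
  then obtain s x where sx: "s \<in> S" "x \<in> open_disc 1" "y = \<phi> s x"
   using cell1_E y by (metis (no_types, lifting) mem_Collect_eq punctured_def)
  have x: "x \<in> topspace (disc 1)" using sx(2) openin_subset[OF openin_open_disc] by blast
  then have "x \<in> topspace D" using y \<phi>_punctured[OF sx(1) x] by (simp add: sx(3) topD)
  then have "g t x \<in> topspace D" by (rule gD[OF t])
  then show ?thesis unfolding sx(3) H_\<phi>[OF sx(1) x] using \<phi>_punctured[OF sx(1)] by (simp add: topD)
 qed
 have "continuous_map (prod_topology ?I ?U) ?U H"
  unfolding continuous_map_in_subtopology unfolding continuous_map_def
 proof (intro conjI allI impI)
  show "H \<in> topspace (prod_topology ?I ?U) \<rightarrow> topspace P1" "H \<in> topspace (prod_topology ?I ?U) \<rightarrow> punctured"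
   using H_U by (auto simp: punctured_def)
  fix W assume W: "openin P1 W"
  show "openin (prod_topology ?I ?U) {z \<in> topspace (prod_topology ?I ?U). H z \<in> W}"
   unfolding openin_prod_topology_alt
  proof (intro allI impI)
   fix t y assume ty: "(t, y) \<in> {z \<in> topspace (prod_topology ?I ?U). H z \<in> W}"
   then have t: "t \<in> {0..1}" and y: "y \<in> punctured" "y \<in> topspace P1" and HW: "H (t, y) \<in> W" by auto
   show "\<exists>A B. openin ?I A \<and> openin ?U B \<and> t \<in> A \<and> y \<in> B \<and> A \<times> B \<subseteq> {z \<in> topspace (prod_topology ?I ?U). H z \<in> W}"
   proof (cases "y = v")
    case True
    \<comment> \<open>A tube argument: in each 1-cell the complement of \<open>N\<close> is the
      projection of a closed set along the compact interval, hence closed. As openness in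
      \<open>P1\<close> is tested cell by cell, \<open>N\<close> is open for any number of
      cells.\<close>
    define N where "N = {y \<in> punctured. \<forall>t\<in>{0..1}. H (t, y) \<in> W}"
    have "openin P1 N"
    proof (subst openin_P1_iff)
     show "N \<subseteq> topspace P1" by (auto simp: N_def punctured_def)
     show "\<forall>s\<in>S. openin (disc 1) {x \<in> topspace (disc 1). \<phi> s x \<in> N}"
     proof
      fix s assume s: "s \<in> S"
      let ?B = "{z \<in> topspace (prod_topology ?I D). (case z of (t, x) => \<phi> s (g t x)) \<in> topspace P1 - W}"
      have "closedin (prod_topology ?I D) ?B"
       by (rule closedin_continuous_map_preimage[OF cg[OF s]]) (use W in auto)
      moreover have "closed_map (prod_topology ?I D) D snd"
       by (rule closed_map_snd) (simp add: compact_space_subtopology)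
      ultimately have "closedin D (snd ` ?B)" by (auto simp: closed_map_def)
      then have "openin (disc 1) (topspace D - snd ` ?B)" by (intro openD) blast
      moreover have "{x \<in> topspace (disc 1). \<phi> s x \<in> N} = topspace D - snd ` ?B"
      proof (intro Set.set_eqI iffI)
       fix x assume x: "x \<in> {x \<in> topspace (disc 1). \<phi> s x \<in> N}"
       then have xD: "x \<in> topspace D" using \<phi>_punctured[OF s, of x] by (simp add: N_def topD)
       have W': "\<phi> s (g t x) \<in> W" if "t \<in> {0..1}" for t
       proof -
        have "H (t, \<phi> s x) \<in> W" using x that unfolding N_def by blast
        then show ?thesis using H_\<phi>[OF s, of x t] x by simp
       qed
       have "x \<notin> snd ` ?B"
       proof
        assume "x \<in> snd ` ?B"
        then obtain z where z: "z \<in> ?B" "x = snd z" by (rule imageE)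
        then have "fst z \<in> {0..1}" "\<phi> s (g (fst z) x) \<notin> W" by (auto simp: case_prod_unfold)
        then show False using W' by blast
       qed
       then show "x \<in> topspace D - snd ` ?B" using xD by (rule DiffI[rotated])
      next
       fix x assume x: "x \<in> topspace D - snd ` ?B"
       then have xd: "x \<in> topspace (disc 1)" "\<phi> s x \<in> punctured" using \<phi>_punctured[OF s, of x] by (auto simp: topD)
       have "H (t, \<phi> s x) \<in> W" if t: "t \<in> {0..1}" for t
       proof -
        have 1: "(t, x) \<notin> ?B"
        proof
         assume "(t, x) \<in> ?B"
         then have "snd (t, x) \<in> snd ` ?B" by (rule imageI)
         then show False using x by simp
        qed
        have 2: "(t, x) \<in> topspace (prod_topology ?I D)" using t x by simp
        have "g t x \<in> topspace D" using gD[OF t] x by blast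
        then have "\<phi> s (g t x) \<in> topspace P1"
         using \<phi>_punctured[OF s, of "g t x"] by (simp add: topD punctured_def)
        then show ?thesis using 1 2 H_\<phi>[OF s xd(1)] by simp
       qed
       then show "x \<in> {x \<in> topspace (disc 1). \<phi> s x \<in> N}" using xd by (simp add: N_def)
      qed
      ultimately show "openin (disc 1) {x \<in> topspace (disc 1). \<phi> s x \<in> N}" by simp
     qed
    qed
    moreover have "N \<subseteq> punctured" by (auto simp: N_def)
    ultimately have "openin ?U N" unfolding openin_subtopology by blast
    moreover have "y \<in> N" using HW y(1) True by (simp add: N_def H_def)
    moreover have "{0..1} \<times> N \<subseteq> {z \<in> topspace (prod_topology ?I ?U). H z \<in> W}"
     unfolding N_def punctured_def by (safe; simp)
    moreover have "openin ?I {0..1}" using openin_topspace[of ?I] by simp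
    ultimately show ?thesis using t by (intro exI[of _ "{0..1}"] exI[of _ N] conjI)
   next
    case False
    then obtain s x where sx: "s \<in> S" "x \<in> open_disc 1" "y = \<phi> s x" using cell1_E y(2) by metis
    have x: "x \<in> topspace (disc 1)" using sx(2) openin_subset[OF openin_open_disc] by blast
    then have xD: "x \<in> topspace D" using y \<phi>_punctured[OF sx(1) x] by (simp add: sx(3) topD)
    have "openin (prod_topology ?I D) {z \<in> topspace (prod_topology ?I D). (case z of (t, x) => \<phi> s (g t x)) \<in> W}"
     by (rule openin_continuous_map_preimage[OF cg[OF sx(1)] W])
    moreover have "(t, x) \<in> {z \<in> topspace (prod_topology ?I D). (case z of (t, x) => \<phi> s (g t x)) \<in> W}"
     using t xD HW H_\<phi>[OF sx(1) x] by (simp add: sx(3))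
    ultimately obtain A B where AB: "openin ?I A" "openin D B" "t \<in> A" "x \<in> B"
     "A \<times> B \<subseteq> {z \<in> topspace (prod_topology ?I D). (case z of (t, x) => \<phi> s (g t x)) \<in> W}"
     unfolding openin_prod_topology_alt by meson
    define B' where "B' = B \<inter> open_disc 1"
    have "openin (disc 1) B'" unfolding B'_def using openD[OF AB(2)] openin_open_disc by blast
    then have "openin P1 (\<phi> s ` B')"
     by (intro openin_cell_image[OF att1 _ sx(1)]) (auto simp: B'_def)
    moreover have "\<phi> s ` B' \<subseteq> punctured"
     using openin_subset[OF AB(2)] \<phi>_punctured[OF sx(1)] by (auto simp: B'_def topD)
    ultimately have "openin ?U (\<phi> s ` B')" unfolding openin_subtopology by blast
    moreover have "y \<in> \<phi> s ` B'" using sx AB(4) by (simp add: B'_def)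
    moreover have "A \<times> \<phi> s ` B' \<subseteq> {z \<in> topspace (prod_topology ?I ?U). H z \<in> W}"
    proof (intro subsetI)
     fix z assume "z \<in> A \<times> \<phi> s ` B'"
     then obtain t' x' where z: "z = (t', \<phi> s x')" "t' \<in> A" "x' \<in> B'" by auto
     then have "(t', x') \<in> topspace (prod_topology ?I D)" "\<phi> s (g t' x') \<in> W"
      using AB(5) by (auto simp: B'_def)
     moreover have "\<phi> s x' \<in> punctured" using \<open>\<phi> s ` B' \<subseteq> punctured\<close> z(3) by blast
     ultimately show "z \<in> {z \<in> topspace (prod_topology ?I ?U). H z \<in> W}"
      using H_\<phi>[OF sx(1), of x' t'] z(1) by (simp add: topD punctured_def)
    qed
    ultimately show ?thesis using AB(1,3) by (intro exI[of _ A] exI[of _ "\<phi> s ` B'"] conjI)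
   qed
  qed
 qed
 moreover have "H (0, y) = y \<and> H (1, y) = v" if yU: "y \<in> topspace ?U" for y
 proof (cases "y = v")
  case False
  then obtain s x where sx: "s \<in> S" "x \<in> open_disc 1" "y = \<phi> s x" using cell1_E[of y] yU by (metis IntE topspace_subtopology)
  have x: "x \<in> topspace (disc 1)" using sx(2) openin_subset[OF openin_open_disc] by blast
  then have "x 0 ~= 0" using yU \<phi>_punctured[OF sx(1) x] by (simp add: sx(3))
  moreover have "line_point (x 0) = x" using x unfolding disc1 by auto
  moreover have "\<phi> s (line_point (sgn (x 0))) = v"
   using \<phi>_end[OF sx(1)] \<open>x 0 ~= 0\<close> by (auto simp: sgn_if)
  ultimately show ?thesis unfolding sx(3) H_\<phi>[OF sx(1) x] by (simp add: g_def)
 qed (simp add: H_def)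
 ultimately have "homotopic_with (\<lambda>x. True) ?U ?U id (\<lambda>_. v)"
  by (subst homotopic_with; (intro exI[of _ H])?) simp_all
 then show ?thesis unfolding contractible_space_def by blast
qed

text \<open>The graph is covered by the contractible star of the vertex and by the disjoint open
  1-cells. They intersect in half-cells, which are contractible too.\<close>

theorem graph_second_homology:
 assumes "singular_relcycle 2 P1 {} z"
 shows "singular_relboundary 2 P1 {} z"
proof -
 define Q where "Q = (\<lambda>b. if b then {0<..<1} else {-1<..<0::real})"
 let ?W = "cells (\<lambda>x. \<exists>b :: bool. x 0 \<in> {-1<..<1})"
 have range: "x 0 \<in> {-1<..<1}" if x: "x \<in> open_disc 1" for x
 proof -
  obtain u where "x = line_point u" "\<bar>u\<bar> < 1" using x unfolding open_disc1 by blast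
  then show ?thesis by auto
 qed
 have W: "?W = topspace P1 - {v}"
 proof (intro Set.set_eqI iffI)
  fix y assume "y \<in> ?W"
  then show "y \<in> topspace P1 - {v}" using cell1 unfolding cells_def by blast
 next
  fix y assume "y \<in> topspace P1 - {v}"
  then obtain s x where "s \<in> S" "x \<in> open_disc 1" "y = \<phi> s x" using cell1_E[of y] by (metis DiffE singletonI)
  then show "y \<in> ?W" using range unfolding cells_def by blast
 qed
 have "v \<in> punctured" by (rule v_punctured)
 have UW: "punctured \<inter> ?W = cells (\<lambda>x. \<exists>b. x 0 \<in> Q b)"
 proof (intro Set.set_eqI iffI)
  fix y assume y: "y \<in> punctured \<inter> ?W"
  then obtain s x where sx: "s \<in> S" "x \<in> open_disc 1" "y = \<phi> s x" unfolding cells_def by blast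
  then have "x 0 ~= 0" using y \<phi>_punctured[of s x] openin_subset[OF openin_open_disc] by blast
  then have "\<exists>b. x 0 \<in> Q b" using range[OF sx(2)] by (intro exI[of _ "x 0 > 0"]) (auto simp: Q_def)
  then show "y \<in> cells (\<lambda>x. \<exists>b. x 0 \<in> Q b)" using sx unfolding cells_def by blast
 next
  fix y assume "y \<in> cells (\<lambda>x. \<exists>b. x 0 \<in> Q b)"
  then obtain s x b where sx: "s \<in> S" "x \<in> open_disc 1" "y = \<phi> s x" "x 0 \<in> Q b" unfolding cells_def by blast
  moreover have "x 0 ~= 0" using sx(4) by (auto simp: Q_def split: if_splits)
  ultimately show "y \<in> punctured \<inter> ?W"
   using \<phi>_punctured[of s x] openin_subset[OF openin_open_disc] range[OF sx(2)] unfolding cells_def by blast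
 qed
 have "openin P1 ?W"
 proof -
  have "{x \<in> topspace (disc 1). \<phi> s x \<in> topspace P1 - {v}} = open_disc 1" if s: "s \<in> S" for s
  proof -
   have "x \<in> open_disc 1" if "x \<in> topspace (disc 1)" "\<phi> s x ~= v" for x
    using disc_cases[of 1 x] that \<phi>_end[OF s] unfolding topspace_bsphere_1 by auto
   then show ?thesis using cell1[OF s] openin_subset[OF openin_open_disc[of 1]] by blast
  qed
  then show ?thesis unfolding W by (subst openin_P1_iff) (auto simp: openin_open_disc)
 qed
 moreover have "singular_relboundary (Suc 1) (subtopology P1 ?W) {} c"
  if "singular_relcycle (Suc 1) (subtopology P1 ?W) {} c" for c
  using that by (intro cells_contractible_pieces) auto
 moreover have "singular_relboundary 1 (subtopology P1 (punctured \<inter> ?W)) {} c"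
  if "singular_relcycle 1 (subtopology P1 (punctured \<inter> ?W)) {} c" for c
  using that unfolding UW by (intro cells_contractible_pieces) (auto simp: Q_def)
 moreover have "singular_relboundary (Suc 1) (subtopology P1 punctured) {} c"
  if "singular_relcycle (Suc 1) (subtopology P1 punctured) {} c" for c
  using contractible_bounds[OF contractible_punctured _ that] by simp
 moreover have "topspace P1 = punctured \<union> ?W"
  unfolding W using v_punctured by (auto simp: punctured_def)
 ultimately have "singular_relboundary (Suc 1) P1 {} z"
  using assms by (intro cycle_bounds_Mayer_Vietoris[OF openin_punctured]) (auto simp: numeral_2_eq_2)
 then show ?thesis by (simp add: numeral_2_eq_2)
qed

end

section \<open>The lower bound\<close>

typedef 'b bijection = "{f :: 'b => 'b. bij f}" morphisms apply_bijection Bijection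
 by (rule exI[of _ id]) simp

setup_lifting type_definition_bijection

instantiation bijection :: (type) group_add
begin

lift_definition zero_bijection :: "'b bijection" is id by simp

lift_definition plus_bijection :: "'b bijection => 'b bijection => 'b bijection" is "(\<circ>)"
 by (rule bij_comp)

lift_definition uminus_bijection :: "'b bijection => 'b bijection" is "inv_into UNIV"
 by (rule bij_imp_bij_inv)

definition minus_bijection :: "'b bijection => 'b bijection => 'b bijection" where
 "minus_bijection f g = f + (- g)"

instance
 by standard (transfer; simp add: o_assoc bij_is_inj minus_bijection_def)+

end

text \<open>
 As a type cannot depend on the normal subgroup \<open>N\<close>, the quotient by \<open>N\<close> is represented by its
 action on the cosets.
\<close>

definition coset_action :: "'g::group_add set => 'g => 'g set => 'g set" where
 "coset_action N g C = (if \<exists>x. C = (+) x ` N then (+) g ` C else C)"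

locale normal_set =
 fixes N :: "'g::group_add set"
 assumes N: "subgroup_set N" and normal: "!!g n. n \<in> N ==> g + n - g \<in> N"
begin

lemma coset_action_add: "coset_action N g \<circ> coset_action N h = coset_action N (g + h)"
proof
 fix C
 show "(coset_action N g \<circ> coset_action N h) C = coset_action N (g + h) C"
 proof (cases "\<exists>x. C = (+) x ` N")
  case True
  then obtain x where x: "C = (+) x ` N" by blast
  have "(+) h ` C = (+) (h + x) ` N" by (simp add: x image_image add.assoc)
  then have "coset_action N g ((+) h ` C) = (+) g ` (+) h ` C" unfolding coset_action_def by metis
  then show ?thesis using True by (simp add: coset_action_def[of N h] coset_action_def[of N "g + h"] image_image add.assoc)
 qed (simp add: coset_action_def)
qed

lemma coset_action_0: "coset_action N 0 = id"
 by (auto simp: coset_action_def fun_eq_iff)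

lemma bij_coset_action: "bij (coset_action N g)"
 using coset_action_add[of g "- g"] coset_action_add[of "- g" g] by (intro o_bij[of "coset_action N (- g)"]) (simp_all add: coset_action_0)

definition quot :: "'g => 'g set bijection" where
 "quot g = Bijection (coset_action N g)"

lemma quot_apply: "apply_bijection (quot g) = coset_action N g"
 unfolding quot_def by (rule Bijection_inverse) (simp add: bij_coset_action)

lemma quot_add: "quot (g + h) = quot g + quot h"
 by (rule apply_bijection_inject[THEN iffD1]) (simp add: quot_apply plus_bijection.rep_eq coset_action_add)

lemma quot_0 [simp]: "quot 0 = 0"
 by (rule apply_bijection_inject[THEN iffD1]) (simp add: quot_apply coset_action_0 zero_bijection.rep_eq)

lemma quot_minus: "quot (- g) = - quot g"
 using quot_add[of g "- g"] by (simp add: minus_unique)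

lemma quot_eq_0: "n \<in> N ==> quot n = 0"
proof -
 assume n: "n \<in> N"
 have "(+) n ` (+) x ` N = (+) x ` N" for x
 proof -
  have *: "(+) m ` (+) x ` N \<subseteq> (+) x ` N" if "m \<in> N" for m
  proof clarsimp
   fix k assume "k \<in> N"
   then have "- x + m + x + k \<in> N" using normal[OF that, of "- x"] subgroup_setD(2)[OF N] by simp
   moreover have "m + (x + k) = x + (- x + m + x + k)" by (simp add: group_add_simps del: add_uminus_conv_diff)
   ultimately show "m + (x + k) \<in> (+) x ` N" by blast
  qed
  have "(+) x ` N = (+) n ` (+) (- n) ` (+) x ` N" by (simp add: image_image add.assoc[symmetric])
  also have "\<dots> \<subseteq> (+) n ` (+) x ` N" using *[OF subgroup_setD(3)[OF N n]] by (rule image_mono)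
  finally show ?thesis using *[OF n] by blast
 qed
 then have "coset_action N n C = C" for C unfolding coset_action_def by metis
 then have "coset_action N n = id" by (simp add: fun_eq_iff)
 then show ?thesis by (intro apply_bijection_inject[THEN iffD1]) (simp add: quot_apply zero_bijection.rep_eq)
qed

lemma quot_eqD:
 assumes "quot g = quot h"
 obtains n where "n \<in> N" "g = h + n"
proof -
 have "coset_action N g N = coset_action N h N" using assms by (metis quot_apply)
 moreover have "\<exists>x. N = (+) x ` N" by (rule exI[of _ 0]) simp
 ultimately have "(+) g ` N = (+) h ` N" by (simp add: coset_action_def)
 moreover have "g + 0 \<in> (+) g ` N" using subgroup_setD(1)[OF N] by blast
 ultimately show ?thesis using that by auto
qed

lemma subgroup_range_quot: "subgroup_set (range quot)"
 unfolding subgroup_set_def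
proof (intro conjI ballI)
 show "0 \<in> range quot" by (rule range_eqI[of _ _ 0]) simp
 show "x + y \<in> range quot" if "x \<in> range quot" "y \<in> range quot" for x y
  using that quot_add[symmetric] by auto
 show "- x \<in> range quot" if "x \<in> range quot" for x
  using that quot_minus[symmetric] by auto
qed

sublocale quot: holonomy "range quot"
 by standard (rule subgroup_range_quot)

lemma development_quot:
 "full.development Z u \<gamma> \<kappa> ==> quot.development Z u (\<lambda>x y. quot (\<gamma> x y)) (\<lambda>z. quot (\<kappa> z))"
 unfolding full.development_def quot.development_def by (fastforce simp: quot_add quot_minus)

lemma local_cocycle_quot:
 "full.local_cocycle Y \<gamma> ==> quot.local_cocycle Y (\<lambda>x y. quot (\<gamma> x y))"
 unfolding full.local_cocycle_def quot.local_cocycle_def strict_def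
 by (simp add: quot_add[symmetric]) metis

lemma hol_quot:
 assumes "full.local_cocycle Y \<gamma>" "singular_simplex 1 Y \<sigma>"
 shows "quot.hol (\<lambda>x y. quot (\<gamma> x y)) \<sigma> = quot (full.hol \<gamma> \<sigma>)"
proof -
 obtain \<kappa> where \<kappa>: "full.development (simplex_top 1) \<sigma> \<gamma> \<kappa>"
  by (rule full.development_simplex[OF assms])
 show ?thesis by (simp add: full.hol_eq[OF \<kappa>] quot.hol_eq[OF development_quot[OF \<kappa>]] quot_add quot_minus)
qed

end

text \<open>A continuous surjection from a compact space to a Hausdorff space; it lets a development
  on the interval descend to the circle.\<close>

lemma nsphere_quotient: "quotient_map (simplex_top 1) (nsphere 1) (\<lambda>x. circle_point (x 1))"
proof (rule continuous_imp_quotient_map)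
 show "continuous_map (simplex_top 1) (nsphere 1) (\<lambda>x. circle_point (x 1))"
  by (rule continuous_map_circle_point[OF continuous_map_coord])
 show "compact_space (simplex_top 1)" using compactin_standard_simplex by (simp add: compact_space_subtopology)
 show "Hausdorff_space (nsphere 1)"
  unfolding nsphere by (intro Hausdorff_space_subtopology) (simp add: Hausdorff_space_product_topology)
 have "\<exists>x\<in>standard_simplex 1. y = circle_point (x 1)" if y: "y \<in> topspace (nsphere 1)" for y
 proof -
  have "(y 0)\<^sup>2 + (y 1)\<^sup>2 = 1" "!!i. i > 1 ==> y i = 0" using y unfolding topspace_circle by auto
  then obtain t where t: "0 <= t" "t < 2 * pi" "y 0 = cos t" "y 1 = sin t"
   using sincos_total_2pi[of "y 0" "y 1"] by metis
  define u where "u = t / (2 * pi)"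
  have u: "0 <= u" "u <= 1" "2 * pi * u = t" using t by (auto simp: u_def)
  define x where "x = (\<lambda>i::nat. if i = 0 then 1 - u else if i = 1 then u else 0)"
  have "x \<in> standard_simplex 1" using u unfolding standard_simplex_1 by (simp add: x_def)
  moreover have "y = circle_point (x 1)"
   using t(3,4) u(3) \<open>!!i. i > 1 ==> y i = 0\<close> by (auto simp: circle_point_def x_def fun_eq_iff)
  ultimately show ?thesis by blast
 qed
 then show "(\<lambda>x. circle_point (x 1)) ` topspace (simplex_top 1) = topspace (nsphere 1)"
  using circle_point_in by fastforce
qed

lemma circle_point_eq:
 assumes "circle_point s = circle_point t" "0 <= s" "s <= t" "t <= 1"
 shows "s = t \<or> s = 0 \<and> t = 1"
proof -
 have "cos (2 * pi * s) = cos (2 * pi * t)" "sin (2 * pi * s) = sin (2 * pi * t)"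
  using fun_cong[OF assms(1), of 0] fun_cong[OF assms(1), of 1] by (simp_all add: circle_point_def)
 then obtain n :: int where "2 * pi * t = 2 * pi * s + 2 * pi * of_int n" using sin_cos_eq_iff by metis
 then have n: "t = s + of_int n" by (simp add: distrib_left[symmetric])
 then have "n = 0 \<or> n = 1" using assms by (simp add: order_antisym_conv) linarith
 then show ?thesis using n assms by auto
qed

section \<open>Coverings of the presentation complex\<close>

context presentation
begin

text \<open>This encodes the universal covering of the 1-skeleton. The trivial cocycle at the vertex
  is extended over the 1-cells, with potential 0 at the start and the letter at the end of each
  cell.\<close>

lemma word_cocycle:
 obtains \<gamma> :: "'x => 'x => 'a fg" where "full.local_cocycle P1 \<gamma>"
  "!!u. u \<in> over S ==> full.hol \<gamma> (edge (word u)) = u"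
proof -
 define k where "k = (\<lambda>s (x :: nat => real). if x 0 > 0 then letter (s, True) else 0 :: 'a fg)"
 have "full.local_cocycle (discrete_topology {v}) (\<lambda>x y. 0 :: 'a fg)"
  unfolding full.local_cocycle_def strict_def by (auto intro!: exI[of _ "{v}"])
 moreover have "full.development (bsphere 1) (\<phi> s) (\<lambda>x y. 0) (k s)" for s
  unfolding full.development_def
 proof (intro conjI ballI UNIV_I)
  fix z assume z: "z \<in> topspace (bsphere 1)"
  define A where "A = (if z 0 > 0 then {0<..} else {..<0::real})"
  let ?V = "{x \<in> topspace (bsphere 1). x 0 \<in> A}"
  have "openin (bsphere 1) ?V"
   unfolding bsphere_def by (rule openin_nsphere_coord) (simp add: A_def)
  moreover have "z \<in> ?V" using z unfolding topspace_bsphere_1 by (auto simp: A_def)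
  moreover have "0 = - k s x + k s y" if "x \<in> ?V" "y \<in> ?V" for x y
   using that by (auto simp: k_def A_def split: if_splits)
  ultimately show "\<exists>V. openin (bsphere 1) V \<and> z \<in> V \<and> (\<forall>x\<in>V. \<forall>y\<in>V. 0 = - k s x + k s y)" by blast
 qed
 ultimately obtain \<gamma> where \<gamma>: "full.local_cocycle P1 \<gamma>"
  and K: "!!s. s \<in> S ==> \<exists>K. full.development (disc 1) (\<phi> s) \<gamma> K \<and> (\<forall>x\<in>topspace (bsphere 1). K x = k s x)"
  by (rule full.extend_over_cells[OF att1 order_refl, where k = k]) blast
 have letter: "full.hol \<gamma> (edge [x]) = letter x" if x: "fst x \<in> S" for x
 proof -
  obtain s b where sb: "x = (s, b)" by (cases x)
  obtain K where K: "full.development (disc 1) (\<phi> s) \<gamma> K" "K (line_point 1) = letter (s, True)" "K (line_point (- 1)) = 0"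
   using K[of s] x sb unfolding topspace_bsphere_1 by (auto simp: k_def)
  let ?m = "\<lambda>z :: nat => real. line_point (if b then 2 * z 1 - 1 else 1 - 2 * z 1)"
  have "continuous_map (simplex_top 1) (disc 1) ?m"
  proof (rule continuous_map_line_point)
   show "continuous_map (simplex_top 1) euclideanreal (\<lambda>z. if b then 2 * z 1 - 1 else 1 - 2 * z 1)"
    by (cases b) (auto intro!: continuous_intros continuous_map_coord)
  qed (use simplex1_eqI(2,3) in fastforce)
  from full.development_compose[OF K(1) this]
  have "full.development (simplex_top 1) (edge [x]) \<gamma> (K \<circ> ?m)"
   by (rule full.development_cong)
     (use x simplex1_eqI(2,3) in \<open>auto simp: edge_def word_simplex_def word_path_single letter_path_line_point sb\<close>)
  then show ?thesis
   using K(2,3) by (cases b) (simp_all add: full.hol_eq sb vert_def minus_letter inv_letter_def)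
 qed
 have "full.hol \<gamma> (edge (word u)) = u" if "u \<in> over S" for u
  using that
 proof (induction u rule: fg_induct)
  case zero
  show ?case using full.hol_const[OF \<gamma> v_in_P1] by (simp only: word_zero edge_Nil const_simplex_def)
 next
  case (Cons x u)
  then have x: "fst x \<in> S" and u: "fst ` set (word u) \<subseteq> S" by (auto simp: over_def)
  obtain \<sigma> where \<sigma>: "triangle P1 \<sigma> (edge [x]) (edge (word u)) (edge (x # word u))" by (rule triangle_Cons[OF x u])
  then have "singular_simplex 2 P1 \<sigma>" by (simp add: triangle_def)
  from full.hol_triangle[OF \<gamma> this] show ?case
   using \<sigma> Cons letter[OF x] u by (simp add: triangle_def over_def)
 qed
 with \<gamma> show ?thesis by (rule that)
qed

definition cell_simplex :: "(nat => real) => 'x" where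
 "cell_simplex = simplex_map 2 \<Phi> disc_simplex"

lemma triangle_cell: "triangle P cell_simplex (edge []) (edge r) (edge [])"
proof -
 have "continuous_map (disc 2) P \<Phi>" using attaches_cells_continuous_map[OF att2] by simp
 then have "singular_simplex 2 P cell_simplex"
  unfolding cell_simplex_def by (rule singular_simplex_simplex_map[OF singular_simplex_disc])
 moreover have "singular_face 2 k cell_simplex = simplex_map 1 \<Phi> (singular_face 2 k disc_simplex)" if "k <= 2" for k
  using that simplical_face_in_standard_simplex[of 2 k]
  by (auto simp: cell_simplex_def singular_face_def simplex_map_def restrict_def fun_eq_iff)
 ultimately show ?thesis
  by (simp add: triangle_def disc_simplex_faces relator_simplex relator_base del: One_nat_def)
qed

text \<open>The development along the relator path takes the same value at both ends if the holonomy
  is trivial, so it descends to the boundary circle of the 2-cell.\<close>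

lemma cell_development:
 assumes \<gamma>: "holonomy.local_cocycle R P1 \<gamma>" and R: "subgroup_set R" and hol: "holonomy.hol R \<gamma> (edge r) = 0"
 obtains k where "holonomy.development R (bsphere 2) \<Phi> \<gamma> k"
proof -
 interpret holonomy R by standard (rule R)
 let ?q = "\<lambda>x. circle_point (x 1)"
 obtain \<kappa> where \<kappa>: "development (simplex_top 1) (edge r) \<gamma> \<kappa>"
  by (rule development_simplex[OF \<gamma> singular_simplex_edge[OF r_over]])
 have end_eq: "\<kappa> (vert 0) = \<kappa> (vert 1)" using hol hol_eq[OF \<kappa>] by (metis add.inverse_inverse minus_unique)
 have same: "\<kappa> x = \<kappa> y" if xy: "x \<in> standard_simplex 1" "y \<in> standard_simplex 1" "?q x = ?q y" "x 1 <= y 1" for x y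
 proof -
  have z: "z = vert i" if "z \<in> standard_simplex 1" "z 1 = of_bool (i = 1)" "i <= 1" for z :: "nat => real" and i
  proof
   fix j :: nat
   have "j = 0 \<or> j = 1 \<or> j > 1" by arith
   then show "z j = vert i j" using that unfolding standard_simplex_1 by (auto simp: vert_def le_Suc_eq)
  qed
  have "x 1 = y 1 \<or> x 1 = 0 \<and> y 1 = 1"
   using circle_point_eq[OF xy(3)] simplex1_eqI(2,3)[OF xy(1)] simplex1_eqI(2,3)[OF xy(2)] xy(4) by blast
  then show ?thesis
  proof
   assume "x 1 = y 1"
   then have "x = y" using simplex1_eqI(1)[OF xy(1)] simplex1_eqI(1)[OF xy(2)] by metis
   then show ?thesis by simp
  next
   assume "x 1 = 0 \<and> y 1 = 1"
   then have "x = vert 0" "y = vert 1" using z[OF xy(1), of 0] z[OF xy(2), of 1] by auto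
   then show ?thesis using end_eq by simp
  qed
 qed
 define k where "k = (\<lambda>y. \<kappa> (inv_into (standard_simplex 1) ?q y))"
 have onto: "?q ` standard_simplex 1 = topspace (nsphere 1)"
  using quotient_imp_surjective_map[OF nsphere_quotient] by simp
 have k: "k (?q x) = \<kappa> x" if "x \<in> standard_simplex 1" for x
 proof -
  let ?y = "inv_into (standard_simplex 1) ?q (?q x)"
  have "?q x \<in> ?q ` standard_simplex 1" using that by (rule imageI)
  then have "?y \<in> standard_simplex 1" "?q ?y = ?q x" by (rule inv_into_into, rule f_inv_into_f)
  then show ?thesis using same[of x ?y] same[of ?y x] that by (simp add: k_def) (metis linear)
 qed
 have "development (nsphere 1) \<Phi> \<gamma> k"
 proof (rule development_final[OF \<gamma>, where I = "{()}" and Z' = "\<lambda>_. simplex_top 1" and f = "\<lambda>_. ?q"])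
  show "continuous_map (nsphere 1) P1 \<Phi>" using att2 by (simp add: attaches_cells_def)
  show "openin (nsphere 1) V" if "V \<subseteq> topspace (nsphere 1)"
   "!!i. i \<in> {()} ==> openin (simplex_top 1) {z \<in> topspace (simplex_top 1). ?q z \<in> V}" for V
   using nsphere_quotient that unfolding quotient_map_def by blast
  show "continuous_map (simplex_top 1) (nsphere 1) ?q"
   by (rule continuous_map_circle_point[OF continuous_map_coord])
  show "development (simplex_top 1) (\<Phi> \<circ> ?q) \<gamma> (k \<circ> ?q)"
   by (rule development_cong[OF \<kappa>])
     (use k relator_path simplex1_eqI(2,3) in \<open>auto simp: edge_def word_simplex_def\<close>)
  show "k z \<in> R" if zS: "z \<in> topspace (nsphere 1)" for z
  proof -
   obtain x where x: "x \<in> standard_simplex 1" "z = ?q x" using zS unfolding onto[symmetric] by blast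
   have "\<kappa> x \<in> R" using \<kappa> x(1) by (simp add: development_def)
   then show ?thesis using k[OF x(1)] x(2) by simp
  qed
 qed
 then show ?thesis using that by (simp add: bsphere_def)
qed

text \<open>The 2-cocycle is a coboundary on \<open>P1\<close> but not in general on
  \<open>X\<close>, because \<psi> uses holonomies in the free group, which are lost over the
  2-cell. This difference is what the fundamental class detects.\<close>

theorem bounded_cocycle:
 fixes Q :: "'a fg => real"
 assumes X: "attaches_high_cells P X" and Q: "qm Q" and r: "reduced_word r"
  and eqv: "!!g h. Q (g + (h + Fg r - h)) = Q g + Q (Fg r)"
 obtains B \<psi> where "!!\<sigma>. singular_simplex 2 X \<sigma> ==> \<bar>B \<sigma>\<bar> <= 1"
  "!!s. singular_simplex 3 X s ==> coboundary 3 B s = 0" "B cell_simplex = 0"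
  "!!\<sigma>. singular_simplex 2 P1 \<sigma> ==> B \<sigma> = coboundary 2 \<psi> \<sigma>" "\<psi> (edge r) = Q (Fg r)"
proof -
 note gs = group_add_simps
 \<comment> \<open>All elements with the property assumed of the relator. They form a normal
   subgroup along which \<open>Q\<close> is additive, and it contains the relator.\<close>
 define N where "N = {n. \<forall>g h. Q (g + (h + n - h)) = Q g + Q n}"
 have Q0: "Q 0 = 0" by (rule qm_0[OF Q])
 have QN: "Q (g + n) = Q g + Q n" if "n \<in> N" for g n
  using that[unfolded N_def, simplified, rule_format, of g 0] by simp
 have conj: "h + n - h \<in> N \<and> Q (h + n - h) = Q n" if n: "n \<in> N" for h n
 proof -
  have *: "Q (g + (k + n - k)) = Q g + Q n" for g k using n by (simp add: N_def)
  have Qc: "Q (h + n - h) = Q n" using *[of 0 h] Q0 by simp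
  have "Q (g + (k + (h + n - h) - k)) = Q g + Q n" for g k
   using *[of g "k + h"] by (simp add: gs del: add_uminus_conv_diff)
  then show ?thesis using Qc by (simp add: N_def)
 qed
 interpret normal_set N
 proof
  show "subgroup_set N"
   unfolding subgroup_set_def
  proof (intro conjI ballI)
   show "0 \<in> N" by (simp add: N_def Q0)
   fix m assume m: "m \<in> N"
   show "m + n \<in> N" if n: "n \<in> N" for n
   proof -
    have "Q (g + (h + (m + n) - h)) = Q g + Q (m + n)" for g h
    proof -
     have "g + (h + (m + n) - h) = (g + (h + m - h)) + (h + n - h)" by (simp add: gs del: add_uminus_conv_diff)
     then have "Q (g + (h + (m + n) - h)) = Q g + Q m + Q n"
      using QN[of "h + n - h"] QN[of "h + m - h"] conj[OF m, of h] conj[OF n, of h] by simp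
     then show ?thesis using QN[OF n, of m] by simp
    qed
    then show ?thesis by (simp add: N_def)
   qed
   have "Q (g + (h + (- m) - h)) = Q g + Q (- m)" for g h
   proof -
    have "Q ((g + (h + (- m) - h)) + (h + m - h)) = Q (g + (h + (- m) - h)) + Q m"
     using QN[of "h + m - h"] conj[OF m, of h] by simp
    moreover have "(g + (h + (- m) - h)) + (h + m - h) = g" by (simp add: gs del: add_uminus_conv_diff)
    ultimately show ?thesis using qm_minus[OF Q, of m] by simp
   qed
   then show "- m \<in> N" by (simp add: N_def)
  qed
  show "g + n - g \<in> N" if "n \<in> N" for g n using conj[OF that] by blast
 qed
 have rN: "Fg r \<in> N" using eqv by (simp add: N_def)
 obtain \<gamma>1 :: "'x => 'x => 'a fg" where \<gamma>1: "full.local_cocycle P1 \<gamma>1"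
  and hol1: "!!u. u \<in> over S ==> full.hol \<gamma>1 (edge (word u)) = u" using word_cocycle by metis
 let ?\<gamma> = "\<lambda>x y. quot (\<gamma>1 x y)"
 have \<gamma>: "quot.local_cocycle P1 ?\<gamma>" by (rule local_cocycle_quot[OF \<gamma>1])
 have "Fg r \<in> over S" using r r_over by (simp add: over_def)
 then have hol_r: "full.hol \<gamma>1 (edge r) = Fg r" using hol1[of "Fg r"] r by simp
 have "quot.hol ?\<gamma> (edge r) = 0"
  using hol_quot[OF \<gamma>1 singular_simplex_edge[OF r_over]] hol_r quot_eq_0[OF rN] by simp
 then obtain k where k: "quot.development (bsphere 2) \<Phi> ?\<gamma> k"
  by (rule cell_development[OF \<gamma> subgroup_range_quot])
 obtain \<gamma>2 where \<gamma>2: "quot.local_cocycle P \<gamma>2"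
  "!!x y. x \<in> topspace P1 ==> y \<in> topspace P1 ==> \<gamma>2 x y = ?\<gamma> x y"
  by (rule quot.extend_over_cells[OF att2 _ \<gamma>, of "\<lambda>_. k"]) (use k in simp_all)
 obtain \<gamma>X where \<gamma>X: "quot.local_cocycle X \<gamma>X"
  "!!x y. x \<in> topspace P ==> y \<in> topspace P ==> \<gamma>X x y = \<gamma>2 x y"
  by (rule quot.extend_over_high_cells[OF X \<gamma>2(1)]) blast
 have P1P: "topspace P1 \<subseteq> topspace P" by (rule attaches_cells_subset[OF att2])
 have holX: "quot.hol \<gamma>X e = quot (full.hol \<gamma>1 e)" if e: "singular_simplex 1 P1 e" for e
 proof -
  obtain \<kappa> where \<kappa>: "quot.development (simplex_top 1) e ?\<gamma> \<kappa>" by (rule quot.development_simplex[OF \<gamma> e])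
  have "e ` standard_simplex 1 \<subseteq> topspace P1"
   using e by (auto simp: singular_simplex_def continuous_map_def)
  then have "quot.development (simplex_top 1) e \<gamma>X \<kappa>"
   using P1P \<gamma>2(2) \<gamma>X(2) by (intro quot.development_cong[OF \<kappa>]) (auto simp: subset_iff)
  then show ?thesis using quot.hol_eq[OF \<kappa>] quot.hol_eq hol_quot[OF \<gamma>1 e] by simp
 qed
 \<comment> \<open>Values at representatives make the bound by the defect immediate; that they do
   not depend on the choice is shown next.\<close>
 define rep where "rep = inv_into UNIV quot"
 define b where "b = (\<lambda>x y. Q (rep x) + Q (rep y) - Q (rep x + rep y))"
 have b: "b (quot g) (quot h) = Q g + Q h - Q (g + h)" for g h
 proof -
  obtain m where m: "m \<in> N" "rep (quot g) = g + m"
   using quot_eqD[of "rep (quot g)" g] f_inv_into_f[of "quot g" quot UNIV] by (metis rangeI rep_def)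
  obtain n where n: "n \<in> N" "rep (quot h) = h + n"
   using quot_eqD[of "rep (quot h)" h] f_inv_into_f[of "quot h" quot UNIV] by (metis rangeI rep_def)
  \<comment> \<open>Moving \<open>m\<close> past \<open>h\<close> replaces it by a conjugate, which
    lies in \<open>N\<close> again and has the same value under \<open>Q\<close>.\<close>
  have "g + m + (h + n) = g + h + (- h + m - (- h)) + n" by (simp add: gs del: add_uminus_conv_diff)
  then have "Q (g + m + (h + n)) = Q (g + h) + Q m + Q n"
   using QN[OF n(1)] QN[of "- h + m - (- h)"] conj[OF m(1), of "- h"] by simp
  then show ?thesis by (simp add: b_def m(2) n(2) QN[OF m(1)] QN[OF n(1)])
 qed
 define B where "B = (\<lambda>\<sigma>. b (quot.hol \<gamma>X (singular_face 2 2 \<sigma>)) (quot.hol \<gamma>X (singular_face 2 0 \<sigma>)))"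
 define \<psi> where "\<psi> = (\<lambda>e. Q (full.hol \<gamma>1 e))"
 show ?thesis
 proof (rule that[of B \<psi>])
  show "\<bar>B \<sigma>\<bar> <= 1" for \<sigma> unfolding B_def b_def by (rule qm_add[OF Q])
  show "coboundary 3 B s = 0" if "singular_simplex 3 X s" for s
   unfolding B_def
  proof (rule quot.hol_cocycle[OF \<gamma>X(1) that])
   fix x y z assume "x \<in> range quot" "y \<in> range quot" "z \<in> range quot"
   then obtain g h k where "x = quot g" "y = quot h" "z = quot k" by blast
   then show "b y z - b (x + y) z + b x (y + z) - b x y = 0"
    by (simp add: quot_add[symmetric] b add.assoc)
  qed
  \<comment> \<open>All edges of the cell simplex have trivial holonomy in the quotient, hence it
    contributes \<open>b 0 0 = 0\<close>.\<close>
  have "quot.hol \<gamma>X (edge []) = quot 0" "quot.hol \<gamma>X (edge r) = quot (Fg r)"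
   using holX[OF singular_simplex_edge] hol1[of 0] hol_r r_over by simp_all
  then show "B cell_simplex = 0"
   using triangle_cell b[of 0 0] Q0 quot_eq_0[OF rN] by (simp add: B_def triangle_def)
  show "\<psi> (edge r) = Q (Fg r)" by (simp add: \<psi>_def hol_r)
  show "B \<sigma> = coboundary 2 \<psi> \<sigma>" if \<sigma>: "singular_simplex 2 P1 \<sigma>" for \<sigma>
  proof -
   have "singular_simplex 1 P1 (singular_face 2 k \<sigma>)" if "k <= 2" for k
    using singular_simplex_singular_face[OF \<sigma> _ that] by simp
   then show ?thesis
    using full.hol_triangle[OF \<gamma>1 \<sigma>] by (simp add: B_def holX b coboundary_2 \<psi>_def)
  qed
 qed
qed

end

section \<open>The upper bound\<close>

definition chain_scale :: "real => 'x real_chain => 'x real_chain" where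
 "chain_scale a c = Poly_Mapping.map ((*) a) c"

lemma lookup_chain_scale [simp]: "Poly_Mapping.lookup (chain_scale a c) \<sigma> = a * Poly_Mapping.lookup c \<sigma>"
 by (simp add: chain_scale_def Poly_Mapping.map.rep_eq when_def)

lemma keys_chain_scale: "Poly_Mapping.keys (chain_scale a c) \<subseteq> Poly_Mapping.keys c"
 by (auto simp: in_keys_iff)

lemma chain_eval_scale: "chain_eval f (chain_scale a c) = a * chain_eval f c"
 using chain_eval_superset[OF finite_keys keys_chain_scale, of f a c]
 by (simp add: chain_eval_def sum_distrib_left mult.assoc)

lemma lookup_chain_eval: "Poly_Mapping.lookup c \<sigma> = chain_eval (\<lambda>\<tau>. of_bool (\<tau> = \<sigma>)) c"
proof -
 have "chain_eval (\<lambda>\<tau>. of_bool (\<tau> = \<sigma>)) c = (\<Sum>\<tau>\<in>insert \<sigma> (Poly_Mapping.keys c). if \<tau> = \<sigma> then Poly_Mapping.lookup c \<tau> else 0)"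
  by (subst chain_eval_superset[of "insert \<sigma> (Poly_Mapping.keys c)"]) (auto intro!: sum.cong)
 then show ?thesis by simp
qed

lemma real_chain_boundary_scale: "real_chain_boundary p (chain_scale a c) = chain_scale a (real_chain_boundary p c)"
proof (cases "p = 0")
 case True
 then show ?thesis by (intro poly_mapping_eqI) (simp add: real_chain_boundary_def)
next
 case False
 then show ?thesis
  by (intro poly_mapping_eqI) (simp add: lookup_chain_eval[of "real_chain_boundary _ _"] chain_eval_boundary chain_eval_scale)
qed

lemma l1_norm_superset:
 "finite A ==> Poly_Mapping.keys c \<subseteq> A ==> l1_norm c = (\<Sum>\<sigma>\<in>A. \<bar>Poly_Mapping.lookup c \<sigma>\<bar>)"
 unfolding l1_norm_def by (rule sum.mono_neutral_left) (auto simp: in_keys_iff)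

lemma l1_norm_scale: "l1_norm (chain_scale a c) = \<bar>a\<bar> * l1_norm c"
 using l1_norm_superset[OF finite_keys keys_chain_scale, of a c]
 by (simp add: l1_norm_def abs_mult sum_distrib_left)

lemma l1_norm_diff: "l1_norm (c - d) <= l1_norm c + l1_norm d"
proof -
 let ?A = "Poly_Mapping.keys c \<union> Poly_Mapping.keys d"
 have "Poly_Mapping.keys (c - d) \<subseteq> ?A" by (rule keys_diff)
 then show ?thesis
  using l1_norm_superset[of ?A c] l1_norm_superset[of ?A d] l1_norm_superset[of ?A "c - d"]
  by (simp add: sum.distrib[symmetric] lookup_minus sum_mono abs_triangle_ineq4)
qed

lemma l1_norm_add: "l1_norm (c + d) <= l1_norm c + l1_norm d"
 using l1_norm_diff[of c "- d"] by (simp add: l1_norm_def)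

lemma l1_norm_frag_cmul_of: "l1_norm (real_of_chain (frag_cmul k (frag_of \<sigma>))) <= \<bar>real_of_int k\<bar>"
proof -
 have "l1_norm (real_of_chain (frag_cmul k (frag_of \<sigma>))) = (\<Sum>\<tau>\<in>{\<sigma>}. \<bar>real_of_int k\<bar>)"
  by (subst l1_norm_superset[of "{\<sigma>}"]) (auto split: if_splits)
 then show ?thesis by simp
qed

lemma l1_norm_frag_extend_of: "l1_norm (real_of_chain (frag_extend (\<lambda>x. frag_of (f x)) c)) <= real (l1 c)"
proof -
 have "l1_norm (real_of_chain (\<Sum>x\<in>A. frag_cmul (Poly_Mapping.lookup c x) (frag_of (f x)))) <= (\<Sum>x\<in>A. \<bar>real_of_int (Poly_Mapping.lookup c x)\<bar>)"
  if "finite A" for A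
  using that
 proof (induction A)
  case empty
  then show ?case by (simp add: l1_norm_def)
 next
  case (insert x A)
  then show ?case
   using l1_norm_add[of "real_of_chain (frag_cmul (Poly_Mapping.lookup c x) (frag_of (f x)))"
     "real_of_chain (\<Sum>x\<in>A. frag_cmul (Poly_Mapping.lookup c x) (frag_of (f x)))"]
    l1_norm_frag_cmul_of[of "Poly_Mapping.lookup c x" "f x"] by (simp add: real_of_chain_add)
 qed
 from this[OF finite_keys] show ?thesis by (simp add: frag_extend_def l1_def)
qed

context presentation
begin

lemma triangle_subspace: "triangle P1 \<sigma> e f g ==> triangle P \<sigma> e f g"
 using continuous_map_compose[OF _ attaches_cells_inclusion[OF att2], of "simplex_top 2" \<sigma>]
 by (simp add: triangle_def singular_simplex_def o_def)

lemma triangle_boundary: "triangle Y \<sigma> e f g ==> chain_boundary 2 (frag_of \<sigma>) = frag_of f - frag_of g + frag_of e"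
 by (simp add: triangle_def chain_boundary_2)

lemma P1_subtopology: "subtopology P (topspace P1) = P1"
 by (rule attaches_cells_subtopology[OF att2]) simp

lemma triangle_relboundary: "triangle P1 \<sigma> e f g ==> singular_relboundary 2 P (topspace P1) (frag_of \<sigma>)"
 by (rule singular_chain_imp_relboundary) (simp add: P1_subtopology triangle_def singular_chain_of)

lemma simplex_relboundary: "singular_simplex 3 Y s ==> singular_relboundary 2 Y T (chain_boundary 3 (frag_of s))"
 unfolding singular_relboundary_alt by (intro exI[of _ "frag_of s"] exI[of _ 0]) (simp add: singular_chain_of)

text \<open>Each step of the induction rearranges \<open>a^(n+1) b^(n+1)\<close> as
  \<open>a^n (a b) b^n\<close> by filling horns. All triangles used lie in \<open>P1\<close> except
  one copy of \<open>D\<close> and the triangle for \<open>n\<close>, so relative to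
  \<open>P1\<close> one more 2-cell is counted.\<close>

lemma power_triangle:
 assumes ab: "a \<in> over S" "b \<in> over S" "word (a + b) = r"
 obtains \<sigma> where "triangle P \<sigma> (edge (word (npow a n))) (edge (word (npow b n))) (edge [])"
  "homologous_rel 2 P (topspace P1) (frag_of \<sigma>) (frag_cmul (int n) (frag_of cell_simplex))"
proof -
 let ?B = "singular_relboundary 2 P (topspace P1)"
 let ?e = "\<lambda>u. edge (word u)"
 note sub = triangle_subspace
 have tri: "\<exists>\<sigma>. triangle P1 \<sigma> (?e u) (?e w) (?e (u + w))" if "u \<in> over S" "w \<in> over S" for u w
  using triangle_words[OF that] by metis
 have deg: "\<exists>\<sigma>. triangle P1 \<sigma> (edge []) (?e u) (?e u)" if "u \<in> over S" for u
 proof -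
  have "fst ` set (word u) \<subseteq> S" using that by (simp add: over_def)
  then show ?thesis by (rule triangle_degenerate) blast
 qed
 note B_add = singular_relboundary_add and B_diff = singular_relboundary_diff
 obtain t where t: "triangle P1 t (?e a) (?e b) (edge r)" using tri[OF ab(1,2)] ab(3) by auto
 obtain u where u: "triangle P1 u (edge []) (?e a) (?e a)" using deg[OF ab(1)] by blast
 \<comment> \<open>From \<open>1 a = a\<close>, from the 2-cell read as \<open>1 r = 1\<close> and
   from \<open>a b = r\<close>, the horn yields \<open>a b = 1\<close>.\<close>
 obtain D s where D: "triangle P D (?e a) (?e b) (edge [])" and s: "singular_simplex 3 P s"
  "chain_boundary 3 (frag_of s) = frag_of t - frag_of D + frag_of cell_simplex - frag_of u"
  by (rule triangle_023[OF sub[OF u] triangle_cell sub[OF t]])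
 have "?B (frag_of t - frag_of u - chain_boundary 3 (frag_of s))"
  by (intro B_diff triangle_relboundary[OF t] triangle_relboundary[OF u] simplex_relboundary s(1))
 then have D1: "?B (frag_of D - frag_of cell_simplex)" unfolding s(2) by (simp add: algebra_simps)
 have "\<exists>\<sigma>. triangle P \<sigma> (?e (npow a n)) (?e (npow b n)) (edge []) \<and>
  ?B (frag_of \<sigma> - frag_cmul (int n) (frag_of cell_simplex))"
 proof (induction n)
  case 0
  obtain \<sigma> where "triangle P1 \<sigma> (edge []) (?e 0) (?e 0)" using deg[of 0] by auto
  then show ?case using sub triangle_relboundary by (intro exI[of _ \<sigma>]) auto
 next
  case (Suc n)
  then obtain En where En: "triangle P En (?e (npow a n)) (?e (npow b n)) (edge [])"
   "?B (frag_of En - frag_cmul (int n) (frag_of cell_simplex))" by blast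
  have o: "npow a n \<in> over S" "npow b n \<in> over S" using ab over_npow by auto
  obtain p where p: "triangle P1 p (edge []) (?e (npow b n)) (?e (npow b n))" using deg[OF o(2)] by blast
  obtain t where t: "triangle P1 t (?e b) (?e (npow b n)) (?e (npow b (Suc n)))"
   using tri[OF ab(2) o(2)] by (auto simp: npow_Suc_left simp del: npow.simps)
  obtain t' where t': "triangle P1 t' (?e (npow a n)) (?e a) (?e (npow a (Suc n)))"
   using tri[OF o(1) ab(1)] by auto
  \<comment> \<open>The first horn solves for \<open>a b^(n+1) = b^n\<close>, using
    \<open>a b = 1\<close>. The second combines this with \<open>a^n a = a^(n+1)\<close> and
    \<open>a^n b^n = 1\<close> to obtain \<open>a^(n+1) b^(n+1) = 1\<close>.\<close>
  obtain N s where N: "triangle P N (?e a) (?e (npow b (Suc n))) (?e (npow b n))" and s: "singular_simplex 3 P s"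
   "chain_boundary 3 (frag_of s) = frag_of t - frag_of p + frag_of N - frag_of D"
   by (rule triangle_013[OF D sub[OF p] sub[OF t]])
  obtain E s' where E: "triangle P E (?e (npow a (Suc n))) (?e (npow b (Suc n))) (edge [])" and s': "singular_simplex 3 P s'"
   "chain_boundary 3 (frag_of s') = frag_of N - frag_of E + frag_of En - frag_of t'"
   by (rule triangle_023[OF sub[OF t'] En(1) N])
  have "?B (chain_boundary 3 (frag_of s) - frag_of t + frag_of p + (frag_of D - frag_of cell_simplex)
    + (frag_of En - frag_cmul (int n) (frag_of cell_simplex)) - frag_of t' - chain_boundary 3 (frag_of s'))"
   by (intro B_add B_diff simplex_relboundary s(1) s'(1) triangle_relboundary[OF t] triangle_relboundary[OF p]
     triangle_relboundary[OF t'] D1 En(2))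
  moreover have "chain_boundary 3 (frag_of s) - frag_of t + frag_of p + (frag_of D - frag_of cell_simplex)
    + (frag_of En - frag_cmul (int n) (frag_of cell_simplex)) - frag_of t' - chain_boundary 3 (frag_of s') =
    frag_of E - frag_cmul (int (Suc n)) (frag_of cell_simplex)"
   unfolding s(2) s'(2) by (simp add: frag_cmul_distrib algebra_simps)
  ultimately show ?case using E by metis
 qed
 then show ?thesis using that unfolding homologous_rel_def by blast
qed

text \<open>Injectivity of the map from \<open>H_2(P)\<close> to \<open>H_2(P, P1)\<close>: the
  correcting chain in the graph is itself a cycle, and it bounds by
  \<open>graph_second_homology\<close>.\<close>

lemma boundary_in_P1:
 assumes "singular_relcycle 2 P {} z" "singular_relboundary 2 P (topspace P1) z"
 shows "singular_relboundary 2 P {} z"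
proof -
 obtain d y where d: "singular_chain (Suc 2) P d" "chain_boundary (Suc 2) d = z + y" and y: "singular_chain 2 P1 y"
  using assms(2) unfolding singular_relboundary_alt P1_subtopology by blast
 have "chain_boundary 2 y = chain_boundary 2 (chain_boundary (Suc 2) d) - chain_boundary 2 z"
  unfolding d(2) chain_boundary_add by simp
 also have "\<dots> = 0" using chain_boundary_boundary[OF d(1)] assms(1) by (simp add: singular_cycle)
 finally have "singular_relcycle 2 P1 {} y" using y by (simp add: singular_cycle)
 then have "singular_relboundary 2 P1 {} y" by (rule graph_second_homology)
 then have "singular_relboundary 2 (subtopology P (topspace P1)) {} y" by (simp add: P1_subtopology)
 then have "singular_relboundary 2 (subtopology P (topspace P)) {} y"
  using attaches_cells_subset[OF att2] by (rule singular_boundary_mono[rotated])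
 then have "singular_relboundary 2 P {} (chain_boundary (Suc 2) d - y)"
  using d(1) by (intro singular_relboundary_diff) (auto simp: singular_boundary)
 moreover have "chain_boundary (Suc 2) d - y = z" unfolding d(2) by simp
 ultimately show ?thesis by simp
qed

text \<open>Bar simplices become triangles of edge paths in \<open>P1\<close>. Labels are retracted
  to \<open>S\<close> first, as a filling found in the type may use letters that have no
  1-cell.\<close>

definition realize :: "('a fg \<times> 'a fg \<Rightarrow>\<^sub>0 int) => 'x chain" where
 "realize = frag_extend (\<lambda>x. frag_of (case x of (g, h) =>
   SOME \<sigma>. triangle P1 \<sigma> (edge (word (retract S g))) (edge (word (retract S h))) (edge (word (retract S (g + h))))))"

lemma singular_chain_realize: "singular_chain 2 P1 (realize c)"
 and boundary_realize: "chain_boundary 2 (realize c) = frag_extend (\<lambda>g. frag_of (edge (word (retract S g)))) (bar_boundary c)"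
proof -
 let ?e = "\<lambda>g. edge (word (retract S g))" and ?\<tau> = "\<lambda>g h. SOME \<sigma>. triangle P1 \<sigma> (edge (word (retract S g))) (edge (word (retract S h))) (edge (word (retract S (g + h))))"
 have \<tau>: "triangle P1 (?\<tau> g h) (?e g) (?e h) (?e (g + h))" for g h
 proof -
  have "\<exists>\<sigma>. triangle P1 \<sigma> (?e g) (?e h) (?e (g + h))"
   unfolding retract_plus by (rule triangle_words[OF retract_in_over retract_in_over]) blast
  then show ?thesis by (rule someI_ex)
 qed
 show "singular_chain 2 P1 (realize c)"
  using \<tau> unfolding realize_def by (intro singular_chain_extend) (auto simp: singular_chain_of triangle_def)
 show "chain_boundary 2 (realize c) = frag_extend (\<lambda>g. frag_of (?e g)) (bar_boundary c)"
  unfolding realize_def using subset_UNIV[of "Poly_Mapping.keys c"]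
 proof (induction c rule: frag_induction)
  case (one x)
  show ?case
   by (cases x) (simp add: triangle_boundary[OF \<tau>] bar_boundary_of frag_extend_diff frag_extend_add)
 qed (simp_all add: bar_boundary_diff frag_extend_diff chain_boundary_diff)
qed

lemma l1_norm_realize: "l1_norm (real_of_chain (realize c)) <= real (l1 c)"
 unfolding realize_def by (rule l1_norm_frag_extend_of)

lemma chain_in_P: "singular_chain 2 P1 z ==> singular_chain 2 P z"
 by (metis P1_subtopology singular_chain_subtopology)

lemma chain_relboundary: "singular_chain 2 P1 z ==> singular_relboundary 2 P (topspace P1) z"
 by (rule singular_chain_imp_relboundary) (simp add: P1_subtopology)

text \<open>The 2-cell and the realized filling of the relator have the same boundary, so their
  difference is a cycle; relative to \<open>P1\<close> only the 2-cell remains.\<close>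

lemma fundamental_cycle:
 assumes c: "bar_boundary c = frag_of (Fg r)" and r: "reduced_word r"
 obtains z where "singular_relcycle 2 P {} z" "homologous_rel 2 P (topspace P1) z (frag_cmul e (frag_of cell_simplex))"
proof -
 let ?T = "realize c"
 have "Fg r \<in> over S" using r r_over by (simp add: over_def)
 then have "chain_boundary 2 ?T = frag_of (edge r)" unfolding boundary_realize c using r by (simp add: retract_over)
 moreover have "chain_boundary 2 (frag_of cell_simplex) = frag_of (edge r)"
  by (simp add: triangle_boundary[OF triangle_cell])
 moreover have "singular_chain 2 P (frag_of cell_simplex - ?T)"
  using triangle_cell chain_in_P[OF singular_chain_realize]
  by (intro singular_chain_diff) (simp_all add: triangle_def singular_chain_of)
 ultimately have "singular_relcycle 2 P {} (frag_of cell_simplex - ?T)"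
  by (simp add: singular_cycle chain_boundary_diff)
 moreover have "homologous_rel 2 P (topspace P1) (frag_of cell_simplex - ?T) (frag_of cell_simplex)"
  using singular_relboundary_minus[THEN iffD2, OF chain_relboundary[OF singular_chain_realize], of c] by (simp add: homologous_rel_def)
 ultimately show ?thesis
  by (rule that[OF singular_relcycle_cmul homologous_rel_cmul])
qed

lemma efficient_cycle:
 assumes ab: "a \<in> over S" "b \<in> over S" "word (a + b) = r"
  and c: "bar_boundary c = frag_cmul (int m) (frag_of (npow a n) + frag_of (npow b n))"
 obtains z where "singular_relcycle 2 P {} z" "l1_norm (real_of_chain z) <= real (l1 c) + 2 * real m"
  "homologous_rel 2 P (topspace P1) z (frag_cmul (- int (m * n)) (frag_of cell_simplex))"
proof -
 let ?T = "realize c" and ?m = "frag_cmul (int m)"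
 obtain D where D: "triangle P D (edge (word (npow a n))) (edge (word (npow b n))) (edge [])"
  "homologous_rel 2 P (topspace P1) (frag_of D) (frag_cmul (int n) (frag_of cell_simplex))"
  using power_triangle[OF ab] .
 obtain k where k: "triangle P1 k (edge []) (edge []) (edge [])" using triangle_degenerate[of "[]"] by auto
 \<comment> \<open>\<open>D\<close> cancels the edges of the two powers but leaves \<open>m\<close>
   constant edges, which the constant triangle \<open>k\<close> removes. These two families of
   triangles account for \<open>2 * real m\<close>.\<close>
 define z where "z = ?T - ?m (frag_of D) - ?m (frag_of k)"
 have o: "npow a n \<in> over S" "npow b n \<in> over S" using ab over_npow by auto
 have "chain_boundary 2 z = 0"
  unfolding z_def chain_boundary_diff chain_boundary_cmul boundary_realize c triangle_boundary[OF D(1)] triangle_boundary[OF k]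
  using o by (simp add: frag_extend_cmul frag_extend_add retract_over frag_cmul_distrib2 frag_cmul_diff)
 moreover have "singular_chain 2 P z"
  using D(1) triangle_subspace[OF k] chain_in_P[OF singular_chain_realize] unfolding z_def
  by (intro singular_chain_diff singular_chain_cmul) (simp_all add: triangle_def singular_chain_of)
 ultimately have C: "singular_relcycle 2 P {} z" by (simp add: singular_cycle)
 have L: "l1_norm (real_of_chain z) <= real (l1 c) + 2 * real m"
  using l1_norm_diff[of "real_of_chain (?T - ?m (frag_of D))" "real_of_chain (?m (frag_of k))"]
   l1_norm_diff[of "real_of_chain ?T" "real_of_chain (?m (frag_of D))"]
   l1_norm_realize[of c] l1_norm_frag_cmul_of[of "int m" D] l1_norm_frag_cmul_of[of "int m" k]
  by (simp add: z_def real_of_chain_diff)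
 have "singular_relboundary 2 P (topspace P1)
   (?T - ?m (frag_of D - frag_cmul (int n) (frag_of cell_simplex)) - ?m (frag_of k))"
  using D(2)[unfolded homologous_rel_def, THEN singular_relboundary_cmul, of "int m"]
   singular_relboundary_cmul[OF triangle_relboundary[OF k], of "int m"]
  by (intro singular_relboundary_diff chain_relboundary[OF singular_chain_realize]) auto
 moreover have "?T - ?m (frag_of D - frag_cmul (int n) (frag_of cell_simplex)) - ?m (frag_of k) =
   z - frag_cmul (- int (m * n)) (frag_of cell_simplex)"
  by (rule poly_mapping_eqI) (simp add: z_def lookup_minus lookup_add algebra_simps)
 ultimately have R: "homologous_rel 2 P (topspace P1) z (frag_cmul (- int (m * n)) (frag_of cell_simplex))"
  by (simp only: homologous_rel_def)
 show ?thesis by (rule that[OF C L R])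
qed

end

context presentation
begin

lemma singular_simplex_P_X: "attaches_high_cells P X ==> singular_simplex p P s ==> singular_simplex p X s"
 using continuous_map_compose[OF _ attaches_high_cells_inclusion, of "simplex_top p" P s X]
 by (simp add: singular_simplex_def o_def)

text \<open>The cocycle has the same value on \<open>c\<close> and on \<open>z\<close>. Up to a
  boundary \<open>z\<close> is \<open>e\<close> times the 2-cell, where the cocycle is 0, minus a
  chain \<open>y\<close> in \<open>P1\<close>. There it is the coboundary of \<psi>, and the
  boundary of \<open>y\<close> is \<open>e\<close> times the relator edge.\<close>

lemma lower_bound:
 fixes Q :: "'a fg => real"
 assumes X: "attaches_high_cells P X" and r: "reduced_word r"
  and Q: "qm Q" "!!g h. Q (g + (h + Fg r - h)) = Q g + Q (Fg r)"
  and z: "singular_relcycle 2 P {} z" "homologous_rel 2 P (topspace P1) z (frag_cmul e (frag_of cell_simplex))"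
  and e: "e = 1 \<or> e = - 1"
  and c: "real_singular_chain 2 X c" "real_homologous 2 X c (real_of_chain z')" "homologous_rel 2 X {} z z'"
 shows "\<bar>Q (Fg r)\<bar> <= l1_norm c"
proof -
 obtain B \<psi> where B: "!!\<sigma>. singular_simplex 2 X \<sigma> ==> \<bar>B \<sigma>\<bar> <= 1"
  "!!s. singular_simplex 3 X s ==> coboundary 3 B s = 0" "B cell_simplex = 0"
  "!!\<sigma>. singular_simplex 2 P1 \<sigma> ==> B \<sigma> = coboundary 2 \<psi> \<sigma>" "\<psi> (edge r) = Q (Fg r)"
  using bounded_cocycle[OF X Q(1) r Q(2)] by metis
 have int0: "int_eval (coboundary 3 B) d = 0" if "singular_chain 3 X d" for d
 proof -
  have "int_eval (coboundary 3 B) d = int_eval (\<lambda>_. 0) d"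
   by (rule int_eval_cong) (use that B(2) in \<open>auto simp: singular_chain_def\<close>)
  then show ?thesis by (simp add: int_eval_def chain_eval_def)
 qed
 obtain d where d: "real_singular_chain 3 X d" "real_chain_boundary 3 d = c - real_of_chain z'"
  using c(2) by (auto simp: real_homologous_def)
 have "chain_eval (coboundary 3 B) d = chain_eval (\<lambda>_. 0) d"
  by (rule chain_eval_cong) (use d(1) B(2) in \<open>auto simp: real_singular_chain_def\<close>)
 then have "chain_eval (coboundary 3 B) d = 0" by (simp add: chain_eval_def)
 then have cz: "chain_eval B c = int_eval B z'"
  using chain_eval_boundary[of 3 B d] by (simp add: d(2) chain_eval_diff int_eval_def)
 obtain d' where d': "singular_chain 3 X d'" "chain_boundary 3 d' = z - z'"
  using c(3) by (auto simp: homologous_rel_def singular_boundary)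
 then have zz: "int_eval B z = int_eval B z'"
  using int_eval_boundary[of 3 B d'] int0 by (simp add: int_eval_diff)
 obtain u y where u: "singular_chain 3 P u" and y: "singular_chain 2 P1 y"
  and uy: "chain_boundary 3 u = z - frag_cmul e (frag_of cell_simplex) + y"
  using z(2) unfolding homologous_rel_def singular_relboundary_alt P1_subtopology by auto
 have "singular_chain 3 X u" using u singular_simplex_P_X[OF X] by (auto simp: singular_chain_def)
 then have "int_eval B z = - int_eval B y"
  using int_eval_boundary[of 3 B u] int0 by (simp add: uy int_eval_diff int_eval_add int_eval_cmul B(3))
 also have "int_eval B y = int_eval (coboundary 2 \<psi>) y"
  by (rule int_eval_cong) (use y B(4) in \<open>auto simp: singular_chain_def\<close>)
 also have "\<dots> = int_eval \<psi> (chain_boundary 2 y)" by (simp add: int_eval_boundary)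
 also have "chain_boundary 2 y = chain_boundary 2 (chain_boundary (Suc 2) u) - chain_boundary 2 z
   + frag_cmul e (chain_boundary 2 (frag_of cell_simplex))"
  using uy by (simp add: chain_boundary_add chain_boundary_diff chain_boundary_cmul del: minus_frag_cmul)
 also have "\<dots> = frag_cmul e (frag_of (edge r))"
  using chain_boundary_boundary[of 3 P u] u z(1) triangle_boundary[OF triangle_cell] by (simp add: singular_cycle)
 finally have "\<bar>int_eval B z\<bar> = \<bar>Q (Fg r)\<bar>" using e by (auto simp: int_eval_cmul B(5))
 then show ?thesis
  using chain_eval_bound[of c B] B(1) c(1) cz zz by (auto simp: real_singular_chain_def)
qed

text \<open>The cycle of \<open>efficient_cycle\<close> represents \<open>m n\<close> times the
  class up to sign by \<open>boundary_in_P1\<close>, and real coefficients allow division by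
  \<open>m n\<close>.\<close>

lemma efficient_real_cycle:
 assumes X: "attaches_high_cells P X" and ab: "a \<in> over S" "b \<in> over S" "word (a + b) = r"
  and c: "bar_boundary c = frag_cmul (int m) (frag_of (npow a n) + frag_of (npow b n))" and mn: "m > 0" "n > 0"
  and z: "singular_relcycle 2 P {} z" "homologous_rel 2 P (topspace P1) z (frag_cmul e (frag_of cell_simplex))"
  and e: "e = 1 \<or> e = - 1"
 obtains w where "real_singular_cycle 2 X w" "real_homologous 2 X w (real_of_chain z)"
  "l1_norm w <= (real (l1 c) + 2 * real m) / (real m * real n)"
proof -
 obtain y where y: "singular_relcycle 2 P {} y" "l1_norm (real_of_chain y) <= real (l1 c) + 2 * real m"
  "homologous_rel 2 P (topspace P1) y (frag_cmul (- int (m * n)) (frag_of cell_simplex))"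
  using efficient_cycle[OF ab c] .
 define k where "k = e * int (m * n)"
 have ee: "e * e = 1" using e by auto
 have "homologous_rel 2 P (topspace P1) (y + frag_cmul k z)
   (frag_cmul (- int (m * n)) (frag_of cell_simplex) + frag_cmul k (frag_cmul e (frag_of cell_simplex)))"
  by (rule homologous_rel_add[OF y(3) homologous_rel_cmul[OF z(2)]])
 moreover have "frag_cmul (- int (m * n)) (frag_of cell_simplex) + frag_cmul k (frag_cmul e (frag_of cell_simplex)) = 0"
  using ee by (intro poly_mapping_eqI) (simp add: lookup_add k_def algebra_simps)
 ultimately have "singular_relboundary 2 P (topspace P1) (y + frag_cmul k z)" by (simp add: homologous_rel_def)
 then have "singular_relboundary 2 P {} (y + frag_cmul k z)"
  by (intro boundary_in_P1 singular_relcycle_add singular_relcycle_cmul y z)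
 then obtain d where d: "singular_chain 3 P d" "chain_boundary 3 d = y + frag_cmul k z"
  by (auto simp: singular_boundary)
 \<comment> \<open>The sign of \<open>e\<close> enters because \<open>y\<close> covers the 2-cell
   \<open>- m n\<close> times, whereas \<open>z\<close> covers it \<open>e\<close> times.\<close>
 define q where "q = - of_int e / (real m * real n)"
 have q: "q * of_int k = - 1"
  using e mn by (auto simp: q_def k_def)
 define w where "w = chain_scale q (real_of_chain y)"
 have sub: "Poly_Mapping.keys x \<subseteq> singular_simplex_set p X" if "singular_chain p P x" for p x
  using that singular_simplex_P_X[OF X] by (auto simp: singular_chain_def)
 have "real_singular_cycle 2 X w"
  unfolding real_singular_cycle_def real_singular_chain_def
 proof
  show "Poly_Mapping.keys w \<subseteq> singular_simplex_set 2 X"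
   using keys_chain_scale[of q "real_of_chain y"] sub[of 2 y] y(1) by (auto simp: w_def singular_cycle)
  show "real_chain_boundary 2 w = 0"
   using y(1) by (simp add: w_def real_chain_boundary_scale real_chain_boundary_of_int singular_cycle)
    (rule poly_mapping_eqI, simp)
 qed
 moreover have "real_homologous 2 X w (real_of_chain z)"
  unfolding real_homologous_def real_singular_chain_def
 proof (intro exI[of _ "chain_scale q (real_of_chain d)"] conjI)
  show "Poly_Mapping.keys (chain_scale q (real_of_chain d)) \<subseteq> singular_simplex_set (Suc 2) X"
   using keys_chain_scale[of q "real_of_chain d"] sub[OF d(1)] by auto
  have "real_chain_boundary 3 (chain_scale q (real_of_chain d)) = chain_scale q (real_of_chain (y + frag_cmul k z))"
   by (simp add: real_chain_boundary_scale real_chain_boundary_of_int d(2))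
  also have "\<dots> = w - real_of_chain z"
   using q by (intro poly_mapping_eqI) (simp add: w_def lookup_minus lookup_add distrib_left mult.assoc[symmetric])
  finally show "real_chain_boundary (Suc 2) (chain_scale q (real_of_chain d)) = w - real_of_chain z" by simp
 qed
 moreover have "\<bar>q\<bar> = 1 / (real m * real n)" using e by (auto simp: q_def)
 then have "l1_norm w <= (real (l1 c) + 2 * real m) / (real m * real n)"
  using y(2) mn by (simp add: w_def l1_norm_scale divide_right_mono)
 ultimately show ?thesis by (rule that)
qed

text \<open>Replaces the description by a unique preimage with an explicit cycle; uniqueness comes
  from \<open>boundary_in_P1\<close>.\<close>

lemma fundamental_class_eq:
 assumes X: "attaches_high_cells P X"
  and \<omega>: "\<omega> = homologous_rel_set 2 (disc 2) (topspace (nsphere 1)) (frag_cmul e (frag_of disc_simplex))"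
  and z: "singular_relcycle 2 P {} z" "homologous_rel 2 P (topspace P1) z (frag_cmul e (frag_of cell_simplex))"
 shows "fundamental_class P1 \<Phi> P X \<omega> = homologous_rel_set 2 X {} z"
proof -
 note induced = hom_induced_chain_map[where p = 2, simplified]
 have id: "chain_map 2 id y = y" if "singular_relcycle 2 P {} y" for y
  using that by (intro chain_map_ident) (auto simp: singular_cycle)
 have \<Phi>: "continuous_map (disc 2) P \<Phi>" using attaches_cells_continuous_map[OF att2] by simp
 have \<Phi>1: "continuous_map (nsphere 1) P1 \<Phi>" using att2 by (simp add: attaches_cells_def)
 have "hom_induced 2 (disc 2) (topspace (nsphere 1)) P (topspace P1) \<Phi> \<omega> =
   homologous_rel_set 2 P (topspace P1) (chain_map 2 \<Phi> (frag_cmul e (frag_of disc_simplex)))"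
  unfolding \<omega> using \<Phi>1 by (intro induced \<Phi> singular_relcycle_cmul relcycle_disc_simplex) (auto simp: continuous_map_def)
 then have cell: "hom_induced 2 (disc 2) (topspace (nsphere 1)) P (topspace P1) \<Phi> \<omega> = homologous_rel_set 2 P (topspace P1) z"
  using z(2) by (simp add: cell_simplex_def homologous_rel_set_eq homologous_rel_sym)
 have j: "hom_induced 2 P {} P (topspace P1) id (homologous_rel_set 2 P {} y) = homologous_rel_set 2 P (topspace P1) y"
  if "singular_relcycle 2 P {} y" for y
  using induced[of P P id "{}" "topspace P1" y] that id[OF that] by simp
 have carrier: "carrier (homology_group 2 P) = homologous_rel_set 2 P {} ` singular_relcycle_set 2 P {}"
  using carrier_relative_homology_group[of 2 P "{}"] by simp
 have "two_cell_class P1 \<Phi> P \<omega> = homologous_rel_set 2 P {} z"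
  unfolding two_cell_class_def cell
 proof (rule the_equality)
  show "homologous_rel_set 2 P {} z \<in> carrier (homology_group 2 P) \<and>
    hom_induced 2 P {} P (topspace P1) id (homologous_rel_set 2 P {} z) = homologous_rel_set 2 P (topspace P1) z"
   using j[OF z(1)] z(1) unfolding carrier by blast
  fix \<alpha> assume \<alpha>: "\<alpha> \<in> carrier (homology_group 2 P) \<and> hom_induced 2 P {} P (topspace P1) id \<alpha> = homologous_rel_set 2 P (topspace P1) z"
  then obtain y where y: "singular_relcycle 2 P {} y" "\<alpha> = homologous_rel_set 2 P {} y" unfolding carrier by blast
  then have "homologous_rel 2 P (topspace P1) y z" using \<alpha> j[OF y(1)] by (simp add: homologous_rel_set_eq)
  then have "homologous_rel 2 P {} y z"
   using boundary_in_P1[OF singular_relcycle_diff[OF y(1) z(1)]] by (simp add: homologous_rel_def)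
  then show "\<alpha> = homologous_rel_set 2 P {} z" unfolding y(2) by (simp add: homologous_rel_set_eq)
 qed
 moreover have "continuous_map P X id" using attaches_high_cells_inclusion[OF X] by (simp add: id_def)
 ultimately show ?thesis
  unfolding fundamental_class_def using induced[of P X id "{}" "{}" z] z(1) id[OF z(1)] by simp
qed

end

theorem theorem1:
  fixes S :: "'a set" and r :: "('a \<times> bool) list"
    and v :: 'x and \<phi> :: "'a \<Rightarrow> (nat \<Rightarrow> real) \<Rightarrow> 'x" and \<Phi> :: "(nat \<Rightarrow> real) \<Rightarrow> 'x"
    and P1 P X :: "'x topology" and \<omega> :: "(nat \<Rightarrow> real) chain set"
  assumes "r \<in> free_commutator_subgroup S"
    and "(\<exists>S1 S2 r1 r2.
            S = S1 \<union> S2 \<and> S1 \<inter> S2 = {} \<and>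
            r1 \<in> free_commutator_subgroup S1 \<and> r1 \<noteq> \<one>\<^bsub>free_group S1\<^esub> \<and>
            r2 \<in> free_commutator_subgroup S2 \<and> r2 \<noteq> \<one>\<^bsub>free_group S2\<^esub> \<and>
            r = r1 \<otimes>\<^bsub>free_group S\<^esub> r2)
       \<or> (\<exists>S' t r1 r2.
            S = S' \<union> {t} \<and> t \<notin> S' \<and>
            r1 \<in> free_commutator_subgroup S' \<and> r1 \<noteq> \<one>\<^bsub>free_group S'\<^esub> \<and>
            r2 \<in> free_commutator_subgroup S' \<and> r2 \<noteq> \<one>\<^bsub>free_group S'\<^esub> \<and>
            r = r1 \<otimes>\<^bsub>free_group S\<^esub> [(t, True)] \<otimes>\<^bsub>free_group S\<^esub> r2
                  \<otimes>\<^bsub>free_group S\<^esub> inv\<^bsub>free_group S\<^esub> [(t, True)])"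
    and "presentation_complex S r v \<phi> P1 \<Phi> P"
    and "attaches_high_cells P X"
    and "classifying_space (one_relator_group S r) X v"
    and "cell_orientation \<omega>"
  shows "simplicial_volume P1 \<Phi> P X \<omega> = 4 * (scl S r - 1 / 2)"
proof -
 obtain a b k q where ab: "a \<in> over S" "b \<in> over S" "Fg r = a + b" and k: "cprod k (Fg r)"
  and scl: "scl S r = (q + 2) / 4"
  and Q: "!!\<epsilon>. \<epsilon> > 0 ==> \<exists>Q. qm Q \<and> (\<forall>g h. Q (g + (h + Fg r - h)) = Q g + Q (Fg r)) \<and> Q (Fg r) >= q - \<epsilon>"
  and fill: "!!n. fill_bound (frag_of (npow a n) + frag_of (npow b n)) (real n * q + 5)"
 proof (rule decomposable_relator[OF assms(1,2)])
  fix a b k q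
  assume "a \<in> over S" "b \<in> over S" "Fg r = a + b" "cprod k (Fg r)" "scl S r = (q + 2) / 4"
   "!!\<epsilon>. \<epsilon> > 0 ==> \<exists>Q. qm Q \<and> (\<forall>g h. Q (g + (h + Fg r - h)) = Q g + Q (Fg r)) \<and> Q (Fg r) >= q - \<epsilon>"
   "!!n. fill_bound (frag_of (npow a n) + frag_of (npow b n)) (real n * q + 5)"
  then show thesis by (rule that)
 qed
 have r: "reduced_word r" "Fg r \<in> over S"
  using free_commutator_subgroup_cprod(1)[OF assms(1)] by (auto simp: carrier_free_group_iff)
 interpret presentation S r v \<phi> P1 \<Phi> P
  by standard (use assms(3) r in \<open>simp_all add: over_def\<close>)
 have abr: "word (a + b) = r" using ab(3) r(1) by (metis word_Fg)
 obtain e where e: "e = 1 \<or> e = - 1"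
  "\<omega> = homologous_rel_set 2 (disc 2) (topspace (nsphere 1)) (frag_cmul e (frag_of disc_simplex))"
  using cell_orientationE[OF assms(6)] by metis
 obtain c0 where "bar_boundary c0 = frag_of (Fg r)" using null_chain_cprod[OF k] by (auto simp: null_chain_def)
 then obtain z where z: "singular_relcycle 2 P {} z" "homologous_rel 2 P (topspace P1) z (frag_cmul e (frag_of cell_simplex))"
  using fundamental_cycle r(1) by metis
 define A where "A = change_of_coefficients 2 X (homologous_rel_set 2 X {} z)"
 have vol: "simplicial_volume P1 \<Phi> P X \<omega> = Inf (l1_norm ` A)"
  unfolding simplicial_volume_def l1_seminorm_def A_def fundamental_class_eq[OF assms(4) e(2) z] ..
 have lower: "q <= l1_norm c" if c: "c \<in> A" for c
 proof (rule field_le_epsilon)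
  fix \<epsilon> :: real assume "\<epsilon> > 0"
  then obtain Q where "qm Q" "!!g h. Q (g + (h + Fg r - h)) = Q g + Q (Fg r)" "Q (Fg r) >= q - \<epsilon>" using Q by blast
  moreover obtain z' where "homologous_rel 2 X {} z z'" "real_homologous 2 X c (real_of_chain z')"
   "real_singular_chain 2 X c"
   using c by (auto simp: A_def change_of_coefficients_def real_singular_cycle_def)
  ultimately show "q <= l1_norm c + \<epsilon>"
   using lower_bound[OF assms(4) r(1) _ _ z e(1), of Q c z'] by fastforce
 qed
 have upper: "\<exists>w\<in>A. l1_norm w <= q + 7 / real n" if n: "n > 0" for n
 proof -
  obtain m c where c: "m > 0" "bar_boundary c = frag_cmul (int m) (frag_of (npow a n) + frag_of (npow b n))"
   "real (l1 c) <= real m * (real n * q + 5)"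
   using fill[of n] by (auto simp: fill_bound_def)
  obtain w where w: "real_singular_cycle 2 X w" "real_homologous 2 X w (real_of_chain z)"
   "l1_norm w <= (real (l1 c) + 2 * real m) / (real m * real n)"
   using efficient_real_cycle[OF assms(4) ab(1,2) abr c(2,1) n z e(1)] by metis
  \<comment> \<open>The filling contributes the 5 and the two families of caps the 2; after division
    by \<open>n\<close> both vanish in the limit.\<close>
  have "(real (l1 c) + 2 * real m) / (real m * real n) <= (real m * (real n * q + 7)) / (real m * real n)"
   using c(3) by (intro divide_right_mono) (simp_all add: algebra_simps)
  also have "\<dots> = q + 7 / real n" using c(1) n by (simp add: field_simps)
  finally have "l1_norm w <= q + 7 / real n" using w(3) by linarith
  moreover have "w \<in> A" using w(1,2) by (auto simp: A_def change_of_coefficients_def intro!: exI[of _ z])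
  ultimately show ?thesis by blast
 qed
 have "Inf (l1_norm ` A) = q"
 proof (rule cInf_eq_non_empty)
  show "l1_norm ` A ~= {}" using upper[of 1] by auto
  show "q <= x" if "x \<in> l1_norm ` A" for x using that lower by auto
  fix y assume y: "!!x. x \<in> l1_norm ` A ==> y <= x"
  show "y <= q"
  proof (rule field_le_epsilon)
   fix \<epsilon> :: real assume \<epsilon>: "\<epsilon> > 0"
   obtain n where n: "7 / \<epsilon> < real n" using reals_Archimedean2 by blast
   moreover have "0 < 7 / \<epsilon>" using \<epsilon> by simp
   ultimately have "n > 0" by (metis less_trans of_nat_0_less_iff)
   then obtain w where w: "w \<in> A" "l1_norm w <= q + 7 / real n" using upper by blast
   have "7 / real n < \<epsilon>" using n \<epsilon> \<open>n > 0\<close> by (simp add: field_simps)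
   then show "y <= q + \<epsilon>" using y[of "l1_norm w"] w by force
  qed
 qed
 then show ?thesis using vol scl by (simp add: field_simps)
qed

end
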